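(* For any constant $\epsilon > 0$, there exists a dynamic algorithm for $\mathsf{LIS}$ with approximation factor $1+\epsilon$ and update time $\tilde O(\sqrt{n})$ in the worst case.
   Context: Dynamic $\mathsf{LIS}$: an array $a$ of distinct numbers starts empty; operations arrive one at a time, each either "insert$(i,x)$" (insert value $x$ at position $i$, shifting later elements right) or "delete$(i)$" (remove the $i$-th element, shifting later elements left). After each operation the algorithm reports a value $v$ with $\mathsf{LIS}(a)/\alpha\le v\le\mathsf{LIS}(a)$, where $\mathsf{LIS}(a)$ is the length of a longest strictly increasing subsequence of the current array and $\alpha$ is the approximation factor. Update time is measured per operation in terms of the current array size $n$; $\tilde O$ hides polylogarithmic factors. *)

theory Defs
  imports Complex_Main "HOL-Library.Sublist" "HOL-Library.Landau_Symbols"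
begin

section \<open>Longest increasing subsequences and array updates\<close>

definition LIS :: "'a::linorder list \<Rightarrow> nat" where
  "LIS a = Max {length b | b. subseq b a \<and> sorted_wrt (<) b}"

text \<open>Positions are counted from 0: an insertion at position \<open>length a\<close> appends.\<close>

datatype update = Insert nat real | Delete nat

fun valid_update :: "update \<Rightarrow> real list \<Rightarrow> bool" where
  "valid_update (Insert i x) a \<longleftrightarrow> i \<le> length a \<and> x \<notin> set a"
| "valid_update (Delete i) a \<longleftrightarrow> i < length a"

fun apply_update :: "update \<Rightarrow> real list \<Rightarrow> real list" where
  "apply_update (Insert i x) a = take i a @ x # drop i a"
| "apply_update (Delete i) a = take i a @ drop (Suc i) a"


section \<open>A word RAM\<close>

text \<open>
  The memory consists of zero-initialised arrays of unbounded length, each named by a natural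
  number. Word arrays hold natural numbers; key arrays hold array values. Keys are atomic:
  they can only be copied and compared with each other, so the model is comparison based and words
  cannot encode keys. Since array names are constants of the program, a program uses only
  finitely many arrays. There are no separate registers: cell 0 of an array serves as one.
\<close>

record state =
  words :: "nat \<Rightarrow> nat \<Rightarrow> nat"
  keys :: "nat \<Rightarrow> nat \<Rightarrow> real"

definition initial_state :: state where
  "initial_state = \<lparr>words = \<lambda>_ _. 0, keys = \<lambda>_ _. 0\<rparr>"

datatype wexp =
    Const nat
  | Cell nat wexp
  | Plus wexp wexp
  | Minus wexp wexp
  | Times wexp wexp
  | Div wexp wexp

datatype test =
    Less wexp wexp
  | KeyLess nat wexp nat wexp
  | Neg test
  | Conj test test

datatype com =
    Skip
  | Store nat wexp wexp
  | KeyCopy nat wexp nat wexp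
  | Seq com com
  | Cond test com com
  | While test com

text \<open>Subtraction is truncated at 0, and division by 0 yields 0.\<close>

fun wval :: "wexp \<Rightarrow> state \<Rightarrow> nat" where
  "wval (Const n) s = n"
| "wval (Cell a e) s = words s a (wval e s)"
| "wval (Plus e1 e2) s = wval e1 s + wval e2 s"
| "wval (Minus e1 e2) s = wval e1 s - wval e2 s"
| "wval (Times e1 e2) s = wval e1 s * wval e2 s"
| "wval (Div e1 e2) s = wval e1 s div wval e2 s"

fun tval :: "test \<Rightarrow> state \<Rightarrow> bool" where
  "tval (Less e1 e2) s \<longleftrightarrow> wval e1 s < wval e2 s"
| "tval (KeyLess a e1 b e2) s \<longleftrightarrow> keys s a (wval e1 s) < keys s b (wval e2 s)"
| "tval (Neg b) s \<longleftrightarrow> \<not> tval b s"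
| "tval (Conj b1 b2) s \<longleftrightarrow> tval b1 s \<and> tval b2 s"

text \<open>
  \<open>wfits B e s\<close>: every word arising in the evaluation of \<open>e\<close>, including intermediate results
  and addresses, is at most \<open>B\<close>.
\<close>

fun wfits :: "nat \<Rightarrow> wexp \<Rightarrow> state \<Rightarrow> bool" where
  "wfits B (Const n) s \<longleftrightarrow> n \<le> B"
| "wfits B (Cell a e) s \<longleftrightarrow> wfits B e s \<and> wval (Cell a e) s \<le> B"
| "wfits B (Plus e1 e2) s \<longleftrightarrow> wfits B e1 s \<and> wfits B e2 s \<and> wval (Plus e1 e2) s \<le> B"
| "wfits B (Minus e1 e2) s \<longleftrightarrow> wfits B e1 s \<and> wfits B e2 s"
| "wfits B (Times e1 e2) s \<longleftrightarrow> wfits B e1 s \<and> wfits B e2 s \<and> wval (Times e1 e2) s \<le> B"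
| "wfits B (Div e1 e2) s \<longleftrightarrow> wfits B e1 s \<and> wfits B e2 s"

fun tfits :: "nat \<Rightarrow> test \<Rightarrow> state \<Rightarrow> bool" where
  "tfits B (Less e1 e2) s \<longleftrightarrow> wfits B e1 s \<and> wfits B e2 s"
| "tfits B (KeyLess a e1 b e2) s \<longleftrightarrow> wfits B e1 s \<and> wfits B e2 s"
| "tfits B (Neg b) s \<longleftrightarrow> tfits B b s"
| "tfits B (Conj b1 b2) s \<longleftrightarrow> tfits B b1 s \<and> tfits B b2 s"

text \<open>Every operator, comparison and memory access costs one time unit.\<close>

fun wcost :: "wexp \<Rightarrow> nat" where
  "wcost (Const n) = 1"
| "wcost (Cell a e) = 1 + wcost e"
| "wcost (Plus e1 e2) = 1 + wcost e1 + wcost e2"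
| "wcost (Minus e1 e2) = 1 + wcost e1 + wcost e2"
| "wcost (Times e1 e2) = 1 + wcost e1 + wcost e2"
| "wcost (Div e1 e2) = 1 + wcost e1 + wcost e2"

fun tcost :: "test \<Rightarrow> nat" where
  "tcost (Less e1 e2) = 1 + wcost e1 + wcost e2"
| "tcost (KeyLess a e1 b e2) = 1 + wcost e1 + wcost e2"
| "tcost (Neg b) = 1 + tcost b"
| "tcost (Conj b1 b2) = 1 + tcost b1 + tcost b2"

definition store_word :: "nat \<Rightarrow> nat \<Rightarrow> nat \<Rightarrow> state \<Rightarrow> state" where
  "store_word a i w s = s\<lparr>words := (words s)(a := (words s a)(i := w))\<rparr>"

definition store_key :: "nat \<Rightarrow> nat \<Rightarrow> real \<Rightarrow> state \<Rightarrow> state" where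
  "store_key a i x s = s\<lparr>keys := (keys s)(a := (keys s a)(i := x))\<rparr>"

text \<open>
  \<open>exec B c s t s'\<close>: on a machine with words of range \<open>{0..B}\<close>, program \<open>c\<close> started in \<open>s\<close>
  terminates in \<open>s'\<close> after \<open>t\<close> time units. A program that overflows the word range gets stuck.
\<close>

inductive exec :: "nat \<Rightarrow> com \<Rightarrow> state \<Rightarrow> nat \<Rightarrow> state \<Rightarrow> bool" for B :: nat where
  Skip: "exec B Skip s 1 s"
| Store: "wfits B e1 s \<Longrightarrow> wfits B e2 s \<Longrightarrow>
    exec B (Store a e1 e2) s (1 + wcost e1 + wcost e2)
      (store_word a (wval e1 s) (wval e2 s) s)"
| KeyCopy: "wfits B e1 s \<Longrightarrow> wfits B e2 s \<Longrightarrow>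
    exec B (KeyCopy a e1 b e2) s (1 + wcost e1 + wcost e2)
      (store_key a (wval e1 s) (keys s b (wval e2 s)) s)"
| Seq: "exec B c1 s t1 s' \<Longrightarrow> exec B c2 s' t2 s'' \<Longrightarrow> exec B (Seq c1 c2) s (t1 + t2) s''"
| CondTrue: "tfits B b s \<Longrightarrow> tval b s \<Longrightarrow> exec B c1 s t s' \<Longrightarrow>
    exec B (Cond b c1 c2) s (tcost b + t) s'"
| CondFalse: "tfits B b s \<Longrightarrow> \<not> tval b s \<Longrightarrow> exec B c2 s t s' \<Longrightarrow>
    exec B (Cond b c1 c2) s (tcost b + t) s'"
| WhileFalse: "tfits B b s \<Longrightarrow> \<not> tval b s \<Longrightarrow> exec B (While b c) s (tcost b) s"
| WhileTrue: "tfits B b s \<Longrightarrow> tval b s \<Longrightarrow> exec B c s t1 s' \<Longrightarrow> exec B (While b c) s' t2 s'' \<Longrightarrow>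
    exec B (While b c) s (tcost b + t1 + t2) s''"

inductive_cases exec_SkipE: "exec B Skip s t s'"
inductive_cases exec_StoreE: "exec B (Store a e1 e2) s t s'"
inductive_cases exec_KeyCopyE: "exec B (KeyCopy a e1 b e2) s t s'"
inductive_cases exec_SeqE: "exec B (Seq c1 c2) s t s'"
inductive_cases exec_CondE: "exec B (Cond b c1 c2) s t s'"
inductive_cases exec_WhileE: "exec B (While b c) s t s'"

lemma exec_deterministic:
  "exec B c s t s' \<Longrightarrow> exec B c s u s'' \<Longrightarrow> u = t \<and> s'' = s'"
proof (induction arbitrary: u s'' rule: exec.induct)
  case (Skip s)
  then show ?case by (auto elim: exec_SkipE)
next
  case (Store e1 s e2 a)
  from Store(3) show ?case by (auto elim: exec_StoreE)
next
  case (KeyCopy e1 s e2 a b)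
  from KeyCopy(3) show ?case by (auto elim: exec_KeyCopyE)
next
  case (Seq c1 s t1 s' c2 t2 s2)
  from Seq.prems Seq.IH show ?case by (blast elim: exec_SeqE)
next
  case (CondTrue b s c1 t s' c2)
  from CondTrue.prems CondTrue.hyps CondTrue.IH show ?case by (blast elim: exec_CondE)
next
  case (CondFalse b s c2 t s' c1)
  from CondFalse.prems CondFalse.hyps CondFalse.IH show ?case by (blast elim: exec_CondE)
next
  case (WhileFalse b s c)
  from WhileFalse.prems WhileFalse.hyps show ?case by (blast elim: exec_WhileE)
next
  case (WhileTrue b s c t1 s' t2 s2)
  from WhileTrue.prems WhileTrue.hyps WhileTrue.IH show ?case by (blast elim: exec_WhileE)
qed


section \<open>Dynamic algorithms\<close>

text \<open>
  A dynamic algorithm consists of one program per kind of update, run on a memory that persists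
  between updates. The position is passed in cell 0 of word array 0, the inserted value in cell 0
  of key array 0, and the answer is read off from cell 0 of word array 1.
\<close>

record dyn_alg =
  insert_code :: com
  delete_code :: com

fun code_for :: "dyn_alg \<Rightarrow> update \<Rightarrow> com" where
  "code_for A (Insert i x) = insert_code A"
| "code_for A (Delete i) = delete_code A"

fun load_update :: "update \<Rightarrow> state \<Rightarrow> state" where
  "load_update (Insert i x) s = store_word 0 0 i (store_key 0 0 x s)"
| "load_update (Delete i) s = store_word 0 0 i s"

definition answer :: "state \<Rightarrow> nat" where
  "answer s = words s 1 0"

text \<open>
  \<open>handles A c \<alpha> T us a N s\<close>: from array \<open>a\<close> and memory \<open>s\<close>, the algorithm processes the updates
  \<open>us\<close> one after the other, each answer being an \<open>\<alpha>\<close>-approximation for the array just obtained and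
  each update taking time at most \<open>T n\<close>, where \<open>n\<close> is the length of that array. Nothing is
  required from the first invalid update on. The parameter \<open>N\<close> is the largest length the array has
  had so far; words are restricted to \<open>{0..(N + 2) ^ c}\<close>, i.e.\ to \<open>O(log N)\<close> bits. Taking the peak
  length instead of the current one guarantees that words in memory always remain within range.
  By \<open>exec_deterministic\<close>, the existentially quantified \<open>t\<close> and \<open>s'\<close> are unique.
\<close>

fun handles ::
  "dyn_alg \<Rightarrow> nat \<Rightarrow> real \<Rightarrow> (nat \<Rightarrow> real) \<Rightarrow> update list \<Rightarrow> real list \<Rightarrow> nat \<Rightarrow> state \<Rightarrow> bool" where
  "handles A c \<alpha> T [] a N s \<longleftrightarrow> True"
| "handles A c \<alpha> T (u # us) a N s \<longleftrightarrow>
    (valid_update u a \<longrightarrow>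
      (let a' = apply_update u a; N' = max N (length a') in
        \<exists>t s'. exec ((N' + 2) ^ c) (code_for A u) (load_update u s) t s' \<and>
          real (LIS a') / \<alpha> \<le> real (answer s') \<and> answer s' \<le> LIS a' \<and>
          real t \<le> T (length a') \<and>
          handles A c \<alpha> T us a' N' s'))"

definition dynamic_LIS_algorithm :: "dyn_alg \<Rightarrow> real \<Rightarrow> (nat \<Rightarrow> real) \<Rightarrow> bool" where
  "dynamic_LIS_algorithm A \<alpha> T \<longleftrightarrow> (\<exists>c. \<forall>us. handles A c \<alpha> T us [] 0 initial_state)"

definition soft_O :: "(nat \<Rightarrow> real) \<Rightarrow> (nat \<Rightarrow> real) set" where
  "soft_O g = {f. \<exists>k::nat. f \<in> O(\<lambda>n. g n * ln (real n) ^ k)}"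

end

(*
  For any assignment of ranks to the elements such that smaller elements to the left have smaller
  ranks and an element of rank r > 1 has a smaller element of rank r - 1 to its left, the largest
  rank is the LIS. Along a rank the values decrease, so an insertion or deletion changes the rank of
  a contiguous piece of each level, by one; the piece is found by binary search. Each level is kept
  as a persistent trie over the positions, in which a piece is moved to the neighbouring level by
  splicing in logarithmic time. One update thus costs polylogarithmic time per level, which is
  affordable as long as there are at most C * sigma levels with sigma about sqrt n. Once there are
  more, the LIS is so large that an additive error of order sigma is within the factor 1 + eps;
  then the LIS of the array as it was sigma updates ago, kept by patience sorting, is good enough.
  Positions are managed by sqrt decomposition into blocks with gaps.

  The parameter sigma and the patience sorting go stale after sigma updates. So a second structure
  is built in the background by appending about sigma elements of the array per update, in
  logarithmic time each, while updates falling into the part already copied are applied to it as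
  well. It is complete after at most sigma updates and then replaces the first one.
*)

theory Submission
  imports Defs "HOL-Real_Asymp.Real_Asymp"
begin

text \<open>The two conditions on ranks force the rank of an element to be the length of a longest
  increasing subsequence ending there. Being local, they can be violated and repaired one level at a
  time, and the invariants of the two cascades say which violations are pending. The tries are keyed
  by addresses rather than positions: an insertion changes the positions of all later elements, but
  only the addresses of O(sigma) elements of one block, and each such change is a polylogarithmic
  move inside one level. Persistence serves the splice: a piece leaves one level and enters the
  other, so both source tries must survive. Nodes are never freed; only the rebuilding keeps their
  number, and with it the word size, within bounds. Appending is cheap because an element to the
  right of all others pushes nothing out of its level. After \<open>e\<close> updates a structure
  without levels answers with additive error at most \<open>2*e\<close>. Its LIS exceeds
  \<open>C*\<sigma> - e\<close> and \<open>e\<close> stays of order sigma, so a constant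
  \<open>C\<close> depending on eps gives the factor 1 + eps.\<close>

section \<open>Elementary bounds on the longest increasing subsequence\<close>

lemma LIS_set_finite: "finite {length b | b. subseq b a & sorted_wrt (<) b}"
proof -
  have "{length b | b. subseq b a & sorted_wrt (<) b} \<subseteq> {..length a}"
    by (auto dest: list_emb_length)
  then show ?thesis by (rule finite_subset) simp
qed

lemma LIS_ge: "subseq b a ==> sorted_wrt (<) b ==> length b <= LIS a"
  unfolding LIS_def using LIS_set_finite[of a] by (intro Max_ge) auto

lemma LIS_witness: "\<exists>b. subseq b a & sorted_wrt (<) b & length b = LIS a"
proof -
  have "LIS a \<in> {length b | b. subseq b a & sorted_wrt (<) b}"
    unfolding LIS_def using LIS_set_finite[of a] by (intro Max_in) (auto intro: exI[of _ "[]"])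
  then show ?thesis by auto
qed

lemma LIS_le: "(!!b. subseq b a ==> sorted_wrt (<) b ==> length b <= n) ==> LIS a <= n"
  using LIS_witness[of a] by metis

lemma LIS_mono: "subseq a b ==> LIS a <= LIS b"
  by (rule LIS_le) (meson LIS_ge subseq_order.trans)

text \<open>Together with \<open>LIS_insert\<close>, one update changes the LIS by at most one. This
  bounds the error of an answer that ignores the last \<open>e\<close> updates.\<close>

lemma LIS_remove: "LIS (p @ q) <= LIS (p @ x # q)"
  by (rule LIS_mono, rule list_emb_append_mono) (auto intro: list_emb_Cons)

lemma LIS_insert: "LIS (p @ x # q) <= Suc (LIS (p @ q))"
proof (rule LIS_le)
  fix b assume b: "subseq b (p @ x # q)" "sorted_wrt (<) b"
  then obtain b1 b2 where 1: "b = b1 @ b2" "subseq b1 p" "subseq b2 (x # q)"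
    by (auto simp: subseq_append_iff)
  show "length b <= Suc (LIS (p @ q))"
  proof (cases "subseq b2 q")
    case True
    then have "subseq b (p @ q)" using 1 by (simp add: list_emb_append_mono)
    then show ?thesis using LIS_ge b(2) le_SucI by blast
  next
    case False
    then obtain b' where "b2 = x # b'" "subseq b' q" using 1(3) by (cases b2) (auto split: if_splits)
    then have "subseq (b1 @ b') (p @ q)" "sorted_wrt (<) (b1 @ b')" "length b = Suc (length (b1 @ b'))"
      using 1 b by (auto simp: list_emb_append_mono sorted_wrt_append)
    then show ?thesis using LIS_ge by fastforce
  qed
qed

lemma LIS_length: "LIS a <= length a"
  by (rule LIS_le) (auto dest: list_emb_length)

section \<open>Levelings\<close>

definition leveling :: "nat set => (nat => 'a::linorder) => (nat => nat) => nat => bool" where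
  "leveling A f g n \<longleftrightarrow> finite A & (\<forall>y\<in>A. 1 <= g y & g y <= n) &
     (\<forall>y\<in>A. \<forall>z\<in>A. y < z --> f y < f z --> g y < g z) &
     (\<forall>z\<in>A. 1 < g z --> (\<exists>y\<in>A. y < z & f y < f z & Suc (g y) = g z)) &
     (n = 0 \<or> (\<exists>z\<in>A. g z = n))"

text \<open>Predecessors are exactly one level lower, so following them visits every level on the
  way down.\<close>

lemma leveling_below:
  assumes L: "leveling A f g n" and z: "z \<in> A" "q <= g z" "1 <= q"
  shows "\<exists>y\<in>A. y <= z & f y <= f z & g y = q"
  using z
proof (induction "g z - q" arbitrary: z)
  case 0
  then show ?case by (intro bexI[of _ z]) auto
next
  case (Suc d)
  then have "1 < g z" by simp
  with L Suc.prems obtain y where y: "y \<in> A" "y < z" "f y < f z" "Suc (g y) = g z"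
    unfolding leveling_def by blast
  have "d = g y - q" "q <= g y" using y(4) Suc.hyps(2) by auto
  from Suc(1)[OF this(1) y(1) this(2)] Suc.prems obtain w where "w \<in> A" "w <= y" "f w <= f y" "g w = q" by auto
  then show ?case using y by (intro bexI[of _ w]) auto
qed

lemma leveling_below_less:
  assumes L: "leveling A f g n" and z: "z \<in> A" "q < g z" "1 <= q"
  shows "\<exists>y\<in>A. y < z & f y < f z & g y = q"
proof -
  from L z obtain y where y: "y \<in> A" "y < z" "f y < f z" "Suc (g y) = g z"
    unfolding leveling_def by (metis le_less_trans)
  then obtain w where "w \<in> A" "w <= y" "f w <= f y" "g w = q"
    using leveling_below[OF L y(1), of q] z by auto
  then show ?thesis using y by (intro bexI[of _ w]) auto
qed

lemma leveling_nonempty: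
  assumes "leveling A f g n" "1 <= q" "q <= n" shows "\<exists>z\<in>A. g z = q"
proof -
  from assms obtain z where "z \<in> A" "g z = n" unfolding leveling_def by fastforce
  then show ?thesis using leveling_below[OF assms(1), of z q] assms by auto
qed

text \<open>Every level is inhabited. This bounds the number of levels by the size of the address
  space, so that level numbers fit into words.\<close>

lemma leveling_le_card:
  assumes "leveling A f g n" shows "n <= card A"
proof -
  have "{1..n} \<subseteq> g ` A" using leveling_nonempty[OF assms] by force
  moreover have "finite A" using assms by (simp add: leveling_def)
  ultimately have "card {1..n} <= card A" by (meson card_image_le card_mono finite_imageI le_trans)
  then show ?thesis by simp
qed

lemma sorted_wrt_subset_subseq:
  fixes C al :: "nat list"
  assumes "sorted_wrt (<) al" "sorted_wrt (<) C" "set C \<subseteq> set al"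
  shows "subseq C al"
proof -
  have "sorted_wrt (<) (filter (%x. x \<in> set C) al)" using assms(1) by (simp add: sorted_wrt_filter)
  moreover have "set (filter (%x. x \<in> set C) al) = set C" using assms(3) by auto
  ultimately have "filter (%x. x \<in> set C) al = C"
    using assms(2) by (simp add: strict_sorted_equal)
  then show ?thesis by (metis subseq_filter_left)
qed

text \<open>Append \<open>z\<close> to a chain that ends in its predecessor one level below.\<close>

lemma leveling_chain:
  assumes L: "leveling A f g n"
  shows "z \<in> A ==> \<exists>C. C ~= [] & sorted_wrt (<) C & set C \<subseteq> A & sorted_wrt (<) (map f C) & last C = z & length C = g z"
proof (induction "g z" arbitrary: z)
  case 0
  then show ?case using L by (auto simp: leveling_def)
next
  case (Suc m)
  show ?case
  proof (cases "m = 0")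
    case True
    then show ?thesis using Suc by (intro exI[of _ "[z]"]) auto
  next
    case False
    then have "1 < g z" using Suc.hyps(2) by linarith
    then obtain y where y: "y \<in> A" "y < z" "f y < f z" "Suc (g y) = g z"
      using L Suc.prems unfolding leveling_def by blast
    then have "g y = m" using Suc.hyps(2) by simp
    note y = y(1-3) this
    from Suc(1)[OF y(4)[symmetric] y(1)] y(4) obtain C where C: "C ~= []" "sorted_wrt (<) C" "set C \<subseteq> A" "sorted_wrt (<) (map f C)" "last C = y" "length C = m"
      by auto
    have "sorted_wrt (<) (C @ [z])"
    proof -
      have "\<forall>x\<in>set C. x <= y" 
      proof -
        obtain D where D: "C = D @ [y]" using C(1,5) by (metis append_butlast_last_id)
        then show ?thesis using C(2) by (auto simp: sorted_wrt_append less_imp_le)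
      qed
      then show ?thesis using C y(2) by (auto simp: sorted_wrt_append)
    qed
    moreover have "sorted_wrt (<) (map f (C @ [z]))"
    proof -
      obtain D where D: "C = D @ [y]" using C(1,5) by (metis append_butlast_last_id)
      then show ?thesis using C(4) y(3) by (auto simp: sorted_wrt_append)
    qed
    ultimately show ?thesis using C Suc by (intro exI[of _ "C @ [z]"]) auto
  qed
qed

text \<open>Levels strictly increase along an increasing subsequence, which therefore meets each of
  the \<open>n\<close> levels at most once; a chain of predecessors from the top level attains
  \<open>n\<close>.\<close>

lemma leveling_LIS:
  assumes al: "sorted_wrt (<) al" and L: "leveling (set al) f g n"
  shows "LIS (map f al) = n"
proof (rule antisym)
  show "LIS (map f al) <= n"
  proof (rule LIS_le)
    fix b assume b: "subseq b (map f al)" "sorted_wrt (<) b"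
    then obtain N where N: "b = nths (map f al) N" by (auto simp: subseq_conv_nths)
    define C where "C = nths al N"
    have bC: "b = map f C" by (simp add: N C_def nths_map)
    have sub: "set C \<subseteq> set al" by (simp add: C_def set_nths_subset)
    have sC: "sorted_wrt (<) C" using al unfolding C_def
      by (simp add: strict_sorted_iff sorted_nths distinct_nthsI)
    have "sorted_wrt (<) (map g C)" using sC b(2) sub unfolding bC
    proof (induction C)
      case (Cons a C)
      then show ?case using L unfolding leveling_def by auto
    qed simp
    then have "distinct (map g C)" by (simp add: strict_sorted_iff)
    then have "length C = card (g ` set C)" by (metis distinct_card length_map set_map)
    also have "\<dots> <= card {1..n}" using sub L by (intro card_mono) (auto simp: leveling_def)
    finally show "length b <= n" by (simp add: bC)
  qed
  show "n <= LIS (map f al)"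
  proof (cases "n = 0")
    case False
    then obtain z where "z \<in> set al" "g z = n" using L by (auto simp: leveling_def)
    with leveling_chain[OF L] obtain C where
      "sorted_wrt (<) C" "set C \<subseteq> set al" "sorted_wrt (<) (map f C)" "length C = n" by metis
    then show ?thesis using LIS_ge[of "map f C" "map f al"] sorted_wrt_subset_subseq[OF al] by (simp add: subseq_map)
  qed simp
qed

text \<open>Only the order of the addresses enters a leveling, so elements may be relocated as long
  as their order is kept.\<close>

lemma leveling_transfer:
  assumes L: "leveling A f g n" and m: "strict_mono_on A \<phi>"
    and e: "!!y. y \<in> A ==> f' (\<phi> y) = f y & g' (\<phi> y) = g y"
  shows "leveling (\<phi> ` A) f' g' n"
proof -
  have mm: "y \<in> A ==> z \<in> A ==> \<phi> y < \<phi> z \<longleftrightarrow> y < z" for y z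
    using m by (metis linorder_neqE_nat not_less_iff_gr_or_eq strict_mono_onD)
  show ?thesis using L unfolding leveling_def by (simp add: e mm)
qed

text \<open>The case needed for shifting inside a block: one element jumps to a free address without
  passing another element.\<close>

lemma leveling_move:
  assumes L: "leveling A f g n" and s: "src \<in> A" "dst \<notin> A"
    and b: "!!y. y \<in> A ==> y ~= src ==> y < src \<longleftrightarrow> y < dst"
  shows "leveling (insert dst (A - {src})) (f(dst := f src)) (g(dst := g src)) n"
proof -
  let ?p = "%y. if y = src then dst else y"
  have m: "strict_mono_on A ?p"
    using s b by (intro strict_mono_onI) (auto, metis linorder_neqE_nat not_less_iff_gr_or_eq)
  have "?p ` A = insert dst (A - {src})" using s by auto
  moreover have "(f(dst := f src)) (?p y) = f y & (g(dst := g src)) (?p y) = g y" if "y \<in> A" for y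
    using that s by auto
  ultimately show ?thesis using leveling_transfer[OF L m, of "f(dst := f src)" "g(dst := g src)"] by simp
qed

section \<open>Insertion cascade on levelings\<close>

text \<open>The level at which a new element \<open>k\<close> belongs, or the level of \<open>k\<close> if it is already present.\<close>

definition rank_in :: "nat set => (nat => 'a::linorder) => (nat => nat) => nat => nat => bool" where
  "rank_in A f g k r \<longleftrightarrow> 1 <= r & (\<forall>q\<ge>1. (\<exists>y\<in>A. g y = q & y < k & f y < f k) \<longleftrightarrow> q < r)"

text \<open>The search for the rank of a new element also recovers the level of a present one, so
  levels need not be stored with the elements.\<close>

lemma rank_in_member:
  assumes L: "leveling A f g n" and k: "k \<in> A" and r: "rank_in A f g k r"
  shows "g k = r"
proof -
  have "q < r \<longleftrightarrow> q < g k" if "1 <= q" for q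
    using leveling_below_less[OF L k, of q] r that L k unfolding rank_in_def leveling_def by blast
  moreover have "1 <= g k" "1 <= r" using L k r by (auto simp: leveling_def rank_in_def)
  ultimately show ?thesis by (metis linorder_neqE_nat less_irrefl)
qed

text \<open>Makes the condition in \<open>rank_in\<close> monotone in the level, hence accessible to
  binary search.\<close>

lemma rank_downward:
  assumes L: "leveling A f g n" and y: "y \<in> A" "g y = q" "y < k" "f y < f k" and p: "1 <= p" "p <= q"
  shows "\<exists>y\<in>A. g y = p & y < k & f y < f k"
  using leveling_below[OF L y(1), of p] y p by (metis le_less_trans)

text \<open>
  Invariant of the insertion cascade: the elements \<open>T\<close> have just been promoted to level \<open>r\<close>,
  where they are the only possible source of conflicts. The last conjunct says that the elements
  which \<open>T\<close> pushes out of level \<open>r\<close> are cut out by one position and one value.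
\<close>

definition ins_inv :: "nat set => (nat => 'a::linorder) => (nat => nat) => nat => nat set => nat => bool" where
  "ins_inv A f g r T n \<longleftrightarrow> finite A & inj_on f A & T \<subseteq> A & 1 <= r & (\<forall>t\<in>T. g t = r) &
    (\<forall>y\<in>A. 1 <= g y) & (\<forall>y\<in>A - T. g y <= n) & (n = 0 \<or> (\<exists>z\<in>A. n <= g z)) &
    (\<forall>y\<in>A. \<forall>z\<in>A. y < z --> f y < f z --> g y < g z \<or> (y \<in> T & z \<notin> T & g z = r)) &
    (\<forall>z\<in>A. 1 < g z -->
       (\<exists>y\<in>A. y < z & f y < f z & Suc (g y) = g z & (r < g z --> y \<notin> T)) \<or>
       (z \<notin> T & g z = r & (\<exists>y\<in>T. y < z & f y < f z))) &
    (\<forall>z\<in>A. z \<notin> T --> g z = r --> T ~= {} --> Min T < z --> f (Max T) < f z -->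
       (\<exists>y\<in>T. y < z & f y < f z))"

text \<open>The rank places \<open>k\<close> above everything to its left with smaller value.
  Elements to its right with larger value lie on level \<open>r\<close> or higher, and those on
  level \<open>r\<close> itself are the conflicts to be repaired.\<close>

lemma ins_inv_init:
  assumes L: "leveling A f g n" and i: "inj_on f (insert k A)" and k: "k \<notin> A" and r: "rank_in A f g k r"
  shows "ins_inv (insert k A) f (g(k := r)) r {k} n"
proof -
  have A: "finite A" "!!y. y \<in> A ==> 1 <= g y & g y <= n"
    "!!y z. y \<in> A ==> z \<in> A ==> y < z ==> f y < f z ==> g y < g z"
    "!!z. z \<in> A ==> 1 < g z ==> \<exists>y\<in>A. y < z & f y < f z & Suc (g y) = g z"
    "n = 0 \<or> (\<exists>z\<in>A. g z = n)" using L unfolding leveling_def by blast+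
  have r1: "1 <= r" and rq: "!!q. q \<ge> 1 ==> (\<exists>y\<in>A. g y = q & y < k & f y < f k) \<longleftrightarrow> q < r"
    using r by (auto simp: rank_in_def)
  have below: "g y < r" if "y \<in> A" "y < k" "f y < f k" for y using rq[of "g y"] A(2) that by blast
  \<comment> \<open>An element of level \<open>r - 1\<close> that lies left of and below
    \<open>k\<close> also lies left of and below \<open>z\<close>, so \<open>z\<close> is above
    level \<open>r - 1\<close>.\<close>
  have above: "r < g z \<or> g z = r" if "z \<in> A" "k < z" "f k < f z" for z
  proof (cases "r = 1")
    case True then show ?thesis using A(2)[OF that(1)] by linarith
  next
    case False
    then have "1 <= r - 1" "r - 1 < r" using r1 by auto
    then obtain y where "y \<in> A" "g y = r - 1" "y < k" "f y < f k" using rq[of "r - 1"] by blast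
    then have "r - 1 < g z" using A(3)[of y z] that by auto
    then show ?thesis by linarith
  qed
  have pk: "\<exists>y\<in>A. y < k & f y < f k & Suc (g y) = r" if "1 < r"
  proof -
    have "1 <= r - 1" "r - 1 < r" using that by auto
    then obtain y where "y \<in> A" "g y = r - 1" "y < k" "f y < f k" using rq[of "r - 1"] by blast
    then show ?thesis using that by (intro bexI[of _ y]) auto
  qed
  show ?thesis
    unfolding ins_inv_def
  proof (intro conjI)
    show "\<forall>y\<in>insert k A. \<forall>z\<in>insert k A. y < z --> f y < f z -->
       (g(k := r)) y < (g(k := r)) z \<or> y \<in> {k} & z \<notin> {k} & (g(k := r)) z = r"
      using k below above A(3) by auto
    show "\<forall>z\<in>insert k A. 1 < (g(k := r)) z -->
       (\<exists>y\<in>insert k A. y < z & f y < f z & Suc ((g(k := r)) y) = (g(k := r)) z & (r < (g(k := r)) z --> y \<notin> {k})) \<or>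
       z \<notin> {k} & (g(k := r)) z = r & (\<exists>y\<in>{k}. y < z & f y < f z)"
    proof (intro ballI impI disjI1)
      fix z assume z: "z \<in> insert k A" "1 < (g(k := r)) z"
      obtain y where "y \<in> A" "y < z" "f y < f z" "Suc (g y) = (g(k := r)) z"
        using z pk A(4)[of z] k by (cases "z = k") auto
      then show "\<exists>y\<in>insert k A. y < z & f y < f z & Suc ((g(k := r)) y) = (g(k := r)) z & (r < (g(k := r)) z --> y \<notin> {k})"
        using k by (intro bexI[of _ y]) auto
    qed
    show "n = 0 \<or> (\<exists>z\<in>insert k A. n <= (g(k := r)) z)" using A(5) k by (auto)
  qed (use A i k r1 in auto)
qed

text \<open>Values decrease from left to right on a level. The excluded pairs are those of which
  only the left element belongs to \<open>T\<close>.\<close>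

lemma ins_inv_antichain:
  assumes I: "ins_inv A f g r T n" and y: "y \<in> A" "z \<in> A" "y < z" "g y = g z" "y \<in> T --> z \<in> T"
  shows "f z < f y"
proof -
  have "~ f y < f z" using I y unfolding ins_inv_def by (metis less_irrefl)
  moreover have "f y ~= f z" using I y unfolding ins_inv_def by (metis inj_onD less_irrefl)
  ultimately show ?thesis by simp
qed

text \<open>Promoting exactly the elements of level \<open>r\<close> that lie right of and above
  some element of \<open>T\<close> repairs the order there; the promoted ones are then the only
  possible conflicts one level higher. As \<open>T\<close> is decreasing, its first position and its
  lowest value, that of \<open>Max T\<close>, cut them out.\<close>

lemma ins_inv_step:
  assumes I: "ins_inv A f g r T n" and ne: "T ~= {}"
    and T': "T' = {z \<in> A. z \<notin> T & g z = r & Min T <= z & ~ f z < f (Max T)}"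
  shows "ins_inv A f (%y. if y \<in> T' then Suc r else g y) (Suc r) T' (max n r)"
proof -
  have A0: "finite A" "inj_on f A" "T \<subseteq> A" "1 <= r" "\<forall>t\<in>T. g t = r" "\<forall>y\<in>A. 1 <= g y"
    "\<forall>y\<in>A - T. g y <= n" "n = 0 \<or> (\<exists>z\<in>A. n <= g z)"
    "\<forall>y\<in>A. \<forall>z\<in>A. y < z --> f y < f z --> g y < g z \<or> (y \<in> T & z \<notin> T & g z = r)"
    "\<forall>z\<in>A. 1 < g z -->
       (\<exists>y\<in>A. y < z & f y < f z & Suc (g y) = g z & (r < g z --> y \<notin> T)) \<or>
       (z \<notin> T & g z = r & (\<exists>y\<in>T. y < z & f y < f z))"
    "\<forall>z\<in>A. z \<notin> T --> g z = r --> T ~= {} --> Min T < z --> f (Max T) < f z -->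
       (\<exists>y\<in>T. y < z & f y < f z)"
    by (insert I[unfolded ins_inv_def], (elim conjE, assumption)+)
  note A = A0[rule_format]
  have fT: "finite T" using A(1,3) finite_subset by blast
  have mT: "Min T \<in> T" "Max T \<in> T" using fT ne by auto
  have T'A: "T' \<subseteq> A" "T' \<inter> T = {}" "!!z. z \<in> T' ==> g z = r" using T' by auto
  \<comment> \<open>Two descriptions of \<open>T'\<close> agree: the cut by one position and one
    value, which can be spliced, and domination by an element of \<open>T\<close>, which the order
    conditions speak about.\<close>
  have T'dom: "z \<in> T' \<longleftrightarrow> z \<in> A & z \<notin> T & g z = r & (\<exists>y\<in>T. y < z & f y < f z)" for z
  proof
    assume z: "z \<in> T'"
    then have z1: "z \<in> A" "z \<notin> T" "g z = r" "Min T <= z" "~ f z < f (Max T)" using T' by auto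
    have "Min T < z" using z1 mT by (metis le_neq_implies_less)
    moreover have "Max T \<in> A" "Max T ~= z" using z1(2) mT(2) A(3) by auto
    then have "f (Max T) ~= f z" using inj_onD[OF A(2)] z1(1) by blast
    then have "f (Max T) < f z" using z1(5) by (meson linorder_neqE)
    ultimately
    show "z \<in> A & z \<notin> T & g z = r & (\<exists>y\<in>T. y < z & f y < f z)" using A(11) z1 ne by blast
  next
    assume z: "z \<in> A & z \<notin> T & g z = r & (\<exists>y\<in>T. y < z & f y < f z)"
    then obtain y where y: "y \<in> T" "y < z" "f y < f z" by blast
    have "Min T <= y" using fT y by simp
    moreover have "f (Max T) <= f y"
    proof (cases "y = Max T")
      case False
      then have "y < Max T" using fT y by (simp add: order.not_eq_order_implies_strict)
      then have "f (Max T) < f y" using ins_inv_antichain[OF I, of y "Max T"] y mT A(3,5) by auto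
      then show ?thesis by simp
    qed simp
    ultimately show "z \<in> T'" using T' z y by (simp add: not_less)
  qed
  have anti: "f z < f y" if "y \<in> A" "z \<in> A" "y < z" "y \<notin> T" "g y = r" "g z = r" for y z
    using ins_inv_antichain[OF I, of y z] that by auto
  let ?g = "%y. if y \<in> T' then Suc r else g y"
  show ?thesis unfolding ins_inv_def
  proof (intro conjI)
    show "\<forall>y\<in>A. \<forall>z\<in>A. y < z --> f y < f z --> ?g y < ?g z \<or> y \<in> T' & z \<notin> T' & ?g z = Suc r"
    proof (intro ballI impI)
      fix y z assume yz: "y \<in> A" "z \<in> A" "y < z" "f y < f z"
      note o = A(9)[OF yz]
      show "?g y < ?g z \<or> y \<in> T' & z \<notin> T' & ?g z = Suc r"
      proof (cases "y \<in> T'")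
        case True
        then have "g y = r" "y \<notin> T" using T'A by auto
        then have "r < g z" using o by auto
        then show ?thesis using True T'A(3)[of z] by auto
      next
        case False
        show ?thesis
        proof (cases "z \<in> T'")
          case True
          then show ?thesis using False o T'A(3)[OF True] A(5)[of y] by auto
        next
          case z: False
          have "~ (y \<in> T & z \<notin> T & g z = r)" using z T'dom yz by blast
          then show ?thesis using o False z by auto
        qed
      qed
    qed
    show "\<forall>z\<in>A. 1 < ?g z -->
       (\<exists>y\<in>A. y < z & f y < f z & Suc (?g y) = ?g z & (Suc r < ?g z --> y \<notin> T')) \<or>
       z \<notin> T' & ?g z = Suc r & (\<exists>y\<in>T'. y < z & f y < f z)"
    proof (intro ballI impI)
      fix z assume z: "z \<in> A" "1 < ?g z"
      show "(\<exists>y\<in>A. y < z & f y < f z & Suc (?g y) = ?g z & (Suc r < ?g z --> y \<notin> T')) \<or>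
       z \<notin> T' & ?g z = Suc r & (\<exists>y\<in>T'. y < z & f y < f z)"
      proof (cases "z \<in> T'")
        case True
        then obtain y where y: "y \<in> T" "y < z" "f y < f z" using T'dom by blast
        moreover have "y \<notin> T'" "y \<in> A" "g y = r" using y T'A A(3,5) by auto
        ultimately show ?thesis using True by (intro disjI1 bexI[of _ y]) auto
      next
        case False
        then have "1 < g z" using z by auto
        moreover have "~ (z \<notin> T & g z = r & (\<exists>y\<in>T. y < z & f y < f z))" using False T'dom z by blast
        ultimately obtain y where y: "y\<in>A" "y < z" "f y < f z" "Suc (g y) = g z" using A(10) z by blast
        show ?thesis
        proof (cases "y \<in> T'")
          case True
          then show ?thesis using y False T'A(3) by auto
        next
          case F2: False
          then show ?thesis using y False by (intro disjI1 bexI[of _ y]) auto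
        qed
      qed
    qed
    \<comment> \<open>If no element of \<open>T'\<close> is left of and below \<open>z\<close>, then
      \<open>z\<close> lies left of \<open>Max T'\<close> and below the value at
      \<open>Min T'\<close>. Its predecessor \<open>y\<close> on level \<open>r\<close> outside
      \<open>T\<close> is then squeezed between \<open>Min T'\<close> and \<open>Max T'\<close> in
      the old level, so it belongs to the contiguous piece \<open>T'\<close>, a
      contradiction.\<close>
    show "\<forall>z\<in>A. z \<notin> T' --> ?g z = Suc r --> T' ~= {} --> Min T' < z --> f (Max T') < f z -->
       (\<exists>y\<in>T'. y < z & f y < f z)"
    proof (intro ballI impI)
      fix z assume z: "z \<in> A" "z \<notin> T'" "?g z = Suc r" "T' ~= {}" "Min T' < z" "f (Max T') < f z"
      have fT': "finite T'" using T'A(1) A(1) finite_subset by blast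
      have m: "Min T' \<in> T'" "Max T' \<in> T'" using fT' z(4) by auto
      have "g z = Suc r" using z by auto
      then have "1 < g z" "r < g z" "g z ~= r" using A(4) by simp_all
      with A(10)[OF z(1)] obtain y where "y \<in> A" "y < z" "f y < f z" "Suc (g y) = g z" "y \<notin> T" by blast
      then have y: "y \<in> A" "y < z" "f y < f z" "g y = r" "y \<notin> T" using \<open>g z = Suc r\<close> by simp_all
      show "\<exists>y\<in>T'. y < z & f y < f z"
      proof (rule ccontr)
        assume n: "~ (\<exists>y\<in>T'. y < z & f y < f z)"
        then have yT': "y \<notin> T'" using y by blast
        have "f z ~= f (Min T')" using A(2) z(1) m(1) T'A(1) z(2) by (metis inj_onD subsetD)
        then have 1: "f z < f (Min T')" using n m(1) z(5) by (meson linorder_neqE)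
        have "Min T' \<notin> T" "Max T' \<notin> T" using m T'A by auto
        have 2: "z < Max T'" using n m(2) z(6) z(2) by (metis linorder_neqE_nat)
        have "y < Max T'" using y 2 by simp
        then have 3: "f (Max T') < f y" using anti[of y "Max T'"] y m T'A by blast
        have "Min T' < y"
        proof (rule ccontr)
          assume "~ Min T' < y"
          then have "y < Min T'" using m(1) yT' by (metis linorder_neqE_nat)
          then have "f (Min T') < f y" using anti[of y "Min T'"] y m T'A by blast
          then show False using 1 y(3) by simp
        qed
        moreover have "Min T <= Min T'" "~ f (Max T') < f (Max T)" using m T' by auto
        ultimately have "y \<in> T'" using T' y 3 by auto
        then show False using yT' by simp
      qed
    qed
    show "max n r = 0 \<or> (\<exists>z\<in>A. max n r <= ?g z)"
    proof -
      have "\<exists>z\<in>A. n <= ?g z" if n0: "n ~= 0"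
      proof -
        obtain z where "z \<in> A" "n <= g z" using A(8) n0 by auto
        then show ?thesis using T'A(3) by (intro bexI[of _ z]) auto
      qed
      moreover have "\<exists>z\<in>A. r <= ?g z" using mT A(3,5) T'A(2) by (intro bexI[of _ "Min T"]) auto
      ultimately show ?thesis by (cases "n <= r") (auto simp: max_def)
    qed
    show "\<forall>y\<in>A - T'. ?g y <= max n r"
    proof
      fix y assume y: "y \<in> A - T'"
      then show "?g y <= max n r" using A(5)[of y] A(7)[of y] by (cases "y \<in> T") auto
    qed
  qed (use A(1-6) T'A in auto)
qed

lemma ins_inv_final:
  assumes "ins_inv A f g r {} n" shows "leveling A f g n"
proof -
  have "n = 0 \<or> (\<exists>z\<in>A. n <= g z)" "\<forall>y\<in>A. g y <= n"
    using assms unfolding ins_inv_def by simp_all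
  then have "n = 0 \<or> (\<exists>z\<in>A. g z = n)" by (meson le_antisym)
  moreover have "\<forall>z\<in>A. 1 < g z --> (\<exists>y\<in>A. y < z & f y < f z & Suc (g y) = g z)"
    using assms unfolding ins_inv_def by blast
  ultimately show ?thesis using assms unfolding leveling_def ins_inv_def by simp
qed

section \<open>Deletion cascade on levelings\<close>

text \<open>
  Invariant of the deletion cascade: some elements at positions in \<open>{lo..<hi}\<close> have just left
  level \<open>r\<close>, so that only elements of level \<open>Suc r\<close> may lack a predecessor.
\<close>

definition del_inv :: "nat set => (nat => 'a::linorder) => (nat => nat) => nat => nat => nat => nat => bool" where
  "del_inv A f g r lo hi n \<longleftrightarrow> finite A & inj_on f A & 1 <= r & r <= n & (\<forall>y\<in>A. 1 <= g y & g y <= n) &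
    (\<forall>y\<in>A. \<forall>z\<in>A. y < z --> f y < f z --> g y < g z) &
    (\<forall>q. 1 <= q --> q <= n --> q ~= r --> (\<exists>z\<in>A. g z = q)) &
    (\<forall>y\<in>A. g y = r --> y < lo \<or> hi <= y) &
    (\<forall>z\<in>A. 1 < g z --> g z ~= Suc r --> (\<exists>y\<in>A. y < z & f y < f z & Suc (g y) = g z)) &
    (\<forall>z\<in>A. g z = Suc r --> (1 < r --> (\<exists>y\<in>A. y < z & f y < f z & Suc (g y) = r)) &
       ((\<exists>y\<in>A. y < z & f y < f z & g y = r) \<or>
        (\<exists>q. lo <= q & q < hi & q < z & f q < f z & (\<forall>c\<in>A. g c = r --> hi <= c --> f c < f q))))"

text \<open>An element whose predecessor was \<open>k\<close> takes \<open>k\<close> itself as the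
  witness \<open>q\<close>: \<open>f\<close> is total and retains the value at \<open>k\<close>
  although \<open>k\<close> has left the set.\<close>

lemma del_inv_init:
  assumes L: "leveling A f g n" and i: "inj_on f A" and k: "k \<in> A"
  shows "del_inv (A - {k}) f g (g k) k (Suc k) n"
proof -
  have A: "finite A" "!!y. y \<in> A ==> 1 <= g y & g y <= n"
    "!!y z. y \<in> A ==> z \<in> A ==> y < z ==> f y < f z ==> g y < g z"
    "!!z. z \<in> A ==> 1 < g z ==> \<exists>y\<in>A. y < z & f y < f z & Suc (g y) = g z"
     using L unfolding leveling_def by blast+
  show ?thesis unfolding del_inv_def
  proof (intro conjI)
    show "\<forall>q\<ge>1. q <= n --> q ~= g k --> (\<exists>z\<in>A - {k}. g z = q)"
      using leveling_nonempty[OF L] by blast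
    show "\<forall>z\<in>A - {k}. 1 < g z --> g z ~= Suc (g k) --> (\<exists>y\<in>A - {k}. y < z & f y < f z & Suc (g y) = g z)"
      using A(4) by (metis Diff_iff singletonD)
    show "\<forall>z\<in>A - {k}. g z = Suc (g k) --> (1 < g k --> (\<exists>y\<in>A - {k}. y < z & f y < f z & Suc (g y) = g k)) &
       ((\<exists>y\<in>A - {k}. y < z & f y < f z & g y = g k) \<or>
        (\<exists>q\<ge>k. q < Suc k & q < z & f q < f z & (\<forall>c\<in>A - {k}. g c = g k --> Suc k <= c --> f c < f q)))"
    proof (intro ballI impI)
      fix z assume z: "z \<in> A - {k}" "g z = Suc (g k)"
      then obtain y where y: "y \<in> A" "y < z" "f y < f z" "g y = g k" using A(4)[of z] A(2)[OF k] by auto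
      have 1: "1 < g k --> (\<exists>y\<in>A - {k}. y < z & f y < f z & Suc (g y) = g k)"
      proof
        assume "1 < g k"
        then obtain w where "w \<in> A" "w < y" "f w < f y" "Suc (g w) = g k" using A(4)[OF y(1)] y(4) by auto
        then show "\<exists>y\<in>A - {k}. y < z & f y < f z & Suc (g y) = g k" using y by (intro bexI[of _ w]) auto
      qed
      have "\<forall>c\<in>A - {k}. g c = g k --> Suc k <= c --> f c < f k"
        using A(3)[OF k] i k by (metis DiffE Suc_le_eq inj_onD less_irrefl linorder_neqE singletonI)
      then have "(\<exists>y\<in>A - {k}. y < z & f y < f z & g y = g k) \<or>
        (\<exists>q\<ge>k. q < Suc k & q < z & f q < f z & (\<forall>c\<in>A - {k}. g c = g k --> Suc k <= c --> f c < f q))"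
        using y by (cases "y = k") auto
      with 1 show "(1 < g k --> (\<exists>y\<in>A - {k}. y < z & f y < f z & Suc (g y) = g k)) &
       ((\<exists>y\<in>A - {k}. y < z & f y < f z & g y = g k) \<or>
        (\<exists>q\<ge>k. q < Suc k & q < z & f q < f z & (\<forall>c\<in>A - {k}. g c = g k --> Suc k <= c --> f c < f q)))" by blast
    qed
  qed (use A i k in "auto simp: inj_on_diff")
qed

lemma del_inv_antichain:
  assumes I: "del_inv A f g r lo hi n" and y: "y \<in> A" "z \<in> A" "y < z" "g y = g z"
  shows "f z < f y"
proof -
  have "~ f y < f z" using I y unfolding del_inv_def by (metis less_irrefl)
  moreover have "f y ~= f z" using I y unfolding del_inv_def by (metis inj_onD less_irrefl)
  ultimately show ?thesis by simp
qed

text \<open>Left of the gap the lowest value on level \<open>r\<close> is that of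
  \<open>Max P\<close>. Right of the gap all values lie below that of the witness \<open>q\<close>,
  so there only the position of \<open>Min C\<close> matters. Hence the orphans, the elements of
  level \<open>Suc r\<close> without predecessor on level \<open>r\<close>, are those of their level
  between \<open>lo'\<close> and \<open>hi'\<close>, and they drop to level
  \<open>r\<close>.\<close>

lemma del_inv_step:
  assumes I: "del_inv A f g r lo hi n" and rn: "r < n"
    and P: "P = {a \<in> A. g a = r & a < lo}" and C: "C = {a \<in> A. g a = r & hi <= a}"
    and lo': "!!z. z \<in> A ==> g z = Suc r ==> lo' <= z \<longleftrightarrow> P = {} \<or> f z < f (Max P)"
    and hi': "C ~= {} ==> hi' = Min C" "C = {} ==> \<forall>z\<in>A. z < hi'"
    and Q: "Q = {z \<in> A. g z = Suc r & lo' <= z & z < hi'}"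
  shows "del_inv A f (%y. if y \<in> Q then r else g y) (Suc r) lo' hi' n"
proof -
  have A0: "finite A" "inj_on f A" "1 <= r" "r <= n" "\<forall>y\<in>A. 1 <= g y & g y <= n"
    "\<forall>y\<in>A. \<forall>z\<in>A. y < z --> f y < f z --> g y < g z"
    "\<forall>q. 1 <= q --> q <= n --> q ~= r --> (\<exists>z\<in>A. g z = q)"
    "\<forall>y\<in>A. g y = r --> y < lo \<or> hi <= y"
    "\<forall>z\<in>A. 1 < g z --> g z ~= Suc r --> (\<exists>y\<in>A. y < z & f y < f z & Suc (g y) = g z)"
    "\<forall>z\<in>A. g z = Suc r --> (1 < r --> (\<exists>y\<in>A. y < z & f y < f z & Suc (g y) = r)) &
       ((\<exists>y\<in>A. y < z & f y < f z & g y = r) \<or>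
        (\<exists>q. lo <= q & q < hi & q < z & f q < f z & (\<forall>c\<in>A. g c = r --> hi <= c --> f c < f q)))"
    by (insert I[unfolded del_inv_def], (elim conjE, assumption)+)
  note A1 = A0[rule_format]
  note A = A1(1-9) conjunct1[OF A1(10), rule_format] conjunct2[OF A1(10)]
  note anti = del_inv_antichain[OF I]
  have fin: "finite P" "finite C" using A(1) P C by auto
  have PD: "!!a. a \<in> P \<longleftrightarrow> a \<in> A & g a = r & a < lo" using P by simp
  have CD: "!!a. a \<in> C \<longleftrightarrow> a \<in> A & g a = r & hi <= a" using C by simp
  have Qch: "z \<in> Q \<longleftrightarrow> ~ (\<exists>y\<in>A. y < z & f y < f z & g y = r)" if z: "z \<in> A" "g z = Suc r" for z
  proof
    assume zQ: "z \<in> Q"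
    show "~ (\<exists>y\<in>A. y < z & f y < f z & g y = r)"
    proof
      assume "\<exists>y\<in>A. y < z & f y < f z & g y = r"
      then obtain y where y: "y \<in> A" "y < z" "f y < f z" "g y = r" by blast
      from A(8)[OF y(1,4)] show False
      proof
        assume "y < lo"
        then have yP: "y \<in> P" using P y by simp
        then have m: "Max P \<in> P" "y <= Max P" using fin by (auto intro: Max_in)
        then have "f (Max P) <= f y" using anti[of y "Max P"] y P by (cases "y = Max P") auto
        moreover have "f z < f (Max P)" using lo'[OF z] zQ Q yP by auto
        ultimately show False using y by simp
      next
        assume "hi <= y"
        then have yC: "y \<in> C" using C y by simp
        then have "hi' = Min C" "Min C <= y" using hi'(1) fin by auto
        then show False using zQ Q y by auto
      qed
    qed
  next
    assume n: "~ (\<exists>y\<in>A. y < z & f y < f z & g y = r)"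
    then obtain q where q: "lo <= q" "q < hi" "q < z" "f q < f z" "\<forall>c\<in>A. g c = r --> hi <= c --> f c < f q"
      using A(11)[OF z] by blast
    have "P = {} \<or> f z < f (Max P)"
    proof (rule ccontr)
      assume c: "~ (P = {} \<or> f z < f (Max P))"
      then have "Max P \<in> P" using fin Max_in by blast
      then have m: "Max P \<in> A" "g (Max P) = r" "Max P < lo" by (simp_all add: PD)
      then have "f z ~= f (Max P)" using inj_onD[OF A(2), of z "Max P"] z by auto
      then have "f (Max P) < f z" using c by (meson linorder_neqE)
      moreover have "Max P < z" using m(3) q by simp
      ultimately show False using n m by blast
    qed
    moreover have "z < hi'"
    proof (cases "C = {}")
      case False
      then have "Min C \<in> C" using fin by simp
      then have m: "Min C \<in> A" "g (Min C) = r" "hi <= Min C" by (simp_all add: CD)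
      then have "f (Min C) < f q" using q(5) by blast
      then have "f (Min C) < f z" using q(4) by (rule less_trans)
      then have "~ Min C < z" using n m by blast
      moreover have "Min C ~= z" using m z by auto
      ultimately show ?thesis using hi'(1)[OF False] by simp
    qed (use hi' z in auto)
    ultimately show "z \<in> Q" using Q z lo'[OF z] by blast
  qed
  have QA: "Q \<subseteq> A" "!!z. z \<in> Q ==> g z = Suc r" using Q by auto
  let ?g = "%y. if y \<in> Q then r else g y"
  show ?thesis unfolding del_inv_def
  proof (intro conjI)
    show "\<forall>y\<in>A. \<forall>z\<in>A. y < z --> f y < f z --> ?g y < ?g z"
    proof (intro ballI impI)
      fix y z assume yz: "y \<in> A" "z \<in> A" "y < z" "f y < f z"
      have o: "g y < g z" using A(6) yz by blast
      show "?g y < ?g z"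
      proof (cases "z \<in> Q")
        case True
        then have "g y ~= r" using Qch QA yz by blast
        then show ?thesis using o True QA(2)[OF True] QA(2)[of y] by auto
      next
        case False
        then show ?thesis using o QA(2)[of y] by auto
      qed
    qed
    show "\<forall>q. 1 <= q --> q <= n --> q ~= Suc r --> (\<exists>z\<in>A. ?g z = q)"
    proof (intro allI impI)
      fix q assume q: "1 <= q" "q <= n" "q ~= Suc r"
      show "\<exists>z\<in>A. ?g z = q"
      proof (cases "q = r")
        case False
        then obtain z where "z \<in> A" "g z = q" using A(7) q by blast
        then show ?thesis using QA(2) q by (intro bexI[of _ z]) auto
      next
        case True
        obtain z where z: "z \<in> A" "g z = Suc r" using A(7)[of "Suc r"] rn by auto
        show ?thesis
        proof (cases "z \<in> Q")
          case True
          then show ?thesis using z \<open>q = r\<close> by (intro bexI[of _ z]) auto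
        next
          case False
          then obtain y where "y \<in> A" "g y = r" using Qch z by blast
          then show ?thesis using \<open>q = r\<close> QA(2)[of y] by (intro bexI[of _ y]) auto
        qed
      qed
    qed
    show "\<forall>y\<in>A. ?g y = Suc r --> y < lo' \<or> hi' <= y" using Q by auto
    show "\<forall>z\<in>A. 1 < ?g z --> ?g z ~= Suc (Suc r) --> (\<exists>y\<in>A. y < z & f y < f z & Suc (?g y) = ?g z)"
    proof (intro ballI impI)
      fix z assume z: "z \<in> A" "1 < ?g z" "?g z ~= Suc (Suc r)"
      show "\<exists>y\<in>A. y < z & f y < f z & Suc (?g y) = ?g z"
      proof (cases "z \<in> Q")
        case True
        then obtain y where y: "y \<in> A" "y < z" "f y < f z" "Suc (g y) = r" using A(10)[OF z(1)] z QA by auto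
        then have "y \<notin> Q" using QA(2)[of y] by auto
        then show ?thesis using True y by (intro bexI[of _ y]) auto
      next
        case False
        obtain y where y: "y \<in> A" "y < z" "f y < f z" "Suc (g y) = g z"
          using False z Qch[of z] A(9)[of z] by (cases "g z = Suc r") auto
        then have "y \<notin> Q" using QA(2)[of y] z False by auto
        then show ?thesis using False y by (intro bexI[of _ y]) auto
      qed
    qed
    show "\<forall>z\<in>A. ?g z = Suc (Suc r) --> (1 < Suc r --> (\<exists>y\<in>A. y < z & f y < f z & Suc (?g y) = Suc r)) &
       ((\<exists>y\<in>A. y < z & f y < f z & ?g y = Suc r) \<or>
        (\<exists>q\<ge>lo'. q < hi' & q < z & f q < f z & (\<forall>c\<in>A. ?g c = Suc r --> hi' <= c --> f c < f q)))"
    proof (intro ballI impI)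
      fix z assume z: "z \<in> A" "?g z = Suc (Suc r)"
      then have zg: "g z = Suc (Suc r)" by (auto split: if_splits)
      then obtain y where y: "y \<in> A" "y < z" "f y < f z" "g y = Suc r" using A(9)[OF z(1)] by auto
      show "(1 < Suc r --> (\<exists>y\<in>A. y < z & f y < f z & Suc (?g y) = Suc r)) &
       ((\<exists>y\<in>A. y < z & f y < f z & ?g y = Suc r) \<or>
        (\<exists>q\<ge>lo'. q < hi' & q < z & f q < f z & (\<forall>c\<in>A. ?g c = Suc r --> hi' <= c --> f c < f q)))"
      proof (cases "y \<in> Q")
        case True
        \<comment> \<open>The predecessor \<open>y\<close> of \<open>z\<close> has dropped as well
          and becomes the new witness, now in the gap of level \<open>Suc r\<close>.\<close>
        have "\<forall>c\<in>A. ?g c = Suc r --> hi' <= c --> f c < f y"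
          using anti[of y] True y Q by (auto split: if_splits)
        moreover have "lo' <= y" "y < hi'" using True Q by auto
        moreover have "\<exists>y\<in>A. y < z & f y < f z & Suc (?g y) = Suc r"
          using y True by (intro bexI[of _ y]) auto
        ultimately show ?thesis using y by auto
      next
        case False
        then obtain w where w: "w \<in> A" "w < y" "f w < f y" "g w = r" using Qch y by blast
        moreover have "w \<notin> Q" using QA(2)[of w] w(4) by auto
        ultimately have "\<exists>y\<in>A. y < z & f y < f z & Suc (?g y) = Suc r"
          using y by (intro bexI[of _ w]) auto
        moreover have "\<exists>y\<in>A. y < z & f y < f z & ?g y = Suc r" using y False by (intro bexI[of _ y]) auto
        ultimately show ?thesis by blast
      qed
    qed
  qed (use A(1-5) QA rn in auto)
qed

text \<open>Above the top level nothing is left to repair. Only that level can have been emptied,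
  and then it is given up.\<close>

lemma del_inv_final:
  assumes I: "del_inv A f g n lo hi n"
  shows "(\<exists>z\<in>A. g z = n) ==> leveling A f g n" "~ (\<exists>z\<in>A. g z = n) ==> leveling A f g (n - 1)"
proof -
  have A: "1 <= n" "!!y. y \<in> A ==> 1 <= g y & g y <= n" 
    "!!q. 1 <= q ==> q <= n ==> q ~= n ==> (\<exists>z\<in>A. g z = q)"
    "!!z. z \<in> A ==> 1 < g z ==> g z ~= Suc n ==> (\<exists>y\<in>A. y < z & f y < f z & Suc (g y) = g z)"
    using I[unfolded del_inv_def] by (elim conjE, simp)+
  have p: "\<forall>z\<in>A. 1 < g z --> (\<exists>y\<in>A. y < z & f y < f z & Suc (g y) = g z)"
  proof (intro ballI impI)
    fix z assume z: "z \<in> A" "1 < g z"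
    then have "g z ~= Suc n" using A(2)[of z] by auto
    with A(4) z show "\<exists>y\<in>A. y < z & f y < f z & Suc (g y) = g z" by blast
  qed
  show "(\<exists>z\<in>A. g z = n) ==> leveling A f g n"
    using I p unfolding leveling_def del_inv_def by blast
  assume ne: "~ (\<exists>z\<in>A. g z = n)"
  have "1 <= g y & g y <= n - 1" if "y \<in> A" for y
    using A(2)[OF that] ne that by (cases "g y = n") auto
  moreover have "n - 1 = 0 \<or> (\<exists>z\<in>A. g z = n - 1)"     using A(3)[of "n - 1"] A(1) by (cases "n = 1") (force, linarith)
  ultimately show "leveling A f g (n - 1)"
    using I p unfolding leveling_def del_inv_def by blast
qed

section \<open>Patience sorting\<close>

text \<open>\<open>t r\<close> is the top card of pile \<open>r\<close>, the least value on level
  \<open>r\<close>. The leveling is only asserted to exist, since the program keeps nothing but the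
  tops.\<close>

definition patience :: "'a::linorder list => nat => (nat => 'a) => bool" where
  "patience xs n t \<longleftrightarrow> (\<exists>g. leveling {..<length xs} ((!) xs) g n &
     (\<forall>r. 1 <= r --> r <= n --> (\<exists>y<length xs. g y = r & xs ! y = t r) &
       (\<forall>y<length xs. g y = r --> t r <= xs ! y)))"

lemma patience_LIS: "patience xs n t ==> LIS xs = n"
  using leveling_LIS[of "[0..<length xs]" "(!) xs"] 
  by (auto simp: patience_def map_nth atLeast0LessThan strict_sorted_iff)

lemma patience_Nil: "patience [] 0 t"
  by (auto simp: patience_def leveling_def)

text \<open>An element attaining the top of pile \<open>q\<close> has a smaller one on level
  \<open>p\<close> to its left. This permits binary search among the tops.\<close>

lemma patience_mono:
  assumes "patience xs n t" "1 <= p" "p < q" "q <= n" shows "t p < t q"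
proof -
  obtain g where L: "leveling {..<length xs} ((!) xs) g n" and
    t: "!!r. 1 <= r ==> r <= n ==> (\<exists>y<length xs. g y = r & xs ! y = t r) & (\<forall>y<length xs. g y = r --> t r <= xs ! y)"
    using assms(1) by (auto simp: patience_def)
  obtain y where y: "y < length xs" "g y = q" "xs ! y = t q" using t[of q] assms by auto
  then obtain z where "z < length xs" "z < y" "xs ! z < xs ! y" "g z = p"
    using leveling_below_less[OF L, of y p] assms by auto
  then show ?thesis using t[of p] assms y by fastforce
qed

text \<open>The new element goes on the first pile whose top is not below it. Nothing lies to its
  right, so all other levels stay as they are.\<close>

lemma patience_snoc:
  assumes p: "patience xs n t" and j: "!!i. i < j ==> t (Suc i) < x" "j < n ==> ~ t (Suc j) < x" "j <= n"
  shows "patience (xs @ [x]) (max n (Suc j)) (t(Suc j := x))"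
proof -
  obtain g where L: "leveling {..<length xs} ((!) xs) g n" and
    t: "!!r. 1 <= r ==> r <= n ==> (\<exists>y<length xs. g y = r & xs ! y = t r) & (\<forall>y<length xs. g y = r --> t r <= xs ! y)"
    using p by (auto simp: patience_def)
  have tl: "x <= t r" if "Suc j <= r" "r <= n" for r
  proof -
    have "x <= t (Suc j)" using j(2) that by (simp add: not_less)
    also have "\<dots> <= t r" using patience_mono[OF p, of "Suc j" r] that by (cases "r = Suc j") auto
    finally show ?thesis .
  qed
  let ?k = "length xs" let ?g = "g(?k := Suc j)"
  have A: "!!y. y < ?k ==> 1 <= g y & g y <= n"
    "!!y z. y < ?k ==> z < ?k ==> y < z ==> xs ! y < xs ! z ==> g y < g z"
    "!!z. z < ?k ==> 1 < g z ==> \<exists>y<?k. y < z & xs ! y < xs ! z & Suc (g y) = g z"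
     using L unfolding leveling_def by (auto simp: Bex_def)
  \<comment> \<open>All values on levels above \<open>j\<close> are at least
    \<open>x\<close>.\<close>
  have lt: "g y <= j" if "y < ?k" "xs ! y < x" for y
    using tl[of "g y"] t[of "g y"] A(1)[OF that(1)] that by (metis leD le_less_trans not_less_eq_eq)
  have nth: "(xs @ [x]) ! y = (if y < ?k then xs ! y else x)" if "y <= ?k" for y
    using that by (auto simp: nth_append)
  have L': "leveling {..<length (xs @ [x])} ((!) (xs @ [x])) ?g (max n (Suc j))"
    unfolding leveling_def
  proof (intro conjI)
    show "\<forall>y\<in>{..<length (xs @ [x])}. 1 <= ?g y & ?g y <= max n (Suc j)"
      using A(1) by (auto simp: less_Suc_eq le_max_iff_disj)
    show "\<forall>y\<in>{..<length (xs @ [x])}. \<forall>z\<in>{..<length (xs @ [x])}. y < z --> (xs @ [x]) ! y < (xs @ [x]) ! z --> ?g y < ?g z"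
      using A(2) lt by (auto simp: nth less_Suc_eq_le)
    show "\<forall>z\<in>{..<length (xs @ [x])}. 1 < ?g z -->
       (\<exists>y\<in>{..<length (xs @ [x])}. y < z & (xs @ [x]) ! y < (xs @ [x]) ! z & Suc (?g y) = ?g z)"
    proof (intro ballI impI)
      fix z assume z: "z \<in> {..<length (xs @ [x])}" "1 < ?g z"
      show "\<exists>y\<in>{..<length (xs @ [x])}. y < z & (xs @ [x]) ! y < (xs @ [x]) ! z & Suc (?g y) = ?g z"
      proof (cases "z = ?k")
        case True
        then have j0: "0 < j" using z by simp
        obtain y where "y < ?k" "g y = j" "xs ! y = t j" using t[of j] j0 j(3) by auto
        then show ?thesis using True j(1)[of "j - 1"] j0 by (intro bexI[of _ y]) (auto simp: nth_append)
      next
        case False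
        then have zk: "z < ?k" using z by simp
        then obtain y where "y < ?k" "y < z" "xs ! y < xs ! z" "Suc (g y) = g z" using A(3)[OF zk] z False by auto
        then show ?thesis using zk by (intro bexI[of _ y]) (auto simp: nth_append)
      qed
    qed
    show "max n (Suc j) = 0 \<or> (\<exists>z\<in>{..<length (xs @ [x])}. ?g z = max n (Suc j))"
    proof (cases "n <= Suc j")
      case True
      then show ?thesis by (intro disjI2 bexI[of _ ?k]) auto
    next
      case False
      then obtain z where "z < ?k" "g z = n" using leveling_nonempty[OF L, of n] by auto
      then show ?thesis using False by (intro disjI2 bexI[of _ z]) auto
    qed
  qed simp
  show ?thesis unfolding patience_def
  proof (intro exI[of _ ?g] conjI allI impI L')
    fix r assume r: "1 <= r" "r <= max n (Suc j)"
    show "\<exists>y<length (xs @ [x]). ?g y = r & (xs @ [x]) ! y = (t(Suc j := x)) r"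
    proof (cases "r = Suc j")
      case True
      then show ?thesis by (intro exI[of _ ?k]) auto
    next
      case False
      then have "r <= n" using r j(3) by auto
      then obtain y where "y < ?k" "g y = r" "xs ! y = t r" using t r by blast
      then show ?thesis using False by (intro exI[of _ y]) (auto simp: nth_append)
    qed
    fix y assume y: "y < length (xs @ [x])" "?g y = r"
    show "(t(Suc j := x)) r <= (xs @ [x]) ! y"
    proof (cases "y = ?k")
      case False
      then have yk: "y < ?k" "g y = r" using y by auto
      then have "t r <= xs ! y" "r <= n" using t[of r] r A(1) by auto
      then show ?thesis using yk tl[of r] by (auto simp: nth_append)
    qed (use y in auto)
  qed
qed

section \<open>Reasoning about programs\<close>

text \<open>Total correctness with a time bound. An overflowing program has no execution, so this
  excludes overflow as well.\<close>

definition run :: "nat => com => state => nat => (state => bool) => bool" where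
  "run B c s k Q \<longleftrightarrow> (\<exists>t s'. exec B c s t s' & t <= k & Q s')"

lemma run_mono: "run B c s k Q ==> k <= k' ==> (!!s'. Q s' ==> Q' s') ==> run B c s k' Q'"
  unfolding run_def by (meson le_trans)

lemma run_Seq:
  "run B c1 s k1 (%s1. run B c2 s1 k2 Q) ==> run B (Seq c1 c2) s (k1 + k2) Q"
  unfolding run_def by (meson add_mono exec.Seq)

lemma run_Cond:
  "tfits B b s ==> (tval b s ==> run B c1 s k Q) ==> (~ tval b s ==> run B c2 s k Q) ==>
   run B (Cond b c1 c2) s (tcost b + k) Q"
  unfolding run_def by (metis add_left_mono exec.CondFalse exec.CondTrue)

text \<open>The index of the invariant counts the remaining iterations.\<close>

lemma run_While:
  assumes "I n s"
    and "!!n s. I n s ==> tfits B b s"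
    and "!!n s. I n s ==> tval b s ==> \<exists>m. n = Suc m & run B c s k (I m)"
  shows "run B (While b c) s (n*(tcost b + k) + tcost b) (%s'. \<exists>m\<le>n. I m s' & ~ tval b s')"
  using assms(1)
proof (induction n arbitrary: s)
  case 0
  have f: "tfits B b s" "~ tval b s" using assms(2,3)[OF 0] by auto
  then show ?case unfolding run_def using exec.WhileFalse[OF f] 0 by fastforce
next
  case (Suc n)
  have f: "tfits B b s" using assms(2)[OF Suc.prems] .
  show ?case
  proof (cases "tval b s")
    case False
    then show ?thesis unfolding run_def using exec.WhileFalse[OF f False] Suc.prems
      by (intro exI[of _ "tcost b"] exI[of _ s]) auto
  next
    case True
    then obtain t s1 where 1: "exec B c s t s1" "t <= k" "I n s1"
      using assms(3)[OF Suc.prems True] unfolding run_def by auto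
    obtain t2 s2 where 2: "exec B (While b c) s1 t2 s2" "t2 <= n*(tcost b + k) + tcost b"
      "\<exists>m\<le>n. I m s2 & ~ tval b s2"
      using Suc.IH[OF 1(3)] unfolding run_def by auto
    have "exec B (While b c) s (tcost b + t + t2) s2" using exec.WhileTrue[OF f True 1(1) 2(1)] .
    moreover have "tcost b + t + t2 <= Suc n*(tcost b + k) + tcost b" using 1(2) 2(2) by simp
    ultimately show ?thesis unfolding run_def using 2(3) le_SucI by blast
  qed
qed

lemma run_SeqI:
  "run B c1 s k1 P ==> (!!s1. P s1 ==> run B c2 s1 k2 Q) ==> run B (Seq c1 c2) s (k1 + k2) Q"
  by (rule run_Seq) (blast intro: run_mono)

text \<open>The form in which loops are verified: when no iterations remain, the invariant must
  refute the test, and every earlier exit must yield the postcondition too.\<close>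

lemma run_loop:
  assumes "I n s" and "!!n s. I n s ==> tfits B b s" and "!!s. I 0 s ==> ~ tval b s"
    and "!!n s. I (Suc n) s ==> tval b s ==> run B c s k (I n)"
    and "!!m s. m <= n ==> I m s ==> ~ tval b s ==> Q s"
  shows "run B (While b c) s (n*(tcost b + k) + tcost b) Q"
proof (rule run_mono[OF run_While[where I = I and n = n and k = k]])
  show "\<exists>m. n = Suc m & run B c s k (I m)" if "I n s" "tval b s" for n s
    using that assms(3,4) by (cases n) auto
qed (use assms in auto)

section \<open>Symbolic execution of loop-free programs\<close>

fun loop_free :: "com => bool" where
  "loop_free (While b c) \<longleftrightarrow> False"
| "loop_free (Seq c1 c2) \<longleftrightarrow> loop_free c1 & loop_free c2"
| "loop_free (Cond b c1 c2) \<longleftrightarrow> loop_free c1 & loop_free c2"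
| "loop_free c \<longleftrightarrow> True"

fun result :: "com => state => state" where
  "result Skip s = s"
| "result (Store a e1 e2) s = store_word a (wval e1 s) (wval e2 s) s"
| "result (KeyCopy a e1 b e2) s = store_key a (wval e1 s) (keys s b (wval e2 s)) s"
| "result (Seq c1 c2) s = result c2 (result c1 s)"
| "result (Cond b c1 c2) s = (if tval b s then result c1 s else result c2 s)"
| "result (While b c) s = s"

fun fits :: "nat => com => state => bool" where
  "fits B Skip s \<longleftrightarrow> True"
| "fits B (Store a e1 e2) s \<longleftrightarrow> wfits B e1 s & wfits B e2 s"
| "fits B (KeyCopy a e1 b e2) s \<longleftrightarrow> wfits B e1 s & wfits B e2 s"
| "fits B (Seq c1 c2) s \<longleftrightarrow> fits B c1 s & fits B c2 (result c1 s)"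
| "fits B (Cond b c1 c2) s \<longleftrightarrow> tfits B b s & (if tval b s then fits B c1 s else fits B c2 s)"
| "fits B (While b c) s \<longleftrightarrow> False"

fun time :: "com => nat" where
  "time Skip = 1"
| "time (Store a e1 e2) = 1 + wcost e1 + wcost e2"
| "time (KeyCopy a e1 b e2) = 1 + wcost e1 + wcost e2"
| "time (Seq c1 c2) = time c1 + time c2"
| "time (Cond b c1 c2) = tcost b + max (time c1) (time c2)"
| "time (While b c) = 0"

lemma exec_loop_free: "loop_free c ==> fits B c s ==> \<exists>t. exec B c s t (result c s) & t <= time c"
proof (induction c arbitrary: s)
  case (Seq c1 c2)
  then obtain t1 t2 where "exec B c1 s t1 (result c1 s)" "t1 <= time c1"
    "exec B c2 (result c1 s) t2 (result c2 (result c1 s))" "t2 <= time c2"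
    by (metis fits.simps(4) loop_free.simps(2))
  then show ?case using exec.Seq by (intro exI[of _ "t1 + t2"]) (auto intro: exec.Seq)
next
  case (Cond b c1 c2)
  show ?case
  proof (cases "tval b s")
    case True
    then obtain t where "exec B c1 s t (result c1 s)" "t <= time c1" using Cond by auto
    then show ?thesis using True Cond.prems by (intro exI[of _ "tcost b + t"]) (auto intro: exec.CondTrue)
  next
    case False
    then obtain t where "exec B c2 s t (result c2 s)" "t <= time c2" using Cond by auto
    then show ?thesis using False Cond.prems by (intro exI[of _ "tcost b + t"]) (auto intro: exec.CondFalse)
  qed
next
  case Skip
  then show ?case using exec.Skip by fastforce
next
  case (Store a e1 e2)
  then show ?case using exec.Store by fastforce
next
  case (KeyCopy a e1 b e2)
  then show ?case using exec.KeyCopy by fastforce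
qed simp

text \<open>Turns straight-line code into simplification goals about \<open>result\<close> and
  \<open>fits\<close>; the time bound depends on the code alone.\<close>

lemma run_loop_free:
  "loop_free c ==> fits B c s ==> time c <= k ==> Q (result c s) ==> run B c s k Q"
  unfolding run_def using exec_loop_free by (meson le_trans)

lemma words_store [simp]:
  "words (store_word a i w s) c j = (if c = a & j = i then w else words s c j)"
  by (simp add: store_word_def)

lemma words_other: "c ~= a ==> words (store_word a i w s) c = words s c"
  by (simp add: store_word_def)

lemma keys_store [simp]: "keys (store_word a i w s) = keys s"
  by (simp add: store_word_def)

lemma words_store_key [simp]: "words (store_key a i w s) = words s"
  by (simp add: store_key_def)

lemma keys_store_key [simp]:
  "keys (store_key a i w s) c j = (if c = a & j = i then w else keys s c j)"
  by (simp add: store_key_def)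

lemma keys_other: "c ~= a ==> keys (store_key a i w s) c = keys s c"
  by (simp add: store_key_def)

text \<open>Cell 0 of a word array serves as a register.\<close>

abbreviation (input) reg :: "state => nat => nat" (infixl "$" 90) where "s$a == words s a 0"

fun seqs :: "com list => com" where
  "seqs [] = Skip"
| "seqs [c] = c"
| "seqs (c # d # cs) = Seq c (seqs (d # cs))"

abbreviation V :: "nat => wexp" where "V a == Cell a (Const 0)"
abbreviation Set :: "nat => wexp => com" where "Set a e == Store a (Const 0) e"

section \<open>Persistent binary tries\<close>

text \<open>One more than the maximum, so that 0 is free to stand for the empty set.\<close>

definition upper :: "nat set => nat" where "upper S = (if S = {} then 0 else Suc (Max S))"

lemma upper_empty [simp]: "upper {} = 0" by (simp add: upper_def)
lemma upper_singleton [simp]: "upper {x} = Suc x" by (simp add: upper_def)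
lemma upper_eq_0: "upper S = 0 \<longleftrightarrow> S = {}" by (simp add: upper_def)

lemma upper_in: "finite S ==> upper S ~= 0 ==> upper S - 1 \<in> S"
  by (auto simp: upper_def split: if_splits)

lemma upper_ge: "finite S ==> x \<in> S ==> x < upper S"
  by (auto simp: upper_def less_Suc_eq_le)

lemma upper_le: "finite S ==> S \<subseteq> {..<n} ==> upper S <= n"
  by (auto simp: upper_def Suc_le_eq)

lemma upper_Un:
  assumes "finite S1" "finite S2" "!!x y. x \<in> S1 ==> y \<in> S2 ==> x < y"
  shows "upper (S1 \<union> S2) = (if S2 = {} then upper S1 else upper S2)"
proof (cases "S1 = {} \<or> S2 = {}")
  case False
  then have "Max (S1 \<union> S2) = max (Max S1) (Max S2)" using assms by (simp add: Max_Un)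
  also have "\<dots> = Max S2" using assms False by (auto intro!: max_absorb2 less_imp_le)
  finally show ?thesis using False by (simp add: upper_def)
qed auto

text \<open>The children \<open>L\<close> and \<open>R\<close> split the range of length
  \<open>2^h\<close> starting at \<open>\<beta>\<close>, and \<open>M\<close> caches
  \<open>upper\<close> of the keys below a node. All nodes lie below the allocation mark
  \<open>fr\<close>.\<close>

fun trie :: "(nat => nat) => (nat => nat) => (nat => nat) => nat => nat => nat => nat => nat set => bool" where
  "trie L R M fr 0 \<beta> u S \<longleftrightarrow> u < fr & (M u = 0 & S = {} \<or> M u = Suc \<beta> & S = {\<beta>})"
| "trie L R M fr (Suc h) \<beta> u S \<longleftrightarrow> u < fr & M u = upper S &
     (\<exists>S1 S2. S = S1 \<union> S2 & trie L R M fr h \<beta> (L u) S1 & trie L R M fr h (\<beta> + 2^h) (R u) S2)"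

lemma trie_props:
  "trie L R M fr h \<beta> u S ==> u < fr & M u = upper S & finite S & S \<subseteq> {\<beta>..<\<beta> + 2^h}"
proof (induction h arbitrary: \<beta> u S)
  case (Suc h)
  then obtain S1 S2 where "S = S1 \<union> S2" "trie L R M fr h \<beta> (L u) S1" "trie L R M fr h (\<beta> + 2^h) (R u) S2"
    and "u < fr" "M u = upper S" by auto
  with Suc.IH[of \<beta> "L u" S1] Suc.IH[of "\<beta> + 2^h" "R u" S2] show ?case by fastforce
qed auto

text \<open>This is persistence: nodes below the allocation mark are never overwritten, hence every
  root obtained earlier stays valid.\<close>

lemma trie_cong:
  "trie L R M fr h \<beta> u S ==> (!!x. x < fr ==> L' x = L x & R' x = R x & M' x = M x) ==> fr <= fr' ==>
   trie L' R' M' fr' h \<beta> u S"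
proof (induction h arbitrary: \<beta> u S)
  case (Suc h)
  then obtain S1 S2 where 1: "S = S1 \<union> S2" "trie L R M fr h \<beta> (L u) S1" "trie L R M fr h (\<beta> + 2^h) (R u) S2"
    and 2: "u < fr" "M u = upper S" by auto
  have "trie L' R' M' fr' h \<beta> (L u) S1" "trie L' R' M' fr' h (\<beta> + 2^h) (R u) S2"
    using Suc.IH 1 Suc.prems(2,3) by blast+
  moreover have "L' u = L u" "R' u = R u" "M' u = M u" using Suc.prems(2)[OF 2(1)] by auto
  ultimately show ?case using 1(1) 2 Suc.prems(3) by auto
qed auto

text \<open>Node 0 is its own left and right child and thus an empty trie of every height.\<close>

lemma trie_null:
  "L 0 = 0 ==> R 0 = 0 ==> M 0 = 0 ==> 0 < fr ==> trie L R M fr h \<beta> 0 {}"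
  by (induction h arbitrary: \<beta>) auto

text \<open>
  Word arrays 2 to 39 hold scratch variables; the arrays of a structure start at its base \<open>b \<ge> 40\<close>.
\<close>

abbreviation (input) vu :: nat where "vu == 2"
abbreviation (input) vv :: nat where "vv == 3"
abbreviation (input) vk :: nat where "vk == 4"
abbreviation (input) vw :: nat where "vw == 5"
abbreviation (input) vd :: nat where "vd == 6"
abbreviation (input) vbest :: nat where "vbest == 7"
abbreviation (input) stash :: nat where "stash == 8"
abbreviation (input) side :: nat where "side == 9"
abbreviation (input) vkk :: nat where "vkk == 23"

abbreviation (input) aL :: "nat => nat" where "aL b == b + 11"
abbreviation (input) aR :: "nat => nat" where "aR b == b + 12"
abbreviation (input) aM :: "nat => nat" where "aM b == b + 13"
abbreviation (input) fresh :: "nat => nat" where "fresh b == b + 14"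
abbreviation (input) univ :: "nat => nat" where "univ b == b + 16"

abbreviation tri :: "state => nat => nat => nat => nat => nat set => bool" where
  "tri s b == trie (words s (aL b)) (words s (aR b)) (words s (aM b)) (s$fresh b)"

definition null_ok :: "state => nat => bool" where
  "null_ok s b \<longleftrightarrow> s$aL b = 0 & s$aR b = 0 & s$aM b = 0 & 0 < s$fresh b"

lemma tri_null: "null_ok s b ==> tri s b h \<beta> 0 {}"
  by (simp add: null_ok_def trie_null)

text \<open>Only the scratch arrays \<open>N\<close> change, and new trie nodes are allocated.\<close>

definition ext :: "nat set => nat => state => state => bool" where
  "ext N b s s' \<longleftrightarrow> keys s' = keys s &
     (\<forall>a. a \<notin> N --> a \<notin> {aL b, aR b, aM b, fresh b} --> words s' a = words s a) &
     s$fresh b <= s'$fresh b &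
     (\<forall>x < s$fresh b. words s' (aL b) x = words s (aL b) x &
        words s' (aR b) x = words s (aR b) x & words s' (aM b) x = words s (aM b) x)"

lemma ext_refl: "ext N b s s" by (simp add: ext_def)

lemma ext_trans: "ext N b s s' ==> ext N' b s' s'' ==> N \<subseteq> N'' ==> N' \<subseteq> N'' ==> ext N'' b s s''"
  unfolding ext_def by (auto 0 3 dest: order.strict_trans2)

lemma ext_tri: "ext N b s s' ==> tri s b h \<beta> u S ==> tri s' b h \<beta> u S"
  by (erule trie_cong) (auto simp: ext_def)

lemma ext_null: "ext N b s s' ==> null_ok s b ==> null_ok s' b"
  by (auto simp: ext_def null_ok_def)

section \<open>Path copying in two tries at once\<close>

text \<open>On a left turn the right sibling covers larger keys and is saved from \<open>vv\<close>;
  on a right turn the left sibling covers smaller keys and is saved from \<open>vu\<close>.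
  \<open>side\<close> records the turn for the way back.\<close>

definition desc_body :: "nat => com" where
  "desc_body b = seqs [
     Cond (Less (V vk) (V vw))
       (seqs [Store stash (V vd) (Cell (aR b) (V vv)), Store side (V vd) (Const 0),
              Set vu (Cell (aL b) (V vu)), Set vv (Cell (aL b) (V vv))])
       (seqs [Store stash (V vd) (Cell (aL b) (V vu)), Store side (V vd) (Const 1),
              Set vu (Cell (aR b) (V vu)), Set vv (Cell (aR b) (V vv)),
              Set vk (Minus (V vk) (V vw))]),
     Set vd (Plus (V vd) (Const 1)),
     Set vw (Div (V vw) (Const 2))]"

text \<open>The maximum of the new node is that of its right child, unless this child is
  empty.\<close>

definition asc_body :: "nat => com" where
  "asc_body b = seqs [
     Set vd (Minus (V vd) (Const 1)),
     Cond (Less (Cell side (V vd)) (Const 1))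
       (seqs [Store (aL b) (V (fresh b)) (V vv), Store (aR b) (V (fresh b)) (Cell stash (V vd))])
       (seqs [Store (aL b) (V (fresh b)) (Cell stash (V vd)), Store (aR b) (V (fresh b)) (V vv)]),
     Cond (Less (Const 0) (Cell (aM b) (Cell (aR b) (V (fresh b)))))
       (Store (aM b) (V (fresh b)) (Cell (aM b) (Cell (aR b) (V (fresh b)))))
       (Store (aM b) (V (fresh b)) (Cell (aM b) (Cell (aL b) (V (fresh b))))),
     Set vv (V (fresh b)),
     Set (fresh b) (Plus (V (fresh b)) (Const 1))]"

text \<open>
  Copies the path of \<open>vk\<close>: keys below it are taken from the trie \<open>vu\<close>, keys above it from the
  trie \<open>vv\<close>, and \<open>mid\<close> computes the new leaf from the leaf \<open>vv\<close>.
\<close>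

definition upd :: "nat => com => com" where
  "upd b mid = seqs [
     seqs [Set vw (Div (V (univ b)) (Const 2)), Set vd (Const 0)],
     While (Less (Const 0) (V vw)) (desc_body b),
     mid,
     While (Less (Const 0) (V vd)) (asc_body b)]"

text \<open>The siblings \<open>X\<close> stashed above the node of height \<open>h\<close> that covers \<open>{\<beta>..<\<beta> + 2^h}\<close>.\<close>

fun stack :: "state => nat => nat => nat => nat => nat set => bool" where
  "stack s b 0 h \<beta> X \<longleftrightarrow> \<beta> = 0 & X = {}"
| "stack s b (Suc d) h \<beta> X \<longleftrightarrow> (\<exists>S X0. X = X0 \<union> S &
     (words s side d = 0 & tri s b h (\<beta> + 2^h) (words s stash d) S & stack s b d (Suc h) \<beta> X0 \<or>
      words s side d = 1 & 2^h <= \<beta> & tri s b h (\<beta> - 2^h) (words s stash d) S & stack s b d (Suc h) (\<beta> - 2^h) X0))"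

text \<open>Confines the range of a node to the universe, so that the cached maxima fit into
  words.\<close>

lemma stack_props: "stack s b d h \<beta> X ==> \<beta> + 2^h <= 2^(h + d) & X \<inter> {\<beta>..<\<beta> + 2^h} = {}"
proof (induction d arbitrary: h \<beta> X)
  case (Suc d)
  then obtain S X0 where X: "X = X0 \<union> S" and
    "words s side d = 0 & tri s b h (\<beta> + 2^h) (words s stash d) S & stack s b d (Suc h) \<beta> X0 \<or>
      words s side d = 1 & 2^h <= \<beta> & tri s b h (\<beta> - 2^h) (words s stash d) S & stack s b d (Suc h) (\<beta> - 2^h) X0"
    by auto
  then show ?case
  proof (elim disjE conjE)
    assume a: "tri s b h (\<beta> + 2^h) (words s stash d) S" "stack s b d (Suc h) \<beta> X0"
    show ?thesis using Suc.IH[OF a(2)] trie_props[OF a(1)] X by fastforce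
  next
    assume a: "2^h <= \<beta>" "tri s b h (\<beta> - 2^h) (words s stash d) S" "stack s b d (Suc h) (\<beta> - 2^h) X0"
    show ?thesis using Suc.IH[OF a(3)] trie_props[OF a(2)] X a(1) by fastforce
  qed
qed auto

lemma stack_cong:
  "stack s b d h \<beta> X ==> (!!h \<beta> u S. tri s b h \<beta> u S ==> tri s' b h \<beta> u S) ==>
   (!!i. i < d ==> words s' side i = words s side i & words s' stash i = words s stash i) ==>
   stack s' b d h \<beta> X"
proof (induction d arbitrary: h \<beta> X)
  case (Suc d)
  then obtain S X0 where X: "X = X0 \<union> S" and
    o: "words s side d = 0 & tri s b h (\<beta> + 2^h) (words s stash d) S & stack s b d (Suc h) \<beta> X0 \<or>
      words s side d = 1 & 2^h <= \<beta> & tri s b h (\<beta> - 2^h) (words s stash d) S & stack s b d (Suc h) (\<beta> - 2^h) X0"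
    by auto
  have st: "!!h \<beta> X. stack s b d h \<beta> X ==> stack s' b d h \<beta> X" using Suc.IH Suc.prems(2,3) less_SucI by blast
  show ?case unfolding stack.simps
    using o X st Suc.prems(2) Suc.prems(3)[of d] by (intro exI[of _ S] exI[of _ X0]) auto
qed auto

abbreviation same_but :: "nat set => state => state => bool" where
  "same_but N s s' == keys s' = keys s & (\<forall>a. a \<notin> N --> words s' a = words s a)"

text \<open>\<open>n\<close> is the height of the current nodes. \<open>2^n div 2\<close> is the
  length of a child's range, and at a leaf it is 0, which ends the loop. The key \<open>k\<close> is
  neither below nor above itself, so the leaf needs the separate last conjunct.\<close>

definition descI :: "nat => nat => state => nat => nat set => nat set => nat => state => bool" where
  "descI b H s k Su Sv n s1 \<longleftrightarrow> n <= H & same_but {2..<10} s s1 &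
     s1$vw = 2^n div 2 & s1$vd = H - n &
     (\<exists>\<beta> X Su' Sv'. stack s1 b (H - n) n \<beta> X & tri s1 b n \<beta> (s1$vu) Su' & tri s1 b n \<beta> (s1$vv) Sv' &
        \<beta> + s1$vk = k & s1$vk < 2^n &
        {x \<in> Su. x < k} \<union> {x \<in> Sv. k < x} = X \<union> {x \<in> Su'. x < k} \<union> {x \<in> Sv'. k < x} &
        Sv' \<inter> {k} = Sv \<inter> {k})"

lemma desc_step:
  assumes I: "descI b H s k Su Sv (Suc n) s1" and b: "40 <= b"
    and B: "s$fresh b + 2*H + 4 <= B" "2^H + 2 <= B"
  shows "run B (desc_body b) s1 50 (descI b H s k Su Sv n)"
proof -
  obtain \<beta> X Su' Sv' where nH: "Suc n <= H" and sm: "same_but {2..<10} s s1" and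
    w0: "s1$vw = 2^Suc n div 2" and d: "s1$vd = H - Suc n" and
    st: "stack s1 b (H - Suc n) (Suc n) \<beta> X" and tu: "tri s1 b (Suc n) \<beta> (s1$vu) Su'" and
    tv: "tri s1 b (Suc n) \<beta> (s1$vv) Sv'" and
    kk: "\<beta> + s1$vk = k" "s1$vk < 2^Suc n" and
    S: "{x \<in> Su. x < k} \<union> {x \<in> Sv. k < x} = X \<union> {x \<in> Su'. x < k} \<union> {x \<in> Sv'. k < x}" "Sv' \<inter> {k} = Sv \<inter> {k}"
    using I unfolding descI_def by blast
  have w: "s1$vw = 2^n" using w0 by simp
  obtain U1 U2 where U: "Su' = U1 \<union> U2" "tri s1 b n \<beta> (words s1 (aL b) (s1$vu)) U1"
     "tri s1 b n (\<beta> + 2^n) (words s1 (aR b) (s1$vu)) U2" using tu by auto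
  obtain V1 V2 where V: "Sv' = V1 \<union> V2" "tri s1 b n \<beta> (words s1 (aL b) (s1$vv)) V1"
     "tri s1 b n (\<beta> + 2^n) (words s1 (aR b) (s1$vv)) V2" using tv by auto
  note Ub = U(2)[THEN trie_props] U(3)[THEN trie_props] V(2)[THEN trie_props] V(3)[THEN trie_props]
    tu[THEN trie_props] tv[THEN trie_props]
  have fr: "s1$fresh b = s$fresh b" using sm b by auto
  have nH2: "(2::nat)^Suc n <= 2^H" using nH by (intro power_increasing) auto
  have HB: "H <= B" "H - Suc n + 1 <= B" using B by auto
  define r1 where "r1 = desc_body b"
  have f: "fits B r1 s1" using b B nH2 w d kk Ub fr HB by (auto simp: r1_def desc_body_def)
  have sm2: "same_but {2..<10} s1 (result r1 s1)"
    using b by (auto simp: r1_def desc_body_def fun_eq_iff)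
  have wa: "words (result r1 s1) (aL b) = words s1 (aL b)" "words (result r1 s1) (aR b) = words s1 (aR b)"
     "words (result r1 s1) (aM b) = words s1 (aM b)" "words (result r1 s1) (fresh b) = words s1 (fresh b)"
    using sm2 b by auto
  have Hd: "H - n = Suc (H - Suc n)" using nH by simp
  have "descI b H s k Su Sv n (result r1 s1)"
  proof (cases "s1$vk < 2^n")
    case True
    have vals: "(result r1 s1)$vw = 2^n div 2" "(result r1 s1)$vd = H - n"
      "(result r1 s1)$vu = words s1 (aL b) (s1$vu)"
      "(result r1 s1)$vv = words s1 (aL b) (s1$vv)" 
      "(result r1 s1)$vk = s1$vk"
      "words (result r1 s1) side (H - Suc n) = 0" 
      "words (result r1 s1) stash (H - Suc n) = words s1 (aR b) (s1$vv)" 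
      "!!i. i < H - Suc n ==> words (result r1 s1) side i = words s1 side i & words (result r1 s1) stash i = words s1 stash i"
      using True b w d nH by (auto simp: r1_def desc_body_def)
    have "stack (result r1 s1) b (H - Suc n) (Suc n) \<beta> X"
      by (rule stack_cong[OF st]) (simp_all add: wa vals(8))
    then have "stack (result r1 s1) b (H - n) n \<beta> (X \<union> V2)"
      unfolding Hd stack.simps using V(3) by (intro exI[of _ V2] exI[of _ X]) (simp add: wa vals)
    moreover have "~ x < k" if "x \<in> U2" for x using that Ub(2) True kk(1) by fastforce
    moreover have "k < x" if "x \<in> V2" for x using that Ub(4) True kk(1) by fastforce
    then have "{x \<in> Su. x < k} \<union> {x \<in> Sv. k < x} = (X \<union> V2) \<union> {x \<in> U1. x < k} \<union> {x \<in> V1. k < x}"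
      "V1 \<inter> {k} = Sv \<inter> {k}"
      unfolding S(1) S(2)[symmetric] U(1) V(1) using calculation(2) by blast+
    ultimately have ex: "\<exists>\<beta> X Su' Sv'. stack (result r1 s1) b (H - n) n \<beta> X & tri (result r1 s1) b n \<beta> ((result r1 s1)$vu) Su' &
        tri (result r1 s1) b n \<beta> ((result r1 s1)$vv) Sv' &
        \<beta> + (result r1 s1)$vk = k & (result r1 s1)$vk < 2^n &
        {x \<in> Su. x < k} \<union> {x \<in> Sv. k < x} = X \<union> {x \<in> Su'. x < k} \<union> {x \<in> Sv'. k < x} &
        Sv' \<inter> {k} = Sv \<inter> {k}"
      using U(2) V(2) kk(1) True
      by - (rule exI[of _ \<beta>], rule exI[of _ "X \<union> V2"], rule exI[of _ U1], rule exI[of _ V1], simp add: vals wa)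
    show ?thesis unfolding descI_def using nH sm sm2 by (intro conjI ex) (simp_all add: vals)
  next
    case False
    have vals: "(result r1 s1)$vw = 2^n div 2" "(result r1 s1)$vd = H - n"
      "(result r1 s1)$vu = words s1 (aR b) (s1$vu)"
      "(result r1 s1)$vv = words s1 (aR b) (s1$vv)" 
      "(result r1 s1)$vk = s1$vk - 2^n"
      "words (result r1 s1) side (H - Suc n) = 1" 
      "words (result r1 s1) stash (H - Suc n) = words s1 (aL b) (s1$vu)" 
      "!!i. i < H - Suc n ==> words (result r1 s1) side i = words s1 side i & words (result r1 s1) stash i = words s1 stash i"
      using False b w d nH by (auto simp: r1_def desc_body_def)
    have "stack (result r1 s1) b (H - Suc n) (Suc n) \<beta> X"
      by (rule stack_cong[OF st]) (simp_all add: wa vals(8))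
    then have "stack (result r1 s1) b (H - n) n (\<beta> + 2^n) (X \<union> U1)"
      unfolding Hd stack.simps using U(2) by (intro exI[of _ U1] exI[of _ X]) (simp add: wa vals)
    moreover have "x < k" if "x \<in> U1" for x using that Ub(1) False kk(1) by fastforce
    moreover have "x < k" if "x \<in> V1" for x using that Ub(3) False kk(1) by fastforce
    then have "{x \<in> Su. x < k} \<union> {x \<in> Sv. k < x} = (X \<union> U1) \<union> {x \<in> U2. x < k} \<union> {x \<in> V2. k < x}"
      "V2 \<inter> {k} = Sv \<inter> {k}"
      unfolding S(1) S(2)[symmetric] U(1) V(1) using calculation(2) by (blast dest: less_asym)+
    moreover have "(\<beta> + 2^n) + (s1$vk - 2^n) = k" "s1$vk - 2^n < 2^n"
      using kk False by auto
    ultimately have ex: "\<exists>\<beta> X Su' Sv'. stack (result r1 s1) b (H - n) n \<beta> X & tri (result r1 s1) b n \<beta> ((result r1 s1)$vu) Su' &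
        tri (result r1 s1) b n \<beta> ((result r1 s1)$vv) Sv' &
        \<beta> + (result r1 s1)$vk = k & (result r1 s1)$vk < 2^n &
        {x \<in> Su. x < k} \<union> {x \<in> Sv. k < x} = X \<union> {x \<in> Su'. x < k} \<union> {x \<in> Sv'. k < x} &
        Sv' \<inter> {k} = Sv \<inter> {k}"
      using U(3) V(3)
      by - (rule exI[of _ "\<beta> + 2^n"], rule exI[of _ "X \<union> U1"], rule exI[of _ U2], rule exI[of _ V2], simp add: vals wa)
    show ?thesis unfolding descI_def using nH sm sm2 by (intro conjI ex) (simp_all add: vals)
  qed
  moreover have "loop_free r1" "time r1 <= 50" by (simp_all add: r1_def desc_body_def)
  ultimately show ?thesis using f unfolding r1_def[symmetric]
    by (intro run_loop_free)
qed

definition ascI :: "nat => nat => state => nat set => nat => nat => state => bool" where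
  "ascI b H s S c n s1 \<longleftrightarrow> n <= H & ext {2..<10} b s s1 & s1$fresh b + n <= s$fresh b + H + c &
     s1$vd = n & (\<exists>\<beta> X S'. stack s1 b n (H - n) \<beta> X & tri s1 b (H - n) \<beta> (s1$vv) S' & X \<union> S' = S)"

lemma asc_step:
  assumes I: "ascI b H s S c (Suc n) s1" and b: "40 <= b"
    and B: "s$fresh b + 2*H + c + 4 <= B" "2^H + 2 <= B" and nu: "null_ok s b"
  shows "run B (asc_body b) s1 70 (ascI b H s S c n)"
proof -
  obtain \<beta> X S' where nH: "Suc n <= H" and ex: "ext {2..<10} b s s1" and
    fr: "s1$fresh b + Suc n <= s$fresh b + H + c" and d: "s1$vd = Suc n" and
    st: "stack s1 b (Suc n) (H - Suc n) \<beta> X" and tv: "tri s1 b (H - Suc n) \<beta> (s1$vv) S'" and S: "X \<union> S' = S"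
    using I unfolding ascI_def by blast
  let ?h = "H - Suc n"
  have Hd: "Suc ?h = H - n" using nH by simp
  define fr1 where "fr1 = s1$fresh b"
  obtain Y X0 where X: "X = X0 \<union> Y" and
     o: "words s1 side n = 0 & tri s1 b ?h (\<beta> + 2^?h) (words s1 stash n) Y & stack s1 b n (H - n) \<beta> X0 \<or>
      words s1 side n = 1 & 2^?h <= \<beta> & tri s1 b ?h (\<beta> - 2^?h) (words s1 stash n) Y & stack s1 b n (H - n) (\<beta> - 2^?h) X0"
    using st unfolding stack.simps Hd by blast
  define r1 where "r1 = asc_body b"
  define l r where "l = (if words s1 side n = 0 then s1$vv else words s1 stash n)"
    and "r = (if words s1 side n = 0 then words s1 stash n else s1$vv)"
  define \<gamma> where "\<gamma> = (if words s1 side n = 0 then \<beta> else \<beta> - 2^?h)"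
  define T1 T2 where "T1 = (if words s1 side n = 0 then S' else Y)" and "T2 = (if words s1 side n = 0 then Y else S')"
  have t1: "tri s1 b ?h \<gamma> l T1" and t2: "tri s1 b ?h (\<gamma> + 2^?h) r T2" and st0: "stack s1 b n (H - n) \<gamma> X0"
    and side: "words s1 side n <= 1"
    using o tv by (auto simp: l_def r_def \<gamma>_def T1_def T2_def)
  note p1 = trie_props[OF t1] and p2 = trie_props[OF t2]
  have sz: "\<gamma> + 2^(H - n) <= 2^H" using stack_props[OF st0] nH by simp
  have top1: "upper T1 <= 2^H" using p1 sz unfolding Hd[symmetric] by (intro upper_le) auto
  have top2: "upper T2 <= 2^H" using p2 sz unfolding Hd[symmetric] by (intro upper_le) auto
  have lr: "l < fr1" "r < fr1" using p1 p2 by (auto simp: fr1_def)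
  have frB: "fr1 + 1 <= B" using fr B by (simp add: fr1_def)
  have vals: "words (result r1 s1) (aL b) = (words s1 (aL b))(fr1 := l)"
     "words (result r1 s1) (aR b) = (words s1 (aR b))(fr1 := r)"
     "words (result r1 s1) (aM b) = (words s1 (aM b))(fr1 := upper (T1 \<union> T2))"
     "(result r1 s1)$fresh b = Suc fr1" "(result r1 s1)$vv = fr1" "(result r1 s1)$vd = n"
     "words (result r1 s1) side = words s1 side" "words (result r1 s1) stash = words s1 stash"
  proof -
    have "T1 \<union> T2 = T1 \<union> T2 & (\<forall>x y. x \<in> T1 --> y \<in> T2 --> x < y)" using p1 p2 by fastforce
    then have tt: "upper (T1 \<union> T2) = (if T2 = {} then upper T1 else upper T2)" using p1 p2 by (intro upper_Un) auto
    show "words (result r1 s1) (aL b) = (words s1 (aL b))(fr1 := l)"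
     "words (result r1 s1) (aR b) = (words s1 (aR b))(fr1 := r)"
     "words (result r1 s1) (aM b) = (words s1 (aM b))(fr1 := upper (T1 \<union> T2))"
     "(result r1 s1)$fresh b = Suc fr1" "(result r1 s1)$vv = fr1" "(result r1 s1)$vd = n"
     "words (result r1 s1) side = words s1 side" "words (result r1 s1) stash = words s1 stash"
      using b d side lr p1 p2 unfolding tt
      by (auto simp: r1_def asc_body_def l_def r_def fr1_def fun_eq_iff upper_eq_0)
  qed
  have f: "fits B r1 s1" using b d side lr p1 p2 frB top1 top2 B fr
    by (auto simp: r1_def asc_body_def l_def r_def fr1_def split: if_splits)
  have e1: "ext {2..<10} b s1 (result r1 s1)" unfolding ext_def
  proof (intro conjI)
    show "\<forall>a. a \<notin> {2..<10} --> a \<notin> {aL b, aR b, aM b, fresh b} --> words (result r1 s1) a = words s1 a"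
      by (auto simp: r1_def asc_body_def fun_eq_iff)
  qed (use vals in "auto simp: r1_def asc_body_def fr1_def")
  have "stack (result r1 s1) b n (H - n) \<gamma> X0"
    by (rule stack_cong[OF st0 ext_tri[OF e1]]) (simp_all add: vals)
  moreover have "tri (result r1 s1) b (H - n) \<gamma> fr1 (T1 \<union> T2)"
    unfolding Hd[symmetric] trie.simps using ext_tri[OF e1 t1] ext_tri[OF e1 t2]
    by (auto simp: vals)
  moreover have "X0 \<union> (T1 \<union> T2) = S" using S X by (auto simp: T1_def T2_def)
  moreover have "ext {2..<10} b s (result r1 s1)" using ext_trans[OF ex e1] by blast
  ultimately have "ascI b H s S c n (result r1 s1)" unfolding ascI_def using nH fr vals
    by (auto simp: fr1_def)
  moreover have "loop_free r1" "time r1 <= 70" by (simp_all add: r1_def asc_body_def)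
  ultimately show ?thesis using f unfolding r1_def[symmetric]
    by (intro run_loop_free)
qed

text \<open>\<open>mid\<close> sees only the leaf of \<open>vv\<close> at \<open>k\<close>. Its
  three instances keep this leaf, clear it, or set it.\<close>

lemma upd_run:
  assumes b: "40 <= b" and B: "s$fresh b + 2*H + 6 <= B" "2^H + 2 <= B" and nu: "null_ok s b"
    and U: "s$univ b = 2^H" and k: "s$vk = k" "k < 2^H"
    and tu: "tri s b H 0 (s$vu) Su" and tv: "tri s b H 0 (s$vv) Sv"
    and mid: "!!s1. same_but {2..<10} s s1 ==> tri s1 b 0 k (s1$vv) (Sv \<inter> {k}) ==>
        run B mid s1 20 (%s2. ext {3} b s1 s2 & s2$fresh b <= Suc (s1$fresh b) &
          tri s2 b 0 k (s2$vv) T)"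
  shows "run B (upd b mid) s (150*H + 50) (%s'. ext {2..<10} b s s' &
     s'$fresh b <= s$fresh b + H + 1 &
     tri s' b H 0 (s'$vv) ({x \<in> Su. x < k} \<union> T \<union> {x \<in> Sv. k < x}))"
proof -
  let ?S = "{x \<in> Su. x < k} \<union> T \<union> {x \<in> Sv. k < x}"
  let ?I1 = "descI b H s k Su Sv" and ?I2 = "ascI b H s ?S 1"
  have init: "run B (seqs [Set vw (Div (V (univ b)) (Const 2)), Set vd (Const 0)]) s 10 (?I1 H)"
  proof (rule run_loop_free)
    let ?s = "result (seqs [Set vw (Div (V (univ b)) (Const 2)), Set vd (Const 0)]) s"
    have sm: "same_but {2..<10} s ?s" using b by (auto simp: fun_eq_iff)
    have w: "words ?s (aL b) = words s (aL b)" "words ?s (aR b) = words s (aR b)"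
      "words ?s (aM b) = words s (aM b)" "words ?s (fresh b) = words s (fresh b)"
      using sm b by auto
    have "\<exists>\<beta> X Su' Sv'. stack ?s b (H - H) H \<beta> X & tri ?s b H \<beta> (?s$vu) Su' & tri ?s b H \<beta> (?s$vv) Sv' &
        \<beta> + ?s$vk = k & ?s$vk < 2^H &
        {x \<in> Su. x < k} \<union> {x \<in> Sv. k < x} = X \<union> {x \<in> Su'. x < k} \<union> {x \<in> Sv'. k < x} &
        Sv' \<inter> {k} = Sv \<inter> {k}"
      unfolding w
      by (rule exI[of _ 0], rule exI[of _ "{}"], rule exI[of _ Su], rule exI[of _ Sv]) (use k tu tv in simp)
    then show "?I1 H ?s"
      unfolding descI_def using b U sm by simp
  qed (use U B b in auto)
  have l1: "run B (While (Less (Const 0) (V vw)) (desc_body b)) s1 (H*(4 + 50) + 4) (?I1 0)" if "?I1 H s1" for s1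
  proof (rule run_mono[OF run_loop[where I = ?I1 and k = 50, OF that]])
    show "tfits B (Less (Const 0) (V vw)) s2" if "?I1 n s2" for n s2
    proof -
      have "n <= H" "s2$vw = 2^n div 2" using that unfolding descI_def by blast+
      then have "s2$vw <= 2^H"
        by (metis div_le_dividend le_trans one_le_numeral power_increasing)
      then show ?thesis using B by simp
    qed
    show "~ tval (Less (Const 0) (V vw)) s2" if "?I1 0 s2" for s2
      using that unfolding descI_def by simp
    show "run B (desc_body b) s2 50 (?I1 n)" if "?I1 (Suc n) s2" for n s2
      using desc_step[OF that b] B by auto
    show "?I1 0 s'" if "?I1 m s'" "~ tval (Less (Const 0) (V vw)) s'" for m s'
    proof -
      have "(2::nat)^m div 2 = 0" using that unfolding descI_def by auto
      then have "m = 0" by (cases m) auto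
      then show ?thesis using that by simp
    qed
  qed auto
  have m: "run B mid s1 20 (?I2 H)" if I0: "?I1 0 s1" for s1
  proof -
    have sm: "same_but {2..<10} s s1" and d: "s1$vd = H"
      using I0 unfolding descI_def by simp_all
    obtain \<beta> X Su' Sv' where st: "stack s1 b H 0 \<beta> X" and t: "tri s1 b 0 \<beta> (s1$vu) Su'" "tri s1 b 0 \<beta> (s1$vv) Sv'" and
      kb: "\<beta> + s1$vk = k" "s1$vk < 2^0" and
      S: "{x \<in> Su. x < k} \<union> {x \<in> Sv. k < x} = X \<union> {x \<in> Su'. x < k} \<union> {x \<in> Sv'. k < x}" "Sv' \<inter> {k} = Sv \<inter> {k}"
      using I0[unfolded descI_def diff_zero] by blast
    have bk: "\<beta> = k" using kb by simp
    have p: "Su' \<subseteq> {k}" "Sv' \<subseteq> {k}" using trie_props[OF t(1)] trie_props[OF t(2)] bk by auto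
    then have X: "X = {x \<in> Su. x < k} \<union> {x \<in> Sv. k < x}" using S by fastforce
    have "Sv' = Sv \<inter> {k}" using p S by blast
    then have tv': "tri s1 b 0 k (s1$vv) (Sv \<inter> {k})" using t(2) bk by simp
    show ?thesis
    proof (rule run_mono[OF mid[OF sm tv'] order_refl])
      fix s2 assume 2: "ext {3} b s1 s2 & s2$fresh b <= Suc (s1$fresh b) &
          tri s2 b 0 k (s2$vv) T"
      have ex: "ext {2..<10} b s s1" using sm b unfolding ext_def by auto
      have "ext {2..<10} b s s2" using ext_trans[OF ex, of "{3}" s2 "{2..<10}"] 2 by auto
      moreover have "stack s2 b H (H - H) \<beta> X"
      proof -
        have e: "ext {3} b s1 s2" using 2 by blast
        have "words s2 side = words s1 side" "words s2 stash = words s1 stash" using e b by (auto simp: ext_def)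
        then show ?thesis using stack_cong[OF st ext_tri[OF e]] by simp
      qed
      moreover have "s2$vd = H" "s1$fresh b = s$fresh b" using 2 d b sm by (auto simp: ext_def)
      moreover have "X \<union> T = ?S" using X by blast
      moreover have "\<exists>\<beta> X S'. stack s2 b H (H - H) \<beta> X & tri s2 b (H - H) \<beta> (s2$vv) S' & X \<union> S' = ?S"
        using 2 bk calculation(2,5)
        by - (rule exI[of _ k], rule exI[of _ X], rule exI[of _ T], simp)
      ultimately show "?I2 H s2" unfolding ascI_def using 2 by simp
    qed
  qed
  have l2: "run B (While (Less (Const 0) (V vd)) (asc_body b)) s1 (H*(4 + 70) + 4) (%s'. ext {2..<10} b s s' &
     s'$fresh b <= s$fresh b + H + 1 & tri s' b H 0 (s'$vv) ?S)" if "?I2 H s1" for s1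
  proof (rule run_mono[OF run_loop[where I = ?I2 and k = 70, OF that]])
    show "tfits B (Less (Const 0) (V vd)) s2" if "?I2 n s2" for n s2
      using that B unfolding ascI_def by auto
    show "~ tval (Less (Const 0) (V vd)) s2" if "?I2 0 s2" for s2
      using that unfolding ascI_def by simp
    show "run B (asc_body b) s2 70 (?I2 n)" if "?I2 (Suc n) s2" for n s2
      using asc_step[OF that b _ _ nu] B by auto
    show "?I2 0 s'" if "?I2 m s'" "~ tval (Less (Const 0) (V vd)) s'" for m s'
    proof -
      have "m = 0" using that unfolding ascI_def by auto
      then show ?thesis using that by simp
    qed
    show "ext {2..<10} b s s' & s'$fresh b <= s$fresh b + H + 1 &
      tri s' b H 0 (s'$vv) ?S" if "?I2 0 s'" for s'
      using that unfolding ascI_def by auto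
  qed auto
  show ?thesis
    unfolding upd_def seqs.simps(2,3)[of "seqs _"] seqs.simps(2,3)[of "While _ _"] seqs.simps(2,3)[of mid]
    by (rule run_mono[OF run_SeqI[OF init run_SeqI[OF l1 run_SeqI[OF m l2]]]]) auto
qed

text \<open>The descent reduces \<open>vk\<close> to an offset, which is 0 at a leaf; therefore the
  key is read from \<open>vkk\<close>.\<close>

definition set_leaf :: "nat => com" where
  "set_leaf b = seqs [Store (aM b) (V (fresh b)) (Plus (V vkk) (Const 1)), Set vv (V (fresh b)),
     Set (fresh b) (Plus (V (fresh b)) (Const 1))]"

lemma upd_splice:
  assumes b: "40 <= b" and B: "s$fresh b + 2*H + 6 <= B" "2^H + 2 <= B" and nu: "null_ok s b"
    and U: "s$univ b = 2^H" and k: "s$vk = k" "k < 2^H"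
    and tu: "tri s b H 0 (s$vu) Su" and tv: "tri s b H 0 (s$vv) Sv"
  shows "run B (upd b Skip) s (150*H + 50) (%s'. ext {2..<10} b s s' &
     s'$fresh b <= s$fresh b + H + 1 &
     tri s' b H 0 (s'$vv) ({x \<in> Su. x < k} \<union> {x \<in> Sv. k <= x}))"
proof -
  have "{x \<in> Su. x < k} \<union> (Sv \<inter> {k}) \<union> {x \<in> Sv. k < x} = {x \<in> Su. x < k} \<union> {x \<in> Sv. k <= x}" by auto
  moreover have "run B (upd b Skip) s (150*H + 50) (%s'. ext {2..<10} b s s' &
     s'$fresh b <= s$fresh b + H + 1 &
     tri s' b H 0 (s'$vv) ({x \<in> Su. x < k} \<union> (Sv \<inter> {k}) \<union> {x \<in> Sv. k < x}))"
    by (rule upd_run[OF assms]) (auto intro!: run_loop_free ext_refl)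
  ultimately show ?thesis by simp
qed

lemma upd_delete:
  assumes b: "40 <= b" and B: "s$fresh b + 2*H + 6 <= B" "2^H + 2 <= B" and nu: "null_ok s b"
    and U: "s$univ b = 2^H" and k: "s$vk = k" "k < 2^H"
    and tu: "tri s b H 0 (s$vu) S" and tv: "tri s b H 0 (s$vv) S"
  shows "run B (upd b (Set vv (Const 0))) s (150*H + 50) (%s'. ext {2..<10} b s s' &
     s'$fresh b <= s$fresh b + H + 1 &
     tri s' b H 0 (s'$vv) (S - {k}))"
proof -
  have "{x \<in> S. x < k} \<union> {} \<union> {x \<in> S. k < x} = S - {k}" by auto
  moreover have "run B (upd b (Set vv (Const 0))) s (150*H + 50) (%s'. ext {2..<10} b s s' &
     s'$fresh b <= s$fresh b + H + 1 &
     tri s' b H 0 (s'$vv) ({x \<in> S. x < k} \<union> {} \<union> {x \<in> S. k < x}))"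
  proof (rule upd_run[OF assms])
    fix s1 assume s1: "same_but {2..<10} s s1"
    then have n: "null_ok s1 b" using nu b by (auto simp: null_ok_def)
    show "run B (Set vv (Const 0)) s1 20 (%s2. ext {3} b s1 s2 &
          s2$fresh b <= Suc (s1$fresh b) & tri s2 b 0 k (s2$vv) {})"
      using n b by (intro run_loop_free) (auto simp: ext_def null_ok_def fun_eq_iff)
  qed
  ultimately show ?thesis by simp
qed

lemma upd_insert:
  assumes b: "40 <= b" and B: "s$fresh b + 2*H + 6 <= B" "2^H + 2 <= B" and nu: "null_ok s b"
    and U: "s$univ b = 2^H" and k: "s$vk = k" "k < 2^H"
    and tu: "tri s b H 0 (s$vu) S" and tv: "tri s b H 0 (s$vv) S"
    and kk: "s$vkk = k"
  shows "run B (upd b (set_leaf b)) s (150*H + 50) (%s'. ext {2..<10} b s s' &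
     s'$fresh b <= s$fresh b + H + 1 &
     tri s' b H 0 (s'$vv) (insert k S))"
proof -
  have "{x \<in> S. x < k} \<union> {k} \<union> {x \<in> S. k < x} = insert k S" by auto
  moreover have "run B (upd b (set_leaf b)) s (150*H + 50) (%s'. ext {2..<10} b s s' &
     s'$fresh b <= s$fresh b + H + 1 &
     tri s' b H 0 (s'$vv) ({x \<in> S. x < k} \<union> {k} \<union> {x \<in> S. k < x}))"
  proof (rule upd_run[OF assms(1-9)])
    fix s1 assume s1: "same_but {2..<10} s s1"
    then have n: "s1$vkk = k" "s1$fresh b = s$fresh b" using kk b by auto
    show "run B (set_leaf b) s1 20 (%s2. ext {3} b s1 s2 &
          s2$fresh b <= Suc (s1$fresh b) & tri s2 b 0 k (s2$vv) {k})"
      using n b B k by (intro run_loop_free) (auto simp: ext_def set_leaf_def fun_eq_iff)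
  qed
  ultimately show ?thesis by simp
qed

section \<open>Predecessor search\<close>

definition pred_body :: "nat => com" where
  "pred_body b = seqs [
     Cond (Less (V vk) (V vw)) (Set vu (Cell (aL b) (V vu)))
       (seqs [Cond (Less (Const 0) (Cell (aM b) (Cell (aL b) (V vu))))
                (Set vbest (Cell (aM b) (Cell (aL b) (V vu)))) Skip,
              Set vk (Minus (V vk) (V vw)), Set vu (Cell (aR b) (V vu))]),
     Set vw (Div (V vw) (Const 2))]"

text \<open>Stores in \<open>vbest\<close> the successor of the largest key below \<open>vk\<close>, or 0 if there is none.\<close>

definition pred :: "nat => com" where
  "pred b = seqs [seqs [Set vw (Div (V (univ b)) (Const 2)), Set vbest (Const 0)],
     While (Less (Const 0) (V vw)) (pred_body b)]"

text \<open>\<open>vbest\<close> comes from the last nonempty left sibling that was passed. It is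
  the answer unless the current subtree still contains a key below \<open>k\<close>.\<close>

definition predI :: "nat => nat => state => nat => nat set => nat => state => bool" where
  "predI b H s k S n s1 \<longleftrightarrow> n <= H & same_but {2..<10} s s1 & s1$vw = 2^n div 2 &
     (\<exists>\<beta> S'. tri s1 b n \<beta> (s1$vu) S' & \<beta> + s1$vk = k & s1$vk < 2^n & S' \<subseteq> S &
        upper {x \<in> S. x < k} = (if {x \<in> S'. x < k} = {} then s1$vbest else upper {x \<in> S'. x < k}))"

lemma same_tri: "same_but N s s1 ==> {aL b, aR b, aM b, fresh b} \<inter> N = {} ==> tri s1 b = tri s b"
  by auto

lemma pred_step:
  assumes I: "predI b H s k S (Suc n) s1" and b: "40 <= b" and S: "S \<subseteq> {..<2^H}"
    and B: "s$fresh b + 2*H + 4 <= B" "2^H + 2 <= B"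
  shows "run B (pred_body b) s1 40 (predI b H s k S n)"
proof -
  obtain \<beta> S' where nH: "Suc n <= H" and sm: "same_but {2..<10} s s1" and
    w0: "s1$vw = 2^Suc n div 2" and
    tu: "tri s1 b (Suc n) \<beta> (s1$vu) S'" and
    kk: "\<beta> + s1$vk = k" "s1$vk < 2^Suc n" and
    S': "S' \<subseteq> S" "upper {x \<in> S. x < k} = (if {x \<in> S'. x < k} = {} then s1$vbest else upper {x \<in> S'. x < k})"
    using I unfolding predI_def by blast
  have w: "s1$vw = 2^n" using w0 by simp
  obtain U1 U2 where U: "S' = U1 \<union> U2" "tri s1 b n \<beta> (words s1 (aL b) (s1$vu)) U1"
     "tri s1 b n (\<beta> + 2^n) (words s1 (aR b) (s1$vu)) U2" using tu by auto
  note Ub = U(2)[THEN trie_props] U(3)[THEN trie_props] tu[THEN trie_props]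
  have fr: "s1$fresh b = s$fresh b" using sm b by auto
  have nH2: "(2::nat)^Suc n <= 2^H" using nH by (intro power_increasing) auto
  have top1: "upper U1 <= 2^H" using Ub S' U S by (intro upper_le) auto
  have f: "fits B (pred_body b) s1" using b B nH2 w kk Ub fr top1 by (auto simp: pred_body_def)
  let ?r = "result (pred_body b) s1"
  have sm2: "same_but {2..<10} s1 ?r" using b by (auto simp: pred_body_def fun_eq_iff)
  have wa: "tri ?r b = tri s1 b" by (rule same_tri[OF sm2]) (use b in auto)
  have vw: "?r$vw = 2^n div 2" using w by (auto simp: pred_body_def)
  have "predI b H s k S n ?r"
  proof (cases "s1$vk < 2^n")
    case True
    have v: "?r$vu = words s1 (aL b) (s1$vu)" "?r$vk = s1$vk" "?r$vbest = s1$vbest"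
      using True w b by (auto simp: pred_body_def)
    have "~ x < k" if "x \<in> U2" for x using that Ub(2) True kk(1) by fastforce
    then have eq: "{x \<in> S'. x < k} = {x \<in> U1. x < k}" using U(1) by blast
    have "\<exists>\<beta> S'. tri ?r b n \<beta> (?r$vu) S' & \<beta> + ?r$vk = k & ?r$vk < 2^n & S' \<subseteq> S &
        upper {x \<in> S. x < k} = (if {x \<in> S'. x < k} = {} then ?r$vbest else upper {x \<in> S'. x < k})"
      unfolding S'(2) eq using True kk(1) U S'(1)
      by - (rule exI[of _ \<beta>], rule exI[of _ U1], simp only: wa v, blast)
    then show ?thesis unfolding predI_def using nH sm sm2 vw by auto
  next
    case False
    have v: "?r$vu = words s1 (aR b) (s1$vu)" "?r$vk = s1$vk - 2^n"
      "?r$vbest = (if U1 = {} then s1$vbest else upper U1)"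
      using False w b Ub(1) by (auto simp: pred_body_def upper_eq_0)
    have "x < k" if "x \<in> U1" for x using that Ub(1) False kk(1) by fastforce
    then have eq: "{x \<in> S'. x < k} = U1 \<union> {x \<in> U2. x < k}" using U(1) by blast
    define W where "W = {x \<in> U2. x < k}"
    have "finite W" "!!x. x \<in> W ==> \<beta> + 2^n <= x" using Ub by (auto simp: W_def)
    then have "upper (U1 \<union> W) = (if W = {} then upper U1 else upper W)"
      using Ub(1) by (intro upper_Un) fastforce+
    then have "upper {x \<in> S. x < k} = (if W = {} then ?r$vbest else upper W)"
      unfolding S'(2) eq v W_def[symmetric] by (cases "W = {}"; cases "U1 = {}") simp_all
    note eq3 = this[unfolded W_def]
    have "\<exists>\<beta> S'. tri ?r b n \<beta> (?r$vu) S' & \<beta> + ?r$vk = k & ?r$vk < 2^n & S' \<subseteq> S &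
        upper {x \<in> S. x < k} = (if {x \<in> S'. x < k} = {} then ?r$vbest else upper {x \<in> S'. x < k})"
      using False kk U S'(1) by - (rule exI[of _ "\<beta> + 2^n"], rule exI[of _ U2], simp only: wa v(1,2) eq3, auto)
    then show ?thesis unfolding predI_def using nH sm sm2 vw by auto
  qed
  moreover have "loop_free (pred_body b)" "time (pred_body b) <= 40" by (simp_all add: pred_body_def)
  ultimately show ?thesis using f by (intro run_loop_free)
qed

lemma pred_run:
  assumes b: "40 <= b" and B: "s$fresh b + 2*H + 6 <= B" "2^H + 2 <= B"
    and U: "s$univ b = 2^H" and k: "s$vk = k" "k < 2^H"
    and tu: "tri s b H 0 (s$vu) S"
  shows "run B (pred b) s (50*H + 20) (%s'. same_but {2..<10} s s' & s'$vbest = upper {x \<in> S. x < k})"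
proof -
  let ?I = "predI b H s k S"
  have S: "S \<subseteq> {..<2^H}" using trie_props[OF tu] by auto
  have init: "run B (seqs [Set vw (Div (V (univ b)) (Const 2)), Set vbest (Const 0)]) s 10 (?I H)"
  proof (rule run_loop_free)
    let ?s = "result (seqs [Set vw (Div (V (univ b)) (Const 2)), Set vbest (Const 0)]) s"
    have sm: "same_but {2..<10} s ?s" using b by (auto simp: fun_eq_iff)
    have w: "tri ?s b = tri s b" by (rule same_tri[OF sm]) (use b in auto)
    have "\<exists>\<beta> S'. tri ?s b H \<beta> (?s$vu) S' & \<beta> + ?s$vk = k & ?s$vk < 2^H & S' \<subseteq> S &
        upper {x \<in> S. x < k} = (if {x \<in> S'. x < k} = {} then ?s$vbest else upper {x \<in> S'. x < k})"
      unfolding w by (rule exI[of _ 0], rule exI[of _ S]) (use k tu in "simp add: upper_eq_0")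
    then show "?I H ?s" unfolding predI_def using b U sm by simp
  qed (use U B b in auto)
  have l1: "run B (While (Less (Const 0) (V vw)) (pred_body b)) s1 (H*(4 + 40) + 4)
     (%s'. same_but {2..<10} s s' & s'$vbest = upper {x \<in> S. x < k})" if I0: "?I H s1" for s1
  proof (rule run_mono[OF run_loop[where I = ?I and k = 40, OF I0]])
    show "tfits B (Less (Const 0) (V vw)) s2" if "?I n s2" for n s2
    proof -
      have "n <= H" "s2$vw = 2^n div 2" using that unfolding predI_def by blast+
      then have "s2$vw <= 2^H"
        by (metis div_le_dividend le_trans one_le_numeral power_increasing)
      then show ?thesis using B by simp
    qed
    show "~ tval (Less (Const 0) (V vw)) s2" if "?I 0 s2" for s2
      using that unfolding predI_def by simp
    show "run B (pred_body b) s2 40 (?I n)" if "?I (Suc n) s2" for n s2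
      using pred_step[OF that b S] B by auto
    show "?I 0 s'" if "?I m s'" "~ tval (Less (Const 0) (V vw)) s'" for m s'
    proof -
      have "(2::nat)^m div 2 = 0" using that unfolding predI_def by auto
      then have "m = 0" by (cases m) auto
      then show ?thesis using that by simp
    qed
    show "same_but {2..<10} s s' & s'$vbest = upper {x \<in> S. x < k}" if i: "?I 0 s'" for s'
    proof -
      obtain \<beta> S' where t: "tri s' b 0 \<beta> (s'$vu) S'" and kb: "\<beta> + s'$vk = k" "s'$vk < 2^0"
        and e: "upper {x \<in> S. x < k} = (if {x \<in> S'. x < k} = {} then s'$vbest else upper {x \<in> S'. x < k})"
        using i unfolding predI_def by blast
      \<comment> \<open>The leaf covers only \<open>k\<close> itself, so \<open>vbest\<close>
        decides.\<close>
      have "{x \<in> S'. x < k} = {}" using t kb by auto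
      then show ?thesis using e i unfolding predI_def by simp
    qed
  qed auto
  show ?thesis unfolding pred_def seqs.simps(2,3)[of "seqs _"] seqs.simps(2,3)[of "While _ _"]
    by (rule run_mono[OF run_SeqI[OF init l1]]) auto
qed

section \<open>Binary search\<close>

abbreviation (input) vhi :: nat where "vhi == 10"
abbreviation (input) vlo :: nat where "vlo == 11"
abbreviation (input) vmid :: nat where "vmid == 12"
abbreviation (input) vflag :: nat where "vflag == 13"

text \<open>Searches for the least index below \<open>e\<close> at which \<open>tst\<close> raises
  \<open>vflag\<close>; the value of \<open>e\<close> is returned if there is none.\<close>

definition bsearch :: "wexp => com => com" where
  "bsearch e tst = seqs [seqs [Set vhi e, Set vlo (Const 0)],
     While (Less (V vlo) (V vhi)) (seqs [
       Set vmid (Div (Plus (V vlo) (V vhi)) (Const 2)), tst,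
       Cond (Less (Const 0) (V vflag)) (Set vhi (V vmid)) (Set vlo (Plus (V vmid) (Const 1)))])]"

lemma bsearch_run:
  assumes e: "wval e s = N" "wfits B e s" "N < 2^g" "2*N + 2 <= B"
    and tst: "!!s1 m. m < N ==> same_but {2..<14} s s1 ==> s1$vmid = m ==>
       run B tst s1 kt (%s2. same_but ({2..<10} \<union> {vflag}) s1 s2 & s2$vflag <= 1 & (s2$vflag = 1 \<longleftrightarrow> Q m))"
    and mono: "!!i j. i <= j ==> j < N ==> Q i ==> Q j"
  shows "run B (bsearch e tst) s (g*(kt + 30) + 20 + wcost e) (%s'. same_but {2..<14} s s' & s'$vlo <= N &
     (\<forall>j<s'$vlo. ~ Q j) & (s'$vlo < N --> Q (s'$vlo)))"
proof -
  \<comment> \<open>With \<open>n\<close> iterations left the interval is shorter than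
    \<open>2^n\<close>. This is why \<open>N < 2^g\<close> yields \<open>g\<close> rounds.\<close>
  let ?I = "%n s1. same_but {2..<14} s s1 & s1$vlo <= s1$vhi & s1$vhi <= N &
    s1$vhi - s1$vlo < 2^n &
    (\<forall>j<s1$vlo. ~ Q j) & (\<forall>j. s1$vhi <= j --> j < N --> Q j)"
  let ?body = "seqs [
       Set vmid (Div (Plus (V vlo) (V vhi)) (Const 2)), tst,
       Cond (Less (Const 0) (V vflag)) (Set vhi (V vmid)) (Set vlo (Plus (V vmid) (Const 1)))]"
  have init: "run B (seqs [Set vhi e, Set vlo (Const 0)]) s (10 + wcost e) (?I g)"
    by (rule run_loop_free) (use e in "auto simp: fun_eq_iff")
  have body: "run B ?body s1 (20 + kt) (?I n)" if I: "?I (Suc n) s1" and lt: "s1$vlo < s1$vhi" for s1 n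
  proof -
    let ?lo = "s1$vlo" and ?hi = "s1$vhi"
    let ?m = "(?lo + ?hi) div 2"
    have m: "?lo <= ?m" "?m < ?hi" using lt by auto
    have 1: "run B (Set vmid (Div (Plus (V vlo) (V vhi)) (Const 2))) s1 10 (%s2. s2 = store_word vmid 0 ?m s1)"
      by (rule run_loop_free) (use I e in auto)
    have 2: "run B tst s2 kt (%s3. same_but {2..<14} s s3 & s3$vlo = ?lo & s3$vhi = ?hi & s3$vmid = ?m &
        s3$vflag <= 1 & (s3$vflag = 1 \<longleftrightarrow> Q ?m))" if s2: "s2 = store_word vmid 0 ?m s1" for s2
    proof (rule run_mono[OF tst order_refl])
      show "?m < N" using m I by simp
      show "same_but {2..<14} s s2" using I s2 by (auto simp: words_other)
      show "s2$vmid = ?m" using s2 by simp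
    qed (use I s2 in "auto simp: words_other")
    have 3: "run B (Cond (Less (Const 0) (V vflag)) (Set vhi (V vmid)) (Set vlo (Plus (V vmid) (Const 1)))) s3 10 (?I n)"
      if s3: "same_but {2..<14} s s3 & s3$vlo = ?lo & s3$vhi = ?hi & s3$vmid = ?m &
        s3$vflag <= 1 & (s3$vflag = 1 \<longleftrightarrow> Q ?m)" for s3
    proof (cases "Q ?m")
      case True
      have "?m - ?lo < 2^n" using I lt by auto
      moreover have "\<forall>j. ?m <= j --> j < N --> Q j" using mono True by blast
      ultimately show ?thesis using s3 I m True e(4)
        by (intro run_loop_free) (auto simp: words_other)
    next
      case False
      have "?hi - Suc ?m < 2^n" using I lt by auto
      moreover have "\<forall>j<Suc ?m. ~ Q j"
      proof (intro allI impI notI)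
        fix j assume "j < Suc ?m" "Q j"
        moreover have "?m < N" using m I by linarith
        ultimately show False using mono[of j ?m] False by simp
      qed
      ultimately show ?thesis using s3 I m False e(4)
        by (intro run_loop_free) (auto simp: words_other)
    qed
    show ?thesis unfolding seqs.simps by (rule run_mono[OF run_SeqI[OF 1 run_SeqI[OF 2 3]]]) auto
  qed
  have l: "run B (While (Less (V vlo) (V vhi)) ?body) s1 (g*(5 + (20 + kt)) + 5) (%s'. same_but {2..<14} s s' & s'$vlo <= N &
     (\<forall>j<s'$vlo. ~ Q j) & (s'$vlo < N --> Q (s'$vlo)))" if I0: "?I g s1" for s1
    by (rule run_mono[OF run_loop[where I = ?I and k = "20 + kt", OF I0 _ _ body]]) (use e(4) in auto)
  show ?thesis unfolding bsearch_def seqs.simps(2,3)[of "seqs _"] seqs.simps(2,3)[of "While _ _"]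
    by (rule run_mono[OF run_SeqI[OF init l]]) (auto simp: algebra_simps)
qed

abbreviation (input) va1 :: nat where "va1 == 14"
abbreviation (input) va2 :: nat where "va2 == 15"
abbreviation (input) vt :: nat where "vt == 16"
abbreviation (input) vr :: nat where "vr == 17"
abbreviation (input) vnew :: nat where "vnew == 18"
abbreviation (input) vlr :: nat where "vlr == 19"
abbreviation (input) vuu :: nat where "vuu == 20"
abbreviation (input) vx :: nat where "vx == 21"
abbreviation (input) vhh :: nat where "vhh == 22"
abbreviation (input) vhr :: nat where "vhr == 24"
abbreviation (input) root :: "nat => nat" where "root b == b + 15"
abbreviation (input) nl :: "nat => nat" where "nl b == b + 17"

lemma same_ext: "same_but N s s' ==> N \<subseteq> {..<40} ==> 40 <= b ==> ext N b s s'"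
proof -
  assume s: "same_but N s s'" and N: "N \<subseteq> {..<40}" "40 <= b"
  have "b + c \<notin> N" for c using N by fastforce
  then show ?thesis using s unfolding ext_def by simp
qed

definition query :: "nat => wexp => wexp => com" where
  "query b e1 e2 = seqs [seqs [Set vu e1, Set vk e2], pred b]"

lemma query_run:
  assumes b: "40 <= b" and B: "s$fresh b + 2*H + 6 <= B" "2^H + 2 <= B"
    and U: "s$univ b = 2^H" and t: "tri s b H 0 (wval e1 s) S"
    and k: "wval e2 (store_word vu 0 (wval e1 s) s) = k" "k < 2^H"
    and f: "wfits B e1 s" "wfits B e2 (store_word vu 0 (wval e1 s) s)"
  shows "run B (query b e1 e2) s (50*H + 30 + wcost e1 + wcost e2)
    (%s'. same_but {2..<10} s s' & s'$vbest = upper {x \<in> S. x < k})"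
proof -
  let ?s = "store_word vk 0 k (store_word vu 0 (wval e1 s) s)"
  have 1: "run B (seqs [Set vu e1, Set vk e2]) s (10 + wcost e1 + wcost e2) (%s1. s1 = ?s)"
    by (rule run_loop_free) (use f k B in auto)
  have sm: "same_but {2..<10} s ?s" by (auto simp: words_other)
  have 2: "run B (pred b) s1 (50*H + 20) (%s'. same_but {2..<10} s s' & s'$vbest = upper {x \<in> S. x < k})"
    if "s1 = ?s" for s1
  proof (rule run_mono[OF pred_run[OF b, of s1 H B k S] order_refl])
    show "tri s1 b H 0 (s1$vu) S" using t b by (simp add: that words_other)
  qed (use that b B U k sm in "auto simp: words_other")
  show ?thesis unfolding query_def seqs.simps(2,3)[of "seqs _"] seqs.simps(2)[of "pred b"]
    by (rule run_mono[OF run_SeqI[OF 1 2]]) auto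
qed

definition rank_test :: "nat => com" where
  "rank_test b = seqs [query b (Cell (root b) (Plus (V vmid) (Const 1))) (V vkk),
     Cond (Conj (Less (Const 0) (V vbest)) (KeyLess b (Minus (V vbest) (Const 1)) b (V vkk)))
       (Set vflag (Const 0)) (Set vflag (Const 1))]"

definition val_test :: "nat => com" where
  "val_test b = seqs [query b (V vuu) (Plus (V vmid) (Const 1)),
     Cond (Conj (Less (Const 0) (V vbest)) (KeyLess b (Minus (V vbest) (Const 1)) b (V vx)))
       (Set vflag (Const 1)) (Set vflag (Const 0))]"

definition ge_test :: "nat => com" where
  "ge_test b = seqs [query b (V vuu) (Plus (V vmid) (Const 1)),
     Cond (Less (V vhh) (V vbest)) (Set vflag (Const 1)) (Set vflag (Const 0))]"

lemma upper_ge_iff: "finite S ==> h < upper {x \<in> S. x < k} \<longleftrightarrow> (\<exists>y\<in>S. h <= y & y < k)"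
proof -
  assume fin: "finite S"
  let ?W = "{x \<in> S. x < k}"
  have fW: "finite ?W" using fin by simp
  show ?thesis
  proof
    assume h: "h < upper ?W"
    then have "upper ?W - 1 \<in> ?W" using upper_in[OF fW] by auto
    then show "\<exists>y\<in>S. h <= y & y < k" using h by (intro bexI[of _ "upper ?W - 1"]) auto
  next
    assume "\<exists>y\<in>S. h <= y & y < k"
    then obtain y where "y \<in> ?W" "h <= y" by blast
    then show "h < upper ?W" using upper_ge[OF fW, of y] by linarith
  qed
qed

text \<open>On a decreasing level the last element before \<open>k\<close> has the least value of
  those before \<open>k\<close>, so one predecessor query and one comparison decide an existential
  statement.\<close>

lemma upper_less_iff:
  fixes f :: "nat => real"
  assumes fin: "finite S" and anti: "!!y z. y \<in> S ==> z \<in> S ==> y < z ==> f z <= f y"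
  shows "0 < upper {x \<in> S. x < k} & f (upper {x \<in> S. x < k} - 1) < c \<longleftrightarrow> (\<exists>y\<in>S. y < k & f y < c)"
proof -
  let ?W = "{x \<in> S. x < k}"
  have fW: "finite ?W" using fin by simp
  show ?thesis
  proof
    assume h: "0 < upper ?W & f (upper ?W - 1) < c"
    then have "upper ?W - 1 \<in> ?W" using upper_in[OF fW] by auto
    then show "\<exists>y\<in>S. y < k & f y < c" using h by blast
  next
    assume "\<exists>y\<in>S. y < k & f y < c"
    then obtain y where y: "y \<in> ?W" "f y < c" by blast
    then have l: "y < upper ?W" using upper_ge[OF fW, of y] by simp
    then have "upper ?W - 1 \<in> ?W" using upper_in[OF fW] by auto
    then have "f (upper ?W - 1) <= f y" using anti[of y "upper ?W - 1"] y l by (cases "y = upper ?W - 1") auto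
    then show "0 < upper ?W & f (upper ?W - 1) < c" using y l by auto
  qed
qed

text \<open>All keys lie below \<open>2^H - 1\<close>, so \<open>vmid + 1\<close> is always a
  legitimate query key. The result \<open>2^H - 1\<close> for an unsuccessful search is beyond all
  keys and still a valid place to splice.\<close>

lemma ge_search:
  assumes b: "40 <= b" and B: "s$fresh b + 2*H + 6 <= B" "2*2^H + 2 <= B"
    and U: "s$univ b = 2^H" and t: "tri s b H 0 (s$vuu) S" and S: "S \<subseteq> {..<2^H - 1}"
    and h: "s$vhh = h" "h <= 2^H"
  shows "run B (bsearch (Minus (V (univ b)) (Const 1)) (ge_test b)) s (200*(H + 1)^2) (%s'. same_but {2..<14} s s' &
    s'$vlo <= 2^H - 1 & (\<forall>y\<in>S. h <= y --> s'$vlo <= y) &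
    (s'$vlo < 2^H - 1 --> s'$vlo \<in> S & h <= s'$vlo))"
proof -
  define Q where "Q j \<longleftrightarrow> (\<exists>y\<in>S. h <= y & y <= j)" for j
  have fin: "finite S" using trie_props[OF t] by simp
  have up: "upper {x \<in> S. x < k} <= 2^H" for k
    using fin S by (intro upper_le) auto
  have N: "wval (Minus (V (univ b)) (Const 1)) s = 2^H - 1" using U by simp
  have tst: "run B (ge_test b) s1 (50*H + 60) (%s2. same_but ({2..<10} \<union> {vflag}) s1 s2 & s2$vflag <= 1 & (s2$vflag = 1 \<longleftrightarrow> Q m))"
    if m: "m < 2^H - 1" and sm: "same_but {2..<14} s s1" and v: "s1$vmid = m" for s1 m
  proof -
    have "tri s1 b = tri s b" by (rule same_tri[OF sm]) (use b in auto)
    then have "tri s1 b H 0 (wval (V vuu) s1) S" using t sm by simp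
    then have 1: "run B (query b (V vuu) (Plus (V vmid) (Const 1))) s1 (50*H + 40)
        (%s'. same_but {2..<10} s1 s' & s'$vbest = upper {x \<in> S. x < Suc m})"
      by (intro run_mono[OF query_run[OF b, of s1 H B _ S _ "Suc m"]])
        (use b B U sm m v trie_props[OF t] in auto)
    have 2: "run B (Cond (Less (V vhh) (V vbest)) (Set vflag (Const 1)) (Set vflag (Const 0))) s2 20
      (%s2. same_but ({2..<10} \<union> {vflag}) s1 s2 & s2$vflag <= 1 & (s2$vflag = 1 \<longleftrightarrow> Q m))"
      if s2: "same_but {2..<10} s1 s2 & s2$vbest = upper {x \<in> S. x < Suc m}" for s2
    proof -
      have "h < upper {x \<in> S. x < Suc m} \<longleftrightarrow> Q m" unfolding Q_def upper_ge_iff[OF fin] by (simp add: less_Suc_eq_le)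
      then show ?thesis using s2 sm h up[of "Suc m"] B
        by (intro run_loop_free) (auto simp: words_other)
    qed
    show ?thesis unfolding ge_test_def seqs.simps by (rule run_mono[OF run_SeqI[OF 1 2]]) auto
  qed
  have "run B (bsearch (Minus (V (univ b)) (Const 1)) (ge_test b)) s
    (H*((50*H + 60) + 30) + 20 + wcost (Minus (V (univ b)) (Const 1))) (%s'. same_but {2..<14} s s' & s'$vlo <= 2^H - 1 &
     (\<forall>j<s'$vlo. ~ Q j) & (s'$vlo < 2^H - 1 --> Q (s'$vlo)))"
  proof (rule bsearch_run[OF N _ _ _ tst])
    show "Q j" if "i <= j" "Q i" for i j using that le_trans unfolding Q_def by blast
  qed (use B U in auto)
  then show ?thesis
  proof (rule run_mono)
    show "H*((50*H + 60) + 30) + 20 + wcost (Minus (V (univ b)) (Const 1)) <= 200*(H + 1)^2"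
      by (simp add: power2_eq_square algebra_simps)
    fix s' assume s': "same_but {2..<14} s s' & s'$vlo <= 2^H - 1 &
     (\<forall>j<s'$vlo. ~ Q j) & (s'$vlo < 2^H - 1 --> Q (s'$vlo))"
    have "s'$vlo \<in> S & h <= s'$vlo" if lt: "s'$vlo < 2^H - 1"
    proof -
      obtain y where y: "y \<in> S" "h <= y" "y <= s'$vlo" using s' lt unfolding Q_def by blast
      moreover have "~ y < s'$vlo" using s' y unfolding Q_def by blast
      ultimately show ?thesis by auto
    qed
    moreover have "s'$vlo <= y" if "y \<in> S" "h <= y" for y
      using s' that unfolding Q_def by (meson not_le order_refl)
    ultimately show "same_but {2..<14} s s' &
    s'$vlo <= 2^H - 1 & (\<forall>y\<in>S. h <= y --> s'$vlo <= y) &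
    (s'$vlo < 2^H - 1 --> s'$vlo \<in> S & h <= s'$vlo)" using s' by blast
  qed
qed

text \<open>Since values decrease along \<open>S\<close>, the elements below a given value form a
  final segment; the search finds where it begins.\<close>

lemma val_search:
  assumes b: "40 <= b" and B: "s$fresh b + 2*H + 6 <= B" "2*2^H + 2 <= B"
    and U: "s$univ b = 2^H" and t: "tri s b H 0 (s$vuu) S" and S: "S \<subseteq> {..<2^H - 1}"
    and x: "s$vx = x" "x <= 2^H"
    and anti: "!!y z. y \<in> S ==> z \<in> S ==> y < z ==> keys s b z <= keys s b y"
  shows "run B (bsearch (Minus (V (univ b)) (Const 1)) (val_test b)) s (200*(H + 1)^2) (%s'. same_but {2..<14} s s' &
    s'$vlo <= 2^H - 1 & (\<forall>y\<in>S. s'$vlo <= y \<longleftrightarrow> keys s b y < keys s b x) &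
    (s'$vlo < 2^H - 1 --> (\<exists>z\<in>S. z <= s'$vlo & keys s b z < keys s b x)))"
proof -
  let ?f = "keys s b"
  define Q where "Q j \<longleftrightarrow> (\<exists>y\<in>S. y <= j & ?f y < ?f x)" for j
  have fin: "finite S" using trie_props[OF t] by simp
  have up: "upper {x \<in> S. x < k} <= 2^H" for k
    using fin S by (intro upper_le) auto
  have N: "wval (Minus (V (univ b)) (Const 1)) s = 2^H - 1" using U by simp
  have tst: "run B (val_test b) s1 (50*H + 60) (%s2. same_but ({2..<10} \<union> {vflag}) s1 s2 & s2$vflag <= 1 & (s2$vflag = 1 \<longleftrightarrow> Q m))"
    if m: "m < 2^H - 1" and sm: "same_but {2..<14} s s1" and v: "s1$vmid = m" for s1 m
  proof -
    have "tri s1 b = tri s b" by (rule same_tri[OF sm]) (use b in auto)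
    then have "tri s1 b H 0 (wval (V vuu) s1) S" using t sm by simp
    then have 1: "run B (query b (V vuu) (Plus (V vmid) (Const 1))) s1 (50*H + 40)
        (%s'. same_but {2..<10} s1 s' & s'$vbest = upper {x \<in> S. x < Suc m})"
      by (intro run_mono[OF query_run[OF b, of s1 H B _ S _ "Suc m"]])
        (use b B U sm m v trie_props[OF t] in auto)
    have 2: "run B (Cond (Conj (Less (Const 0) (V vbest)) (KeyLess b (Minus (V vbest) (Const 1)) b (V vx)))
       (Set vflag (Const 1)) (Set vflag (Const 0))) s2 20
      (%s2. same_but ({2..<10} \<union> {vflag}) s1 s2 & s2$vflag <= 1 & (s2$vflag = 1 \<longleftrightarrow> Q m))"
      if s2: "same_but {2..<10} s1 s2 & s2$vbest = upper {x \<in> S. x < Suc m}" for s2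
    proof -
      have "(0 < s2$vbest & keys s2 b (s2$vbest - 1) < keys s2 b (s2$vx)) \<longleftrightarrow> Q m"
        unfolding Q_def using upper_less_iff[where f = ?f and k = "Suc m" and c = "?f x", OF fin anti] s2 sm x
        by (simp add: less_Suc_eq_le)
      then show ?thesis using s2 sm x up[of "Suc m"] B
        by (intro run_loop_free) (auto simp: words_other)
    qed
    show ?thesis unfolding val_test_def seqs.simps by (rule run_mono[OF run_SeqI[OF 1 2]]) auto
  qed
  have "run B (bsearch (Minus (V (univ b)) (Const 1)) (val_test b)) s
    (H*((50*H + 60) + 30) + 20 + wcost (Minus (V (univ b)) (Const 1))) (%s'. same_but {2..<14} s s' & s'$vlo <= 2^H - 1 &
     (\<forall>j<s'$vlo. ~ Q j) & (s'$vlo < 2^H - 1 --> Q (s'$vlo)))"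
  proof (rule bsearch_run[OF N _ _ _ tst])
    show "Q j" if "i <= j" "Q i" for i j using that le_trans unfolding Q_def by blast
  qed (use B U in auto)
  then show ?thesis
  proof (rule run_mono)
    show "H*((50*H + 60) + 30) + 20 + wcost (Minus (V (univ b)) (Const 1)) <= 200*(H + 1)^2"
      by (simp add: power2_eq_square algebra_simps)
    fix s' assume s': "same_but {2..<14} s s' & s'$vlo <= 2^H - 1 &
     (\<forall>j<s'$vlo. ~ Q j) & (s'$vlo < 2^H - 1 --> Q (s'$vlo))"
    let ?l = "s'$vlo"
    have "?l <= y \<longleftrightarrow> ?f y < ?f x" if y: "y \<in> S" for y
    proof
      assume "?l <= y"
      then have "?l < 2^H - 1" using y S by auto
      then obtain z where z: "z \<in> S" "z <= ?l" "?f z < ?f x" using s' unfolding Q_def by blast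
      then have "?f y <= ?f z" using anti[of z y] y \<open>?l <= y\<close> by (cases "z = y") auto
      then show "?f y < ?f x" using z by simp
    next
      assume "?f y < ?f x"
      then show "?l <= y" using s' y unfolding Q_def by (meson not_le order_refl)
    qed
    then show "same_but {2..<14} s s' &
    ?l <= 2^H - 1 & (\<forall>y\<in>S. ?l <= y \<longleftrightarrow> ?f y < ?f x) &
    (?l < 2^H - 1 --> (\<exists>z\<in>S. z <= ?l & ?f z < ?f x))" using s' unfolding Q_def by blast
  qed
qed

section \<open>Levels stored as tries, and the rank of an element\<close>

text \<open>The levels \<open>1..n\<close> of \<open>g\<close>, without the elements \<open>T\<close>, are stored as tries.\<close>

definition lvls :: "state => nat => nat => nat set => (nat => nat) => nat => nat set => bool" where
  "lvls s b H A g n T \<longleftrightarrow> null_ok s b & s$univ b = 2^H & s$nl b = n &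
     A \<subseteq> {..<2^H - 1} &
     (\<forall>q. 1 <= q --> q <= n --> tri s b H 0 (words s (root b) q) {y \<in> A. y \<notin> T & g y = q})"

lemma lvls_ext:
  assumes "ext N b s s'" "N \<subseteq> {..<40}" "40 <= b" "lvls s b H A g n T" shows "lvls s' b H A g n T"
proof -
  have w: "words s' (univ b) = words s (univ b)" "words s' (nl b) = words s (nl b)" "words s' (root b) = words s (root b)"
  proof -
    have "b + c \<notin> N" for c using assms(2,3) by fastforce
    then show "words s' (univ b) = words s (univ b)" "words s' (nl b) = words s (nl b)" "words s' (root b) = words s (root b)"
      using assms(1) unfolding ext_def by simp_all
  qed
  show ?thesis using assms(4) ext_null[OF assms(1)] ext_tri[OF assms(1)] unfolding lvls_def w by blast
qed

lemma leveling_anti: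
  assumes "leveling A f g n" "y \<in> A" "z \<in> A" "y < z" "g y = g z" shows "f z <= f y"
proof (rule leI, rule notI)
  assume "f y < f z"
  then have "g y < g z" using assms unfolding leveling_def by blast
  then show False using assms by simp
qed

definition rank :: "nat => com" where
  "rank b = bsearch (V (nl b)) (rank_test b)"

text \<open>Index \<open>j\<close> is flagged if level \<open>Suc j\<close> has no element left of
  and below \<open>k\<close>. The least flagged index is the rank minus one.\<close>

lemma rank_run:
  assumes b: "40 <= b" and B: "s$fresh b + 2*H + 6 <= B" "2*2^H + 2 <= B"
    and l: "lvls s b H A g n {}" and L: "leveling A (keys s b) g n"
    and k: "s$vkk = k" "k < 2^H - 1"
  shows "run B (rank b) s (200*(H + 1)^2) (%s'. same_but {2..<14} s s' &
    s'$vlo <= n & rank_in A (keys s b) g k (Suc (s'$vlo)))"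
proof -
  let ?f = "keys s b"
  define P where "P q \<longleftrightarrow> (\<exists>y\<in>A. g y = q & y < k & ?f y < ?f k)" for q
  define Q where "Q j \<longleftrightarrow> ~ P (Suc j)" for j
  have U: "s$univ b = 2^H" and nlv: "s$nl b = n" and A: "A \<subseteq> {..<2^H - 1}"
    and tr: "!!q. 1 <= q ==> q <= n ==> tri s b H 0 (words s (root b) q) {y \<in> A. g y = q}"
    using l unfolding lvls_def by auto
  have fin: "finite A" using L by (simp add: leveling_def)
  have "n <= card A" using leveling_le_card[OF L] .
  also have "\<dots> <= card {..<(2::nat)^H - 1}" using A by (intro card_mono) auto
  finally have n: "n <= 2^H - 1" by simp
  have n2: "n < 2^H" using n by (metis Suc_diff_1 le_imp_less_Suc pos2 zero_less_power)
  have down: "P p" if "P q" "1 <= p" "p <= q" for p q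
    using that rank_downward[OF L] unfolding P_def by blast
  have up: "upper {x \<in> {y \<in> A. g y = q}. x < k} <= 2^H" for q
    using fin A by (intro upper_le) auto
  have tst: "run B (rank_test b) s1 (50*H + 60) (%s2. same_but ({2..<10} \<union> {vflag}) s1 s2 & s2$vflag <= 1 & (s2$vflag = 1 \<longleftrightarrow> Q m))"
    if m: "m < n" and sm: "same_but {2..<14} s s1" and v: "s1$vmid = m" for s1 m
  proof -
    let ?S = "{y \<in> A. g y = Suc m}"
    have "tri s1 b = tri s b" by (rule same_tri[OF sm]) (use b in auto)
    moreover have t: "tri s b H 0 (words s (root b) (Suc m)) ?S" using tr[of "Suc m"] m by simp
    ultimately have "tri s1 b H 0 (wval (Cell (root b) (Plus (V vmid) (Const 1))) s1) ?S"
      using b sm v by auto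
    then have 1: "run B (query b (Cell (root b) (Plus (V vmid) (Const 1))) (V vkk)) s1 (50*H + 40)
        (%s'. same_but {2..<10} s1 s' & s'$vbest = upper {x \<in> ?S. x < k})"
      by (intro run_mono[OF query_run[OF b, of s1 H B _ ?S _ k]])
        (use b B U sm m v n2 k trie_props[OF t] in auto)
    have 2: "run B (Cond (Conj (Less (Const 0) (V vbest)) (KeyLess b (Minus (V vbest) (Const 1)) b (V vkk)))
       (Set vflag (Const 0)) (Set vflag (Const 1))) s2 20
      (%s2. same_but ({2..<10} \<union> {vflag}) s1 s2 & s2$vflag <= 1 & (s2$vflag = 1 \<longleftrightarrow> Q m))"
      if s2: "same_but {2..<10} s1 s2 & s2$vbest = upper {x \<in> ?S. x < k}" for s2
    proof -
      have anti: "!!y z. y \<in> ?S ==> z \<in> ?S ==> y < z ==> ?f z <= ?f y"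
        using leveling_anti[OF L] by auto
      have "(0 < s2$vbest & keys s2 b (s2$vbest - 1) < keys s2 b (s2$vkk)) \<longleftrightarrow> ~ Q m"
        unfolding Q_def P_def using upper_less_iff[where f = ?f and S = ?S and k = k and c = "?f k", OF _ anti] fin s2 sm k by simp blast
      then show ?thesis using s2 sm k up[of "Suc m"] B
        by (intro run_loop_free) (auto simp: words_other)
    qed
    show ?thesis unfolding rank_test_def seqs.simps by (rule run_mono[OF run_SeqI[OF 1 2]]) auto
  qed
  have "run B (bsearch (V (nl b)) (rank_test b)) s
    (H*((50*H + 60) + 30) + 20 + wcost (V (nl b))) (%s'. same_but {2..<14} s s' & s'$vlo <= n &
     (\<forall>j<s'$vlo. ~ Q j) & (s'$vlo < n --> Q (s'$vlo)))"
  proof (rule bsearch_run[OF _ _ n2 _ tst])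
    show "Q j" if "i <= j" "j < n" "Q i" for i j
      using that down[of "Suc j" "Suc i"] unfolding Q_def by auto
  qed (use B nlv n2 in auto)
  then show ?thesis unfolding rank_def
  proof (rule run_mono)
    show "H*((50*H + 60) + 30) + 20 + wcost (V (nl b)) <= 200*(H + 1)^2"
      by (simp add: power2_eq_square algebra_simps)
    fix s' assume s': "same_but {2..<14} s s' & s'$vlo <= n &
     (\<forall>j<s'$vlo. ~ Q j) & (s'$vlo < n --> Q (s'$vlo))"
    have "P q \<longleftrightarrow> q < Suc (s'$vlo)" if "1 <= q" for q
    proof
      assume "P q"
      then have "q <= n" using L unfolding P_def leveling_def by auto
      show "q < Suc (s'$vlo)"
      proof (rule ccontr)
        assume "~ q < Suc (s'$vlo)"
        then have "Suc (s'$vlo) <= q" by simp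
        then have "P (Suc (s'$vlo))" "s'$vlo < n" using down[OF \<open>P q\<close>] \<open>q <= n\<close> by auto
        then show False using s' unfolding Q_def by blast
      qed
    next
      assume "q < Suc (s'$vlo)"
      then have "~ Q (q - 1)" using s' that by auto
      then show "P q" using that unfolding Q_def by simp
    qed
    then show "same_but {2..<14} s s' & s'$vlo <= n & rank_in A ?f g k (Suc (s'$vlo))"
      using s' unfolding rank_in_def P_def by simp
  qed
qed

text \<open>Replaces the keys in \<open>{va1..<va2}\<close> of the trie \<open>eu\<close> by those of the trie \<open>ev\<close>.\<close>

definition rng :: "nat => wexp => wexp => nat => com" where
  "rng b eu ev dst = seqs [seqs [Set vu eu, Set vv ev, Set vk (V va1)], upd b Skip,
     seqs [Set vu (V vv), Set vv eu, Set vk (V va2)], upd b Skip, Set dst (V vv)]"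

text \<open>The first splice switches from \<open>Su\<close> to \<open>Sv\<close> at
  \<open>lo\<close>, the second one back to \<open>Su\<close> at \<open>hi\<close>. As
  \<open>eu\<close> is evaluated again after the first splice, its value must not depend on the
  scratch arrays \<open>{2..<10}\<close>.\<close>

lemma rng_run:
  assumes b: "40 <= b" and B: "s$fresh b + 4*H + 10 <= B" "2^H + 2 <= B" and nu: "null_ok s b"
    and U: "s$univ b = 2^H"
    and e: "!!s'. ext {2..<10} b s s' ==> wval eu s' = x & wfits B eu s' & wval ev s' = y & wfits B ev s'"
    and c: "wcost eu <= 10" "wcost ev <= 10"
    and t: "tri s b H 0 x Su" "tri s b H 0 y Sv"
    and k: "s$va1 = lo" "s$va2 = hi" "lo < 2^H" "hi < 2^H"
    and dst: "10 <= dst" "dst < 40"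
  shows "run B (rng b eu ev dst) s (450*(H + 1)) (%s'. ext ({2..<10} \<union> {dst}) b s s' &
     s'$fresh b <= s$fresh b + 2*H + 2 &
     tri s' b H 0 (s'$dst) ((Su - {lo..<hi}) \<union> (Sv \<inter> {lo..<hi})))"
proof -
  let ?s1 = "store_word vk 0 lo (store_word vv 0 y (store_word vu 0 x s))"
  have ex: "ext {2..<10} b s (store_word a 0 w s)" if "a \<in> {2..<10}" for a w s
    using that b by (intro same_ext) (auto simp: words_other)
  have ex1: "ext {2..<10} b s (store_word a 0 w s')" if "ext {2..<10} b s s'" "a \<in> {2..<10}" for a w s'
    using ext_trans[OF that(1) ex[OF that(2)]] by blast
  have 1: "run B (seqs [Set vu eu, Set vv ev, Set vk (V va1)]) s 50 (%s'. s' = ?s1)"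
    using e[OF ext_refl] e[OF ex, of vu x] c k B
    by (intro run_loop_free) auto
  let ?S1 = "{z \<in> Su. z < lo} \<union> {z \<in> Sv. lo <= z}"
  have x1: "ext {2..<10} b s ?s1" by (intro ex1 ext_refl) auto
  have 2: "run B (upd b Skip) s1 (150*H + 50) (%s'. ext {2..<10} b s s' &
     s'$fresh b <= s$fresh b + H + 1 & tri s' b H 0 (s'$vv) ?S1)" if s1: "s1 = ?s1" for s1
  proof (rule run_mono[OF upd_splice[OF b, of s1 H B lo Su Sv] order_refl])
    show "null_ok s1 b" using ext_null[OF x1 nu] s1 by simp
    show "tri s1 b H 0 (s1$vu) Su" "tri s1 b H 0 (s1$vv) Sv"
      using ext_tri[OF x1 t(1)] ext_tri[OF x1 t(2)] by (simp_all add: s1)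
    fix s' assume "ext {2..<10} b s1 s' & s'$fresh b <= s1$fresh b + H + 1 & tri s' b H 0 (s'$vv) ?S1"
    then show "ext {2..<10} b s s' & s'$fresh b <= s$fresh b + H + 1 & tri s' b H 0 (s'$vv) ?S1"
      using ext_trans[OF x1, of "{2..<10}" s' "{2..<10}"] b s1 by auto
  qed (use s1 b B U k in "auto simp: words_other")
  have 3: "run B (seqs [Set vu (V vv), Set vv eu, Set vk (V va2)]) s2 50 (%s'. ext {2..<10} b s s' &
     s'$fresh b <= s$fresh b + H + 1 & tri s' b H 0 (s'$vu) ?S1 & s'$vv = x & s'$vk = hi)"
    if s2: "ext {2..<10} b s s2 & s2$fresh b <= s$fresh b + H + 1 & tri s2 b H 0 (s2$vv) ?S1" for s2
  proof -
    let ?s3 = "store_word vk 0 hi (store_word vv 0 x (store_word vu 0 (s2$vv) s2))"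
    have k2: "s2$va2 = hi" using s2 k b by (auto simp: ext_def)
    have "s2$vv < s2$fresh b" using s2 trie_props by blast
    then have "s2$vv <= B" using s2 B by auto
    moreover have "result (seqs [Set vu (V vv), Set vv eu, Set vk (V va2)]) s2 = ?s3"
      using e[OF ex1[of s2 vu "s2$vv"]] s2 k2 by simp
    moreover have "ext {2..<10} b s ?s3" using s2 by (intro ex1) auto
    moreover have "tri ?s3 b = tri s2 b" using b by (simp add: words_other)
    ultimately show ?thesis using s2 e[OF ex1[of s2 vu "s2$vv"]] c k k2 B b
      by (intro run_loop_free) (auto simp: words_other)
  qed
  let ?S2 = "{z \<in> ?S1. z < hi} \<union> {z \<in> Su. hi <= z}"
  have S2: "?S2 = (Su - {lo..<hi}) \<union> (Sv \<inter> {lo..<hi})" by auto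
  have 4: "run B (upd b Skip) s3 (150*H + 50) (%s'. ext {2..<10} b s s' &
     s'$fresh b <= s$fresh b + 2*H + 2 & tri s' b H 0 (s'$vv) ?S2)"
    if s3: "ext {2..<10} b s s3 &
     s3$fresh b <= s$fresh b + H + 1 & tri s3 b H 0 (s3$vu) ?S1 & s3$vv = x & s3$vk = hi" for s3
  proof (rule run_mono[OF upd_splice[OF b, of s3 H B hi ?S1 Su] order_refl])
    show "null_ok s3 b" using ext_null[OF _ nu] s3 by blast
    show "tri s3 b H 0 (s3$vu) ?S1" using s3 by simp
    show "tri s3 b H 0 (s3$vv) Su" using s3 ext_tri[OF _ t(1), of "{2..<10}" s3] by simp
    show "s3$univ b = 2^H" using s3 b U by (auto simp: ext_def)
    fix s' assume "ext {2..<10} b s3 s' & s'$fresh b <= s3$fresh b + H + 1 & tri s' b H 0 (s'$vv) ?S2"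
    then show "ext {2..<10} b s s' & s'$fresh b <= s$fresh b + 2*H + 2 & tri s' b H 0 (s'$vv) ?S2"
      using ext_trans[of "{2..<10}" b s s3 "{2..<10}" s' "{2..<10}"] b s3 by auto
  qed (use s3 B k in auto)
  have 5: "run B (Set dst (V vv)) s4 10 (%s'. ext ({2..<10} \<union> {dst}) b s s' &
     s'$fresh b <= s$fresh b + 2*H + 2 & tri s' b H 0 (s'$dst) ?S2)"
    if s4: "ext {2..<10} b s s4 &
     s4$fresh b <= s$fresh b + 2*H + 2 & tri s4 b H 0 (s4$vv) ?S2" for s4
  proof (rule run_loop_free)
    have "s4$vv < s4$fresh b" using s4 trie_props by blast
    then show "fits B (Set dst (V vv)) s4" using s4 B by simp
    have sm: "same_but {dst} s4 (store_word dst 0 (s4$vv) s4)" by (auto simp: words_other)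
    then have "ext {dst} b s4 (store_word dst 0 (s4$vv) s4)" by (rule same_ext) (use dst b in auto)
    then have "ext ({2..<10} \<union> {dst}) b s (store_word dst 0 (s4$vv) s4)"
      using s4 ext_trans[of "{2..<10}" b s s4 "{dst}" _ "{2..<10} \<union> {dst}"] by auto
    moreover have "tri (store_word dst 0 (s4$vv) s4) b = tri s4 b" by (rule same_tri[OF sm]) (use dst b in auto)
    ultimately show "ext ({2..<10} \<union> {dst}) b s (result (Set dst (V vv)) s4) &
     (result (Set dst (V vv)) s4)$fresh b <= s$fresh b + 2*H + 2 & 
     tri (result (Set dst (V vv)) s4) b H 0 ((result (Set dst (V vv)) s4)$dst) ?S2"
      using s4 dst b by simp
  qed simp_all
  show ?thesis
    unfolding rng_def seqs.simps(2,3)[of "seqs _"] seqs.simps(2,3)[of "upd _ _"] seqs.simps(2)[of "Set _ _"] S2[symmetric]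
    by (rule run_mono[OF run_SeqI[OF 1 run_SeqI[OF 2 run_SeqI[OF 3 run_SeqI[OF 4 5]]]]]) auto
qed

section \<open>Insertion cascade on the stored levels\<close>

text \<open>Searching from address 0 on yields \<open>Min T\<close> for \<open>va1\<close>;
  \<open>va2\<close> is where the values of level \<open>vr\<close> fall below that of
  \<open>Max T\<close>. Both new tries are made from the old ones: the level receives
  \<open>T\<close> in this window, and what it loses there becomes the next
  \<open>vt\<close>.\<close>

definition dins_body :: "nat => com" where
  "dins_body b = seqs [
     Cond (Less (V (nl b)) (V vr)) (seqs [Set (nl b) (V vr), Store (root b) (V vr) (Const 0)]) Skip,
     seqs [Set vx (Minus (Cell (aM b) (V vt)) (Const 1)), Set vuu (V vt), Set vhh (Const 0)],
     bsearch (Minus (V (univ b)) (Const 1)) (ge_test b),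
     seqs [Set va1 (V vlo), Set vuu (Cell (root b) (V vr))],
     bsearch (Minus (V (univ b)) (Const 1)) (val_test b),
     Set va2 (V vlo),
     rng b (Cell (root b) (V vr)) (V vt) vnew,
     rng b (Const 0) (Cell (root b) (V vr)) vt,
     seqs [Store (root b) (V vr) (V vnew), Set vr (Plus (V vr) (Const 1))]]"

text \<open>Inserts the key at address \<open>vkk\<close> into the levels.\<close>

definition dins :: "nat => com" where
  "dins b = seqs [rank b,
     seqs [Set vr (Plus (V vlo) (Const 1)), Set vu (Const 0), Set vv (Const 0), Set vk (V vkk)],
     upd b (set_leaf b), Set vt (V vv),
     While (Less (Const 0) (Cell (aM b) (V vt))) (dins_body b)]"

abbreviation (input) dmod :: "nat => nat set" where "dmod b == {2..<25} \<union> {root b, nl b}"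

lemma ext_step: "ext N b s s1 ==> ext M b s1 s2 ==> M \<subseteq> N ==> ext N b s s2"
  using ext_trans[of N b s s1 M s2 N] by blast

lemma ext_word: "ext N b s s' ==> a \<notin> N ==> a \<notin> {aL b, aR b, aM b, fresh b} ==> words s' a = words s a"
  by (simp add: ext_def)

lemma ext_keys: "ext N b s s' ==> keys s' = keys s"
  by (simp add: ext_def)

lemma ext_store: "a < 40 ==> 40 <= b ==> ext {a} b s (store_word a i w s)"
  by (rule same_ext) (auto simp: words_other)

lemma lvls_le:
  assumes L: "leveling A f g n" and "lvls s b H A g n {}" shows "n < 2^H"
proof -
  have "n <= card A" using leveling_le_card[OF L] .
  also have "\<dots> <= card {..<(2::nat)^H - 1}" using assms by (intro card_mono) (auto simp: lvls_def)
  finally have "n <= 2^H - 1" by simp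
  moreover have "(0::nat) < 2^H" by simp
  ultimately show ?thesis by linarith
qed

text \<open>An element of \<open>T\<close> has a predecessor on level \<open>r - 1\<close>, which
  lies outside \<open>T\<close>. Hence the cascade opens at most one new level.\<close>

lemma ins_inv_level:
  assumes I: "ins_inv A f g r T n" and ne: "T ~= {}" shows "r <= Suc n"
proof (cases "r = 1")
  case False
  obtain z where z: "z \<in> T" using ne by blast
  have p: "\<forall>z\<in>A. 1 < g z -->
       (\<exists>y\<in>A. y < z & f y < f z & Suc (g y) = g z & (r < g z --> y \<notin> T)) \<or>
       (z \<notin> T & g z = r & (\<exists>y\<in>T. y < z & f y < f z))"
    and r: "1 <= r" "\<forall>t\<in>T. g t = r" "T \<subseteq> A" "\<forall>y\<in>A - T. g y <= n"
    by (insert I[unfolded ins_inv_def], (elim conjE, assumption)+)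
  have "1 < g z" using r z False by auto
  then obtain y where y: "y \<in> A" "Suc (g y) = g z" using p z r(3) by blast
  then have "y \<notin> T" using r(2) z by auto
  then show ?thesis using y r(2,4) z by auto
qed simp

lemma ins_inv_order:
  assumes I: "ins_inv A f g r T n" and "y \<in> A" "z \<in> A" "y < z" "f y < f z" "y \<notin> T" shows "g y < g z"
proof -
  have "\<forall>y\<in>A. \<forall>z\<in>A. y < z --> f y < f z --> g y < g z \<or> (y \<in> T & z \<notin> T & g z = r)"
    by (insert I[unfolded ins_inv_def], (elim conjE, assumption)+)
  then show ?thesis using assms(2-6) by blast
qed

lemma run_seqs:
  "run B c s k1 P ==> (!!s1. P s1 ==> run B (seqs (d # cs)) s1 k2 Q) ==>
   run B (seqs (c # d # cs)) s (k1 + k2) Q"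
  by (simp add: run_SeqI)

lemma run_seqs1: "run B c s k Q ==> run B (seqs [c]) s k Q"
  by simp

lemma sq_ge: "H + 1 <= (H + 1)^2" for H :: nat
  by (simp add: power2_eq_square)

lemma dins_step:
  assumes b: "40 <= b" and B: "s$fresh b + 6*H + 20 <= B" "2*2^H + 4 <= B"
    and l: "lvls s b H A g n T" and I: "ins_inv A (keys s b) g r T n" and ne: "T ~= {}"
    and t: "tri s b H 0 (s$vt) T" and r: "s$vr = r" "r <= 2^H + 1" and n: "n <= 2^H"
    and T': "T' = {z \<in> A. z \<notin> T & g z = r & Min T <= z & ~ keys s b z < keys s b (Max T)}"
  shows "run B (dins_body b) s (1500*(H + 1)^2) (%s'. ext (dmod b) b s s' &
    s'$fresh b <= s$fresh b + (4*H + 4) &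
    lvls s' b H A (%y. if y \<in> T' then Suc r else g y) (max n r) T' &
    tri s' b H 0 (s'$vt) T' & s'$vr = Suc r)"
proof -
  let ?f = "keys s b"
  let ?Lr = "{y \<in> A. y \<notin> T & g y = r}"
  let ?fr = "s$fresh b"
  let ?N = "Minus (V (univ b)) (Const 1)"
  have A: "A \<subseteq> {..<2^H - 1}" and U: "s$univ b = 2^H" and nlv: "s$nl b = n" and nu: "null_ok s b"
    using l by (auto simp: lvls_def)
  have TA: "T \<subseteq> A" and r1: "1 <= r" and Tg: "!!z. z \<in> T ==> g z = r" and gn: "!!y. y \<in> A ==> y \<notin> T ==> g y <= n"
    using I unfolding ins_inv_def by auto
  have fT: "finite T" using trie_props[OF t] by simp
  have mT: "Min T \<in> T" "Max T \<in> T" using fT ne by auto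
  have mb: "Max T < 2^H - 1" "Min T < 2^H - 1" using mT TA A by auto
  have rn: "r <= Suc n" using ins_inv_level[OF I ne] .
  \<comment> \<open>What every phase before the final stores preserves; \<open>c\<close> bounds the
    nodes allocated so far.\<close>
  define K where "K c s1 \<longleftrightarrow> ext (dmod b) b s s1 & lvls s1 b H A g (max n r) T &
    tri s1 b H 0 (s1$vt) T & s1$vr = r & s1$fresh b <= ?fr + c" for c s1
  have Kext: "K (c + d) s2" if "K c s1" "ext M b s1 s2" "M \<subseteq> {2..<25} - {vt, vr}" "s2$fresh b <= s1$fresh b + d" for c d s1 s2 M
  proof -
    have "words s2 vt = words s1 vt" "words s2 vr = words s1 vr"
      using that(2,3) b by (auto intro!: ext_word[OF that(2)])
    moreover have "M \<subseteq> {..<40}" using that(3) by auto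
    moreover have "M \<subseteq> dmod b" using that(3) by blast
    ultimately show ?thesis using that b ext_step[of "dmod b" b s s1 M s2] lvls_ext[OF that(2)] ext_tri[OF that(2)]
      unfolding K_def by auto
  qed
  have Kst: "K c (store_word a i w s1)" if "K c s1" "a \<in> {2..<25} - {vt, vr}" for c a i w s1
    using Kext[of c s1 "{a}" _ 0] ext_store[of a b s1 i w] that b by auto
  have Kfacts: "s1$univ b = 2^H" "null_ok s1 b" "s1$fresh b <= ?fr + c" "keys s1 = keys s"
      "tri s1 b H 0 (s1$vt) T" "tri s1 b H 0 (words s1 (root b) r) ?Lr" "s1$vr = r"
      "s1$vt < s1$fresh b" "words s1 (root b) r < s1$fresh b"
      "words s1 (aM b) (s1$vt) = Suc (Max T)"
    if "K c s1" for c s1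
  proof -
    show a: "s1$univ b = 2^H" "null_ok s1 b" "s1$fresh b <= ?fr + c" "keys s1 = keys s"
      "tri s1 b H 0 (s1$vt) T" "tri s1 b H 0 (words s1 (root b) r) ?Lr" "s1$vr = r"
      using that r1 unfolding K_def lvls_def ext_def by auto
    show "s1$vt < s1$fresh b" "words s1 (root b) r < s1$fresh b"
      "words s1 (aM b) (s1$vt) = Suc (Max T)"
      using trie_props[OF a(5)] trie_props[OF a(6)] ne by (auto simp: upper_def)
  qed
  have anti: "!!y z. y \<in> ?Lr ==> z \<in> ?Lr ==> y < z ==> ?f z <= ?f y"
    using ins_inv_antichain[OF I] by (auto intro: less_imp_le)
  have 1: "run B (Cond (Less (V (nl b)) (V vr)) (seqs [Set (nl b) (V vr), Store (root b) (V vr) (Const 0)]) Skip) s 20 (K 0)"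
    (is "run B ?c s 20 _")
  proof (rule run_loop_free)
    show "fits B ?c s" using nlv r n B by auto
    let ?s = "result ?c s"
    have ex: "ext (dmod b) b s ?s" using b unfolding ext_def by (auto simp: words_other)
    have "lvls ?s b H A g (max n r) T" unfolding lvls_def
    proof (intro conjI allI impI)
      show "null_ok ?s b" using ext_null[OF ex nu] .
      show "?s$univ b = 2^H" "?s$nl b = max n r" using U nlv r b by auto
      fix q assume q: "1 <= q" "q <= max n r"
      show "tri ?s b H 0 (words ?s (root b) q) {y \<in> A. y \<notin> T & g y = q}"
      proof (cases "q <= n")
        case True
        then have "words ?s (root b) q = words s (root b) q" using nlv r b by auto
        then show ?thesis using l q True ext_tri[OF ex] unfolding lvls_def by simp
      next
        case False
        \<comment> \<open>Only a newly opened level \<open>r\<close> can exceed \<open>n\<close>.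
          The null node represents it, since no element outside \<open>T\<close> is above level
          \<open>n\<close>.\<close>
        then have "q = r" using q rn by auto
        then have "words ?s (root b) q = 0" using False nlv r b by auto
        moreover have "{y \<in> A. y \<notin> T & g y = q} = {}" using gn False by auto
        ultimately show ?thesis using tri_null[OF ext_null[OF ex nu]] by (simp only:)
      qed
    qed (use A in simp)
    moreover have "?s$fresh b = ?fr" "?s$vt = s$vt" "?s$vr = r" using r b by auto
    ultimately show "K 0 ?s" unfolding K_def using ex ext_tri[OF ex t] by simp
  qed simp_all
  have 2: "run B (seqs [Set vx (Minus (Cell (aM b) (V vt)) (Const 1)), Set vuu (V vt), Set vhh (Const 0)]) s1 30
    (%s2. K 0 s2 & s2$vx = Max T & s2$vuu = s2$vt & s2$vhh = 0)" if K1: "K 0 s1" for s1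
    by (rule run_loop_free) (use Kfacts[OF K1] mb B b in "auto intro!: Kst K1")
  have 3: "run B (bsearch ?N (ge_test b)) s2 (200*(H + 1)^2)
    (%s3. K 0 s3 & s3$vx = Max T & s3$vlo = Min T)"
    if K2: "K 0 s2 & s2$vx = Max T & s2$vuu = s2$vt & s2$vhh = 0" for s2
  proof (rule run_mono[OF ge_search[OF b, of s2 H B T 0] order_refl])
    note F = Kfacts[OF conjunct1[OF K2]]
    show "tri s2 b H 0 (s2$vuu) T" using F K2 by simp
    fix s' assume s': "same_but {2..<14} s2 s' & s'$vlo <= 2^H - 1 & (\<forall>y\<in>T. 0 <= y --> s'$vlo <= y) &
      (s'$vlo < 2^H - 1 --> s'$vlo \<in> T & 0 <= s'$vlo)"
    then have "s'$vlo <= Min T" using mT by auto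
    then have "s'$vlo \<in> T" using s' mb by auto
    then have "s'$vlo = Min T" using \<open>s'$vlo <= Min T\<close> fT by (metis Min_le antisym)
    moreover have "ext {2..<14} b s2 s'" by (rule same_ext[OF _ _ b]) (use s' in auto)
    then have "K (0 + 0) s'" by (rule Kext[OF conjunct1[OF K2]]) (use s' b in auto)
    ultimately show "K 0 s' & s'$vx = Max T & s'$vlo = Min T" using s' K2 by simp
  qed (use Kfacts[OF conjunct1[OF K2]] K2 TA A B in auto)
  have 4: "run B (seqs [Set va1 (V vlo), Set vuu (Cell (root b) (V vr))]) s3 20
    (%s4. K 0 s4 & s4$vx = Max T & s4$va1 = Min T & s4$vuu = words s4 (root b) r)"
    if K3: "K 0 s3 & s3$vx = Max T & s3$vlo = Min T" for s3
  proof -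
    note F = Kfacts[OF conjunct1[OF K3]]
    show ?thesis by (rule run_loop_free) (use F K3 mb r B b in "auto intro!: Kst")
  qed
  define hs where "hs hi \<longleftrightarrow> hi <= 2^H - 1 & (\<forall>y\<in>?Lr. hi <= y \<longleftrightarrow> ?f y < ?f (Max T)) &
    (hi < 2^H - 1 --> (\<exists>z\<in>?Lr. z <= hi & ?f z < ?f (Max T)))" for hi
  have 5: "run B (bsearch ?N (val_test b)) s4 (200*(H + 1)^2)
    (%s5. K 0 s5 & s5$va1 = Min T & hs (s5$vlo))"
    if K4: "K 0 s4 & s4$vx = Max T & s4$va1 = Min T & s4$vuu = words s4 (root b) r" for s4
  proof (rule run_mono[OF val_search[OF b, of s4 H B ?Lr "Max T"] order_refl])
    note F = Kfacts[OF conjunct1[OF K4]]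
    show "tri s4 b H 0 (s4$vuu) ?Lr" using F(6) K4 by simp
    show "keys s4 b z <= keys s4 b y" if "y \<in> ?Lr" "z \<in> ?Lr" "y < z" for y z
      using anti[OF that] F(4) by simp
    fix s' assume s': "same_but {2..<14} s4 s' & s'$vlo <= 2^H - 1 &
      (\<forall>y\<in>?Lr. s'$vlo <= y \<longleftrightarrow> keys s4 b y < keys s4 b (Max T)) &
      (s'$vlo < 2^H - 1 --> (\<exists>z\<in>?Lr. z <= s'$vlo & keys s4 b z < keys s4 b (Max T)))"
    then have "hs (s'$vlo)" unfolding hs_def using F(4) by simp
    moreover have "ext {2..<14} b s4 s'" by (rule same_ext[OF _ _ b]) (use s' in auto)
    then have "K (0 + 0) s'" by (rule Kext[OF conjunct1[OF K4]]) (use s' b in auto)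
    ultimately show "K 0 s' & s'$va1 = Min T & hs (s'$vlo)" using s' K4 by simp
  qed (use Kfacts[OF conjunct1[OF K4]] K4 mb A B in auto)
  have 6: "run B (Set va2 (V vlo)) s5 10 (%s6. K 0 s6 & s6$va1 = Min T & hs (s6$va2))"
    if K5: "K 0 s5 & s5$va1 = Min T & hs (s5$vlo)" for s5
  proof -
    have "s5$vlo <= B" using K5 B unfolding hs_def by auto
    then show ?thesis by (intro run_loop_free) (use K5 in "auto intro!: Kst")
  qed
  have hT: "T' = ?Lr \<inter> {Min T..<hi}" "T \<subseteq> {Min T..<hi}" "hi < 2^H" if hi: "hs hi" for hi
  proof -
    show "T' = ?Lr \<inter> {Min T..<hi}" using hi unfolding hs_def T' by (auto simp: not_le[symmetric])
    show "T \<subseteq> {Min T..<hi}"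
    proof
      fix x assume x: "x \<in> T"
      \<comment> \<open>The window covers all of \<open>T\<close>: if it ended at or before
        \<open>Max T\<close>, some element of level \<open>r\<close> would lie left of and below
        \<open>Max T\<close>, against the order condition.\<close>
      have "x < hi"
      proof (rule ccontr)
        assume n: "~ x < hi"
        then have "hi <= Max T" using fT x by (meson Max_ge le_trans not_less)
        then obtain z where z: "z \<in> ?Lr" "z <= hi" "?f z < ?f (Max T)" using hi mb unfolding hs_def by auto
        then have "z ~= Max T" using mT by auto
        then have "z < Max T" using z \<open>hi <= Max T\<close> by simp
        then have "g z < g (Max T)" using ins_inv_order[OF I, of z "Max T"] z mT TA by auto
        then show False using z Tg mT by simp
      qed
      then show "x \<in> {Min T..<hi}" using fT x by simp
    qed
    show "hi < 2^H" using hi unfolding hs_def by (metis diff_less less_le_trans not_less pos2 zero_less_one zero_less_power le_less_trans)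
  qed
  have 7: "run B (rng b (Cell (root b) (V vr)) (V vt) vnew) s6 (450*(H + 1))
    (%s7. K (2*H + 2) s7 & s7$va1 = Min T & hs (s7$va2) &
      tri s7 b H 0 (s7$vnew) ((?Lr - T') \<union> T))"
    if K6: "K 0 s6 & s6$va1 = Min T & hs (s6$va2)" for s6
  proof (rule run_mono[OF rng_run[OF b, of s6 H B, where Su = ?Lr and Sv = T and lo = "Min T" and hi = "s6$va2"
        and x = "words s6 (root b) r" and y = "s6$vt"] order_refl])
    note F = Kfacts[OF conjunct1[OF K6]]
    show "wval (Cell (root b) (V vr)) s' = words s6 (root b) r & wfits B (Cell (root b) (V vr)) s' &
      wval (V vt) s' = s6$vt & wfits B (V vt) s'" if e: "ext {2..<10} b s6 s'" for s'
    proof -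
      have "words s' (root b) = words s6 (root b)" "words s' vr = words s6 vr" "words s' vt = words s6 vt"
        using b by (auto intro!: ext_word[OF e])
      then show ?thesis using F r B by simp
    qed
    fix s7 assume s7: "ext ({2..<10} \<union> {vnew}) b s6 s7 & s7$fresh b <= s6$fresh b + 2*H + 2 &
      tri s7 b H 0 (s7$vnew) ((?Lr - {Min T..<s6$va2}) \<union> (T \<inter> {Min T..<s6$va2}))"
    have "(?Lr - {Min T..<s6$va2}) \<union> (T \<inter> {Min T..<s6$va2}) = (?Lr - T') \<union> T"
      using hT[of "s6$va2"] K6 by blast
    moreover have "K (0 + (2*H + 2)) s7" by (rule Kext[OF conjunct1[OF K6] conjunct1[OF s7]]) (use s7 in auto)
    moreover have "words s7 va1 = words s6 va1" "words s7 va2 = words s6 va2" using b by (auto intro!: ext_word[OF conjunct1[OF s7]])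
    ultimately show "K (2*H + 2) s7 & s7$va1 = Min T & hs (s7$va2) &
      tri s7 b H 0 (s7$vnew) ((?Lr - T') \<union> T)" using s7 K6 by simp
  qed (use Kfacts[OF conjunct1[OF K6]] K6 hT B mb in auto)
  have 8: "run B (rng b (Const 0) (Cell (root b) (V vr)) vt) s7 (450*(H + 1))
    (%s8. ext (dmod b) b s s8 & lvls s8 b H A g (max n r) T & s8$vr = r & s8$fresh b <= ?fr + (4*H + 4) &
      tri s8 b H 0 (s8$vnew) ((?Lr - T') \<union> T) & tri s8 b H 0 (s8$vt) T')"
    if K7: "K (2*H + 2) s7 & s7$va1 = Min T & hs (s7$va2) &
      tri s7 b H 0 (s7$vnew) ((?Lr - T') \<union> T)" for s7
  proof (rule run_mono[OF rng_run[OF b, of s7 H B, where Su = "{}" and Sv = ?Lr and lo = "Min T" and hi = "s7$va2"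
        and x = 0 and y = "words s7 (root b) r"] order_refl])
    note F = Kfacts[OF conjunct1[OF K7]]
    show "wval (Const 0) s' = 0 & wfits B (Const 0) s' &
      wval (Cell (root b) (V vr)) s' = words s7 (root b) r & wfits B (Cell (root b) (V vr)) s'" if e: "ext {2..<10} b s7 s'" for s'
    proof -
      have "words s' (root b) = words s7 (root b)" "words s' vr = words s7 vr"
        using b by (auto intro!: ext_word[OF e])
      then show ?thesis using F r B by simp
    qed
    show "tri s7 b H 0 0 {}" using tri_null F by blast
    fix s8 assume s8: "ext ({2..<10} \<union> {vt}) b s7 s8 & s8$fresh b <= s7$fresh b + 2*H + 2 &
      tri s8 b H 0 (s8$vt) (({} - {Min T..<s7$va2}) \<union> (?Lr \<inter> {Min T..<s7$va2}))"
    note e8 = conjunct1[OF s8]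
    have "({} - {Min T..<s7$va2}) \<union> (?Lr \<inter> {Min T..<s7$va2}) = T'"
      using hT[of "s7$va2"] K7 by blast
    moreover have "ext (dmod b) b s s8" using K7 unfolding K_def by (intro ext_step[OF _ e8]) auto
    moreover have "lvls s8 b H A g (max n r) T" using K7 unfolding K_def by (intro lvls_ext[OF e8 _ b]) auto
    moreover have "words s8 vr = words s7 vr" "words s8 vnew = words s7 vnew" using b by (auto intro!: ext_word[OF e8])
    moreover have "s8$fresh b <= ?fr + (4*H + 4)" using s8 F(3) by simp
    ultimately show "ext (dmod b) b s s8 & lvls s8 b H A g (max n r) T & s8$vr = r & s8$fresh b <= ?fr + (4*H + 4) &
      tri s8 b H 0 (s8$vnew) ((?Lr - T') \<union> T) & tri s8 b H 0 (s8$vt) T'"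
      using s8 K7 F ext_tri[OF e8, of H 0 "s7$vnew"] by simp
  qed (use Kfacts[OF conjunct1[OF K7]] K7 hT B mb in auto)
  have 9: "run B (seqs [Store (root b) (V vr) (V vnew), Set vr (Plus (V vr) (Const 1))]) s8 20
    (%s'. ext (dmod b) b s s' & s'$fresh b <= ?fr + (4*H + 4) &
      lvls s' b H A (%y. if y \<in> T' then Suc r else g y) (max n r) T' &
      tri s' b H 0 (s'$vt) T' & s'$vr = Suc r)"
    if K8: "ext (dmod b) b s s8 & lvls s8 b H A g (max n r) T & s8$vr = r & s8$fresh b <= ?fr + (4*H + 4) &
      tri s8 b H 0 (s8$vnew) ((?Lr - T') \<union> T) & tri s8 b H 0 (s8$vt) T'" for s8
  proof (rule run_loop_free)
    let ?c = "seqs [Store (root b) (V vr) (V vnew), Set vr (Plus (V vr) (Const 1))]"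
    let ?s = "result ?c s8"
    have "s8$vnew < s8$fresh b" using K8 trie_props by blast
    then have v: "s8$vnew <= B" using K8 B by linarith
    then show "fits B ?c s8" using K8 r B b by simp
    have ex8: "ext {root b, vr} b s8 ?s" using b unfolding ext_def by (auto simp: words_other)
    have ex: "ext (dmod b) b s ?s" using K8 by (intro ext_step[OF _ ex8]) auto
    have tr: "!!u S. tri s8 b H 0 u S ==> tri ?s b H 0 u S" using ext_tri[OF ex8] .
    have "lvls ?s b H A (%y. if y \<in> T' then Suc r else g y) (max n r) T'" unfolding lvls_def
    proof (intro conjI allI impI)
      show "null_ok ?s b" using ext_null[OF ex nu] .
      show "?s$univ b = 2^H" "?s$nl b = max n r" using K8 b by (auto simp: lvls_def)
      fix q assume q: "1 <= q" "q <= max n r"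
      let ?Q = "{y \<in> A. y \<notin> T' & (if y \<in> T' then Suc r else g y) = q}"
      show "tri ?s b H 0 (words ?s (root b) q) ?Q"
      proof (cases "q = r")
        case True
        have "?Q = (?Lr - T') \<union> T" using True Tg TA T' by auto
        moreover have "words ?s (root b) q = s8$vnew" using True K8 b by simp
        ultimately show ?thesis using tr K8 by simp
      next
        case False
        have "?Q = {y \<in> A. y \<notin> T & g y = q}" using False Tg T' by auto
        moreover have "words ?s (root b) q = words s8 (root b) q" using False K8 b by simp
        ultimately show ?thesis using tr K8 q unfolding lvls_def by simp
      qed
    qed (use A in simp)
    moreover have "?s$vt = s8$vt" "?s$vr = Suc r" "?s$fresh b = s8$fresh b" using K8 b by auto
    ultimately show "ext (dmod b) b s ?s & ?s$fresh b <= ?fr + (4*H + 4) &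
      lvls ?s b H A (%y. if y \<in> T' then Suc r else g y) (max n r) T' &
      tri ?s b H 0 (?s$vt) T' & ?s$vr = Suc r" using ex tr K8 by simp
  qed simp_all
  show ?thesis
    unfolding dins_body_def
    by (rule run_mono[OF run_seqs[OF 1 run_seqs[OF 2 run_seqs[OF 3 run_seqs[OF 4 run_seqs[OF 5 run_seqs[OF 6
        run_seqs[OF 7 run_seqs[OF 8 run_seqs1[OF 9]]]]]]]]]]) (use sq_ge[of H] in auto)
qed

text \<open>An element to the right of all others pushes nothing out, so one pass suffices; this is
  what makes appending polylogarithmic. In general the cascade visits at most the levels from the
  rank of \<open>k\<close> to \<open>n + 1\<close>.\<close>

lemma dins_run:
  assumes b: "40 <= b" and B: "s$fresh b + (n + 3)*(4*H + 4) + 20 <= B" "2*2^H + 4 <= B"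
    and l: "lvls s b H A g n {}" and L: "leveling A (keys s b) g n" and i: "inj_on (keys s b) (insert k A)"
    and k: "s$vkk = k" "k \<notin> A" "k < 2^H - 1"
    and c: "c = (if \<forall>y\<in>A. y < k then 1 else n + 1)"
  shows "run B (dins b) s ((c + 1)*(2000*(H + 1)^2)) (%s'. ext (dmod b) b s s' &
    s'$fresh b <= s$fresh b + (n + 2)*(4*H + 4) &
    (\<exists>g' n'. n' <= Suc n & lvls s' b H (insert k A) g' n' {} & leveling (insert k A) (keys s b) g' n'))"
proof -
  let ?f = "keys s b" and ?A = "insert k A" and ?fr = "s$fresh b"
  have n: "n < 2^H" using lvls_le[OF L l] .
  have A: "?A \<subseteq> {..<2^H - 1}" and U: "s$univ b = 2^H" and nu: "null_ok s b"
    using l k by (auto simp: lvls_def)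
  have frB: "?fr + 4*H + 24 <= B" "?fr + (n + 2)*(4*H + 4) + 4*H + 24 <= B" using B(1) by (auto simp: algebra_simps)
  define R where "R r s1 \<longleftrightarrow> ext (dmod b) b s s1 & s1$vr = r & r <= Suc n & rank_in A ?f g k r &
     lvls s1 b H A g n {}" for r s1
  have 2: "run B (seqs [Set vr (Plus (V vlo) (Const 1)), Set vu (Const 0), Set vv (Const 0), Set vk (V vkk)]) s1 30
    (%s2. (\<exists>r. R r s2) & s2$fresh b = ?fr & s2$vkk = k & s2$vk = k & s2$vu = 0 & s2$vv = 0)"
    if s1: "ext (dmod b) b s s1 & s1$fresh b = ?fr &
    s1$vkk = k & s1$vlo <= n & rank_in A ?f g k (Suc (s1$vlo)) & lvls s1 b H A g n {}" for s1
  proof (rule run_loop_free)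
    let ?c = "seqs [Set vr (Plus (V vlo) (Const 1)), Set vu (Const 0), Set vv (Const 0), Set vk (V vkk)]"
    let ?s = "result ?c s1"
    have sm: "same_but {vr, vu, vv, vk} s1 ?s" by (auto simp: words_other)
    have e: "ext {vr, vu, vv, vk} b s1 ?s" by (rule same_ext[OF sm _ b]) auto
    have "ext (dmod b) b s ?s" using ext_step[OF conjunct1[OF s1] e] by auto
    moreover have "lvls ?s b H A g n {}" by (rule lvls_ext[OF e _ b]) (use s1 in auto)
    ultimately have "R (Suc (s1$vlo)) ?s" unfolding R_def using s1 by simp
    then show "(\<exists>r. R r ?s) & ?s$fresh b = ?fr & ?s$vkk = k & ?s$vk = k & ?s$vu = 0 & ?s$vv = 0"
      using s1 b by auto
    have "k <= B" "n + 1 <= B" using k B n by auto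
    then show "fits B ?c s1" using s1 b by auto
  qed simp_all
  have 3: "run B (upd b (set_leaf b)) s2 (150*H + 50) (%s3. (\<exists>r. R r s3) & s3$fresh b <= ?fr + H + 1 & tri s3 b H 0 (s3$vv) {k})"
    if s2: "(\<exists>r. R r s2) & s2$fresh b = ?fr & s2$vkk = k & s2$vk = k & s2$vu = 0 & s2$vv = 0" for s2
  proof -
    obtain r where R: "R r s2" using s2 by blast
    then have nu2: "null_ok s2 b" and U2: "s2$univ b = 2^H" unfolding R_def lvls_def by blast+
    show ?thesis
    proof (rule run_mono[OF upd_insert[OF b, of s2 H B k "{}"] order_refl])
      fix s3 assume s3: "ext {2..<10} b s2 s3 & s3$fresh b <= s2$fresh b + H + 1 & tri s3 b H 0 (s3$vv) (insert k {})"
      note e = conjunct1[OF s3]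
      have "ext (dmod b) b s s3" using R unfolding R_def by (intro ext_step[OF _ e]) auto
      moreover have "lvls s3 b H A g n {}" by (rule lvls_ext[OF e _ b]) (use R in "auto simp: R_def")
      moreover have "words s3 vr = words s2 vr" using b by (intro ext_word[OF e]) auto
      ultimately have "R r s3" using R unfolding R_def by simp
      then show "(\<exists>r. R r s3) & s3$fresh b <= ?fr + H + 1 & tri s3 b H 0 (s3$vv) {k}" using s3 s2 by auto
    qed (use s2 nu2 U2 tri_null[OF nu2] frB B k in auto)
  qed
  let ?app = "\<forall>y\<in>A. y < k"
  \<comment> \<open>\<open>c0\<close> is the number of passes granted and \<open>m\<close> the
    number left. In general \<open>r + m = n + 2\<close> ties the passes to the level; when
    appending, \<open>T\<close> is still \<open>{k}\<close> or already empty.\<close>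
  define I where "I c0 m s1 \<longleftrightarrow> ext (dmod b) b s s1 & s1$fresh b + m*(4*H + 4) <= ?fr + c0*(4*H + 4) + H + 1 &
    (\<exists>g' T n' r. lvls s1 b H ?A g' n' T & ins_inv ?A ?f g' r T n' & tri s1 b H 0 (s1$vt) T &
      s1$vr = r & r <= n + 2 & n' <= max n (r - 1) & (T ~= {} --> r <= n + 1 & 1 <= m) &
      (if ?app then T = {} \<or> T = {k} else r + m = n + 2))" for c0 m s1
  have 4: "run B (Set vt (V vv)) s3 10 (%s4. \<exists>c0. 1 <= c0 & c0 <= c & I c0 c0 s4)"
    if s3: "(\<exists>r. R r s3) & s3$fresh b <= ?fr + H + 1 & tri s3 b H 0 (s3$vv) {k}" for s3
  proof -
    obtain r where R: "R r s3" using s3 by blast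
    let ?s = "store_word vt 0 (s3$vv) s3"
    have e: "ext {vt} b s3 ?s" by (rule ext_store) (use b in auto)
    have r: "1 <= r" "r <= n + 1" "rank_in A ?f g k r" using R unfolding R_def rank_in_def by auto
    define c0 where "c0 = (if ?app then 1 else n + 2 - r)"
    have c0: "1 <= c0" "c0 <= c" using c r by (auto simp: c0_def)
    have ls: "lvls ?s b H A g n {}" by (rule lvls_ext[OF e _ b]) (use R in "auto simp: R_def")
    have "{y \<in> ?A. y \<notin> {k} & (g(k := r)) y = q} = {y \<in> A. y \<notin> {} & g y = q}" for q using k by auto
    then have "lvls ?s b H ?A (g(k := r)) n {k}" using ls A unfolding lvls_def by simp
    moreover have "ins_inv ?A ?f (g(k := r)) r {k} n" using ins_inv_init[OF L i k(2) r(3)] .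
    moreover have "tri ?s b H 0 (?s$vt) {k}" using ext_tri[OF e] s3 by simp
    moreover have "?s$vr = r" using R b unfolding R_def by simp
    ultimately have ex: "\<exists>g' T n' r. lvls ?s b H ?A g' n' T & ins_inv ?A ?f g' r T n' & tri ?s b H 0 (?s$vt) T &
      ?s$vr = r & r <= n + 2 & n' <= max n (r - 1) & (T ~= {} --> r <= n + 1 & 1 <= c0) &
      (if ?app then T = {} \<or> T = {k} else r + c0 = n + 2)"
      using r c0 by - (rule exI[of _ "g(k := r)"], rule exI[of _ "{k}"], rule exI[of _ n], rule exI[of _ r], simp add: c0_def)
    moreover have "ext (dmod b) b s ?s" using R unfolding R_def by (intro ext_step[OF _ e]) auto
    moreover have "?s$fresh b + c0*(4*H + 4) <= ?fr + c0*(4*H + 4) + H + 1" using s3 b by simp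
    ultimately have "I c0 c0 ?s" unfolding I_def by blast
    moreover have "s3$vv <= B" using trie_props[of _ _ _ _ H 0 "s3$vv" "{k}"] s3 frB by fastforce
    ultimately show ?thesis using c0 by (intro run_loop_free) auto
  qed
  have cn: "c <= n + 1" using c by auto
  have 5: "run B (While (Less (Const 0) (Cell (aM b) (V vt))) (dins_body b)) s4 (c*(1510*(H + 1)^2) + 10)
    (%s'. ext (dmod b) b s s' & s'$fresh b <= s$fresh b + (n + 2)*(4*H + 4) &
    (\<exists>g' n'. n' <= Suc n & lvls s' b H ?A g' n' {} & leveling ?A ?f g' n'))"
    if s4: "\<exists>c0. 1 <= c0 & c0 <= c & I c0 c0 s4" for s4
  proof -
    obtain c0 where c0: "1 <= c0" "c0 <= c" and I0: "I c0 c0 s4" using s4 by blast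
    have c0': "c0*(4*H + 4) <= (n + 1)*(4*H + 4)" using c0 cn by (intro mult_le_mono1) simp
    have ex: "tfits B (Less (Const 0) (Cell (aM b) (V vt))) s1 & (m = 0 --> ~ tval (Less (Const 0) (Cell (aM b) (V vt))) s1) &
      (~ tval (Less (Const 0) (Cell (aM b) (V vt))) s1 --> ext (dmod b) b s s1 & s1$fresh b <= ?fr + (n + 2)*(4*H + 4) &
        (\<exists>g' n'. n' <= Suc n & lvls s1 b H ?A g' n' {} & leveling ?A ?f g' n'))" if Im: "I c0 m s1" for m s1
    proof -
      obtain g' T n' r where a: "lvls s1 b H ?A g' n' T" "ins_inv ?A ?f g' r T n'" "tri s1 b H 0 (s1$vt) T"
        "T ~= {} --> r <= n + 1 & 1 <= m" "r <= n + 2" "n' <= max n (r - 1)" using Im unfolding I_def by blast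
      note p = trie_props[OF a(3)]
      have "T \<subseteq> ?A" using a(2) unfolding ins_inv_def by blast
      then have "upper T <= 2^H" using A p by (intro upper_le) (auto simp: subset_iff)
      moreover have "s1$fresh b <= B" using Im c0' frB unfolding I_def by (auto simp: algebra_simps)
      ultimately have 1: "tfits B (Less (Const 0) (Cell (aM b) (V vt))) s1" using p B by auto
      have 2: "m = 0 --> ~ tval (Less (Const 0) (Cell (aM b) (V vt))) s1" using a(4) p by auto
      have 3: "ext (dmod b) b s s1 & s1$fresh b <= ?fr + (n + 2)*(4*H + 4) &
        (\<exists>g' n'. n' <= Suc n & lvls s1 b H ?A g' n' {} & leveling ?A ?f g' n')" if nt: "~ tval (Less (Const 0) (Cell (aM b) (V vt))) s1"
      proof -
        have T: "T = {}" using p nt by (auto simp: upper_eq_0)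
        have "leveling ?A ?f g' n'" using ins_inv_final a(2) unfolding T by blast
        moreover have "lvls s1 b H ?A g' n' {}" using a(1) unfolding T .
        moreover have "n' <= Suc n" using a(5,6) by auto
        moreover have "s1$fresh b <= ?fr + (n + 2)*(4*H + 4)" using Im c0' unfolding I_def by (auto simp: algebra_simps)
        ultimately show ?thesis using Im unfolding I_def by blast
      qed
      show ?thesis using 1 2 3 by blast
    qed
    have loop: "run B (While (Less (Const 0) (Cell (aM b) (V vt))) (dins_body b)) s4
       (c0*(tcost (Less (Const 0) (Cell (aM b) (V vt))) + 1500*(H + 1)^2) + tcost (Less (Const 0) (Cell (aM b) (V vt))))
       (%s'. ext (dmod b) b s s' & s'$fresh b <= s$fresh b + (n + 2)*(4*H + 4) &
    (\<exists>g' n'. n' <= Suc n & lvls s' b H ?A g' n' {} & leveling ?A ?f g' n'))"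
    proof (rule run_loop[where I = "I c0", OF I0])
      fix m s1 assume Im: "I c0 (Suc m) s1" and tv: "tval (Less (Const 0) (Cell (aM b) (V vt))) s1"
      then obtain g' T n' r where a: "lvls s1 b H ?A g' n' T" "ins_inv ?A ?f g' r T n'" "tri s1 b H 0 (s1$vt) T"
        "s1$vr = r" "T ~= {} --> r <= n + 1 & 1 <= Suc m" "r <= n + 2" "n' <= max n (r - 1)"
        "if ?app then T = {} \<or> T = {k} else r + Suc m = n + 2" unfolding I_def by blast
      have ex1: "ext (dmod b) b s s1" and fr1: "s1$fresh b + Suc m*(4*H + 4) <= ?fr + c0*(4*H + 4) + H + 1"
        using Im unfolding I_def by blast+
      note p = trie_props[OF a(3)]
      have ne: "T ~= {}" using tv p by auto
      then have r: "r <= n + 1" using a by blast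
      have kk: "keys s1 b = ?f" using ext_keys[OF ex1] by simp
      define T' where "T' = {z \<in> ?A. z \<notin> T & g' z = r & Min T <= z & ~ ?f z < ?f (Max T)}"
      let ?g = "%y. if y \<in> T' then Suc r else g' y"
      show "run B (dins_body b) s1 (1500*(H + 1)^2) (I c0 m)"
      proof (rule run_mono[OF dins_step[OF b _ B(2) a(1) _ ne a(3,4), where T' = T'] order_refl])
        show "s1$fresh b + 6*H + 20 <= B"
        proof -
          have "s1$fresh b + 4*H + 4 <= ?fr + (n + 1)*(4*H + 4) + H + 1" using fr1 c0' by (auto simp: algebra_simps)
          then show ?thesis using frB by (auto simp: algebra_simps)
        qed
        show "ins_inv ?A (keys s1 b) g' r T n'" using a(2) kk by simp
        show "r <= 2^H + 1" "n' <= 2^H" using r n a(7) by auto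
        show "T' = {z \<in> ?A. z \<notin> T & g' z = r & Min T <= z & ~ keys s1 b z < keys s1 b (Max T)}" unfolding T'_def kk ..
        fix s' assume s': "ext (dmod b) b s1 s' & s'$fresh b <= s1$fresh b + (4*H + 4) &
            lvls s' b H ?A ?g (max n' r) T' & tri s' b H 0 (s'$vt) T' & s'$vr = Suc r"
        have ii: "ins_inv ?A ?f ?g (Suc r) T' (max n' r)" using ins_inv_step[OF a(2) ne T'_def] .
        \<comment> \<open>A promoted element lay outside \<open>T\<close>, so its level
          \<open>r\<close> is at most \<open>n'\<close>, and therefore at most
          \<open>n\<close>.\<close>
        have T'n: "r <= n" if nee: "T' ~= {}"
        proof -
          obtain z where "z \<in> ?A - T" "g' z = r" using nee unfolding T'_def by blast
          moreover have "\<forall>y\<in>?A - T. g' y <= n'" by (insert a(2)[unfolded ins_inv_def], (elim conjE, assumption)+)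
          ultimately have "r <= n'" by blast
          moreover have "1 <= r" using a(2) unfolding ins_inv_def by blast
          ultimately show ?thesis using a(7) by (cases "n <= r - 1") auto
        qed
        have "T' ~= {} --> Suc r <= n + 1 & 1 <= m"
        proof
          assume nee: "T' ~= {}"
          have "~ ?app"
          \<comment> \<open>When appending, all other elements lie left of \<open>k\<close>, so none
            of them is promoted.\<close>
          proof
            assume ap: ?app
            then have "T = {k}" using a(8) ne by simp
            then show False using nee ap unfolding T'_def by auto
          qed
          then have "r + Suc m = n + 2" using a(8) by (simp only: if_False)
          then show "Suc r <= n + 1 & 1 <= m" using T'n[OF nee] by auto
        qed
        moreover have "if ?app then T' = {} \<or> T' = {k} else Suc r + m = n + 2"
        proof (cases ?app)
          case True
          then have "T = {k}" using a(8) ne by simp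
          then show ?thesis using True unfolding T'_def by auto
        next
          case False
          then show ?thesis using a(8) by (simp only: if_False)
        qed
        moreover have "max n' r <= max n (Suc r - 1)" using a(7) by auto
        ultimately have "\<exists>g' T n' r. lvls s' b H ?A g' n' T & ins_inv ?A ?f g' r T n' & tri s' b H 0 (s'$vt) T &
          s'$vr = r & r <= n + 2 & n' <= max n (r - 1) & (T ~= {} --> r <= n + 1 & 1 <= m) &
          (if ?app then T = {} \<or> T = {k} else r + m = n + 2)"
          using s' ii r by - (rule exI[of _ ?g], rule exI[of _ T'], rule exI[of _ "max n' r"], rule exI[of _ "Suc r"], simp)
        moreover have "ext (dmod b) b s s'" using ext_step[OF ex1 conjunct1[OF s']] by blast
        moreover have "s'$fresh b + m*(4*H + 4) <= ?fr + c0*(4*H + 4) + H + 1" using s' fr1 by simp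
        ultimately show "I c0 m s'" unfolding I_def by blast
      qed
    qed (use ex in blast)+
    show ?thesis
    proof (rule run_mono[OF loop])
      have "c0*(5 + 1500*(H + 1)^2) <= c*(1510*(H + 1)^2)" using c0 by (intro mult_le_mono) auto
      then show "c0*(tcost (Less (Const 0) (Cell (aM b) (V vt))) + 1500*(H + 1)^2) + tcost (Less (Const 0) (Cell (aM b) (V vt)))
         <= c*(1510*(H + 1)^2) + 10" by (simp add: algebra_simps)
    qed
  qed
  have 1: "run B (rank b) s (200*(H + 1)^2) (%s'. ext (dmod b) b s s' & s'$fresh b = ?fr &
    s'$vkk = k & s'$vlo <= n & rank_in A ?f g k (Suc (s'$vlo)) & lvls s' b H A g n {})"
  proof (rule run_mono[OF rank_run[OF b _ _ l L k(1,3)] order_refl])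
    fix s' assume s': "same_but {2..<14} s s' & s'$vlo <= n & rank_in A ?f g k (Suc (s'$vlo))"
    have e: "ext {2..<14} b s s'" by (rule same_ext[OF _ _ b]) (use s' in auto)
    have "ext (dmod b) b s s'" by (rule ext_step[OF ext_refl e]) auto
    moreover have "lvls s' b H A g n {}" by (rule lvls_ext[OF e _ b l]) auto
    ultimately show "ext (dmod b) b s s' & s'$fresh b = ?fr &
    s'$vkk = k & s'$vlo <= n & rank_in A ?f g k (Suc (s'$vlo)) & lvls s' b H A g n {}" using s' b k by auto
  qed (use frB B in auto)
  have tm: "200*(H + 1)^2 + (30 + ((150*H + 50) + (10 + (c*(1510*(H + 1)^2) + 10)))) <= (c + 1)*(2000*(H + 1)^2)"
  proof -
    have "c*(1510*(H + 1)^2) <= c*(2000*(H + 1)^2)" by simp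
    then show ?thesis using sq_ge[of H] by (simp add: add_mult_distrib)
  qed
  show ?thesis unfolding dins_def
    by (rule run_mono[OF run_seqs[OF 1 run_seqs[OF 2 run_seqs[OF 3 run_seqs[OF 4 run_seqs1[OF 5]]]]] tm])
qed

section \<open>Deletion cascade on the stored levels\<close>

text \<open>The right end \<open>va2\<close> of the orphans is the first element of level
  \<open>vr\<close> beyond the gap. The left end \<open>va1\<close> is where the next level falls
  below the value of the last element before the gap, or 0 if there is no such element. The two ends
  delimit the gap one level higher.\<close>

definition ddel_body :: "nat => com" where
  "ddel_body b = seqs [
     seqs [Set vuu (Cell (root b) (V vr)), Set vhh (V vhr)],
     bsearch (Minus (V (univ b)) (Const 1)) (ge_test b),
     Set va2 (V vlo),
     query b (Cell (root b) (V vr)) (V vlr),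
     Cond (Less (V vbest) (Const 1)) (Set va1 (Const 0))
       (seqs [seqs [Set vx (Minus (V vbest) (Const 1)), Set vuu (Cell (root b) (Plus (V vr) (Const 1)))],
          bsearch (Minus (V (univ b)) (Const 1)) (val_test b), Set va1 (V vlo)]),
     rng b (Cell (root b) (V vr)) (Cell (root b) (Plus (V vr) (Const 1))) vnew,
     rng b (Cell (root b) (Plus (V vr) (Const 1))) (Const 0) vt,
     seqs [Store (root b) (V vr) (V vnew), Set vr (Plus (V vr) (Const 1)), Store (root b) (V vr) (V vt),
       Set vlr (V va1), Set vhr (V va2)]]"

lemma del_inv_order:
  assumes I: "del_inv A f g r lo hi n" and "y \<in> A" "z \<in> A" "y < z" "f y < f z" shows "g y < g z"
proof -
  have "\<forall>y\<in>A. \<forall>z\<in>A. y < z --> f y < f z --> g y < g z"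
    by (insert I[unfolded del_inv_def], (elim conjE, assumption)+)
  then show ?thesis using assms(2-5) by blast
qed

lemma del_inv_gap: "del_inv A f g r lo hi n ==> y \<in> A ==> g y = r ==> y < lo \<or> hi <= y"
proof -
  assume I: "del_inv A f g r lo hi n" and y: "y \<in> A" "g y = r"
  have "\<forall>y\<in>A. g y = r --> y < lo \<or> hi <= y"
    by (insert I[unfolded del_inv_def], (elim conjE, assumption)+)
  then show ?thesis using y by blast
qed

lemma ddel_step:
  assumes b: "40 <= b" and B: "s$fresh b + 6*H + 20 <= B" "2*2^H + 4 <= B"
    and l: "lvls s b H A g n {}" and I: "del_inv A (keys s b) g r lo hi n" and rn: "r < n" and n: "n < 2^H"
    and r: "s$vr = r" and lo: "s$vlr = lo" "lo < 2^H" and hi: "s$vhr = hi" "hi < 2^H"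
  shows "run B (ddel_body b) s (1500*(H + 1)^2) (%s'. ext (dmod b) b s s' &
    s'$fresh b <= s$fresh b + (4*H + 4) & s'$vr = Suc r &
    s'$vlr < 2^H & s'$vhr < 2^H &
    (\<exists>g'. lvls s' b H A g' n {} & del_inv A (keys s b) g' (Suc r) (s'$vlr) (s'$vhr) n))"
proof -
  let ?f = "keys s b"
  let ?L = "%q. {y \<in> A. g y = q}"
  let ?fr = "s$fresh b"
  let ?N = "Minus (V (univ b)) (Const 1)"
  have A: "A \<subseteq> {..<2^H - 1}" and U: "s$univ b = 2^H" and nlv: "s$nl b = n" and nu: "null_ok s b"
    using l by (auto simp: lvls_def)
  have r1: "1 <= r" and fA: "finite A" using I unfolding del_inv_def by blast+
  define P where "P = {a \<in> A. g a = r & a < lo}"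
  define C where "C = {a \<in> A. g a = r & hi <= a}"
  have fP: "finite P" "finite C" using fA by (auto simp: P_def C_def)
  have PL: "P = {x \<in> ?L r. x < lo}" by (auto simp: P_def)
  define K where "K c s1 \<longleftrightarrow> ext (dmod b) b s s1 & lvls s1 b H A g n {} &
    s1$vr = r & s1$vlr = lo & s1$vhr = hi & s1$fresh b <= ?fr + c" for c s1
  have Kext: "K (c + d) s2" if k1: "K c s1" and e: "ext M b s1 s2" and M: "M \<subseteq> {2..<25} - {vlr, vhr, vr}" and
    d: "s2$fresh b <= s1$fresh b + d" for c d s1 s2 M
  proof -
    have "words s2 vlr = words s1 vlr" "words s2 vhr = words s1 vhr" "words s2 vr = words s1 vr"
      using M b by (auto intro!: ext_word[OF e])
    moreover have "lvls s2 b H A g n {}" by (rule lvls_ext[OF e _ b]) (use M k1 in "auto simp: K_def")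
    moreover have "ext (dmod b) b s s2" using k1 unfolding K_def by (intro ext_step[OF _ e]) (use M in auto)
    ultimately show ?thesis using k1 d unfolding K_def by auto
  qed
  have Kst: "K c (store_word a i w s1)" if "K c s1" "a \<in> {2..<25} - {vlr, vhr, vr}" for c a i w s1
    using Kext[of c s1 "{a}" _ 0] ext_store[of a b s1 i w] that b by auto
  have Kfacts: "s1$univ b = 2^H" "null_ok s1 b" "s1$fresh b <= ?fr + c" "keys s1 = keys s"
      "tri s1 b H 0 (words s1 (root b) r) (?L r)" "tri s1 b H 0 (words s1 (root b) (Suc r)) (?L (Suc r))"
      "s1$vr = r" "s1$vlr = lo" "s1$vhr = hi"
      "words s1 (root b) r < s1$fresh b" "words s1 (root b) (Suc r) < s1$fresh b"
    if "K c s1" for c s1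
  proof -
    show a: "s1$univ b = 2^H" "null_ok s1 b" "s1$fresh b <= ?fr + c" "keys s1 = keys s"
      "tri s1 b H 0 (words s1 (root b) r) (?L r)" "tri s1 b H 0 (words s1 (root b) (Suc r)) (?L (Suc r))"
      "s1$vr = r" "s1$vlr = lo" "s1$vhr = hi"
      using that r1 rn unfolding K_def lvls_def ext_def by auto
    show "words s1 (root b) r < s1$fresh b" "words s1 (root b) (Suc r) < s1$fresh b"
      using trie_props[OF a(5)] trie_props[OF a(6)] by auto
  qed
  have anti: "!!y z q. y \<in> ?L q ==> z \<in> ?L q ==> y < z ==> ?f z <= ?f y"
    using del_inv_antichain[OF I] by (auto intro: less_imp_le)
  have K0: "K 0 s" unfolding K_def using l r lo hi by (simp add: ext_refl)
  have 1: "run B (seqs [Set vuu (Cell (root b) (V vr)), Set vhh (V vhr)]) s 20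
    (%s2. K 0 s2 & s2$vuu = words s2 (root b) r & s2$vhh = hi)"
    by (rule run_loop_free) (use Kfacts[OF K0] hi rn n B b in "auto intro!: Kst K0")
  \<comment> \<open>If nothing lies right of the gap, the search ends at \<open>2^H - 1\<close>,
    beyond all addresses.\<close>
  define hs where "hs h \<longleftrightarrow> h < 2^H & (C ~= {} --> h = Min C) & (C = {} --> (\<forall>z\<in>A. z < h))" for h
  have 2: "run B (bsearch ?N (ge_test b)) s2 (200*(H + 1)^2) (%s3. K 0 s3 & hs (s3$vlo))"
    if K2: "K 0 s2 & s2$vuu = words s2 (root b) r & s2$vhh = hi" for s2
  proof (rule run_mono[OF ge_search[OF b, of s2 H B "?L r" hi] order_refl])
    note F = Kfacts[OF conjunct1[OF K2]]
    show "tri s2 b H 0 (s2$vuu) (?L r)" using F K2 by simp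
    fix s' assume s': "same_but {2..<14} s2 s' & s'$vlo <= 2^H - 1 & (\<forall>y\<in>?L r. hi <= y --> s'$vlo <= y) &
      (s'$vlo < 2^H - 1 --> s'$vlo \<in> ?L r & hi <= s'$vlo)"
    let ?h = "s'$vlo"
    have "(2::nat)^H > 0" by simp
    then have hH: "?h < 2^H" using s' by linarith
    have hC: "?h < 2^H - 1 --> ?h \<in> C" "\<forall>y\<in>C. ?h <= y" using s' by (auto simp: C_def)
    have "?h = Min C" if ne: "C ~= {}"
    proof -
      have m: "Min C \<in> C" using fP ne by simp
      then have "?h <= Min C" "Min C < 2^H - 1" using hC A by (auto simp: C_def)
      then have "?h \<in> C" using hC by auto
      then show ?thesis using \<open>?h <= Min C\<close> fP by (metis Min_le antisym)
    qed
    moreover have "\<forall>z\<in>A. z < ?h" if "C = {}"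
    proof -
      have "?h = 2^H - 1" using hC that s' by auto
      then show ?thesis using A by auto
    qed
    ultimately have "hs ?h" using hH unfolding hs_def by blast
    moreover have e: "ext {2..<14} b s2 s'" by (rule same_ext[OF _ _ b]) (use s' in auto)
    have "K (0 + 0) s'" by (rule Kext[OF conjunct1[OF K2] e]) (use s' b in auto)
    ultimately show "K 0 s' & hs (s'$vlo)" by simp
  qed (use Kfacts[OF conjunct1[OF K2]] K2 hi A B in auto)
  have 3: "run B (Set va2 (V vlo)) s3 10 (%s4. K 0 s4 & hs (s4$va2))"
    if K3: "K 0 s3 & hs (s3$vlo)" for s3
  proof -
    have "s3$vlo <= B" using K3 B unfolding hs_def by auto
    then show ?thesis by (intro run_loop_free) (use K3 in "auto intro!: Kst")
  qed
  have 4: "run B (query b (Cell (root b) (V vr)) (V vlr)) s4 (50*H + 40)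
      (%s5. K 0 s5 & hs (s5$va2) & s5$vbest = upper P)" if K4: "K 0 s4 & hs (s4$va2)" for s4
  proof (rule run_mono[OF query_run[OF b, of s4 H B _ "?L r" _ lo]])
    note F = Kfacts[OF conjunct1[OF K4]]
    show "tri s4 b H 0 (wval (Cell (root b) (V vr)) s4) (?L r)" using F by simp
    fix s' assume s': "same_but {2..<10} s4 s' & s'$vbest = upper {x \<in> ?L r. x < lo}"
    have e: "ext {2..<10} b s4 s'" by (rule same_ext[OF _ _ b]) (use s' in auto)
    have "K (0 + 0) s'" by (rule Kext[OF conjunct1[OF K4] e]) (use s' b in auto)
    then show "K 0 s' & hs (s'$va2) & s'$vbest = upper P" using s' K4 PL by simp
  qed (use Kfacts[OF conjunct1[OF K4]] lo B b rn n in auto)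
  \<comment> \<open>The last clause keeps the elements left of the gap out of the window, so that
    splicing the orphans into level \<open>r\<close> discards nothing.\<close>
  define ls where "ls h \<longleftrightarrow> h < 2^H & (\<forall>z\<in>?L (Suc r). h <= z \<longleftrightarrow> P = {} \<or> ?f z < ?f (Max P)) & (\<forall>a\<in>P. a < h)" for h
  have 5: "run B (Cond (Less (V vbest) (Const 1)) (Set va1 (Const 0))
       (seqs [seqs [Set vx (Minus (V vbest) (Const 1)), Set vuu (Cell (root b) (Plus (V vr) (Const 1)))],
          bsearch ?N (val_test b), Set va1 (V vlo)])) s5 (4 + (20 + (200*(H + 1)^2 + 10)))
       (%s6. K 0 s6 & hs (s6$va2) & ls (s6$va1))"
    if K5: "K 0 s5 & hs (s5$va2) & s5$vbest = upper P" for s5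
  proof -
    note F = Kfacts[OF conjunct1[OF K5]]
    have uP: "upper P <= 2^H" using fP A by (intro upper_le) (auto simp: P_def)
    show ?thesis
    proof (rule run_mono[OF run_Cond])
      show "tfits B (Less (V vbest) (Const 1)) s5" using uP K5 B by simp
      show "run B (Set va1 (Const 0)) s5 (20 + (200*(H + 1)^2 + 10)) (%s6. K 0 s6 & hs (s6$va2) & ls (s6$va1))"
        if tv: "tval (Less (V vbest) (Const 1)) s5"
      proof (rule run_loop_free)
        have "P = {}" using tv K5 by (simp add: upper_eq_0)
        then have "ls 0" unfolding ls_def by simp
        then show "K 0 (result (Set va1 (Const 0)) s5) & hs ((result (Set va1 (Const 0)) s5)$va2) &
           ls ((result (Set va1 (Const 0)) s5)$va1)" using K5 by (auto intro!: Kst)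
      qed (use B in auto)
      assume "~ tval (Less (V vbest) (Const 1)) s5"
      then have ne: "P ~= {}" using K5 by (auto simp: upper_eq_0)
      then have mP: "Max P \<in> P" "upper P = Suc (Max P)" using fP by (auto simp: upper_def)
      have a: "run B (seqs [Set vx (Minus (V vbest) (Const 1)), Set vuu (Cell (root b) (Plus (V vr) (Const 1)))]) s5 20
        (%s6. K 0 s6 & hs (s6$va2) & s6$vx = Max P & s6$vuu = words s6 (root b) (Suc r))"
        by (rule run_loop_free) (use F K5 mP uP rn n B b in "auto intro!: Kst")
      have bb: "run B (bsearch ?N (val_test b)) s6 (200*(H + 1)^2) (%s7. K 0 s7 & hs (s7$va2) & ls (s7$vlo))"
        if K6: "K 0 s6 & hs (s6$va2) & s6$vx = Max P & s6$vuu = words s6 (root b) (Suc r)" for s6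
      proof (rule run_mono[OF val_search[OF b, of s6 H B "?L (Suc r)" "Max P"] order_refl])
        note G = Kfacts[OF conjunct1[OF K6]]
        show "tri s6 b H 0 (s6$vuu) (?L (Suc r))" using G K6 by simp
        show "keys s6 b z <= keys s6 b y" if "y \<in> ?L (Suc r)" "z \<in> ?L (Suc r)" "y < z" for y z
          using anti[OF that] G(4) by simp
        show "s6$vx = Max P" "Max P <= 2^H" using K6 mP A by (auto simp: P_def)
        fix s' assume s': "same_but {2..<14} s6 s' & s'$vlo <= 2^H - 1 &
          (\<forall>y\<in>?L (Suc r). s'$vlo <= y \<longleftrightarrow> keys s6 b y < keys s6 b (Max P)) &
          (s'$vlo < 2^H - 1 --> (\<exists>z\<in>?L (Suc r). z <= s'$vlo & keys s6 b z < keys s6 b (Max P)))"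
        let ?h = "s'$vlo"
        have "(2::nat)^H > 0" by simp
        then have hH: "?h < 2^H" using s' by linarith
        \<comment> \<open>Otherwise an element of level \<open>Suc r\<close> would lie left of and
          below \<open>Max P\<close>, which is on level \<open>r\<close>.\<close>
        have "\<forall>a\<in>P. a < ?h"
        proof (intro ballI, rule ccontr)
          fix a assume a: "a \<in> P" "~ a < ?h"
          then have le: "?h <= Max P" using fP by (meson Max_ge le_trans not_less)
          have "Max P < 2^H - 1" using mP A by (auto simp: P_def)
          then obtain z where z: "z \<in> ?L (Suc r)" "z <= ?h" "?f z < ?f (Max P)" using s' le G(4) by auto
          have mPA: "Max P \<in> A" "g (Max P) = r" using mP by (auto simp: P_def)
          then have "z ~= Max P" using z by auto
          then have "z < Max P" using z le by simp
          then have "g z < g (Max P)" by (intro del_inv_order[OF I]) (use z mPA in auto)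
          then show False using z mPA by simp
        qed
        then have "ls ?h" using s' hH ne G(4) unfolding ls_def by simp
        moreover have e: "ext {2..<14} b s6 s'" by (rule same_ext[OF _ _ b]) (use s' in auto)
        have "K (0 + 0) s'" by (rule Kext[OF conjunct1[OF K6] e]) (use s' b in auto)
        ultimately show "K 0 s' & hs (s'$va2) & ls ?h" using s' K6 by simp
      qed (use Kfacts[OF conjunct1[OF K6]] A B in auto)
      have cc: "run B (Set va1 (V vlo)) s7 10 (%s8. K 0 s8 & hs (s8$va2) & ls (s8$va1))"
        if K7: "K 0 s7 & hs (s7$va2) & ls (s7$vlo)" for s7
      proof -
        have "s7$vlo <= B" using K7 B unfolding ls_def by auto
        then show ?thesis by (intro run_loop_free) (use K7 in "auto intro!: Kst")
      qed
      show "run B (seqs [seqs [Set vx (Minus (V vbest) (Const 1)), Set vuu (Cell (root b) (Plus (V vr) (Const 1)))],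
          bsearch ?N (val_test b), Set va1 (V vlo)]) s5 (20 + (200*(H + 1)^2 + 10)) (%s6. K 0 s6 & hs (s6$va2) & ls (s6$va1))"
        by (rule run_seqs[OF a run_seqs[OF bb run_seqs1[OF cc]]])
    qed simp_all
  qed
  define Q where "Q lo' hi' = {z \<in> A. g z = Suc r & lo' <= z & z < hi'}" for lo' hi'
  have gap: "?L r \<inter> {lo'..<hi'} = {}" if "ls lo'" "hs hi'" for lo' hi'
  proof -
    have False if a: "a \<in> A" "g a = r" "lo' <= a" "a < hi'" for a
      using del_inv_gap[OF I a(1,2)]
    proof
      assume "a < lo"
      then have "a \<in> P" using a by (simp add: P_def)
      then show False using \<open>ls lo'\<close> a unfolding ls_def by auto
    next
      assume "hi <= a"
      then have aC: "a \<in> C" using a by (simp add: C_def)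
      then have "hi' <= a" using \<open>hs hi'\<close> fP unfolding hs_def by auto
      then show False using a by simp
    qed
    then show ?thesis by fastforce
  qed
  have 6: "run B (rng b (Cell (root b) (V vr)) (Cell (root b) (Plus (V vr) (Const 1))) vnew) s6 (450*(H + 1))
    (%s7. K (2*H + 2) s7 & hs (s7$va2) & ls (s7$va1) &
      tri s7 b H 0 (s7$vnew) (?L r \<union> Q (s7$va1) (s7$va2)))"
    if K6: "K 0 s6 & hs (s6$va2) & ls (s6$va1)" for s6
  proof (rule run_mono[OF rng_run[OF b, of s6 H B, where Su = "?L r" and Sv = "?L (Suc r)" and lo = "s6$va1" and hi = "s6$va2"
        and x = "words s6 (root b) r" and y = "words s6 (root b) (Suc r)"] order_refl])
    note F = Kfacts[OF conjunct1[OF K6]]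
    show "wval (Cell (root b) (V vr)) s' = words s6 (root b) r & wfits B (Cell (root b) (V vr)) s' &
      wval (Cell (root b) (Plus (V vr) (Const 1))) s' = words s6 (root b) (Suc r) & wfits B (Cell (root b) (Plus (V vr) (Const 1))) s'"
      if e: "ext {2..<10} b s6 s'" for s'
    proof -
      have "words s' (root b) = words s6 (root b)" "words s' vr = words s6 vr"
        using b by (auto intro!: ext_word[OF e])
      then show ?thesis using F rn n B by simp
    qed
    fix s7 assume s7: "ext ({2..<10} \<union> {vnew}) b s6 s7 & s7$fresh b <= s6$fresh b + 2*H + 2 &
      tri s7 b H 0 (s7$vnew) ((?L r - {s6$va1..<s6$va2}) \<union> (?L (Suc r) \<inter> {s6$va1..<s6$va2}))"
    have "(?L r - {s6$va1..<s6$va2}) \<union> (?L (Suc r) \<inter> {s6$va1..<s6$va2}) = ?L r \<union> Q (s6$va1) (s6$va2)"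
      using gap[of "s6$va1" "s6$va2"] K6 unfolding Q_def by auto
    moreover have "K (0 + (2*H + 2)) s7" by (rule Kext[OF conjunct1[OF K6] conjunct1[OF s7]]) (use s7 in auto)
    moreover have "words s7 va1 = words s6 va1" "words s7 va2 = words s6 va2" using b by (auto intro!: ext_word[OF conjunct1[OF s7]])
    ultimately show "K (2*H + 2) s7 & hs (s7$va2) & ls (s7$va1) &
      tri s7 b H 0 (s7$vnew) (?L r \<union> Q (s7$va1) (s7$va2))" using s7 K6 by simp
  qed (use Kfacts[OF conjunct1[OF K6]] K6 B in "auto simp: ls_def hs_def")
  have 7: "run B (rng b (Cell (root b) (Plus (V vr) (Const 1))) (Const 0) vt) s7 (450*(H + 1))
    (%s8. ext (dmod b) b s s8 & lvls s8 b H A g n {} & s8$vr = r & s8$fresh b <= ?fr + (4*H + 4) &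
      hs (s8$va2) & ls (s8$va1) &
      tri s8 b H 0 (s8$vnew) (?L r \<union> Q (s8$va1) (s8$va2)) &
      tri s8 b H 0 (s8$vt) (?L (Suc r) - Q (s8$va1) (s8$va2)))"
    if K7: "K (2*H + 2) s7 & hs (s7$va2) & ls (s7$va1) &
      tri s7 b H 0 (s7$vnew) (?L r \<union> Q (s7$va1) (s7$va2))" for s7
  proof (rule run_mono[OF rng_run[OF b, of s7 H B, where Su = "?L (Suc r)" and Sv = "{}" and lo = "s7$va1" and hi = "s7$va2"
        and y = 0 and x = "words s7 (root b) (Suc r)"] order_refl])
    note F = Kfacts[OF conjunct1[OF K7]]
    show "wval (Cell (root b) (Plus (V vr) (Const 1))) s' = words s7 (root b) (Suc r) & wfits B (Cell (root b) (Plus (V vr) (Const 1))) s' &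
      wval (Const 0) s' = 0 & wfits B (Const 0) s'" if e: "ext {2..<10} b s7 s'" for s'
    proof -
      have "words s' (root b) = words s7 (root b)" "words s' vr = words s7 vr"
        using b by (auto intro!: ext_word[OF e])
      then show ?thesis using F rn n B by simp
    qed
    show "tri s7 b H 0 0 {}" using tri_null F by blast
    fix s8 assume s8: "ext ({2..<10} \<union> {vt}) b s7 s8 & s8$fresh b <= s7$fresh b + 2*H + 2 &
      tri s8 b H 0 (s8$vt) ((?L (Suc r) - {s7$va1..<s7$va2}) \<union> ({} \<inter> {s7$va1..<s7$va2}))"
    note e8 = conjunct1[OF s8]
    have "(?L (Suc r) - {s7$va1..<s7$va2}) \<union> ({} \<inter> {s7$va1..<s7$va2}) = ?L (Suc r) - Q (s7$va1) (s7$va2)"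
      unfolding Q_def by auto
    moreover have "ext (dmod b) b s s8" using K7 unfolding K_def by (intro ext_step[OF _ e8]) auto
    moreover have "lvls s8 b H A g n {}" by (rule lvls_ext[OF e8 _ b]) (use K7 in "auto simp: K_def")
    moreover have "words s8 vr = words s7 vr" "words s8 vnew = words s7 vnew" "words s8 va1 = words s7 va1" "words s8 va2 = words s7 va2"
      using b by (auto intro!: ext_word[OF e8])
    moreover have "s8$fresh b <= ?fr + (4*H + 4)" using s8 F(3) by simp
    ultimately show "ext (dmod b) b s s8 & lvls s8 b H A g n {} & s8$vr = r & s8$fresh b <= ?fr + (4*H + 4) &
      hs (s8$va2) & ls (s8$va1) &
      tri s8 b H 0 (s8$vnew) (?L r \<union> Q (s8$va1) (s8$va2)) &
      tri s8 b H 0 (s8$vt) (?L (Suc r) - Q (s8$va1) (s8$va2))"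
      using s8 K7 F ext_tri[OF e8, of H 0 "s7$vnew"] by simp
  qed (use Kfacts[OF conjunct1[OF K7]] K7 B in "auto simp: ls_def hs_def")
  have 8: "run B (seqs [Store (root b) (V vr) (V vnew), Set vr (Plus (V vr) (Const 1)), Store (root b) (V vr) (V vt),
       Set vlr (V va1), Set vhr (V va2)]) s8 50
    (%s'. ext (dmod b) b s s' &
    s'$fresh b <= ?fr + (4*H + 4) & s'$vr = Suc r &
    s'$vlr < 2^H & s'$vhr < 2^H &
    (\<exists>g'. lvls s' b H A g' n {} & del_inv A ?f g' (Suc r) (s'$vlr) (s'$vhr) n))"
    if K8: "ext (dmod b) b s s8 & lvls s8 b H A g n {} & s8$vr = r & s8$fresh b <= ?fr + (4*H + 4) &
      hs (s8$va2) & ls (s8$va1) &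
      tri s8 b H 0 (s8$vnew) (?L r \<union> Q (s8$va1) (s8$va2)) &
      tri s8 b H 0 (s8$vt) (?L (Suc r) - Q (s8$va1) (s8$va2))" for s8
  proof (rule run_loop_free)
    let ?c = "seqs [Store (root b) (V vr) (V vnew), Set vr (Plus (V vr) (Const 1)), Store (root b) (V vr) (V vt),
       Set vlr (V va1), Set vhr (V va2)]"
    let ?s = "result ?c s8"
    let ?lo = "s8$va1" and ?hi = "s8$va2"
    let ?Q = "Q ?lo ?hi"
    define g' where "g' = (%y. if y \<in> ?Q then r else g y)"
    have "s8$vnew < s8$fresh b" "s8$vt < s8$fresh b" using K8 trie_props by blast+
    then have v: "s8$vnew <= B" "s8$vt <= B" using K8 B by linarith+
    have v2: "?lo < 2^H" "?hi < 2^H" using K8 unfolding ls_def hs_def by blast+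
    show "fits B ?c s8" using K8 v v2 rn n B b by simp
    have ex8: "ext {root b, vr, vlr, vhr} b s8 ?s" using b unfolding ext_def by (auto simp: words_other)
    have ex: "ext (dmod b) b s ?s" by (rule ext_step[OF conjunct1[OF K8] ex8]) auto
    have tr: "!!u S. tri s8 b H 0 u S ==> tri ?s b H 0 u S" using ext_tri[OF ex8] .
    have rt: "words ?s (root b) q = (if q = r then s8$vnew else if q = Suc r then s8$vt else words s8 (root b) q)" for q
      using K8 b by simp
    have "lvls ?s b H A g' n {}" unfolding lvls_def
    proof (intro conjI allI impI)
      show "null_ok ?s b" using ext_null[OF ex nu] .
      show "?s$univ b = 2^H" "?s$nl b = n" using K8 b by (auto simp: lvls_def)
      fix q assume q: "1 <= q" "q <= n"
      let ?W = "{y \<in> A. y \<notin> {} & g' y = q}"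
      have W: "?W = (if q = r then ?L r \<union> ?Q else if q = Suc r then ?L (Suc r) - ?Q else ?L q)"
        unfolding g'_def Q_def by auto
      show "tri ?s b H 0 (words ?s (root b) q) ?W"
        unfolding W rt using tr K8 q unfolding lvls_def by simp
    qed (use A in simp)
    moreover have "del_inv A ?f g' (Suc r) ?lo ?hi n" unfolding g'_def
    proof (rule del_inv_step[OF I rn P_def C_def])
      show "?lo <= z \<longleftrightarrow> P = {} \<or> ?f z < ?f (Max P)" if "z \<in> A" "g z = Suc r" for z
        using K8 that unfolding ls_def by blast
      show "?hi = Min C" if "C ~= {}" using K8 that unfolding hs_def by blast
      show "\<forall>z\<in>A. z < ?hi" if "C = {}" using K8 that unfolding hs_def by blast
    qed (simp add: Q_def)
    moreover have "?s$vlr = ?lo" "?s$vhr = ?hi" "?s$vr = Suc r" "?s$fresh b = s8$fresh b" using K8 b by auto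
    ultimately show "ext (dmod b) b s ?s &
    ?s$fresh b <= ?fr + (4*H + 4) & ?s$vr = Suc r &
    ?s$vlr < 2^H & ?s$vhr < 2^H &
    (\<exists>g'. lvls ?s b H A g' n {} & del_inv A ?f g' (Suc r) (?s$vlr) (?s$vhr) n)" using ex K8 v2 by auto
  qed simp_all
  show ?thesis
    unfolding ddel_body_def
    by (rule run_mono[OF run_seqs[OF 1 run_seqs[OF 2 run_seqs[OF 3 run_seqs[OF 4 run_seqs[OF 5 run_seqs[OF 6
        run_seqs[OF 7 run_seqs1[OF 8]]]]]]]]]) (use sq_ge[of H] in auto)
qed

abbreviation (input) vsrc :: nat where "vsrc == 25"
abbreviation (input) vdst :: nat where "vdst == 26"

text \<open>The level is recomputed by the rank search. The level without the element is left in
  \<open>vv\<close> and its root is not yet replaced, as deletion and relocation continue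
  differently.\<close>

definition find_level :: "nat => com" where
  "find_level b = seqs [rank b,
     seqs [Set vr (Plus (V vlo) (Const 1)), Set vu (Cell (root b) (V vr)), Set vv (Cell (root b) (V vr)), Set vk (V vkk)],
     upd b (Set vv (Const 0))]"

lemma find_level_run:
  assumes b: "40 <= b" and B: "s$fresh b + 2*H + 6 <= B" "2*2^H + 4 <= B"
    and l: "lvls s b H A g n {}" and L: "leveling A (keys s b) g n"
    and k: "s$vkk = k" "k \<in> A"
  shows "run B (find_level b) s (500*(H + 1)^2) (%s'. ext ({2..<14} \<union> {vr}) b s s' &
    s'$fresh b <= s$fresh b + H + 1 & lvls s' b H A g n {} & s'$vr = g k &
    tri s' b H 0 (s'$vv) ({y \<in> A. g y = g k} - {k}))"
proof -
  let ?M = "{2..<14} \<union> {vr}" and ?fr = "s$fresh b"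
  have n: "n < 2^H" using lvls_le[OF L l] .
  have kb: "k < 2^H - 1" using k l by (auto simp: lvls_def)
  have gk: "1 <= g k" "g k <= n" using L k unfolding leveling_def by auto
  have 1: "run B (rank b) s (200*(H + 1)^2) (%s'. ext ?M b s s' & s'$fresh b = ?fr &
    s'$vkk = k & Suc (s'$vlo) = g k & lvls s' b H A g n {})"
  proof (rule run_mono[OF rank_run[OF b _ _ l L k(1) kb] order_refl])
    fix s' assume s': "same_but {2..<14} s s' & s'$vlo <= n & rank_in A (keys s b) g k (Suc (s'$vlo))"
    have e: "ext {2..<14} b s s'" by (rule same_ext[OF _ _ b]) (use s' in auto)
    have "ext ?M b s s'" by (rule ext_step[OF ext_refl e]) auto
    moreover have "lvls s' b H A g n {}" by (rule lvls_ext[OF e _ b l]) auto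
    moreover have "Suc (s'$vlo) = g k" using rank_in_member[OF L k(2)] s' by auto
    ultimately show "ext ?M b s s' & s'$fresh b = ?fr &
    s'$vkk = k & Suc (s'$vlo) = g k & lvls s' b H A g n {}" using s' b k by auto
  qed (use B in auto)
  let ?c = "seqs [Set vr (Plus (V vlo) (Const 1)), Set vu (Cell (root b) (V vr)), Set vv (Cell (root b) (V vr)), Set vk (V vkk)]"
  have lf: "tri s1 b H 0 (words s1 (root b) (g k)) {y \<in> A. g y = g k}" if "lvls s1 b H A g n {}" for s1
    using that gk unfolding lvls_def by auto
  have 2: "run B ?c s1 40 (%s2. ext ?M b s s2 & s2$fresh b = ?fr & s2$vr = g k & s2$vk = k &
     s2$vu = words s2 (root b) (g k) & s2$vv = words s2 (root b) (g k) & lvls s2 b H A g n {})"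
    if s1: "ext ?M b s s1 & s1$fresh b = ?fr &
    s1$vkk = k & Suc (s1$vlo) = g k & lvls s1 b H A g n {}" for s1
  proof (rule run_loop_free)
    let ?s = "result ?c s1"
    have sm: "same_but {vr, vu, vv, vk} s1 ?s" by (auto simp: words_other)
    have e: "ext {vr, vu, vv, vk} b s1 ?s" by (rule same_ext[OF sm _ b]) auto
    have "ext ?M b s ?s" by (rule ext_step[OF conjunct1[OF s1] e]) auto
    moreover have "lvls ?s b H A g n {}" by (rule lvls_ext[OF e _ b]) (use s1 in auto)
    ultimately show "ext ?M b s ?s & ?s$fresh b = ?fr & ?s$vr = g k & ?s$vk = k &
     ?s$vu = words ?s (root b) (g k) & ?s$vv = words ?s (root b) (g k) & lvls ?s b H A g n {}" using s1 b by simp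
    have "words s1 (root b) (g k) < s1$fresh b" using lf trie_props s1 by blast
    then show "fits B ?c s1" using s1 b gk n kb B by simp
  qed simp_all
  have 3: "run B (upd b (Set vv (Const 0))) s2 (150*H + 50) (%s'. ext ?M b s s' &
    s'$fresh b <= ?fr + H + 1 & lvls s' b H A g n {} & s'$vr = g k &
    tri s' b H 0 (s'$vv) ({y \<in> A. g y = g k} - {k}))"
    if s2: "ext ?M b s s2 & s2$fresh b = ?fr & s2$vr = g k & s2$vk = k &
     s2$vu = words s2 (root b) (g k) & s2$vv = words s2 (root b) (g k) & lvls s2 b H A g n {}" for s2
  proof (rule run_mono[OF upd_delete[OF b, of s2 H B k "{y \<in> A. g y = g k}"] order_refl])
    have "s2$vu = words s2 (root b) (g k)" "s2$vv = words s2 (root b) (g k)" using s2 by blast+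
    then show "tri s2 b H 0 (s2$vu) {y \<in> A. g y = g k}" "tri s2 b H 0 (s2$vv) {y \<in> A. g y = g k}"
      using lf[of s2] s2 by (simp_all only:)
    show "null_ok s2 b" "s2$univ b = 2^H" using s2 unfolding lvls_def by blast+
    fix s' assume s': "ext {2..<10} b s2 s' & s'$fresh b <= s2$fresh b + H + 1 &
      tri s' b H 0 (s'$vv) ({y \<in> A. g y = g k} - {k})"
    note e = conjunct1[OF s']
    have "ext ?M b s s'" by (rule ext_step[OF conjunct1[OF s2] e]) auto
    moreover have "lvls s' b H A g n {}" by (rule lvls_ext[OF e _ b]) (use s2 in auto)
    moreover have "words s' vr = words s2 vr" using b by (intro ext_word[OF e]) auto
    ultimately show "ext ?M b s s' & s'$fresh b <= ?fr + H + 1 & lvls s' b H A g n {} & s'$vr = g k &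
      tri s' b H 0 (s'$vv) ({y \<in> A. g y = g k} - {k})" using s' s2 by simp
  qed (use s2 B kb in auto)
  show ?thesis unfolding find_level_def
    by (rule run_mono[OF run_seqs[OF 1 run_seqs[OF 2 run_seqs1[OF 3]]]]) (use sq_ge[of H] in auto)
qed

text \<open>Removes the key at address \<open>vkk\<close> from the levels.\<close>

definition ddel :: "nat => com" where
  "ddel b = seqs [find_level b,
     seqs [Store (root b) (V vr) (V vv), Set vlr (V vkk), Set vhr (Plus (V vkk) (Const 1))],
     While (Less (V vr) (V (nl b))) (ddel_body b),
     Cond (Less (Const 0) (Cell (aM b) (Cell (root b) (V (nl b))))) Skip (Set (nl b) (Minus (V (nl b)) (Const 1)))]"

text \<open>The loop runs up to the top level even if the orphans have died out earlier. The
  witnesses of the invariant refer to the old value at \<open>k\<close>, which stays in memory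
  meanwhile.\<close>

lemma ddel_run:
  assumes b: "40 <= b" and B: "s$fresh b + (n + 3)*(4*H + 4) + 20 <= B" "2*2^H + 4 <= B"
    and l: "lvls s b H A g n {}" and L: "leveling A (keys s b) g n" and i: "inj_on (keys s b) A"
    and k: "s$vkk = k" "k \<in> A"
  shows "run B (ddel b) s ((n + 2)*(2000*(H + 1)^2)) (%s'. ext (dmod b) b s s' &
    s'$fresh b <= s$fresh b + (n + 2)*(4*H + 4) &
    (\<exists>g' n'. n' <= n & lvls s' b H (A - {k}) g' n' {} & leveling (A - {k}) (keys s b) g' n'))"
proof -
  let ?f = "keys s b" and ?A = "A - {k}" and ?fr = "s$fresh b"
  have n: "n < 2^H" using lvls_le[OF L l] .
  have kb: "k < 2^H - 1" using k l by (auto simp: lvls_def)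
  have gk: "1 <= g k" "g k <= n" using L k unfolding leveling_def by auto
  have frB: "?fr + n*(4*H + 4) + 12*H + 32 <= B" using B(1) by (auto simp: algebra_simps)
  have 1: "run B (find_level b) s (500*(H + 1)^2) (%s'. ext ({2..<14} \<union> {vr}) b s s' &
    s'$fresh b <= ?fr + H + 1 & lvls s' b H A g n {} & s'$vr = g k &
    tri s' b H 0 (s'$vv) ({y \<in> A. g y = g k} - {k}))"
    by (rule find_level_run[OF b _ B(2) l L k]) (use frB in auto)
  define I where "I m s1 \<longleftrightarrow> ext (dmod b) b s s1 & s1$fresh b + m*(4*H + 4) <= ?fr + n*(4*H + 4) + H + 1 &
    s1$vlr < 2^H & s1$vhr < 2^H &
    (\<exists>g' r. lvls s1 b H ?A g' n {} & del_inv ?A ?f g' r (s1$vlr) (s1$vhr) n &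
      s1$vr = r & r + m = n)" for m s1
  let ?c = "seqs [Store (root b) (V vr) (V vv), Set vlr (V vkk), Set vhr (Plus (V vkk) (Const 1))]"
  have 2: "run B ?c s1 40 (I (n - g k))"
    if s1: "ext ({2..<14} \<union> {vr}) b s s1 &
    s1$fresh b <= ?fr + H + 1 & lvls s1 b H A g n {} & s1$vr = g k &
    tri s1 b H 0 (s1$vv) ({y \<in> A. g y = g k} - {k})" for s1
  proof (rule run_loop_free)
    let ?s = "result ?c s1"
    note e1 = conjunct1[OF s1]
    have kk: "s1$vkk = k" using ext_word[OF e1, of vkk] k b by simp
    have ex8: "ext {root b, vlr, vhr} b s1 ?s" using b unfolding ext_def by (auto simp: words_other)
    have ex: "ext (dmod b) b s ?s" by (rule ext_trans[OF e1 ex8]) auto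
    have "lvls ?s b H ?A g n {}" unfolding lvls_def
    proof (intro conjI allI impI)
      show "null_ok ?s b" using ext_null[OF ex] l unfolding lvls_def by blast
      show "?s$univ b = 2^H" "?s$nl b = n" using s1 b by (auto simp: lvls_def)
      show "?A \<subseteq> {..<2^H - 1}" using l unfolding lvls_def by auto
      fix q assume q: "1 <= q" "q <= n"
      let ?W = "{y \<in> ?A. y \<notin> {} & g y = q}"
      have W: "?W = (if q = g k then {y \<in> A. g y = g k} - {k} else {y \<in> A. g y = q})" by auto
      have rt: "words ?s (root b) q = (if q = g k then s1$vv else words s1 (root b) q)" using s1 b by simp
      show "tri ?s b H 0 (words ?s (root b) q) ?W"
        unfolding W rt using ext_tri[OF ex8] s1 q unfolding lvls_def by simp
    qed
    moreover have "del_inv ?A ?f g (g k) k (Suc k) n" using del_inv_init[OF L i k(2)] .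
    moreover have "?s$vlr = k" "?s$vhr = Suc k" "?s$vr = g k" "?s$fresh b = s1$fresh b"
      using s1 b kk by auto
    moreover have "s1$fresh b + (n - g k)*(4*H + 4) <= ?fr + n*(4*H + 4) + H + 1"
    proof -
      have "(n - g k)*(4*H + 4) <= n*(4*H + 4)" by (intro mult_le_mono1) simp
      then show ?thesis using s1 by linarith
    qed
    ultimately show "I (n - g k) ?s" unfolding I_def using ex kb gk by auto
    have "s1$vv < s1$fresh b" using trie_props s1 by blast
    moreover have "Suc k <= B" "g k <= B" using kb gk n B(2) by linarith+
    ultimately show "fits B ?c s1" using s1 b kk frB by simp
  qed simp_all
  have 3: "run B (While (Less (V vr) (V (nl b))) (ddel_body b)) s2 ((n - g k)*(5 + 1500*(H + 1)^2) + 5)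
    (%s3. ext (dmod b) b s s3 & s3$fresh b <= ?fr + n*(4*H + 4) + H + 1 &
      (\<exists>g' lo hi. lvls s3 b H ?A g' n {} & del_inv ?A ?f g' n lo hi n))" if I0: "I (n - g k) s2" for s2
  proof -
    have J: "s1$vr + m = n" "s1$nl b = n" if Im: "I m s1" for m s1
      using Im unfolding I_def lvls_def by auto
    show ?thesis
    proof (rule run_mono[OF run_loop[where I = I, OF I0]])
      show "tfits B (Less (V vr) (V (nl b))) s1" if "I m s1" for m s1 using J[OF that] n B by auto
      show "~ tval (Less (V vr) (V (nl b))) s1" if "I 0 s1" for s1 using J[OF that] by auto
      show "ext (dmod b) b s s1 & s1$fresh b <= ?fr + n*(4*H + 4) + H + 1 &
        (\<exists>g' lo hi. lvls s1 b H ?A g' n {} & del_inv ?A ?f g' n lo hi n)"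
        if Im: "I m s1" and nt: "~ tval (Less (V vr) (V (nl b))) s1" for m s1
      proof -
        have "m = 0" using J[OF Im] nt by auto
        then show ?thesis using Im unfolding I_def by auto
      qed
      show "run B (ddel_body b) s1 (1500*(H + 1)^2) (I m)" if Im: "I (Suc m) s1" for m s1
      proof -
        obtain g' r where a: "lvls s1 b H ?A g' n {}" "del_inv ?A ?f g' r (s1$vlr) (s1$vhr) n"
          "s1$vr = r" "r + Suc m = n" and ex1: "ext (dmod b) b s s1"
          and fr1: "s1$fresh b + Suc m*(4*H + 4) <= ?fr + n*(4*H + 4) + H + 1"
          and bd: "s1$vlr < 2^H" "s1$vhr < 2^H"
          using Im unfolding I_def by blast
        have kk: "keys s1 b = ?f" using ext_keys[OF ex1] by simp
        show ?thesis
        proof (rule run_mono[OF ddel_step[OF b _ B(2) a(1) _ _ n a(3) refl bd(1) refl bd(2)] order_refl])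
          show "s1$fresh b + 6*H + 20 <= B" using fr1 frB by simp
          show "del_inv ?A (keys s1 b) g' r (s1$vlr) (s1$vhr) n" using a(2) kk by simp
          show "r < n" using a(4) by simp
          fix s' assume s': "ext (dmod b) b s1 s' & s'$fresh b <= s1$fresh b + (4*H + 4) & s'$vr = Suc r &
            s'$vlr < 2^H & s'$vhr < 2^H &
            (\<exists>g'. lvls s' b H ?A g' n {} & del_inv ?A (keys s1 b) g' (Suc r) (s'$vlr) (s'$vhr) n)"
          have "ext (dmod b) b s s'" by (rule ext_step[OF ex1 conjunct1[OF s']]) auto
          moreover have "s'$fresh b + m*(4*H + 4) <= ?fr + n*(4*H + 4) + H + 1" using s' fr1 by simp
          ultimately show "I m s'" unfolding I_def using s' a(4) kk by auto
        qed
      qed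
    qed (simp_all add: add_mult_distrib2)
  qed
  let ?d = "Cond (Less (Const 0) (Cell (aM b) (Cell (root b) (V (nl b))))) Skip (Set (nl b) (Minus (V (nl b)) (Const 1)))"
  have 4: "run B ?d s3 20 (%s'. ext (dmod b) b s s' &
    s'$fresh b <= ?fr + (n + 2)*(4*H + 4) &
    (\<exists>g' n'. n' <= n & lvls s' b H ?A g' n' {} & leveling ?A ?f g' n'))"
    if s3: "ext (dmod b) b s s3 & s3$fresh b <= ?fr + n*(4*H + 4) + H + 1 &
      (\<exists>g' lo hi. lvls s3 b H ?A g' n {} & del_inv ?A ?f g' n lo hi n)" for s3
  proof -
    obtain g' lo hi where l3: "lvls s3 b H ?A g' n {}" and d3: "del_inv ?A ?f g' n lo hi n" using s3 by blast
    have nn: "s3$nl b = n" using l3 unfolding lvls_def by blast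
    have n1: "1 <= n" using gk by simp
    have t: "tri s3 b H 0 (words s3 (root b) n) {y \<in> ?A. g' y = n}" using l3 n1 unfolding lvls_def by auto
    note p = trie_props[OF t]
    have up: "upper {y \<in> ?A. g' y = n} <= 2^H" using p l3 by (intro upper_le) (auto simp: lvls_def)
    have f: "fits B ?d s3" using nn n up p s3 frB B by (auto simp: algebra_simps)
    have fr: "s3$fresh b <= ?fr + (n + 2)*(4*H + 4)" using s3 by (auto simp: algebra_simps)
    show ?thesis
    proof (cases "\<exists>z\<in>?A. g' z = n")
      case True
      have ne: "upper {y \<in> ?A. g' y = n} ~= 0" using True by (auto simp: upper_eq_0)
      have "leveling ?A ?f g' n" using del_inv_final(1)[OF d3 True] .
      then have "ext (dmod b) b s s3 & s3$fresh b <= ?fr + (n + 2)*(4*H + 4) &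
        (\<exists>g' n'. n' <= n & lvls s3 b H ?A g' n' {} & leveling ?A ?f g' n')" using s3 l3 fr by blast
      then show ?thesis using f ne nn p by (intro run_loop_free) auto
    next
      case False
      have e0: "{y \<in> ?A. g' y = n} = {}" using False by auto
      let ?s = "store_word (nl b) 0 (n - 1) s3"
      have ex8: "ext {nl b} b s3 ?s" using b unfolding ext_def by (auto simp: words_other)
      have ex: "ext (dmod b) b s ?s" by (rule ext_step[OF conjunct1[OF s3] ex8]) auto
      have "leveling ?A ?f g' (n - 1)" using del_inv_final(2)[OF d3 False] .
      moreover have "lvls ?s b H ?A g' (n - 1) {}" using l3 ext_tri[OF ex8] ext_null[OF ex8] b unfolding lvls_def by simp
      ultimately have "ext (dmod b) b s ?s & ?s$fresh b <= ?fr + (n + 2)*(4*H + 4) &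
        (\<exists>g' n'. n' <= n & lvls ?s b H ?A g' n' {} & leveling ?A ?f g' n')" using ex fr b
        by (intro conjI exI[of _ g'] exI[of _ "n - 1"]) auto
      moreover have "words s3 (aM b) (words s3 (root b) n) = 0" using p by (simp only: e0 upper_empty)
      then have rs: "result ?d s3 = ?s" using nn by simp
      ultimately show ?thesis by (intro run_loop_free[OF _ f]) (simp_all only: rs, simp_all)
    qed
  qed
  have tm: "500*(H + 1)^2 + (40 + (((n - g k)*(5 + 1500*(H + 1)^2) + 5) + 20)) <= (n + 2)*(2000*(H + 1)^2)"
  proof -
    have "(n - g k)*(5 + 1500*(H + 1)^2) <= n*(2000*(H + 1)^2)" using sq_ge[of H] by (intro mult_le_mono) auto
    then show ?thesis using sq_ge[of H] by (simp add: add_mult_distrib)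
  qed
  show ?thesis unfolding ddel_def
    by (rule run_mono[OF run_seqs[OF 1 run_seqs[OF 2 run_seqs[OF 3 run_seqs1[OF 4]]]] tm])
qed

section \<open>Relocating an element within its level\<close>

text \<open>Moves the element at address \<open>vsrc\<close> to the free address \<open>vdst\<close> within its level.\<close>

definition dmove :: "nat => com" where
  "dmove b = seqs [Set vkk (V vsrc), find_level b,
     seqs [Set vu (V vv), Set vk (V vdst), Set vkk (V vdst)],
     upd b (set_leaf b), Store (root b) (V vr) (V vv)]"

text \<open>Removing \<open>src\<close> from the trie of its level and adding \<open>dst\<close> to
  the same trie leaves all other levels alone; \<open>leveling_move\<close> supplies the
  leveling.\<close>

lemma dmove_run:
  assumes b: "40 <= b" and B: "s$fresh b + 4*H + 20 <= B" "2*2^H + 4 <= B"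
    and l: "lvls s b H A g n {}" and L: "leveling A (keys s b) g n"
    and src: "s$vsrc = src" "src \<in> A" and dst: "s$vdst = dst" "dst \<notin> A" "dst < 2^H - 1"
    and bt: "!!y. y \<in> A ==> y ~= src ==> y < src \<longleftrightarrow> y < dst" and key: "keys s b dst = keys s b src"
  shows "run B (dmove b) s (1000*(H + 1)^2) (%s'. ext (dmod b) b s s' &
    s'$fresh b <= s$fresh b + (2*H + 2) &
    (\<exists>g'. lvls s' b H (insert dst (A - {src})) g' n {} & leveling (insert dst (A - {src})) (keys s b) g' n))"
proof -
  let ?f = "keys s b" and ?A = "insert dst (A - {src})" and ?fr = "s$fresh b" and ?g = "g(dst := g src)"
  let ?S = "{y \<in> A. g y = g src} - {src}"
  have n: "n < 2^H" using lvls_le[OF L l] .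
  have sb: "src < 2^H - 1" using src l by (auto simp: lvls_def)
  have gk: "1 <= g src" "g src <= n" using L src unfolding leveling_def by auto
  have 1: "run B (Set vkk (V vsrc)) s 10 (%s1. s1 = store_word vkk 0 src s)"
    by (rule run_loop_free) (use src sb B in auto)
  have 2: "run B (find_level b) s1 (500*(H + 1)^2) (%s2. ext (dmod b) b s s2 &
    s2$fresh b <= ?fr + H + 1 & lvls s2 b H A g n {} & s2$vr = g src &
    tri s2 b H 0 (s2$vv) ?S)" if s1: "s1 = store_word vkk 0 src s" for s1
  proof -
    have e1: "ext {vkk} b s s1" unfolding s1 by (rule ext_store) (use b in auto)
    have l1: "lvls s1 b H A g n {}" by (rule lvls_ext[OF e1 _ b l]) auto
    have L1: "leveling A (keys s1 b) g n" using L ext_keys[OF e1] by simp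
    have fr: "s1$fresh b = ?fr" using b by (simp add: s1)
    show ?thesis
    proof (rule run_mono[OF find_level_run[OF b _ B(2) l1 L1 _ src(2)] order_refl])
      fix s2 assume s2: "ext ({2..<14} \<union> {vr}) b s1 s2 &
        s2$fresh b <= s1$fresh b + H + 1 & lvls s2 b H A g n {} & s2$vr = g src &
        tri s2 b H 0 (s2$vv) ?S"
      have "ext (dmod b) b s s2" by (rule ext_trans[OF e1 conjunct1[OF s2]]) auto
      then show "ext (dmod b) b s s2 &
        s2$fresh b <= ?fr + H + 1 & lvls s2 b H A g n {} & s2$vr = g src &
        tri s2 b H 0 (s2$vv) ?S" using s2 fr by simp
    qed (use fr B s1 in auto)
  qed
  let ?c = "seqs [Set vu (V vv), Set vk (V vdst), Set vkk (V vdst)]"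
  have 3: "run B ?c s2 30 (%s3. ext (dmod b) b s s3 &
    s3$fresh b <= ?fr + H + 1 & lvls s3 b H A g n {} & s3$vr = g src &
    tri s3 b H 0 (s3$vv) ?S & s3$vu = s3$vv & s3$vk = dst & s3$vkk = dst)"
    if s2: "ext (dmod b) b s s2 &
    s2$fresh b <= ?fr + H + 1 & lvls s2 b H A g n {} & s2$vr = g src &
    tri s2 b H 0 (s2$vv) ?S" for s2
  proof (rule run_loop_free)
    let ?s = "result ?c s2"
    note e2 = conjunct1[OF s2]
    have dd: "s2$vdst = dst" using ext_word[OF e2, of vdst] dst b by simp
    have sm: "same_but {vu, vk, vkk} s2 ?s" by (auto simp: words_other)
    have e: "ext {vu, vk, vkk} b s2 ?s" by (rule same_ext[OF sm _ b]) auto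
    have "ext (dmod b) b s ?s" by (rule ext_step[OF e2 e]) auto
    moreover have "lvls ?s b H A g n {}" by (rule lvls_ext[OF e _ b]) (use s2 in auto)
    moreover have "tri ?s b H 0 (s2$vv) ?S" using ext_tri[OF e] s2 by blast
    ultimately show "ext (dmod b) b s ?s &
    ?s$fresh b <= ?fr + H + 1 & lvls ?s b H A g n {} & ?s$vr = g src &
    tri ?s b H 0 (?s$vv) ?S & ?s$vu = ?s$vv & ?s$vk = dst & ?s$vkk = dst"
      using s2 b dd by simp
    have "s2$vv < s2$fresh b" using trie_props s2 by blast
    then show "fits B ?c s2" using s2 dd dst B by simp
  qed simp_all
  have 4: "run B (upd b (set_leaf b)) s3 (150*H + 50) (%s4. ext (dmod b) b s s4 &
    s4$fresh b <= ?fr + (2*H + 2) & lvls s4 b H A g n {} & s4$vr = g src &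
    tri s4 b H 0 (s4$vv) (insert dst ?S))"
    if s3: "ext (dmod b) b s s3 &
    s3$fresh b <= ?fr + H + 1 & lvls s3 b H A g n {} & s3$vr = g src &
    tri s3 b H 0 (s3$vv) ?S & s3$vu = s3$vv & s3$vk = dst & s3$vkk = dst" for s3
  proof (rule run_mono[OF upd_insert[OF b, of s3 H B dst ?S] order_refl])
    show "null_ok s3 b" "s3$univ b = 2^H" using s3 unfolding lvls_def by blast+
    show "tri s3 b H 0 (s3$vu) ?S" "tri s3 b H 0 (s3$vv) ?S" using s3 by simp_all
    fix s' assume s': "ext {2..<10} b s3 s' & s'$fresh b <= s3$fresh b + H + 1 &
      tri s' b H 0 (s'$vv) (insert dst ?S)"
    note e = conjunct1[OF s']
    have "ext (dmod b) b s s'" by (rule ext_step[OF conjunct1[OF s3] e]) auto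
    moreover have "lvls s' b H A g n {}" by (rule lvls_ext[OF e _ b]) (use s3 in auto)
    moreover have "words s' vr = words s3 vr" using b by (intro ext_word[OF e]) auto
    ultimately show "ext (dmod b) b s s' &
    s'$fresh b <= ?fr + (2*H + 2) & lvls s' b H A g n {} & s'$vr = g src &
    tri s' b H 0 (s'$vv) (insert dst ?S)" using s' s3 by simp
  qed (use s3 B dst in auto)
  have 5: "run B (Store (root b) (V vr) (V vv)) s4 10 (%s'. ext (dmod b) b s s' &
    s'$fresh b <= ?fr + (2*H + 2) &
    (\<exists>g'. lvls s' b H ?A g' n {} & leveling ?A ?f g' n))"
    if s4: "ext (dmod b) b s s4 &
    s4$fresh b <= ?fr + (2*H + 2) & lvls s4 b H A g n {} & s4$vr = g src &
    tri s4 b H 0 (s4$vv) (insert dst ?S)" for s4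
  proof (rule run_loop_free)
    let ?s = "result (Store (root b) (V vr) (V vv)) s4"
    have ex8: "ext {root b} b s4 ?s" using b unfolding ext_def by (auto simp: words_other)
    have ex: "ext (dmod b) b s ?s" by (rule ext_step[OF conjunct1[OF s4] ex8]) auto
    have "lvls ?s b H ?A ?g n {}" unfolding lvls_def
    proof (intro conjI allI impI)
      show "null_ok ?s b" using ext_null[OF ex] l unfolding lvls_def by blast
      show "?s$univ b = 2^H" "?s$nl b = n" using s4 b by (auto simp: lvls_def)
      show "?A \<subseteq> {..<2^H - 1}" using l dst unfolding lvls_def by auto
      fix q assume q: "1 <= q" "q <= n"
      let ?W = "{y \<in> ?A. y \<notin> {} & ?g y = q}"
      have W: "?W = (if q = g src then insert dst ?S else {y \<in> A. g y = q})" using dst src by auto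
      have rt: "words ?s (root b) q = (if q = g src then s4$vv else words s4 (root b) q)" using s4 b by simp
      show "tri ?s b H 0 (words ?s (root b) q) ?W"
        unfolding W rt using ext_tri[OF ex8] s4 q unfolding lvls_def by simp
    qed
    moreover have "leveling ?A ?f ?g n"
    proof -
      have "?f(dst := ?f src) = ?f" using key by auto
      then show ?thesis using leveling_move[OF L src(2) dst(2) bt] by simp
    qed
    ultimately show "ext (dmod b) b s ?s & ?s$fresh b <= ?fr + (2*H + 2) &
      (\<exists>g'. lvls ?s b H ?A g' n {} & leveling ?A ?f g' n)" using ex s4 b by auto
    have "s4$vv < s4$fresh b" using trie_props s4 by blast
    then show "fits B (Store (root b) (V vr) (V vv)) s4" using s4 gk n B by simp
  qed simp_all
  show ?thesis unfolding dmove_def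
    by (rule run_mono[OF run_seqs[OF 1 run_seqs[OF 2 run_seqs[OF 3 run_seqs[OF 4 run_seqs1[OF 5]]]]]]) (use sq_ge[of H] in auto)
qed

abbreviation (input) vj :: nat where "vj == 30"
abbreviation (input) vi :: nat where "vi == 31"
abbreviation (input) vbase :: nat where "vbase == 32"
abbreviation (input) vtt :: nat where "vtt == 33"
abbreviation (input) cnt :: "nat => nat" where "cnt b == b + 18"
abbreviation (input) cb :: "nat => nat" where "cb b == b + 19"
abbreviation (input) sz :: "nat => nat" where "sz b == b + 20"
abbreviation (input) big :: "nat => nat" where "big b == b + 21"
abbreviation (input) eu :: "nat => nat" where "eu b == b + 22"
abbreviation (input) ntl :: "nat => nat" where "ntl b == b + 23"

section \<open>Blocked arrays\<close>

text \<open>The addresses in use when each block \<open>j < m\<close> of width \<open>W\<close> holds \<open>c j\<close> elements.\<close>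

definition row :: "nat => (nat => nat) => nat => nat list" where
  "row W c j = map (%i. j*W + i) [0..<c j]"

definition adl :: "nat => nat => (nat => nat) => nat list" where
  "adl W m c = concat (map (row W c) [0..<m])"

lemma adl_Suc: "adl W (Suc m) c = adl W m c @ row W c m"
  by (simp add: adl_def)

lemma adl_0: "adl W 0 c = []"
  by (simp add: adl_def)

lemma adl_cong: "(!!j. j < m ==> c j = c' j) ==> adl W m c = adl W m c'"
  by (induction m) (simp_all add: adl_0 adl_Suc row_def)

lemma length_adl: "length (adl W m c) = (\<Sum>j<m. c j)"
  by (induction m) (simp_all add: adl_0 adl_Suc row_def)

lemma set_row: "set (row W c j) = {j*W..<j*W + c j}"
proof -
  have "(%i. j*W + i) ` {0..<c j} = {j*W..<j*W + c j}"
    using image_add_atLeastLessThan[of "j*W" 0 "c j"] by (simp add: add.commute)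
  then show ?thesis by (simp add: row_def)
qed

lemma set_adl: "set (adl W m c) = (\<Union>j<m. {j*W..<j*W + c j})"
  by (induction m) (auto simp: adl_0 adl_Suc set_row less_Suc_eq)

lemma adl_bound: "(!!j. j < m ==> c j <= W) ==> x \<in> set (adl W m c) ==> x < m*W"
proof -
  assume c: "!!j. j < m ==> c j <= W" and "x \<in> set (adl W m c)"
  then obtain j where j: "j < m" "x < j*W + c j" by (auto simp: set_adl)
  have "j*W + c j <= Suc j*W" using c[OF j(1)] by simp
  also have "\<dots> <= m*W" using j by (intro mult_le_mono1) simp
  finally show ?thesis using j by simp
qed

lemma sorted_adl: "(!!j. j < m ==> c j <= W) ==> sorted_wrt (<) (adl W m c)"
proof (induction m)
  case (Suc m)
  then have s: "sorted_wrt (<) (adl W m c)" by simp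
  have r: "sorted_wrt (<) (row W c m)" by (simp add: row_def sorted_wrt_map)
  have "x < y" if "x \<in> set (adl W m c)" "y \<in> set (row W c m)" for x y
    using adl_bound[of m c W x] Suc.prems that by (auto simp: set_row)
  then show ?case using s r by (simp add: adl_Suc sorted_wrt_append)
qed (simp add: adl_0)

text \<open>No block exceeds its width, so an address belongs to exactly one block.\<close>

lemma in_block_iff:
  assumes c: "!!j. j < m ==> c j <= W" and j: "j < m" and i: "i < W"
  shows "j*W + i \<in> set (adl W m c) \<longleftrightarrow> i < c j"
proof
  assume "j*W + i \<in> set (adl W m c)"
  then obtain j' where j': "j' < m" "j'*W <= j*W + i" "j*W + i < j'*W + c j'" by (auto simp: set_adl)
  have "j' < Suc j"
  proof -
    have "j'*W < Suc j*W" using j'(2) i by simp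
    then show ?thesis by (metis mult_less_cancel2)
  qed
  moreover have "j < Suc j'"
  proof -
    have "j*W < Suc j'*W" using j'(3) c[OF j'(1)] by simp
    then show ?thesis by (metis mult_less_cancel2)
  qed
  ultimately have "j' = j" by simp
  then show "i < c j" using j'(3) by simp
next
  assume "i < c j"
  then show "j*W + i \<in> set (adl W m c)" unfolding set_adl using j by (intro UN_I[of j]) auto
qed

lemma adl_split:
  assumes "j < m"
  shows "adl W m c = adl W j c @ row W c j @ concat (map (row W c) [Suc j..<m])"
proof -
  have "[0..<m] = [0..<j] @ j # [Suc j..<m]" using assms upt_conv_Cons[of j m] upt_add_eq_append[of 0 j "m - j"] by simp
  then show ?thesis unfolding adl_def by simp
qed

lemma set_adl_upd:
  assumes "j < m"
  shows "set (adl W m (c(j := v))) = (\<Union>j'\<in>{..<m} - {j}. {j'*W..<j'*W + c j'}) \<union> {j*W..<j*W + v}"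
  using assms by (auto simp: set_adl split: if_splits)

text \<open>\<open>f'\<close> is the memory after the tail of block \<open>j\<close> has been
  shifted by one and \<open>x\<close> put into the hole. The other blocks contribute the same values
  as before, so the comparison reduces to one row.\<close>

lemma adl_insert:
  assumes j: "j < m" and i: "i <= c j" and c: "!!j. j < m ==> c j <= W" "c j < W"
    and f: "f' (j*W + i) = x" "!!i'. i' < i ==> f' (j*W + i') = f (j*W + i')"
      "!!i'. i <= i' ==> i' < c j ==> f' (j*W + Suc i') = f (j*W + i')"
    and o: "!!a. a < j*W \<or> j*W + W <= a ==> f' a = f a"
    and p: "p = (\<Sum>j'<j. c j') + i"
  shows "map f' (adl W m (c(j := Suc (c j)))) = take p (map f (adl W m c)) @ x # drop p (map f (adl W m c))"
proof -
  let ?c = "c(j := Suc (c j))"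
  let ?A = "adl W j c" and ?Z = "concat (map (row W c) [Suc j..<m])"
  have A: "adl W j ?c = ?A" by (rule adl_cong) simp
  have Z: "concat (map (row W ?c) [Suc j..<m]) = ?Z"
    by (intro arg_cong[of _ _ concat] map_cong refl) (simp add: row_def)
  have fA: "map f' ?A = map f ?A"
  proof (intro map_cong refl o disjI1)
    fix a assume "a \<in> set ?A"
    then show "a < j*W" using adl_bound[of j c W a] c j by simp
  qed
  have fZ: "map f' ?Z = map f ?Z"
  proof (intro map_cong refl o disjI2)
    fix a assume "a \<in> set ?Z"
    then obtain j' where "Suc j <= j'" "a \<in> set (row W c j')" by auto
    then have "Suc j*W <= j'*W" "j'*W <= a" by (auto simp only: set_row atLeastLessThan_iff intro!: mult_le_mono1)
    then show "j*W + W <= a" by simp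
  qed
  have row': "map f' (row W ?c j) = take i (map f (row W c j)) @ x # drop i (map f (row W c j))"
  proof (rule nth_equalityI)
    fix q assume "q < length (map f' (row W ?c j))"
    then have q: "q <= c j" by (simp add: row_def)
    show "map f' (row W ?c j) ! q = (take i (map f (row W c j)) @ x # drop i (map f (row W c j))) ! q"
    proof (cases "q < i")
      case True
      then show ?thesis using q i f(2) by (simp add: row_def nth_append)
    next
      case F: False
      show ?thesis
      proof (cases "q = i")
        case True
        then show ?thesis using i f(1) by (simp add: row_def nth_append del: upt_Suc)
      next
        case False
        then obtain q' where q': "q = Suc q'" "i <= q'" using F by (cases q) auto
        then show ?thesis using q i f(3)[of q'] by (simp add: row_def nth_append Suc_diff_le del: upt_Suc)
      qed
    qed
  qed (use i in "simp add: row_def")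
  have l: "length (map f ?A) = (\<Sum>j'<j. c j')" by (simp add: length_adl)
  show ?thesis
    unfolding adl_split[OF j] A Z map_append fA fZ row' p using l i by (simp add: row_def)
qed

lemma adl_delete:
  assumes j: "j < m" and i: "i < c j" and c: "!!j. j < m ==> c j <= W"
    and f: "!!i'. i' < i ==> f' (j*W + i') = f (j*W + i')"
      "!!i'. i <= i' ==> Suc i' < c j ==> f' (j*W + i') = f (j*W + Suc i')"
    and o: "!!a. a < j*W \<or> j*W + W <= a ==> f' a = f a"
    and p: "p = (\<Sum>j'<j. c j') + i"
  shows "map f' (adl W m (c(j := c j - 1))) = take p (map f (adl W m c)) @ drop (Suc p) (map f (adl W m c))"
proof -
  let ?c = "c(j := c j - 1)"
  let ?A = "adl W j c" and ?Z = "concat (map (row W c) [Suc j..<m])"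
  have A: "adl W j ?c = ?A" by (rule adl_cong) simp
  have Z: "concat (map (row W ?c) [Suc j..<m]) = ?Z"
    by (intro arg_cong[of _ _ concat] map_cong refl) (simp add: row_def)
  have fA: "map f' ?A = map f ?A"
  proof (intro map_cong refl o disjI1)
    fix a assume "a \<in> set ?A"
    then show "a < j*W" using adl_bound[of j c W a] c j by simp
  qed
  have fZ: "map f' ?Z = map f ?Z"
  proof (intro map_cong refl o disjI2)
    fix a assume "a \<in> set ?Z"
    then obtain j' where "Suc j <= j'" "a \<in> set (row W c j')" by auto
    then have "Suc j*W <= j'*W" "j'*W <= a" by (auto simp only: set_row atLeastLessThan_iff intro!: mult_le_mono1)
    then show "j*W + W <= a" by simp
  qed
  have row': "map f' (row W ?c j) = take i (map f (row W c j)) @ drop (Suc i) (map f (row W c j))"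
  proof (rule nth_equalityI)
    fix q assume "q < length (map f' (row W ?c j))"
    then have q: "q < c j - 1" by (simp add: row_def)
    show "map f' (row W ?c j) ! q = (take i (map f (row W c j)) @ drop (Suc i) (map f (row W c j))) ! q"
    proof (cases "q < i")
      case True
      then show ?thesis using q i f(1) by (simp add: row_def nth_append)
    next
      case False
      then show ?thesis using q i f(2)[of q] by (simp add: row_def nth_append)
    qed
  qed (use i in "simp add: row_def")
  have l: "length (map f ?A) = (\<Sum>j'<j. c j')" by (simp add: length_adl)
  show ?thesis
    unfolding adl_split[OF j] A Z map_append fA fZ row' p using l i by (simp add: row_def)
qed

section \<open>Locating a position\<close>

text \<open>The loop stops once the offset is at most the size of the block, so a boundary position
  counts as the end of the earlier block and a positive offset stays positive. This suits insertion.
  Deletion locates the following position and steps back by one, which yields an offset strictly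
  inside the block.\<close>

definition locate :: "nat => com" where
  "locate b = seqs [Set vj (Const 0), While (Less (Cell (cnt b) (V vj)) (V vi))
     (seqs [Set vi (Minus (V vi) (Cell (cnt b) (V vj))), Set vj (Plus (V vj) (Const 1))])]"

lemma locate_run:
  assumes b: "40 <= b" and p: "s$vi = p" "p <= (\<Sum>j<Suc m. words s (cnt b) j)"
    and B: "p <= B" "m + 2 <= B" "!!j. j <= m ==> words s (cnt b) j <= B"
  shows "run B (locate b) s (50*(m + 1)) (%s'. same_but {vi, vj} s s' & s'$vj <= m &
    s'$vi <= words s (cnt b) (s'$vj) &
    p = (\<Sum>j<s'$vj. words s (cnt b) j) + s'$vi & (0 < p --> 0 < s'$vi))"
proof -
  let ?c = "words s (cnt b)"
  define I where "I n s1 \<longleftrightarrow> same_but {vi, vj} s s1 & s1$vj + n = m &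
    p = (\<Sum>j<s1$vj. ?c j) + s1$vi & (0 < p --> 0 < s1$vi)" for n s1
  have c: "words s1 (cnt b) = ?c" if "I n s1" for n s1 using that b unfolding I_def by auto
  have 1: "run B (Set vj (Const 0)) s 10 (I m)"
    by (rule run_loop_free) (use p in "auto simp: I_def words_other")
  have 2: "run B (While (Less (Cell (cnt b) (V vj)) (V vi))
     (seqs [Set vi (Minus (V vi) (Cell (cnt b) (V vj))), Set vj (Plus (V vj) (Const 1))])) s1 (m*(6 + 20) + 6)
     (%s'. same_but {vi, vj} s s' & s'$vj <= m &
    s'$vi <= words s (cnt b) (s'$vj) &
    p = (\<Sum>j<s'$vj. words s (cnt b) j) + s'$vi & (0 < p --> 0 < s'$vi))" if I0: "I m s1" for s1
  proof (rule run_mono[OF run_loop[where I = I and k = 20, OF I0]])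
    show "tfits B (Less (Cell (cnt b) (V vj)) (V vi)) s2" if "I n s2" for n s2
      using that c[OF that] B unfolding I_def by auto
    show "~ tval (Less (Cell (cnt b) (V vj)) (V vi)) s2" if "I 0 s2" for s2
      using that c[OF that] p(2) unfolding I_def by auto
    show "run B (seqs [Set vi (Minus (V vi) (Cell (cnt b) (V vj))), Set vj (Plus (V vj) (Const 1))]) s2 20 (I n)"
      if i: "I (Suc n) s2" and t: "tval (Less (Cell (cnt b) (V vj)) (V vi)) s2" for n s2
    proof (rule run_loop_free)
      let ?r = "result (seqs [Set vi (Minus (V vi) (Cell (cnt b) (V vj))), Set vj (Plus (V vj) (Const 1))]) s2"
      show "fits B (seqs [Set vi (Minus (V vi) (Cell (cnt b) (V vj))), Set vj (Plus (V vj) (Const 1))]) s2"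
        using i c[OF i] B unfolding I_def by auto
      have "?r$vi = s2$vi - ?c (s2$vj)" "?r$vj = Suc (s2$vj)"
        "same_but {vi, vj} s2 ?r" using c[OF i] by (auto simp: words_other)
      then show "I n ?r" using i t c[OF i] unfolding I_def by auto
    qed simp_all
    show "same_but {vi, vj} s s2 & s2$vj <= m &
      s2$vi <= words s (cnt b) (s2$vj) &
      p = (\<Sum>j<s2$vj. words s (cnt b) j) + s2$vi & (0 < p --> 0 < s2$vi)"
      if i: "I n s2" and t: "~ tval (Less (Cell (cnt b) (V vj)) (V vi)) s2" for n s2
      using i t c[OF i] unfolding I_def by auto
  qed auto
  show ?thesis unfolding locate_def
    by (rule run_mono[OF run_seqs[OF 1 run_seqs1[OF 2]]]) auto
qed

section \<open>Shifting elements inside a block\<close>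

definition dsame :: "nat => state => state => bool" where
  "dsame b s s' \<longleftrightarrow> (\<forall>a. a \<notin> dmod b --> a \<notin> {aL b, aR b, aM b, fresh b} --> words s' a = words s a)"

text \<open>Unless the structure is marked as big, the elements at the addresses \<open>A\<close> are organised in levels.\<close>

definition levelled :: "state => nat => nat => nat set => nat => bool" where
  "levelled s b H A lm \<longleftrightarrow> s$big b <= 1 & (s$big b = 0 -->
     (\<exists>g n. n <= lm & lvls s b H A g n {} & leveling A (keys s b) g n))"

lemma leveling_cong: "(!!y. y \<in> A ==> f' y = f y) ==> leveling A f' g n \<longleftrightarrow> leveling A f g n"
  unfolding leveling_def by (simp cong: conj_cong)

definition move :: "nat => com" where
  "move b = seqs [KeyCopy b (V vdst) b (V vsrc), Cond (Less (V (big b)) (Const 1)) (dmove b) Skip]"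

lemma lvls_store_key: "lvls (store_key a i x s) b H A g n T = lvls s b H A g n T"
  by (simp add: lvls_def null_ok_def)

text \<open>The key is copied before the levels are updated, and the source keeps its own key; the
  rank search for the source still depends on it.\<close>

lemma move_run:
  assumes b: "40 <= b" and B: "s$fresh b + 4*H + 20 <= B" "2*2^H + 4 <= B"
    and l: "levelled s b H A lm"
    and src: "s$vsrc = src" "src \<in> A" "src <= B" and dst: "s$vdst = dst" "dst \<notin> A" "dst < 2^H - 1"
    and bt: "!!y. y \<in> A ==> y ~= src ==> y < src \<longleftrightarrow> y < dst"
  shows "run B (move b) s (1100*(H + 1)^2) (%s'. dsame b s s' &
    keys s' = (keys s)(b := (keys s b)(dst := keys s b src)) &
    s'$fresh b <= s$fresh b + (2*H + 2) &
    levelled s' b H (insert dst (A - {src})) lm)"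
proof -
  let ?s1 = "store_key b dst (keys s b src) s"
  have k1: "keys ?s1 = (keys s)(b := (keys s b)(dst := keys s b src))" by (simp add: store_key_def)
  have 1: "run B (KeyCopy b (V vdst) b (V vsrc)) s 10 (%s1. s1 = ?s1)"
    by (rule run_loop_free) (use src dst B in auto)
  have 2: "run B (Cond (Less (V (big b)) (Const 1)) (dmove b) Skip) s1 (4 + 1000*(H + 1)^2)
    (%s'. dsame b s s' &
    keys s' = (keys s)(b := (keys s b)(dst := keys s b src)) &
    s'$fresh b <= s$fresh b + (2*H + 2) &
    levelled s' b H (insert dst (A - {src})) lm)" if s1: "s1 = ?s1" for s1
  proof (rule run_mono[OF run_Cond])
    have w: "words s1 = words s" by (simp add: s1)
    show "tfits B (Less (V (big b)) (Const 1)) s1" using l B w by (simp add: levelled_def)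
    show "run B Skip s1 (1000*(H + 1)^2) (%s'. dsame b s s' &
    keys s' = (keys s)(b := (keys s b)(dst := keys s b src)) &
    s'$fresh b <= s$fresh b + (2*H + 2) &
    levelled s' b H (insert dst (A - {src})) lm)" if "~ tval (Less (V (big b)) (Const 1)) s1"
      by (rule run_loop_free) (use that w l k1 in "auto simp: s1 dsame_def levelled_def")
    assume "tval (Less (V (big b)) (Const 1)) s1"
    then have b0: "s$big b = 0" using w by simp
    then obtain g n where n: "n <= lm" and lv: "lvls s b H A g n {}" and L: "leveling A (keys s b) g n"
      using l unfolding levelled_def by blast
    have lv1: "lvls s1 b H A g n {}" using lv by (simp add: s1 lvls_store_key)
    have "leveling A (keys s1 b) g n \<longleftrightarrow> leveling A (keys s b) g n"
      by (rule leveling_cong) (use dst in "auto simp: s1")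
    then have L1: "leveling A (keys s1 b) g n" using L by simp
    show "run B (dmove b) s1 (1000*(H + 1)^2) (%s'. dsame b s s' &
      keys s' = (keys s)(b := (keys s b)(dst := keys s b src)) &
      s'$fresh b <= s$fresh b + (2*H + 2) &
      levelled s' b H (insert dst (A - {src})) lm)"
    proof (rule run_mono[OF dmove_run[OF b _ B(2) lv1 L1 _ src(2) _ dst(2,3) bt] order_refl])
      show "keys s1 b dst = keys s1 b src" by (simp add: s1)
      fix s' assume s': "ext (dmod b) b s1 s' &
        s'$fresh b <= s1$fresh b + (2*H + 2) &
        (\<exists>g'. lvls s' b H (insert dst (A - {src})) g' n {} & leveling (insert dst (A - {src})) (keys s1 b) g' n)"
      have "keys s' = keys s1" using s' ext_keys by blast
      moreover have "dsame b s s'" using s' w unfolding dsame_def ext_def by simp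
      moreover have "s'$big b = 0" using b0 w s' b unfolding ext_def by auto
      ultimately show "dsame b s s' &
        keys s' = (keys s)(b := (keys s b)(dst := keys s b src)) &
        s'$fresh b <= s$fresh b + (2*H + 2) &
        levelled s' b H (insert dst (A - {src})) lm" using s' n w k1 s1 unfolding levelled_def by auto
    qed (use w B src dst in auto)
  qed auto
  show ?thesis unfolding move_def
    by (rule run_mono[OF run_seqs[OF 1 run_seqs1[OF 2]]]) (use sq_ge[of H] in auto)
qed

definition shift_up :: "nat => com" where
  "shift_up b = seqs [seqs [Set vdst (Plus (V vbase) (V vtt)), Set vsrc (Minus (Plus (V vbase) (V vtt)) (Const 1))],
     move b, Set vtt (Minus (V vtt) (Const 1))]"

definition shift_down :: "nat => com" where
  "shift_down b = seqs [seqs [Set vsrc (Plus (V vbase) (V vtt)), Set vdst (Minus (Plus (V vbase) (V vtt)) (Const 1))],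
     move b, Set vtt (Plus (V vtt) (Const 1))]"

text \<open>Blocks are six times \<open>\<sigma>\<close> wide: they are filled up to
  \<open>\<sigma>\<close> when built and gain at most one element per update, of which a structure
  sees at most \<open>2*\<sigma> + 1\<close>.\<close>

definition set_base :: "nat => com" where
  "set_base b = Set vbase (Times (V vj) (Times (Const 6) (V (sz b))))"

text \<open>
  Insertion of the key in cell 0 of key array 0 at offset \<open>vi\<close> of block \<open>vj\<close>. A structure with
  more than \<open>C*\<sigma>\<close> levels is marked as big and its levels are given up.
\<close>

definition ins_at :: "nat => nat => com" where
  "ins_at C b = seqs [
     seqs [set_base b, Set vtt (Cell (cnt b) (V vj))],
     While (Less (V vi) (V vtt)) (shift_up b),
     KeyCopy b (Plus (V vbase) (V vi)) 0 (Const 0),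
     Cond (Less (V (big b)) (Const 1))
       (seqs [Set vkk (Plus (V vbase) (V vi)), dins b,
          Cond (Less (Times (Const C) (V (sz b))) (V (nl b))) (Set (big b) (Const 1)) Skip]) Skip,
     Store (cnt b) (V vj) (Plus (Cell (cnt b) (V vj)) (Const 1))]"

text \<open>The element leaves the levels before the shift, which frees its address for the right
  neighbour.\<close>

definition del_at :: "nat => com" where
  "del_at b = seqs [
     set_base b,
     Cond (Less (V (big b)) (Const 1)) (seqs [Set vkk (Plus (V vbase) (V vi)), ddel b]) Skip,
     Set vtt (Plus (V vi) (Const 1)),
     While (Less (V vtt) (Cell (cnt b) (V vj))) (shift_down b),
     Store (cnt b) (V vj) (Minus (Cell (cnt b) (V vj)) (Const 1))]"

abbreviation (input) pmod :: "nat => nat set" where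
  "pmod b == {2..<40} \<union> {aL b, aR b, aM b, fresh b, root b, nl b, cnt b, big b}"

definition pframe :: "nat => state => state => bool" where
  "pframe b s s' \<longleftrightarrow> (\<forall>a. a \<notin> pmod b --> words s' a = words s a) & (\<forall>k. k ~= b --> keys s' k = keys s k)"

lemma pframe_trans: "pframe b s s' ==> pframe b s' s'' ==> pframe b s s''"
  by (simp add: pframe_def)

definition stored :: "state => nat => nat => nat => real list => bool" where
  "stored s b \<sigma> m xs \<longleftrightarrow> s$cb b = m & s$sz b = \<sigma> & (\<forall>j\<le>m. words s (cnt b) j <= 6*\<sigma>) &
     map (keys s b) (adl (6*\<sigma>) (Suc m) (words s (cnt b))) = xs"

lemma levelled_ext:
  assumes e: "ext N b s s'" "N \<subseteq> {..<40}" "40 <= b" and l: "levelled s b H A lm"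
  shows "levelled s' b H A lm"
proof -
  have "b + c \<notin> N" for c using e(2,3) by fastforce
  then have w: "words s' (big b) = words s (big b)" using e(1) by (simp add: ext_def)
  show ?thesis using l lvls_ext[OF e] unfolding levelled_def w ext_keys[OF e(1)] by blast
qed

lemma dsame_word: "dsame b s s' ==> a \<notin> dmod b ==> a \<notin> {aL b, aR b, aM b, fresh b} ==> words s' a = words s a"
  by (simp add: dsame_def)

lemma ins_budget:
  fixes z :: nat
  assumes "1 <= z"
  shows "20 + ((q*(5 + 1200*z) + 5) + (10 + ((4 + (10 + ((c + 1)*(2000*z) + 20))) + 20))) <= (q + c + 2)*(2000*z)"
  using assms by (cases z) (auto simp: algebra_simps)

text \<open>During the shift the addresses in use are \<open>A'\<close> minus a single free one,
  which wanders from the end of the block down to the insertion point. The time keeps the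
  \<open>q\<close> shifts and the \<open>cc\<close> cascade passes apart, because both are bounded
  by a constant when appending.\<close>

lemma ins_at_run:
  assumes b: "40 <= b" and st: "stored s b \<sigma> m xs" and j: "s$vj = j" "j <= m"
    and i: "s$vi = i" "i <= words s (cnt b) j" "words s (cnt b) j < 6*\<sigma>"
    and p: "p = (\<Sum>j'<j. words s (cnt b) j') + i"
    and x: "keys s 0 0 = x" "x \<notin> set xs" "distinct xs"
    and l: "levelled s b H (set (adl (6*\<sigma>) (Suc m) (words s (cnt b)))) (C*\<sigma>)"
    and H: "Suc m*(6*\<sigma>) + 2 <= 2^H"
    and B: "s$fresh b + 6*\<sigma>*(2*H + 2) + (C*\<sigma> + 3)*(4*H + 4) + 40 <= B" "2*2^H + 4 <= B" "C <= B"
    and q: "q = words s (cnt b) j - i"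
    and c': "c' = (words s (cnt b))(j := Suc (words s (cnt b) j))"
    and cc: "cc = (if \<forall>y\<in>set (adl (6*\<sigma>) (Suc m) c') - {j*(6*\<sigma>) + i}. y < j*(6*\<sigma>) + i then 1 else C*\<sigma> + 1)"
    and xs': "xs' = take p xs @ x # drop p xs"
  shows "run B (ins_at C b) s ((q + cc + 2)*(2000*(H + 1)^2)) (%s'. pframe b s s' &
    words s' (cnt b) = c' & stored s' b \<sigma> m xs' & levelled s' b H (set (adl (6*\<sigma>) (Suc m) c')) (C*\<sigma>) &
    (s'$big b ~= 0 --> s$big b ~= 0 \<or> C*\<sigma> < LIS xs') &
    s'$fresh b <= s$fresh b + q*(2*H + 2) + (C*\<sigma> + 2)*(4*H + 4))"
proof -
  let ?W = "6*\<sigma>" and ?c = "words s (cnt b)" and ?f = "keys s b" and ?fr = "s$fresh b"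
  let ?a = "%t. j*?W + t"
  define A' where "A' = set (adl ?W (Suc m) c')"
  have cW: "!!j. j < Suc m ==> ?c j <= ?W" and cbm: "s$cb b = m" and szs: "s$sz b = \<sigma>"
    and xs: "map ?f (adl ?W (Suc m) ?c) = xs" using st unfolding stored_def by auto
  have c'W: "!!j. j < Suc m ==> c' j <= ?W" using cW i(3) by (auto simp: c')
  have jm: "j < Suc m" using j by simp
  have jW: "Suc j*?W <= Suc m*?W" using jm by (intro mult_le_mono1) simp
  have A'b: "y < 2^H - 1" if "y \<in> A'" for y using adl_bound[OF c'W] that H unfolding A'_def by fastforce
  have A'i: "?a t \<in> A' \<longleftrightarrow> t < Suc (?c j)" if "t < ?W" for t
    using in_block_iff[where c = c', OF c'W jm that] unfolding A'_def by (simp add: c')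
  \<comment> \<open>Before the shift the free address is the one just past the end of block
    \<open>j\<close>.\<close>
  have A0: "A' - {?a (?c j)} = set (adl ?W (Suc m) ?c)"
  proof -
    have "set (adl ?W (Suc m) ?c) = set (adl ?W (Suc m) (?c(j := ?c j)))" by simp
    then have "A' = insert (?a (?c j)) (set (adl ?W (Suc m) ?c))"
      unfolding A'_def c' set_adl_upd[OF jm] by auto
    moreover have "?a (?c j) \<notin> set (adl ?W (Suc m) ?c)"
      using in_block_iff[where c = ?c, OF cW jm i(3)] by simp
    ultimately show ?thesis by auto
  qed
  have jB: "j*?W + ?W <= B"
  proof -
    have "j*?W + ?W = Suc j*?W" by simp
    then show ?thesis using jW H B(2) by linarith
  qed
  have 1: "run B (seqs [set_base b, Set vtt (Cell (cnt b) (V vj))]) s 20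
    (%s1. s1 = store_word vtt 0 (?c j) (store_word vbase 0 (j*?W) s))"
  proof (rule run_loop_free)
    have "6*\<sigma> <= B" "j*(6*\<sigma>) <= B" using jB by auto
    moreover have "j <= B"
    proof -
      have "1 <= \<sigma>" using i(3) by simp
      then have "j <= j*(6*\<sigma>)" by simp
      then show ?thesis using calculation by linarith
    qed
    ultimately show "fits B (seqs [set_base b, Set vtt (Cell (cnt b) (V vj))]) s"
      using j i szs b B(1) by (auto simp: set_base_def)
    show "result (seqs [set_base b, Set vtt (Cell (cnt b) (V vj))]) s = store_word vtt 0 (?c j) (store_word vbase 0 (j*?W) s)"
      using j szs b by (simp add: set_base_def)
  qed (simp_all add: set_base_def)
  define I where "I q s1 \<longleftrightarrow> pframe b s s1 & words s1 (cnt b) = ?c & words s1 (big b) = words s (big b) &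
    s1$vj = j & s1$vi = i & s1$vbase = j*?W & s1$vtt = i + q & i + q <= ?c j &
    (\<forall>a. a < j*?W \<or> j*?W + ?W <= a --> keys s1 b a = ?f a) &
    (\<forall>i'<i + q. keys s1 b (?a i') = ?f (?a i')) & (\<forall>i'. i + q <= i' --> i' < ?c j --> keys s1 b (?a (Suc i')) = ?f (?a i')) &
    levelled s1 b H (A' - {?a (i + q)}) (C*\<sigma>) &
    s1$fresh b + q*(2*H + 2) <= ?fr + (?c j - i)*(2*H + 2)" for q s1
  have qi: "i + q = ?c j" using q i by simp
  have Iq: "I q s1" if s1: "s1 = store_word vtt 0 (?c j) (store_word vbase 0 (j*?W) s)" for s1
  proof -
    have e: "ext {vtt, vbase} b s s1" unfolding s1 by (rule same_ext) (use b in "auto simp: words_other")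
    have "levelled s1 b H (A' - {?a (i + q)}) (C*\<sigma>)" unfolding qi A0 by (rule levelled_ext[OF e _ b l]) auto
    moreover have "pframe b s s1" unfolding pframe_def s1 by (auto simp: words_other)
    ultimately show ?thesis unfolding I_def qi using j i b q by (auto simp: s1 words_other)
  qed
  have 2: "run B (While (Less (V vi) (V vtt)) (shift_up b)) s1 (q*(5 + 1200*(H + 1)^2) + 5) (I 0)"
    if s1: "s1 = store_word vtt 0 (?c j) (store_word vbase 0 (j*?W) s)" for s1
  proof (rule run_mono[OF run_loop[where I = I and n = q]])
    show "I q s1" using Iq[OF s1] .
    show "tfits B (Less (V vi) (V vtt)) s2" if "I n s2" for n s2 using that i(3) jB unfolding I_def by auto
    show "~ tval (Less (V vi) (V vtt)) s2" if "I 0 s2" for s2 using that unfolding I_def by auto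
    show "I 0 s2" if "I n s2" "~ tval (Less (V vi) (V vtt)) s2" for n s2
    proof -
      have "n = 0" using that unfolding I_def by auto
      then show ?thesis using that by simp
    qed
    show "run B (shift_up b) s2 (1200*(H + 1)^2) (I n)" if I2: "I (Suc n) s2" for n s2
    proof -
      have a: "pframe b s s2" "words s2 (cnt b) = ?c" "words s2 (big b) = words s (big b)" "s2$vj = j" "s2$vi = i" "s2$vbase = j*?W"
        "s2$vtt = i + Suc n" "i + Suc n <= ?c j"
        "!!a. a < j*?W \<or> j*?W + ?W <= a ==> keys s2 b a = ?f a"
        "!!i'. i' < i + Suc n ==> keys s2 b (?a i') = ?f (?a i')"
        "!!i'. i + Suc n <= i' ==> i' < ?c j ==> keys s2 b (?a (Suc i')) = ?f (?a i')"
        "levelled s2 b H (A' - {?a (i + Suc n)}) (C*\<sigma>)"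
        "s2$fresh b + Suc n*(2*H + 2) <= ?fr + (?c j - i)*(2*H + 2)"
        using I2 unfolding I_def by blast+
      let ?src = "?a (i + n)" and ?dst = "?a (i + Suc n)"
      let ?s3 = "store_word vsrc 0 ?src (store_word vdst 0 ?dst s2)"
      have dB: "?dst <= B" "?dst < j*?W + ?W" using a(8) i(3) jB by auto
      have A: "run B (seqs [Set vdst (Plus (V vbase) (V vtt)), Set vsrc (Minus (Plus (V vbase) (V vtt)) (Const 1))]) s2 20 (%s3. s3 = ?s3)"
        by (rule run_loop_free) (use a dB in auto)
      have inA: "?src \<in> A' - {?dst}" "?dst \<in> A'" using A'i[of "i + n"] A'i[of "i + Suc n"] a(8) i(3) by auto
      have fle: "?fr + (?c j - i)*(2*H + 2) + 4*H + 20 <= B"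
      proof -
        have "(?c j - i)*(2*H + 2) <= 6*\<sigma>*(2*H + 2)" using i(3) by (intro mult_le_mono1) simp
        then show ?thesis using B(1) by (simp add: algebra_simps)
      qed
      define P4 where "P4 s4 \<longleftrightarrow> pframe b s s4 & words s4 (cnt b) = ?c & words s4 (big b) = words s (big b) & s4$vj = j & s4$vi = i & s4$vbase = j*?W &
        s4$vtt = i + Suc n & keys s4 b = (keys s2 b)(?dst := keys s2 b ?src) &
        s4$fresh b <= s2$fresh b + (2*H + 2) & levelled s4 b H (A' - {?src}) (C*\<sigma>)" for s4
      have C: "run B (move b) s3 (1100*(H + 1)^2) P4" if s3: "s3 = ?s3" for s3
      proof -
        have e: "ext {vsrc, vdst} b s2 s3" unfolding s3 by (rule same_ext) (use b in "auto simp: words_other")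

        have l3: "levelled s3 b H (A' - {?dst}) (C*\<sigma>)"
          by (rule levelled_ext[OF e _ b a(12)]) auto
        show ?thesis
        proof (rule run_mono[OF move_run[OF b _ B(2) l3, where src = ?src and dst = ?dst] order_refl])
          show "s3$fresh b + 4*H + 20 <= B" using a(13) fle b by (simp add: s3)
          show "s3$vsrc = ?src" "s3$vdst = ?dst" by (simp_all add: s3)
          show "?src \<in> A' - {?dst}" "?src <= B" using inA dB by auto
          show "?dst \<notin> A' - {?dst}" "?dst < 2^H - 1" using A'b inA by auto
          show "y < ?src \<longleftrightarrow> y < ?dst" if "y \<in> A' - {?dst}" "y ~= ?src" for y using that by auto
          fix s4 assume s4: "dsame b s3 s4 & keys s4 = (keys s3)(b := (keys s3 b)(?dst := keys s3 b ?src)) &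
            s4$fresh b <= s3$fresh b + (2*H + 2) & levelled s4 b H (insert ?dst (A' - {?dst} - {?src})) (C*\<sigma>)"
          have k: "keys s4 = (keys s2)(b := (keys s2 b)(?dst := keys s2 b ?src))" using s4 s3 by simp
          have d: "dsame b s3 s4" using s4 by blast
          have w: "words s4 (cnt b) = words s3 (cnt b)" "words s4 (big b) = words s3 (big b)" "words s4 vj = words s3 vj" "words s4 vi = words s3 vi" "words s4 vbase = words s3 vbase" "words s4 vtt = words s3 vtt"
            using b by (auto intro!: dsame_word[OF d])
          have "pframe b s2 s4" using d b unfolding pframe_def dsame_def k s3 by (auto simp: words_other)
          then have "pframe b s s4" using a(1) pframe_trans by blast
          moreover have "insert ?dst (A' - {?dst} - {?src}) = A' - {?src}" using inA by auto
          ultimately show "P4 s4" unfolding P4_def using s4 w a(2-7) b k by (simp add: s3 words_other)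
        qed
      qed
      have D: "run B (Set vtt (Minus (V vtt) (Const 1))) s4 10 (I n)" if P: "P4 s4" for s4
      proof (rule run_loop_free)
        let ?s5 = "store_word vtt 0 (i + n) s4"
        have k: "keys s4 b = (keys s2 b)(?dst := keys s2 b ?src)" using P unfolding P4_def by blast
        have e: "ext {vtt} b s4 ?s5" by (rule ext_store) (use b in auto)
        have "levelled ?s5 b H (A' - {?src}) (C*\<sigma>)"
          by (rule levelled_ext[OF e _ b]) (use P in "auto simp: P4_def")
        moreover have "pframe b s ?s5" using P unfolding P4_def pframe_def by (auto simp: words_other)
        moreover have "\<forall>a. a < j*?W \<or> j*?W + ?W <= a --> keys ?s5 b a = ?f a" using a(9) k dB by auto
        moreover have "\<forall>i'<i + n. keys ?s5 b (?a i') = ?f (?a i')" using a(10) k by auto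
        moreover have "\<forall>i'. i + n <= i' --> i' < ?c j --> keys ?s5 b (?a (Suc i')) = ?f (?a i')"
        proof (intro allI impI)
          fix i' assume i': "i + n <= i'" "i' < ?c j"
          show "keys ?s5 b (?a (Suc i')) = ?f (?a i')"
          proof (cases "i' = i + n")
            case True
            then show ?thesis using k a(10)[of "i + n"] by simp
          next
            case False
            then show ?thesis using k a(11)[of i'] i' by simp
          qed
        qed
        ultimately have "I n ?s5" unfolding I_def using P a(8,13) b unfolding P4_def by (simp add: words_other)
        then show "I n (result (Set vtt (Minus (V vtt) (Const 1))) s4)" using P unfolding P4_def by simp
        show "fits B (Set vtt (Minus (V vtt) (Const 1))) s4" using P dB unfolding P4_def by simp
      qed simp_all
      show ?thesis unfolding shift_up_def
        by (rule run_mono[OF run_seqs[OF A run_seqs[OF C run_seqs1[OF D]]]]) (use sq_ge[of H] in auto)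
    qed
  qed (simp_all add: add_mult_distrib2)
  let ?k = "?a i"
  define Q where "Q s1 \<longleftrightarrow> pframe b s s1 & words s1 (cnt b) = ?c &
    s1$vj = j & s1$vi = i & s1$vbase = j*?W & map (keys s1 b) (adl ?W (Suc m) c') = xs'" for s1
  have kA: "?k \<in> A'" using A'i[of i] i by auto
  have kB: "?k <= B" using i(2,3) jB by simp
  define f2 where "f2 = s$big b"
  have 3: "run B (KeyCopy b (Plus (V vbase) (V vi)) 0 (Const 0)) s1 10
    (%s2. Q s2 & words s2 (big b) = words s (big b) & levelled s2 b H (A' - {?k}) (C*\<sigma>) & s2$fresh b <= ?fr + q*(2*H + 2))" if I1: "I 0 s1" for s1
  proof (rule run_loop_free)
    let ?c3 = "KeyCopy b (Plus (V vbase) (V vi)) 0 (Const 0)"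
    let ?s = "store_key b ?k x s1"
    have a: "pframe b s s1" "words s1 (cnt b) = ?c" "words s1 (big b) = words s (big b)" "s1$vj = j" "s1$vi = i" "s1$vbase = j*?W"
        "!!a. a < j*?W \<or> j*?W + ?W <= a ==> keys s1 b a = ?f a"
        "!!i'. i' < i ==> keys s1 b (?a i') = ?f (?a i')"
        "!!i'. i <= i' ==> i' < ?c j ==> keys s1 b (?a (Suc i')) = ?f (?a i')"
        "levelled s1 b H (A' - {?k}) (C*\<sigma>)" "s1$fresh b <= ?fr + q*(2*H + 2)"
        using I1 unfolding I_def q by auto
    have x1: "keys s1 0 0 = x" using a(1) x(1) b unfolding pframe_def by auto
    have "map (keys ?s b) (adl ?W (Suc m) c') = xs'" unfolding c' xs' xs[symmetric]
      by (rule adl_insert[OF jm i(2) cW i(3) _ _ _ _ p]) (use a i in auto)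
    moreover have "pframe b s ?s" using a(1) unfolding pframe_def by (auto simp: keys_other)
    ultimately have "Q ?s" unfolding Q_def using a by simp
    moreover have "levelled ?s b H (A' - {?k}) (C*\<sigma>)"
    proof -
      have "leveling (A' - {?k}) (keys ?s b) g n \<longleftrightarrow> leveling (A' - {?k}) (keys s1 b) g n" for g n
        by (rule leveling_cong) auto
      then show ?thesis using a(10) unfolding levelled_def lvls_store_key by simp
    qed
    moreover have "result ?c3 s1 = ?s" using a x1 by simp
    ultimately show "Q (result ?c3 s1) & words (result ?c3 s1) (big b) = words s (big b) & levelled (result ?c3 s1) b H (A' - {?k}) (C*\<sigma>) & (result ?c3 s1)$fresh b <= ?fr + q*(2*H + 2)"
      using a by simp
    show "fits B ?c3 s1" using a kB by simp
  qed simp_all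
  have dxs': "distinct xs'"
    using x set_take_subset[of p xs] set_drop_subset[of p xs] set_take_disj_set_drop_if_distinct[of xs p p] unfolding xs' by auto
  let ?G = "?fr + q*(2*H + 2) + (C*\<sigma> + 2)*(4*H + 4)"
  define R where "R s1 \<longleftrightarrow> Q s1 & levelled s1 b H A' (C*\<sigma>) & s1$fresh b <= ?G &
    (s1$big b ~= 0 --> s$big b ~= 0 \<or> C*\<sigma> < LIS xs')" for s1
  have qW: "q*(2*H + 2) <= 6*\<sigma>*(2*H + 2)" using q i(3) by (intro mult_le_mono1) simp
  have CB: "C*\<sigma> + 1 <= B"
  proof -
    have "C*\<sigma> + 3 <= (C*\<sigma> + 3)*(4*H + 4)" by simp
    then show ?thesis using B(1) by linarith
  qed
  have 4: "run B (Cond (Less (V (big b)) (Const 1))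
       (seqs [Set vkk (Plus (V vbase) (V vi)), dins b,
          Cond (Less (Times (Const C) (V (sz b))) (V (nl b))) (Set (big b) (Const 1)) Skip]) Skip) s2
       (4 + (10 + ((cc + 1)*(2000*(H + 1)^2) + 20))) R"
    if s2: "Q s2 & words s2 (big b) = words s (big b) & levelled s2 b H (A' - {?k}) (C*\<sigma>) & s2$fresh b <= ?fr + q*(2*H + 2)" for s2
  proof (rule run_mono[OF run_Cond])
    have "s2$big b <= 1" using s2 unfolding levelled_def by blast
    then have "s2$big b <= B" "1 <= B" using CB by linarith+
    then show "tfits B (Less (V (big b)) (Const 1)) s2" by simp
    show "run B Skip s2 (10 + ((cc + 1)*(2000*(H + 1)^2) + 20)) R" if "~ tval (Less (V (big b)) (Const 1)) s2"
      by (rule run_loop_free) (use s2 that in "auto simp: R_def levelled_def")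
    assume "tval (Less (V (big b)) (Const 1)) s2"
    then have b0: "s2$big b = 0" by simp
    then obtain g n where n: "n <= C*\<sigma>" and lv: "lvls s2 b H (A' - {?k}) g n {}" and L: "leveling (A' - {?k}) (keys s2 b) g n"
      using s2 unfolding levelled_def by blast
    have Qd: "pframe b s s2" "words s2 (cnt b) = ?c" "s2$vj = j" "s2$vi = i" "s2$vbase = j*?W"
      "map (keys s2 b) (adl ?W (Suc m) c') = xs'" using s2 unfolding Q_def by blast+
    have ik: "insert ?k (A' - {?k}) = A'" using kA by auto
    let ?s3 = "store_word vkk 0 ?k s2"
    have A: "run B (Set vkk (Plus (V vbase) (V vi))) s2 10 (%s3. s3 = ?s3)"
      by (rule run_loop_free) (use Qd kB in auto)
    define P where "P s4 \<longleftrightarrow> Q s4 & s4$fresh b <= ?G & s4$big b = 0 &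
       (\<exists>g n. n <= Suc (C*\<sigma>) & lvls s4 b H A' g n {} & leveling A' (keys s4 b) g n)" for s4
    have D: "run B (dins b) s3 ((cc + 1)*(2000*(H + 1)^2)) P" if s3: "s3 = ?s3" for s3
    proof -
      have e: "ext {vkk} b s2 s3" unfolding s3 by (rule ext_store) (use b in auto)
      have l3: "lvls s3 b H (A' - {?k}) g n {}" by (rule lvls_ext[OF e _ b lv]) auto
      have k3: "keys s3 = keys s2" using ext_keys[OF e] .
      have fr3: "s3$fresh b = s2$fresh b" using b by (simp add: s3)
      have nm: "(n + 3)*(4*H + 4) <= (C*\<sigma> + 3)*(4*H + 4)" using n by (intro mult_le_mono1) simp
      have nm2: "(n + 2)*(4*H + 4) <= (C*\<sigma> + 2)*(4*H + 4)" using n by (intro mult_le_mono1) simp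
      show ?thesis
      proof (rule run_mono[OF dins_run[OF b _ B(2) l3, where k = ?k and c = "if \<forall>y\<in>A' - {?k}. y < ?k then 1 else n + 1"]])
        show "s3$fresh b + (n + 3)*(4*H + 4) + 20 <= B" using fr3 s2 nm qW B(1) by linarith
        show "leveling (A' - {?k}) (keys s3 b) g n" using L k3 by simp
        have "distinct (map (keys s3 b) (adl ?W (Suc m) c'))" using dxs' Qd(6) k3 by simp
        then show "inj_on (keys s3 b) (insert ?k (A' - {?k}))" unfolding ik unfolding A'_def by (simp only: distinct_map)
        show "s3$vkk = ?k" by (simp add: s3)
        show "?k < 2^H - 1" using A'b kA by blast
        have "(if \<forall>y\<in>A' - {?k}. y < ?k then 1 else n + 1) <= cc" using n unfolding cc A'_def by simp
        then show "((if \<forall>y\<in>A' - {?k}. y < ?k then 1 else n + 1) + 1)*(2000*(H + 1)^2) <= (cc + 1)*(2000*(H + 1)^2)"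
          by (intro mult_le_mono1) simp
        fix s4 assume s4: "ext (dmod b) b s3 s4 & s4$fresh b <= s3$fresh b + (n + 2)*(4*H + 4) &
          (\<exists>g' n'. n' <= Suc n & lvls s4 b H (insert ?k (A' - {?k})) g' n' {} & leveling (insert ?k (A' - {?k})) (keys s3 b) g' n')"
        note e4 = conjunct1[OF s4]
        have k4: "keys s4 = keys s2" using ext_keys[OF e4] k3 by simp
        have w: "words s4 (cnt b) = words s3 (cnt b)" "words s4 (big b) = words s3 (big b)" "words s4 vj = words s3 vj" "words s4 vi = words s3 vi" "words s4 vbase = words s3 vbase"
          using b by (auto intro!: ext_word[OF e4])
        have "pframe b s2 s4" using e4 b unfolding pframe_def ext_def k4 s3 by (auto simp: words_other)
        then have "pframe b s s4" using Qd(1) pframe_trans by blast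
        then have "Q s4" unfolding Q_def using w k4 Qd b by (simp add: s3 words_other)
        moreover have "s4$fresh b <= ?G" using s4 fr3 s2 nm2 by linarith
        moreover have "s4$big b = 0" using w b0 b by (simp add: s3)
        moreover have "\<exists>g n. n <= Suc (C*\<sigma>) & lvls s4 b H A' g n {} & leveling A' (keys s4 b) g n"
        proof -
          obtain g' n' where "n' <= Suc n" "lvls s4 b H A' g' n' {}" "leveling A' (keys s3 b) g' n'" using s4 unfolding ik by blast
          then show ?thesis using n k4 k3 by (intro exI[of _ g'] exI[of _ n']) auto
        qed
        ultimately show "P s4" unfolding P_def by blast
      qed simp_all
    qed
    have E: "run B (Cond (Less (Times (Const C) (V (sz b))) (V (nl b))) (Set (big b) (Const 1)) Skip) s4 20 R"
      if P4: "P s4" for s4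
    proof (rule run_loop_free)
      let ?c4 = "Cond (Less (Times (Const C) (V (sz b))) (V (nl b))) (Set (big b) (Const 1)) Skip"
      obtain g n where g: "n <= Suc (C*\<sigma>)" "lvls s4 b H A' g n {}" "leveling A' (keys s4 b) g n" using P4 unfolding P_def by blast
      have nl: "s4$nl b = n" using g(2) unfolding lvls_def by blast
      have Q4: "Q s4" and b4: "s4$big b = 0" and f4: "s4$fresh b <= ?G" using P4 unfolding P_def by blast+
      have sz4: "s4$sz b = \<sigma>" using Q4 szs b unfolding Q_def pframe_def by auto
      have "\<sigma> <= 6*\<sigma>*(2*H + 2)" by simp
      then have "\<sigma> <= B" using B(1) by linarith
      then show "fits B ?c4 s4" using sz4 nl g CB B(3) by simp
      show "R (result ?c4 s4)"
      proof (cases "C*\<sigma> < n")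
        case False
        have "result ?c4 s4 = s4" using False sz4 nl by simp
        moreover have "levelled s4 b H A' (C*\<sigma>)" unfolding levelled_def using b4 g False
          by (intro conjI impI exI[of _ g] exI[of _ n]) auto
        then have "R s4" unfolding R_def using Q4 b4 f4 by simp
        ultimately show ?thesis by simp
      next
        case True
        have rs: "result ?c4 s4 = store_word (big b) 0 1 s4" using True sz4 nl by simp
        \<comment> \<open>The levels are still exact at this moment, so the excessive number of
          levels is the LIS itself and justifies the mark.\<close>
        have "sorted_wrt (<) (adl ?W (Suc m) c')" using sorted_adl[OF c'W] .
        then have "LIS (map (keys s4 b) (adl ?W (Suc m) c')) = n" using leveling_LIS g(3) unfolding A'_def by blast
        then have "LIS xs' = n" using Q4 unfolding Q_def by simp
        moreover have "Q (store_word (big b) 0 1 s4)" using Q4 b unfolding Q_def pframe_def by (auto simp: words_other)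
        ultimately show ?thesis unfolding rs R_def levelled_def using f4 True b by auto
      qed
    qed simp_all
    show "run B (seqs [Set vkk (Plus (V vbase) (V vi)), dins b,
          Cond (Less (Times (Const C) (V (sz b))) (V (nl b))) (Set (big b) (Const 1)) Skip]) s2 (10 + ((cc + 1)*(2000*(H + 1)^2) + 20)) R"
      by (rule run_seqs[OF A run_seqs[OF D run_seqs1[OF E]]])
  qed simp_all
  let ?c5 = "Store (cnt b) (V vj) (Plus (Cell (cnt b) (V vj)) (Const 1))"
  have 5: "run B ?c5 s3 20 (%s'. pframe b s s' &
    words s' (cnt b) = c' & stored s' b \<sigma> m xs' & levelled s' b H (set (adl ?W (Suc m) c')) (C*\<sigma>) &
    (s'$big b ~= 0 --> s$big b ~= 0 \<or> C*\<sigma> < LIS xs') & s'$fresh b <= ?G)" if R3: "R s3" for s3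
  proof (rule run_loop_free)
    let ?s = "store_word (cnt b) j (Suc (?c j)) s3"
    have Q3: "pframe b s s3" "words s3 (cnt b) = ?c" "s3$vj = j" "map (keys s3 b) (adl ?W (Suc m) c') = xs'"
      using R3 unfolding R_def Q_def by blast+
    have w: "words ?s (cnt b) = c'" by (simp add: fun_eq_iff c' Q3(2))
    have pf: "pframe b s ?s" using Q3(1) unfolding pframe_def by (auto simp: words_other)
    have wp: "?s$cb b = m" "?s$sz b = \<sigma>" using pf cbm szs b unfolding pframe_def by auto
    have st': "stored ?s b \<sigma> m xs'" unfolding stored_def w using wp Q3(4) c'W by (auto simp: less_Suc_eq_le)
    have ex8: "ext {cnt b} b s3 ?s" using b unfolding ext_def by (auto simp: words_other)
    have l': "levelled ?s b H A' (C*\<sigma>)"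
      using R3 b ext_tri[OF ex8] ext_null[OF ex8] unfolding R_def levelled_def lvls_def by (auto simp: words_other)
    have rs: "result ?c5 s3 = ?s" using Q3 by simp
    show "pframe b s (result ?c5 s3) &
    words (result ?c5 s3) (cnt b) = c' & stored (result ?c5 s3) b \<sigma> m xs' & levelled (result ?c5 s3) b H (set (adl ?W (Suc m) c')) (C*\<sigma>) &
    ((result ?c5 s3)$big b ~= 0 --> s$big b ~= 0 \<or> C*\<sigma> < LIS xs') & (result ?c5 s3)$fresh b <= ?G"
      unfolding rs using pf w st' l' R3 b unfolding R_def A'_def by simp
    have "j <= B"
    proof -
      have "1 <= \<sigma>" using i(3) by simp
      then have "j <= j*(6*\<sigma>)" by simp
      then show ?thesis using jB by linarith
    qed
    then show "fits B ?c5 s3" using Q3 i(3) jB by auto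
  qed simp_all
  have tm: "20 + ((q*(5 + 1200*(H + 1)^2) + 5) + (10 + ((4 + (10 + ((cc + 1)*(2000*(H + 1)^2) + 20))) + 20)))
     <= (q + cc + 2)*(2000*(H + 1)^2)"
    by (rule ins_budget) simp
  show ?thesis unfolding ins_at_def
    by (rule run_mono[OF run_seqs[OF 1 run_seqs[OF 2 run_seqs[OF 3 run_seqs[OF 4 run_seqs1[OF 5]]]]] tm])
qed

lemma ext_pframe:
  assumes e: "ext N b s s'" and N: "N \<subseteq> pmod b" shows "pframe b s s'"
proof -
  have "words s' a = words s a" if "a \<notin> pmod b" for a
    using ext_word[OF e, of a] that N by blast
  then show ?thesis unfolding pframe_def ext_keys[OF e] by blast
qed

lemma pframe_store: "pframe b s s' ==> a \<in> pmod b ==> pframe b s (store_word a i w s')"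
  unfolding pframe_def by (metis keys_store words_other)

lemma del_budget:
  fixes z :: nat
  assumes "1 <= z" "q <= k"
  shows "20 + ((4 + (10 + (c + 2)*(2000*z))) + (10 + ((q*(6 + 1200*z) + 6) + 20))) <= (k + c + 4)*(2000*z)"
proof -
  have "q*(6 + 1200*z) <= k*(6 + 1200*z)" using assms(2) by (rule mult_le_mono1)
  moreover have "20 + ((4 + (10 + (c + 2)*(2000*z))) + (10 + ((k*(6 + 1200*z) + 6) + 20))) <= (k + c + 4)*(2000*z)"
    using assms(1) by (cases z) (auto simp: algebra_simps)
  ultimately show ?thesis by linarith
qed

text \<open>The free address starts at the deleted element and wanders to the end of the block. A
  deletion does not raise the number of levels, so \<open>lm\<close> serves before and
  after.\<close>

lemma del_at_run:
  assumes b: "40 <= b" and st: "stored s b \<sigma> m xs" and j: "s$vj = j" "j <= m"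
    and i: "s$vi = i" "i < words s (cnt b) j"
    and p: "p = (\<Sum>j'<j. words s (cnt b) j') + i"
    and x: "distinct xs"
    and l: "levelled s b H (set (adl (6*\<sigma>) (Suc m) (words s (cnt b)))) lm"
    and H: "Suc m*(6*\<sigma>) + 2 <= 2^H"
    and B: "s$fresh b + 6*\<sigma>*(2*H + 2) + (lm + 3)*(4*H + 4) + 40 <= B" "2*2^H + 4 <= B"
    and c': "c' = (words s (cnt b))(j := words s (cnt b) j - 1)"
    and xs': "xs' = take p xs @ drop (Suc p) xs"
  shows "run B (del_at b) s ((words s (cnt b) j + lm + 4)*(2000*(H + 1)^2)) (%s'. pframe b s s' &
    words s' (cnt b) = c' & stored s' b \<sigma> m xs' & levelled s' b H (set (adl (6*\<sigma>) (Suc m) c')) lm &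
    s'$big b = s$big b &
    s'$fresh b <= s$fresh b + 6*\<sigma>*(2*H + 2) + (lm + 2)*(4*H + 4))"
proof -
  let ?W = "6*\<sigma>" and ?c = "words s (cnt b)" and ?f = "keys s b" and ?fr = "s$fresh b"
  let ?a = "%t. j*?W + t"
  define A where "A = set (adl ?W (Suc m) ?c)"
  have cW: "!!j. j < Suc m ==> ?c j <= ?W" and cbm: "s$cb b = m" and szs: "s$sz b = \<sigma>"
    and xs: "map ?f (adl ?W (Suc m) ?c) = xs" using st unfolding stored_def by auto
  have jm: "j < Suc m" using j by simp
  have cj: "?c j <= ?W" using cW jm by simp
  have c'W: "c' j' <= ?W" if "j' < Suc m" for j'
  proof (cases "j' = j")
    case True
    then show ?thesis using cj unfolding c' by simp
  next
    case False
    then show ?thesis using cW[OF that] unfolding c' by simp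
  qed
  have jW: "Suc j*?W <= Suc m*?W" using jm by (intro mult_le_mono1) simp
  have Ab: "y < 2^H - 1" if "y \<in> A" for y using adl_bound[OF cW] that H unfolding A_def by fastforce
  have Ai: "?a t \<in> A \<longleftrightarrow> t < ?c j" if "t < ?W" for t
    using in_block_iff[where c = ?c, OF cW jm that] unfolding A_def by simp
  have jB: "j*?W + ?W + 2 <= B"
  proof -
    have "j*?W + ?W = Suc j*?W" by simp
    then show ?thesis using jW H B(2) by linarith
  qed
  have s1: "1 <= \<sigma>" using cj i by (cases \<sigma>) auto
  have jB': "j <= B"
  proof -
    have "j <= j*(6*\<sigma>)" using s1 by simp
    then show ?thesis using jB by linarith
  qed
  \<comment> \<open>After the shift the free address is the former last one of block
    \<open>j\<close>.\<close>
  have fin: "set (adl ?W (Suc m) c') = A - {?a (?c j - 1)}"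
  proof -
    have "A = set (adl ?W (Suc m) (?c(j := ?c j)))" by (simp add: A_def)
    also have "\<dots> = insert (?a (?c j - 1)) (set (adl ?W (Suc m) c'))"
      using i unfolding c' set_adl_upd[OF jm] by auto
    finally have "A = insert (?a (?c j - 1)) (set (adl ?W (Suc m) c'))" .
    moreover have "?a (?c j - 1) \<notin> set (adl ?W (Suc m) c')"
      using in_block_iff[where c = c', OF c'W jm, of "?c j - 1"] cj i by (auto simp: c')
    ultimately show ?thesis by auto
  qed
  have 1: "run B (set_base b) s 20 (%s1. s1 = store_word vbase 0 (j*?W) s)"
  proof (rule run_loop_free)
    have "6*\<sigma> <= B" "j*(6*\<sigma>) <= B" using jB by auto
    then show "fits B (set_base b) s" using j jB' szs b B(1) by (auto simp: set_base_def)
  qed (use j szs b in "simp_all add: set_base_def")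
  let ?k = "?a i"
  have iW: "i < ?W" using i cj by simp
  have kA: "?k \<in> A" using Ai[OF iW] i by auto
  have kB: "?k <= B" using iW jB by simp
  have inj: "inj_on ?f A" using x unfolding xs[symmetric] A_def by (simp only: distinct_map)
  define Q where "Q s1 \<longleftrightarrow> pframe b s s1 & words s1 (cnt b) = ?c & s1$big b = s$big b &
    s1$vj = j & s1$vbase = j*?W" for s1
  have Qst: "Q (store_word vtt i w s1)" if "Q s1" for s1 i w
    using that b pframe_store[of b s s1 vtt] unfolding Q_def by (simp add: words_other)
  let ?fr2 = "?fr + (lm + 2)*(4*H + 4)"
  have lmB: "lm + 3 <= B"
  proof -
    have "lm + 3 <= (lm + 3)*(4*H + 4)" by simp
    then show ?thesis using B(1) by linarith
  qed
  have bg1: "s$big b <= 1" using l unfolding levelled_def by blast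
  have 2: "run B (Cond (Less (V (big b)) (Const 1)) (seqs [Set vkk (Plus (V vbase) (V vi)), ddel b]) Skip) s1
     (4 + (10 + (lm + 2)*(2000*(H + 1)^2)))
     (%s2. Q s2 & s2$vi = i & keys s2 b = ?f & levelled s2 b H (A - {?k}) lm & s2$fresh b <= ?fr2)"
    if s1: "s1 = store_word vbase 0 (j*?W) s" for s1
  proof (rule run_mono[OF run_Cond])
    have e1: "ext {vbase} b s s1" unfolding s1 by (rule ext_store) (use b in auto)
    have Q1: "Q s1" unfolding Q_def pframe_def using b j by (auto simp: s1 words_other)
    have v1: "s1$vi = i" "keys s1 b = ?f" "s1$fresh b = ?fr" "s1$big b = s$big b" using i b by (auto simp: s1)
    show "tfits B (Less (V (big b)) (Const 1)) s1" using v1 bg1 lmB by simp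
    show "run B Skip s1 (10 + (lm + 2)*(2000*(H + 1)^2))
       (%s2. Q s2 & s2$vi = i & keys s2 b = ?f & levelled s2 b H (A - {?k}) lm & s2$fresh b <= ?fr2)"
      if "~ tval (Less (V (big b)) (Const 1)) s1"
      by (rule run_loop_free) (use that Q1 v1 bg1 in "auto simp: levelled_def")
    assume "tval (Less (V (big b)) (Const 1)) s1"
    then have b0: "s$big b = 0" using v1 by simp
    then obtain g n where n: "n <= lm" and lv: "lvls s b H A g n {}" and L: "leveling A ?f g n"
      using l unfolding levelled_def A_def by blast
    let ?s2 = "store_word vkk 0 ?k s1"
    have a: "run B (Set vkk (Plus (V vbase) (V vi))) s1 10 (%s2. s2 = ?s2)"
      by (rule run_loop_free) (use v1 kB Q1 in "auto simp: Q_def")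
    have d: "run B (ddel b) s2 ((lm + 2)*(2000*(H + 1)^2))
       (%s2. Q s2 & s2$vi = i & keys s2 b = ?f & levelled s2 b H (A - {?k}) lm & s2$fresh b <= ?fr2)"
      if s2: "s2 = ?s2" for s2
    proof -
      have e2: "ext {vkk} b s1 s2" unfolding s2 by (rule ext_store) (use b in auto)
      have e: "ext {vbase, vkk} b s s2" by (rule ext_trans[OF e1 e2]) auto
      have l2: "lvls s2 b H A g n {}" by (rule lvls_ext[OF e _ b lv]) auto
      have k2: "keys s2 = keys s" using ext_keys[OF e] .
      have fr2: "s2$fresh b = ?fr" using b v1 by (simp add: s2)
      have nm: "(n + 3)*(4*H + 4) <= (lm + 3)*(4*H + 4)" "(n + 2)*(4*H + 4) <= (lm + 2)*(4*H + 4)"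
        using n by (intro mult_le_mono1, simp)+
      show ?thesis
      proof (rule run_mono[OF ddel_run[OF b _ B(2) l2 _ _ _ kA]])
        show "s2$fresh b + (n + 3)*(4*H + 4) + 20 <= B" using fr2 nm B(1) by linarith
        show "leveling A (keys s2 b) g n" "inj_on (keys s2 b) A" using L inj k2 by simp_all
        show "s2$vkk = ?k" by (simp add: s2)
        show "(n + 2)*(2000*(H + 1)^2) <= (lm + 2)*(2000*(H + 1)^2)" using n by (intro mult_le_mono1) simp
        fix s3 assume s3: "ext (dmod b) b s2 s3 & s3$fresh b <= s2$fresh b + (n + 2)*(4*H + 4) &
          (\<exists>g' n'. n' <= n & lvls s3 b H (A - {?k}) g' n' {} & leveling (A - {?k}) (keys s2 b) g' n')"
        note e3 = conjunct1[OF s3]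
        have k3: "keys s3 = keys s" using ext_keys[OF e3] k2 by simp
        have w: "words s3 (cnt b) = words s2 (cnt b)" "words s3 (big b) = words s2 (big b)" "words s3 vj = words s2 vj" "words s3 vi = words s2 vi" "words s3 vbase = words s2 vbase"
          using b by (auto intro!: ext_word[OF e3])
        have "pframe b s s3" by (rule pframe_trans[OF ext_pframe[OF e] ext_pframe[OF e3]]) auto
        then have Q3: "Q s3" unfolding Q_def using w Q1 b by (simp add: s2 s1 words_other j)
        obtain g' n' where g': "n' <= n" "lvls s3 b H (A - {?k}) g' n' {}" "leveling (A - {?k}) (keys s2 b) g' n'" using s3 by blast
        then have "n' <= lm" "leveling (A - {?k}) (keys s3 b) g' n'" using n k2 k3 by simp_all
        moreover have "s3$big b = 0" using w b0 v1 b by (simp add: s2)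
        ultimately have "levelled s3 b H (A - {?k}) lm" using g'(2) unfolding levelled_def by (metis zero_le)
        note Q3 this
        moreover have "s3$fresh b <= ?fr2" using s3 fr2 nm(2) by linarith
        moreover have "s3$vi = i" "keys s3 b = ?f" using w v1 k3 by (simp_all add: s2)
        ultimately show "Q s3 & s3$vi = i & keys s3 b = ?f & levelled s3 b H (A - {?k}) lm & s3$fresh b <= ?fr2"
          by blast
      qed
    qed
    show "run B (seqs [Set vkk (Plus (V vbase) (V vi)), ddel b]) s1 (10 + (lm + 2)*(2000*(H + 1)^2))
       (%s2. Q s2 & s2$vi = i & keys s2 b = ?f & levelled s2 b H (A - {?k}) lm & s2$fresh b <= ?fr2)"
      by (rule run_seqs[OF a run_seqs1[OF d]])
  qed simp_all
  define I where "I q s1 \<longleftrightarrow> Q s1 & (\<exists>t. s1$vtt = t & t + q = ?c j & i < t &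
    (\<forall>a. a < j*?W \<or> j*?W + ?W <= a --> keys s1 b a = ?f a) &
    (\<forall>i'<i. keys s1 b (?a i') = ?f (?a i')) & (\<forall>i'. i <= i' --> Suc i' < t --> keys s1 b (?a i') = ?f (?a (Suc i'))) &
    (\<forall>i'. t <= i' --> i' < ?c j --> keys s1 b (?a i') = ?f (?a i')) &
    levelled s1 b H (A - {?a (t - 1)}) lm &
    s1$fresh b + q*(2*H + 2) <= ?fr2 + ?c j*(2*H + 2))" for q s1
  have 3: "run B (Set vtt (Plus (V vi) (Const 1))) s2 10 (I (?c j - Suc i))"
    if s2: "Q s2 & s2$vi = i & keys s2 b = ?f & levelled s2 b H (A - {?k}) lm & s2$fresh b <= ?fr2" for s2
  proof (rule run_loop_free)
    let ?s = "store_word vtt 0 (Suc i) s2"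
    have e: "ext {vtt} b s2 ?s" by (rule ext_store) (use b in auto)
    have "levelled ?s b H (A - {?k}) lm" by (rule levelled_ext[OF e _ b]) (use s2 in auto)
    moreover have "Q ?s" using s2 Qst by blast
    moreover have "(?c j - Suc i)*(2*H + 2) <= ?c j*(2*H + 2)" by (intro mult_le_mono1) simp
    then have "?s$fresh b + (?c j - Suc i)*(2*H + 2) <= ?fr2 + ?c j*(2*H + 2)" using s2 b by simp
    moreover have "?s$vtt = Suc i" "Suc i + (?c j - Suc i) = ?c j" "keys ?s b = ?f" using s2 i by auto
    ultimately have "I (?c j - Suc i) ?s" unfolding I_def by auto
    then show "I (?c j - Suc i) (result (Set vtt (Plus (V vi) (Const 1))) s2)" using s2 by simp
    show "fits B (Set vtt (Plus (V vi) (Const 1))) s2" using s2 iW jB by simp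
  qed simp_all
  have 4: "run B (While (Less (V vtt) (Cell (cnt b) (V vj))) (shift_down b)) s2 ((?c j - Suc i)*(6 + 1200*(H + 1)^2) + 6) (I 0)"
    if I0: "I (?c j - Suc i) s2" for s2
  proof (rule run_mono[OF run_loop[where I = I, OF I0]])
    show "tfits B (Less (V vtt) (Cell (cnt b) (V vj))) s1" if "I n s1" for n s1 using that cj jB jB' unfolding I_def Q_def by auto
    show "~ tval (Less (V vtt) (Cell (cnt b) (V vj))) s1" if "I 0 s1" for s1 using that unfolding I_def Q_def by auto
    show "I 0 s1" if "I n s1" "~ tval (Less (V vtt) (Cell (cnt b) (V vj))) s1" for n s1
    proof -
      have "n = 0" using that unfolding I_def Q_def by auto
      then show ?thesis using that by simp
    qed
    show "run B (shift_down b) s1 (1200*(H + 1)^2) (I n)" if I1: "I (Suc n) s1" for n s1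
    proof -
      have Q1: "Q s1" using I1 unfolding I_def by blast
      obtain t where a: "s1$vtt = t" "t + Suc n = ?c j" "i < t"
        "!!a. a < j*?W \<or> j*?W + ?W <= a ==> keys s1 b a = ?f a"
        "!!i'. i' < i ==> keys s1 b (?a i') = ?f (?a i')"
        "!!i'. i <= i' ==> Suc i' < t ==> keys s1 b (?a i') = ?f (?a (Suc i'))"
        "!!i'. t <= i' ==> i' < ?c j ==> keys s1 b (?a i') = ?f (?a i')"
        "levelled s1 b H (A - {?a (t - 1)}) lm"
        "s1$fresh b + Suc n*(2*H + 2) <= ?fr2 + ?c j*(2*H + 2)"
        using I1 unfolding I_def by blast
      let ?src = "?a t" and ?dst = "?a (t - 1)"
      let ?s3 = "store_word vdst 0 ?dst (store_word vsrc 0 ?src s1)"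
      have tW: "t < ?c j" "t < ?W" using a(2) cj by auto
      have dB: "?src <= B" "?dst < j*?W + ?W" using tW jB by auto
      have pre: "run B (seqs [Set vsrc (Plus (V vbase) (V vtt)), Set vdst (Minus (Plus (V vbase) (V vtt)) (Const 1))]) s1 20 (%s3. s3 = ?s3)"
        by (rule run_loop_free) (use a Q1 dB jB in "auto simp: Q_def")
      have inA: "?src \<in> A - {?dst}" "?dst \<in> A" using Ai[of t] Ai[of "t - 1"] tW a(3) by auto
      have fle: "?fr2 + ?c j*(2*H + 2) + 4*H + 20 <= B"
      proof -
        have "?c j*(2*H + 2) <= 6*\<sigma>*(2*H + 2)" using cj by (intro mult_le_mono1)
        then show ?thesis using B(1) by (simp add: algebra_simps)
      qed
      define P4 where "P4 s4 \<longleftrightarrow> Q s4 & s4$vtt = t & keys s4 b = (keys s1 b)(?dst := keys s1 b ?src) &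
        s4$fresh b <= s1$fresh b + (2*H + 2) & levelled s4 b H (A - {?src}) lm" for s4
      have mv: "run B (move b) s3 (1100*(H + 1)^2) P4" if s3: "s3 = ?s3" for s3
      proof -
        have e: "ext {vsrc, vdst} b s1 s3" unfolding s3 by (rule same_ext) (use b in "auto simp: words_other")
        have l3: "levelled s3 b H (A - {?dst}) lm" by (rule levelled_ext[OF e _ b a(8)]) auto
        show ?thesis
        proof (rule run_mono[OF move_run[OF b _ B(2) l3, where src = ?src and dst = ?dst] order_refl])
          have "s3$fresh b = s1$fresh b" using b by (simp add: s3)
          then show "s3$fresh b + 4*H + 20 <= B" using a(9) fle by simp
          show "s3$vsrc = ?src" "s3$vdst = ?dst" by (simp_all add: s3)
          show "?src \<in> A - {?dst}" "?src <= B" using inA dB by auto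
          show "?dst \<notin> A - {?dst}" "?dst < 2^H - 1" using Ab inA by auto
          show "y < ?src \<longleftrightarrow> y < ?dst" if "y \<in> A - {?dst}" "y ~= ?src" for y using that a(3) by auto
          fix s4 assume s4: "dsame b s3 s4 & keys s4 = (keys s3)(b := (keys s3 b)(?dst := keys s3 b ?src)) &
            s4$fresh b <= s3$fresh b + (2*H + 2) & levelled s4 b H (insert ?dst (A - {?dst} - {?src})) lm"
          have k: "keys s4 = (keys s1)(b := (keys s1 b)(?dst := keys s1 b ?src))" using s4 s3 by simp
          have d: "dsame b s3 s4" using s4 by blast
          have w: "words s4 (cnt b) = words s3 (cnt b)" "words s4 (big b) = words s3 (big b)" "words s4 vj = words s3 vj" "words s4 vbase = words s3 vbase" "words s4 vtt = words s3 vtt"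
            using b by (auto intro!: dsame_word[OF d])
          have "pframe b s1 s4" using d b unfolding pframe_def dsame_def k s3 by (auto simp: words_other)
          then have "pframe b s s4" using Q1 pframe_trans unfolding Q_def by blast
          moreover have "insert ?dst (A - {?dst} - {?src}) = A - {?src}" using inA by auto
          moreover have "s3$fresh b = s1$fresh b" using b by (simp add: s3)
          ultimately show "P4 s4" unfolding P4_def Q_def using s4 w Q1 a(1) b k by (simp add: Q_def s3 words_other)
        qed
      qed
      have post: "run B (Set vtt (Plus (V vtt) (Const 1))) s4 10 (I n)" if P: "P4 s4" for s4
      proof (rule run_loop_free)
        let ?s5 = "store_word vtt 0 (Suc t) s4"
        have k: "keys s4 b = (keys s1 b)(?dst := keys s1 b ?src)" using P unfolding P4_def by blast
        have e: "ext {vtt} b s4 ?s5" by (rule ext_store) (use b in auto)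
        have "levelled ?s5 b H (A - {?a (Suc t - 1)}) lm"
          by (rule levelled_ext[OF e _ b]) (use P in "auto simp: P4_def")
        moreover have "Q ?s5" using P Qst unfolding P4_def by blast
        moreover have "\<forall>a. a < j*?W \<or> j*?W + ?W <= a --> keys ?s5 b a = ?f a" using a(4) k dB by auto
        moreover have "\<forall>i'<i. keys ?s5 b (?a i') = ?f (?a i')" using a(3,5) k by auto
        moreover have "\<forall>i'. i <= i' --> Suc i' < Suc t --> keys ?s5 b (?a i') = ?f (?a (Suc i'))"
        proof (intro allI impI)
          fix i' assume i': "i <= i'" "Suc i' < Suc t"
          show "keys ?s5 b (?a i') = ?f (?a (Suc i'))"
          proof (cases "i' = t - 1")
            case True
            then show ?thesis using k a(7)[of t] a(3) tW by simp
          next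
            case False
            then have "?a i' ~= ?dst" by simp
            then have "keys ?s5 b (?a i') = keys s1 b (?a i')" unfolding keys_store k by (rule fun_upd_other)
            moreover have "Suc i' < t" using i' False a(3) by simp
            ultimately show ?thesis using a(6)[of i'] i' by simp
          qed
        qed
        moreover have "\<forall>i'. Suc t <= i' --> i' < ?c j --> keys ?s5 b (?a i') = ?f (?a i')" using a(7) k by auto
        moreover have "?s5$fresh b + n*(2*H + 2) <= ?fr2 + ?c j*(2*H + 2)"
          using P a(9) b unfolding P4_def by simp
        moreover have "?s5$vtt = Suc t" "Suc t + n = ?c j" "i < Suc t" using a(2,3) by auto
        ultimately have "I n ?s5" unfolding I_def by blast
        then show "I n (result (Set vtt (Plus (V vtt) (Const 1))) s4)" using P unfolding P4_def by simp
        show "fits B (Set vtt (Plus (V vtt) (Const 1))) s4" using P tW jB unfolding P4_def by simp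
      qed simp_all
      show ?thesis unfolding shift_down_def
        by (rule run_mono[OF run_seqs[OF pre run_seqs[OF mv run_seqs1[OF post]]]]) (use sq_ge[of H] in auto)
    qed
  qed (simp_all add: add_mult_distrib2)
  let ?c5 = "Store (cnt b) (V vj) (Minus (Cell (cnt b) (V vj)) (Const 1))"
  have 5: "run B ?c5 s3 20 (%s'. pframe b s s' &
    words s' (cnt b) = c' & stored s' b \<sigma> m xs' & levelled s' b H (set (adl ?W (Suc m) c')) lm &
    s'$big b = s$big b &
    s'$fresh b <= ?fr + 6*\<sigma>*(2*H + 2) + (lm + 2)*(4*H + 4))" if I3: "I 0 s3" for s3
  proof (rule run_loop_free)
    let ?s = "store_word (cnt b) j (?c j - 1) s3"
    have Q3: "pframe b s s3" "words s3 (cnt b) = ?c" "s3$vj = j" "s3$big b = s$big b"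
      using I3 unfolding I_def Q_def by blast+
    have a: "!!a. a < j*?W \<or> j*?W + ?W <= a ==> keys s3 b a = ?f a"
        "!!i'. i' < i ==> keys s3 b (?a i') = ?f (?a i')"
        "!!i'. i <= i' ==> Suc i' < ?c j ==> keys s3 b (?a i') = ?f (?a (Suc i'))"
        "levelled s3 b H (A - {?a (?c j - 1)}) lm" "s3$fresh b <= ?fr2 + ?c j*(2*H + 2)"
      using I3 unfolding I_def by auto
    have w: "words ?s (cnt b) = c'" by (simp add: fun_eq_iff c' Q3(2))
    have pf: "pframe b s ?s" by (rule pframe_store[OF Q3(1)]) simp
    have wp: "?s$cb b = m" "?s$sz b = \<sigma>" using pf cbm szs b unfolding pframe_def by auto
    have "map (keys s3 b) (adl ?W (Suc m) c') = xs'" unfolding c' xs' xs[symmetric]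
      by (rule adl_delete[OF jm i(2) cW _ _ _ p]) (use a in auto)
    then have st': "stored ?s b \<sigma> m xs'" unfolding stored_def w using wp c'W by (auto simp: less_Suc_eq_le)
    have ex8: "ext {cnt b} b s3 ?s" using b unfolding ext_def by (auto simp: words_other)
    have l': "levelled ?s b H (set (adl ?W (Suc m) c')) lm"
      using a(4) b ext_tri[OF ex8] ext_null[OF ex8] unfolding fin levelled_def lvls_def by (auto simp: words_other)
    have cjH: "?c j*(2*H + 2) <= 6*\<sigma>*(2*H + 2)" using cj by (intro mult_le_mono1)
    have rs: "result ?c5 s3 = ?s" using Q3 by simp
    have fb: "?s$fresh b <= ?fr + 6*\<sigma>*(2*H + 2) + (lm + 2)*(4*H + 4)"
    proof -
      have "?s$fresh b = s3$fresh b" using b by simp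
      then show ?thesis using a(5) cjH by linarith
    qed
    have "?s$big b = s$big b" using Q3 b by simp
    then show "pframe b s (result ?c5 s3) &
    words (result ?c5 s3) (cnt b) = c' & stored (result ?c5 s3) b \<sigma> m xs' & levelled (result ?c5 s3) b H (set (adl ?W (Suc m) c')) lm &
    (result ?c5 s3)$big b = s$big b &
    (result ?c5 s3)$fresh b <= ?fr + 6*\<sigma>*(2*H + 2) + (lm + 2)*(4*H + 4)"
      unfolding rs using pf w st' l' fb by blast
    show "fits B ?c5 s3" using Q3 cj jB jB' by auto
  qed simp_all
  show ?thesis unfolding del_at_def
  proof (rule run_mono[OF run_seqs[OF 1 run_seqs[OF 2 run_seqs[OF 3 run_seqs[OF 4 run_seqs1[OF 5]]]]]])
    show "20 + ((4 + (10 + (lm + 2)*(2000*(H + 1)^2))) + (10 + (((?c j - Suc i)*(6 + 1200*(H + 1)^2) + 6) + 20)))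
      <= (?c j + lm + 4)*(2000*(H + 1)^2)"
      by (rule del_budget) auto
  qed
qed

section \<open>The maintained structure\<close>

text \<open>The node budget of one update: shifting a whole block, then a cascade through all
  levels.\<close>

definition alloc :: "nat => nat => nat => nat" where
  "alloc C \<sigma> H = 6*\<sigma>*(2*H + 2) + (C*\<sigma> + 3)*(4*H + 4)"

text \<open>
  The structure at base \<open>b\<close> represents \<open>xs\<close> after \<open>e\<close> updates. The levels are exact unless the
  structure is big. The list \<open>bs\<close> consists of the elements appended so far; it ignores the
  updates, and so its \<open>LIS\<close> is only known to be within \<open>e\<close> of that of \<open>xs\<close>.
\<close>

definition X :: "nat => nat => nat => nat => nat => real list => state => bool" where
  "X C b H \<sigma> e xs s \<longleftrightarrow> (\<exists>m. stored s b \<sigma> m xs & 1 <= \<sigma> & 128*\<sigma>*\<sigma> <= 2^H & distinct xs & s$eu b = e &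
     (\<forall>j\<le>m. words s (cnt b) j <= \<sigma> + e) & m*\<sigma> + words s (cnt b) m <= length xs + e &
     s$univ b = 2^H &
     levelled s b H (set (adl (6*\<sigma>) (Suc m) (words s (cnt b)))) (C*\<sigma>) &
     (s$big b ~= 0 --> C*\<sigma> < LIS xs + e) &
     s$fresh b <= 1 + (length xs + 2*e)*alloc C \<sigma> H &
     (\<exists>bs. patience bs (s$ntl b) (keys s (b + 11)) & length bs <= length xs + e &
       (\<forall>zs. LIS (bs @ zs) <= LIS (xs @ zs) + e & LIS (xs @ zs) <= LIS (bs @ zs) + e)))"

definition xframe :: "nat => state => state => bool" where
  "xframe b s s' \<longleftrightarrow> (\<forall>a. a \<notin> {2..<40} \<union> {b + 11..<b + 24} --> words s' a = words s a) &
     (\<forall>k. k \<notin> {b, b + 11} --> keys s' k = keys s k)"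

lemma xframe_trans: "xframe b s s' ==> xframe b s' s'' ==> xframe b s s''"
  by (simp add: xframe_def)

lemma pframe_xframe: "pframe b s s' ==> xframe b s s'"
proof -
  assume p: "pframe b s s'"
  have "words s' a = words s a" if "a \<notin> {2..<40} \<union> {b + 11..<b + 24}" for a
  proof -
    have "a \<notin> pmod b" using that by auto
    then show ?thesis using p unfolding pframe_def by blast
  qed
  then show ?thesis using p unfolding xframe_def pframe_def by simp
qed

lemma xframe_store: "xframe b s s' ==> a \<in> {2..<40} \<union> {b + 11..<b + 24} ==> xframe b s (store_word a i w s')"
  unfolding xframe_def by (metis keys_store words_other)

text \<open>The invariant reads only the word arrays at offsets 11 to 23 and two key arrays of its
  base, so two structures can coexist.\<close>

lemma X_cong:
  assumes X: "X C b H \<sigma> e xs s" and w: "!!a. a \<in> {b + 11..<b + 24} ==> words s' a = words s a"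
    and k: "keys s' b = keys s b" "keys s' (b + 11) = keys s (b + 11)"
  shows "X C b H \<sigma> e xs s'"
proof -
  have w': "words s' (b + 11) = words s (b + 11)" "words s' (b + 12) = words s (b + 12)" "words s' (b + 13) = words s (b + 13)"
    "words s' (b + 14) = words s (b + 14)" "words s' (b + 15) = words s (b + 15)" "words s' (b + 16) = words s (b + 16)"
    "words s' (b + 17) = words s (b + 17)" "words s' (b + 18) = words s (b + 18)" "words s' (b + 19) = words s (b + 19)"
    "words s' (b + 20) = words s (b + 20)" "words s' (b + 21) = words s (b + 21)" "words s' (b + 22) = words s (b + 22)"
    "words s' (b + 23) = words s (b + 23)"
    by (simp_all add: w)
  show ?thesis using X unfolding X_def stored_def levelled_def lvls_def null_ok_def w' k .
qed

definition ins :: "nat => nat => com" where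
  "ins C b = seqs [locate b, ins_at C b, Set (eu b) (Plus (V (eu b)) (Const 1))]"

definition del :: "nat => com" where
  "del b = seqs [Set vi (Plus (V vi) (Const 1)), locate b, Set vi (Minus (V vi) (Const 1)), del_at b,
     Set (eu b) (Plus (V (eu b)) (Const 1))]"

text \<open>The last block has index at most \<open>10*\<sigma>\<close>, so the blocks of width
  \<open>6*\<sigma>\<close> occupy at most \<open>60*\<sigma>*\<sigma> + 6*\<sigma>\<close>
  addresses. This explains the choice of \<open>128*\<sigma>*\<sigma>\<close> as a lower bound for
  the universe.\<close>

lemma X_bounds:
  assumes X: "1 <= \<sigma>" "128*\<sigma>*\<sigma> <= 2^H" "m*\<sigma> + c <= len + e" and S: "len + e <= 10*\<sigma>*\<sigma>"
  shows "m <= 10*\<sigma>" "Suc m*(6*\<sigma>) + 2 <= 2^H" "20*\<sigma> + 2 <= 2^H" "len + e + 2 < 2^H"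
proof -
  have "m*\<sigma> <= 10*\<sigma>*\<sigma>" using X(3) S by linarith
  then show "m <= 10*\<sigma>" using X(1) by simp
  have s: "\<sigma> <= \<sigma>*\<sigma>" using X(1) by simp
  have "Suc m*(6*\<sigma>) + 2 = 6*(m*\<sigma>) + 6*\<sigma> + 2" by (simp add: algebra_simps)
  also have "\<dots> <= 128*\<sigma>*\<sigma>" using \<open>m*\<sigma> <= 10*\<sigma>*\<sigma>\<close> s X(1) by linarith
  finally show "Suc m*(6*\<sigma>) + 2 <= 2^H" using X(2) by linarith
  show "20*\<sigma> + 2 <= 2^H" "len + e + 2 < 2^H" using s X(1,2) S by linarith+
qed

lemma sum_adl: "(\<Sum>j<Suc m. words s (cnt b) j) = length xs" if "stored s b \<sigma> m xs"
  using that length_adl[of "6*\<sigma>" "Suc m" "words s (cnt b)"] unfolding stored_def by (metis length_map)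

lemma ins_X_budget:
  fixes z :: nat
  assumes "1 <= z" "1 <= \<sigma>" "m <= 10*\<sigma>" "q <= 3*\<sigma> + 2" "c <= C*\<sigma> + 1"
  shows "50*(m + 1) + ((q + c + 2)*(2000*z) + 10) <= (C + 20)*\<sigma>*(2000*z)"
proof -
  have "q + c + 2 <= (C + 8)*\<sigma>" using assms by (simp add: algebra_simps)
  then have "(q + c + 2)*(2000*z) <= (C + 8)*\<sigma>*(2000*z)" by (rule mult_le_mono1)
  moreover have "50*(m + 1) + 10 <= 560*\<sigma>" using assms(2,3) by simp
  moreover have "560*\<sigma> <= 12*\<sigma>*(2000*z)" using assms(1) by simp
  moreover have "(C + 20)*\<sigma>*(2000*z) = (C + 8)*\<sigma>*(2000*z) + 12*\<sigma>*(2000*z)" by (simp add: algebra_simps)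
  ultimately show ?thesis by linarith
qed

lemma X_ins:
  assumes b: "40 <= b" and X: "X C b H \<sigma> e xs s" and p: "s$vi = p" "p <= length xs"
    and x: "keys s 0 0 = x" "x \<notin> set xs" and e: "e <= 2*\<sigma>" and S: "length xs + e <= 10*\<sigma>*\<sigma>"
    and B: "(length xs + 2*e + 2)*alloc C \<sigma> H + 50 <= B" "2*2^H + 4 <= B" "C <= B"
  shows "run B (ins C b) s ((C + 20)*\<sigma>*(2000*(H + 1)^2)) (%s'. xframe b s s' &
    X C b H \<sigma> (Suc e) (take p xs @ x # drop p xs) s')"
proof -
  let ?xs = "take p xs @ x # drop p xs"
  obtain m bs where st: "stored s b \<sigma> m xs" and s1: "1 <= \<sigma>" and U: "128*\<sigma>*\<sigma> <= 2^H" "s$univ b = 2^H"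
    and d: "distinct xs" and eu: "s$eu b = e" and ce: "\<forall>j\<le>m. words s (cnt b) j <= \<sigma> + e"
    and mc: "m*\<sigma> + words s (cnt b) m <= length xs + e"
    and l: "levelled s b H (set (adl (6*\<sigma>) (Suc m) (words s (cnt b)))) (C*\<sigma>)"
    and bg: "s$big b ~= 0 --> C*\<sigma> < LIS xs + e" and fr: "s$fresh b <= 1 + (length xs + 2*e)*alloc C \<sigma> H"
    and bs: "patience bs (s$ntl b) (keys s (b + 11))" "length bs <= length xs + e"
      "\<forall>zs. LIS (bs @ zs) <= LIS (xs @ zs) + e & LIS (xs @ zs) <= LIS (bs @ zs) + e"
    using X unfolding X_def by blast
  note bd = X_bounds[OF s1 U(1) mc S]
  have fa: "s$fresh b + alloc C \<sigma> H + 40 <= B" "s$fresh b + alloc C \<sigma> H <= 1 + (length ?xs + 2*Suc e)*alloc C \<sigma> H"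
  proof -
    have len: "length ?xs = Suc (length xs)" using p(2) by simp
    show "s$fresh b + alloc C \<sigma> H + 40 <= B" "s$fresh b + alloc C \<sigma> H <= 1 + (length ?xs + 2*Suc e)*alloc C \<sigma> H"
      unfolding len using fr B(1) by (simp_all add: add_mult_distrib)
  qed
  have H2: "2^H <= B" using B(2) by linarith
  define P1 where "P1 s1 \<longleftrightarrow> same_but {vi, vj} s s1 & s1$vj <= m &
    s1$vi <= words s (cnt b) (s1$vj) & p = (\<Sum>j<s1$vj. words s (cnt b) j) + s1$vi" for s1
  have 1: "run B (locate b) s (50*(m + 1)) P1"
  proof (rule run_mono[OF locate_run[OF b p(1), of m] order_refl])
    show "p <= (\<Sum>j<Suc m. words s (cnt b) j)" using sum_adl[OF st] p(2) by simp
    show "p <= B" "m + 2 <= B" using p(2) bd H2 by linarith+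
    show "words s (cnt b) j <= B" if "j <= m" for j
    proof -
      have "words s (cnt b) j <= \<sigma> + e" using ce that by blast
      then show ?thesis using bd(3) H2 e by linarith
    qed
  qed (auto simp: P1_def)
  define P2 where "P2 s2 \<longleftrightarrow> pframe b s s2 & stored s2 b \<sigma> m ?xs &
     (\<forall>j\<le>m. words s2 (cnt b) j <= \<sigma> + Suc e) & words s2 (cnt b) m <= Suc (words s (cnt b) m) &
     levelled s2 b H (set (adl (6*\<sigma>) (Suc m) (words s2 (cnt b)))) (C*\<sigma>) &
     (s2$big b ~= 0 --> s$big b ~= 0 \<or> C*\<sigma> < LIS ?xs) &
     s2$fresh b <= 1 + (length ?xs + 2*Suc e)*alloc C \<sigma> H" for s2
  have 2: "run B (ins_at C b) s1 ((3*\<sigma> + 2 + (C*\<sigma> + 1) + 2)*(2000*(H + 1)^2)) P2" if P: "P1 s1" for s1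
  proof -
    let ?j = "s1$vj" and ?i = "s1$vi"
    have sm: "same_but {vi, vj} s s1" and jm: "?j <= m" and ij: "?i <= words s (cnt b) ?j"
      and pp: "p = (\<Sum>j<?j. words s (cnt b) j) + ?i" using P unfolding P1_def by blast+
    have ws: "words s1 a = words s a" if "a ~= vi" "a ~= vj" for a using sm that by simp
    have w1: "words s1 (cnt b) = words s (cnt b)" "words s1 (cb b) = words s (cb b)" "words s1 (sz b) = words s (sz b)"
      "words s1 (fresh b) = words s (fresh b)" "words s1 (big b) = words s (big b)" using b by (auto intro!: ws)
    have e1: "ext {vi, vj} b s s1" by (rule same_ext[OF sm _ b]) auto
    have st1: "stored s1 b \<sigma> m xs" using st sm unfolding stored_def w1 by simp
    have l1: "levelled s1 b H (set (adl (6*\<sigma>) (Suc m) (words s1 (cnt b)))) (C*\<sigma>)"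
      unfolding w1 by (rule levelled_ext[OF e1 _ b l]) auto
    have cj: "words s (cnt b) ?j <= \<sigma> + e" using ce jm by blast
    have cj6: "words s1 (cnt b) ?j < 6*\<sigma>" using cj e s1 unfolding w1 by linarith
    have ij1: "?i <= words s1 (cnt b) ?j" using ij w1 by simp
    have pp1: "p = (\<Sum>j<?j. words s1 (cnt b) j) + ?i" using pp w1 by simp
    have k1: "keys s1 0 0 = x" using x sm by simp
    have aB: "s1$fresh b + 6*\<sigma>*(2*H + 2) + (C*\<sigma> + 3)*(4*H + 4) + 40 <= B"
      using fa(1) w1 unfolding alloc_def by simp
    show ?thesis
    proof (rule run_mono[OF ins_at_run[OF b st1 refl jm refl ij1 cj6 pp1 k1 x(2) d l1 bd(2) aB B(2,3) refl refl refl refl]])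
      show "(words s1 (cnt b) ?j - ?i + (if \<forall>y\<in>set (adl (6*\<sigma>) (Suc m) ((words s1 (cnt b))(?j := Suc (words s1 (cnt b) ?j)))) - {?j*(6*\<sigma>) + ?i}.
           y < ?j*(6*\<sigma>) + ?i then 1 else C*\<sigma> + 1) + 2)*(2000*(H + 1)^2) <= (3*\<sigma> + 2 + (C*\<sigma> + 1) + 2)*(2000*(H + 1)^2)"
      proof (intro mult_le_mono1 add_le_mono order_refl)
        show "words s1 (cnt b) ?j - ?i <= 3*\<sigma> + 2" using cj e w1 by simp
      qed simp
      fix s2 assume s2: "pframe b s1 s2 & words s2 (cnt b) = (words s1 (cnt b))(?j := Suc (words s1 (cnt b) ?j)) & stored s2 b \<sigma> m ?xs &
         levelled s2 b H (set (adl (6*\<sigma>) (Suc m) ((words s1 (cnt b))(?j := Suc (words s1 (cnt b) ?j))))) (C*\<sigma>) &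
         (s2$big b ~= 0 --> s1$big b ~= 0 \<or> C*\<sigma> < LIS ?xs) &
         s2$fresh b <= s1$fresh b + (words s1 (cnt b) ?j - ?i)*(2*H + 2) + (C*\<sigma> + 2)*(4*H + 4)"
      have "(words s1 (cnt b) ?j - ?i)*(2*H + 2) <= 6*\<sigma>*(2*H + 2)" using cj6 by (intro mult_le_mono1) simp
      moreover have "(C*\<sigma> + 2)*(4*H + 4) <= (C*\<sigma> + 3)*(4*H + 4)" by (intro mult_le_mono1) simp
      ultimately have "s2$fresh b <= s$fresh b + alloc C \<sigma> H" using s2 w1 unfolding alloc_def by simp
      then have "s2$fresh b <= 1 + (length ?xs + 2*Suc e)*alloc C \<sigma> H" using fa(2) by (rule le_trans)
      moreover have "pframe b s s2" using pframe_trans[OF ext_pframe[OF e1]] s2 by auto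
      moreover have "words s2 (cnt b) = (words s (cnt b))(?j := Suc (words s (cnt b) ?j))" using s2 w1 by simp
      then have "\<forall>j\<le>m. words s2 (cnt b) j <= \<sigma> + Suc e" "words s2 (cnt b) m <= Suc (words s (cnt b) m)" using ce cj by (auto simp: le_SucI)
      ultimately show "P2 s2" unfolding P2_def using s2 w1 by simp
    qed
  qed
  have 3: "run B (Set (eu b) (Plus (V (eu b)) (Const 1))) s2 10 (%s'. xframe b s s' & X C b H \<sigma> (Suc e) ?xs s')" if P: "P2 s2" for s2
  proof (rule run_loop_free)
    let ?s = "store_word (eu b) 0 (Suc e) s2"
    have pf: "pframe b s s2" using P unfolding P2_def by blast
    have e2: "s2$eu b = e" using pf eu b unfolding pframe_def by auto
    have xf: "xframe b s ?s" by (rule xframe_store[OF pframe_xframe[OF pf]]) simp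
    have ex: "ext {eu b} b s2 ?s" using b unfolding ext_def by (auto simp: words_other)
    have wo: "words ?s a = words s2 a" if "a ~= eu b" for a using that by (rule words_other)
    have ll: "levelled ?s b H A lm" if "levelled s2 b H A lm" for A lm
      using that b ext_tri[OF ex] ext_null[OF ex] unfolding levelled_def lvls_def by (auto simp: words_other)
    have n: "?s$ntl b = s$ntl b" "keys ?s (b + 11) = keys s (b + 11)" "?s$univ b = 2^H"
      using pf b U unfolding pframe_def by auto
    have tk: "take p xs @ drop p xs @ zs = xs @ zs" for zs by (metis append.assoc append_take_drop_id)
    \<comment> \<open>The estimate is made with an arbitrary continuation \<open>zs\<close>, because
      elements may still be appended to a structure under construction after this update.\<close>
    have Lx: "LIS (?xs @ zs) <= Suc (LIS (xs @ zs))" "LIS (xs @ zs) <= LIS (?xs @ zs)" for zs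
      using LIS_insert[of "take p xs" x "drop p xs @ zs", unfolded tk]
        LIS_remove[of "take p xs" "drop p xs @ zs" x, unfolded tk] by simp_all
    have bs': "LIS (bs @ zs) <= LIS (?xs @ zs) + Suc e & LIS (?xs @ zs) <= LIS (bs @ zs) + Suc e" for zs
      using bs(3)[rule_format, of zs] Lx[of zs] by linarith
    have "stored ?s b \<sigma> m ?xs" using P b unfolding P2_def stored_def by (simp add: words_other)
    moreover have "distinct ?xs"
      using x d set_take_subset[of p xs] set_drop_subset[of p xs] set_take_disj_set_drop_if_distinct[of xs p p] by auto
    moreover have "words ?s (cnt b) = words s2 (cnt b)" "words ?s (big b) = words s2 (big b)" "words ?s (fresh b) = words s2 (fresh b)"
      using b by (auto intro!: wo)
    moreover have "m*\<sigma> + words s2 (cnt b) m <= length ?xs + Suc e" using P mc p(2) unfolding P2_def by simp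
    moreover have "s2$big b ~= 0 --> C*\<sigma> < LIS ?xs + Suc e" using P bg Lx(2)[of "[]"] unfolding P2_def by auto
    moreover have "length bs <= length ?xs + Suc e" using bs(2) p(2) by simp
    ultimately have "X C b H \<sigma> (Suc e) ?xs ?s" unfolding X_def using P s1 U(1) n bs(1) bs' ll unfolding P2_def
      by (intro exI[of _ m]) (simp, blast)
    then show "xframe b s (result (Set (eu b) (Plus (V (eu b)) (Const 1))) s2) &
       X C b H \<sigma> (Suc e) ?xs (result (Set (eu b) (Plus (V (eu b)) (Const 1))) s2)" using xf e2 by simp
    have "e + 1 <= B" using bd(3) e H2 by linarith
    then show "fits B (Set (eu b) (Plus (V (eu b)) (Const 1))) s2" using e2 b by simp
  qed simp_all
  show ?thesis unfolding ins_def
  proof (rule run_mono[OF run_seqs[OF 1 run_seqs[OF 2 run_seqs1[OF 3]]]])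
    show "50*(m + 1) + ((3*\<sigma> + 2 + (C*\<sigma> + 1) + 2)*(2000*(H + 1)^2) + 10) <= (C + 20)*\<sigma>*(2000*(H + 1)^2)"
      by (rule ins_X_budget[OF _ s1 bd(1)]) auto
  qed
qed

lemma X_del:
  assumes b: "40 <= b" and X: "X C b H \<sigma> e xs s" and p: "s$vi = p" "p < length xs"
    and e: "e <= 2*\<sigma>" and S: "length xs + e <= 10*\<sigma>*\<sigma>"
    and B: "(length xs + 2*e + 2)*alloc C \<sigma> H + 50 <= B" "2*2^H + 4 <= B"
  shows "run B (del b) s ((C + 20)*\<sigma>*(2000*(H + 1)^2)) (%s'. xframe b s s' &
    X C b H \<sigma> (Suc e) (take p xs @ drop (Suc p) xs) s')"
proof -
  let ?xs = "take p xs @ drop (Suc p) xs"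
  obtain m bs where st: "stored s b \<sigma> m xs" and s1: "1 <= \<sigma>" and U: "128*\<sigma>*\<sigma> <= 2^H" "s$univ b = 2^H"
    and d: "distinct xs" and eu: "s$eu b = e" and ce: "\<forall>j\<le>m. words s (cnt b) j <= \<sigma> + e"
    and mc: "m*\<sigma> + words s (cnt b) m <= length xs + e"
    and l: "levelled s b H (set (adl (6*\<sigma>) (Suc m) (words s (cnt b)))) (C*\<sigma>)"
    and bg: "s$big b ~= 0 --> C*\<sigma> < LIS xs + e" and fr: "s$fresh b <= 1 + (length xs + 2*e)*alloc C \<sigma> H"
    and bs: "patience bs (s$ntl b) (keys s (b + 11))" "length bs <= length xs + e"
      "\<forall>zs. LIS (bs @ zs) <= LIS (xs @ zs) + e & LIS (xs @ zs) <= LIS (bs @ zs) + e"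
    using X unfolding X_def by blast
  note bd = X_bounds[OF s1 U(1) mc S]
  have len: "Suc (length ?xs) = length xs" using p(2) by simp
  \<comment> \<open>A deletion shortens \<open>xs\<close> by one but raises \<open>2*e\<close> by
    two, so the bound on the number of nodes still grows by one \<open>alloc\<close>.\<close>
  have fa: "s$fresh b + alloc C \<sigma> H + 40 <= B" "s$fresh b + alloc C \<sigma> H <= 1 + (length ?xs + 2*Suc e)*alloc C \<sigma> H"
    using fr B(1) unfolding len[symmetric] by (simp_all add: add_mult_distrib)
  have H2: "2^H <= B" using B(2) by linarith
  have 0: "run B (Set vi (Plus (V vi) (Const 1))) s 10 (%s0. s0 = store_word vi 0 (Suc p) s)"
    by (rule run_loop_free) (use p bd(4) H2 in auto)
  define P1 where "P1 q s1 \<longleftrightarrow> same_but {vi, vj} s s1 & s1$vj <= m &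
    s1$vi = q + (p - (\<Sum>j<s1$vj. words s (cnt b) j)) &
    p - (\<Sum>j<s1$vj. words s (cnt b) j) < words s (cnt b) (s1$vj) & (\<Sum>j<s1$vj. words s (cnt b) j) <= p" for q s1
  have 1: "run B (locate b) s0 (50*(m + 1)) (P1 1)" if s0: "s0 = store_word vi 0 (Suc p) s" for s0
  proof (rule run_mono[OF locate_run[OF b, of s0 "Suc p" m] order_refl])
    have w: "words s0 (cnt b) = words s (cnt b)" unfolding s0 using b by (intro words_other) simp
    show "s0$vi = Suc p" by (simp add: s0)
    show "Suc p <= (\<Sum>j<Suc m. words s0 (cnt b) j)" using sum_adl[OF st] p(2) unfolding w by simp
    show "Suc p <= B" "m + 2 <= B" using p(2) bd H2 by linarith+
    show "words s0 (cnt b) j <= B" if "j <= m" for j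
    proof -
      have "words s (cnt b) j <= \<sigma> + e" using ce that by blast
      then show ?thesis using bd(3) H2 e unfolding w by linarith
    qed
    fix s1 assume a: "same_but {vi, vj} s0 s1 & s1$vj <= m &
      s1$vi <= words s0 (cnt b) (s1$vj) &
      Suc p = (\<Sum>j<s1$vj. words s0 (cnt b) j) + s1$vi & (0 < Suc p --> 0 < s1$vi)"
    have "same_but {vi, vj} s s1" using a by (auto simp: s0 words_other)
    then show "P1 1 s1" unfolding P1_def using a unfolding w by auto
  qed
  have 2: "run B (Set vi (Minus (V vi) (Const 1))) s1 10 (P1 0)" if P: "P1 1 s1" for s1
  proof (rule run_loop_free)
    show "P1 0 (result (Set vi (Minus (V vi) (Const 1))) s1)" using P unfolding P1_def by (auto simp: words_other)
    show "fits B (Set vi (Minus (V vi) (Const 1))) s1" using P p(2) bd(4) H2 unfolding P1_def by auto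
  qed simp_all
  define P2 where "P2 s2 \<longleftrightarrow> pframe b s s2 & stored s2 b \<sigma> m ?xs &
     (\<forall>j\<le>m. words s2 (cnt b) j <= \<sigma> + e) & words s2 (cnt b) m <= words s (cnt b) m &
     levelled s2 b H (set (adl (6*\<sigma>) (Suc m) (words s2 (cnt b)))) (C*\<sigma>) &
     s2$big b = s$big b &
     s2$fresh b <= 1 + (length ?xs + 2*Suc e)*alloc C \<sigma> H" for s2
  have 3: "run B (del_at b) s1 ((3*\<sigma> + 2 + (C*\<sigma> + 1) + 2)*(2000*(H + 1)^2)) P2" if P: "P1 0 s1" for s1
  proof -
    let ?j = "s1$vj" and ?i = "s1$vi"
    have sm: "same_but {vi, vj} s s1" and jm: "?j <= m" and ij: "?i < words s (cnt b) ?j"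
      and pp: "p = (\<Sum>j<?j. words s (cnt b) j) + ?i" using P unfolding P1_def by auto
    have ws: "words s1 a = words s a" if "a ~= vi" "a ~= vj" for a using sm that by simp
    have w1: "words s1 (cnt b) = words s (cnt b)" "words s1 (cb b) = words s (cb b)" "words s1 (sz b) = words s (sz b)"
      "words s1 (fresh b) = words s (fresh b)" "words s1 (big b) = words s (big b)" using b by (auto intro!: ws)
    have e1: "ext {vi, vj} b s s1" by (rule same_ext[OF sm _ b]) auto
    have st1: "stored s1 b \<sigma> m xs" using st sm unfolding stored_def w1 by simp
    have l1: "levelled s1 b H (set (adl (6*\<sigma>) (Suc m) (words s1 (cnt b)))) (C*\<sigma>)"
      unfolding w1 by (rule levelled_ext[OF e1 _ b l]) auto
    have cj: "words s (cnt b) ?j <= \<sigma> + e" using ce jm by blast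
    have ij1: "?i < words s1 (cnt b) ?j" using ij w1 by simp
    have pp1: "p = (\<Sum>j<?j. words s1 (cnt b) j) + ?i" using pp w1 by simp
    have aB: "s1$fresh b + 6*\<sigma>*(2*H + 2) + (C*\<sigma> + 3)*(4*H + 4) + 40 <= B"
      using fa(1) w1 unfolding alloc_def by simp
    show ?thesis
    proof (rule run_mono[OF del_at_run[OF b st1 refl jm refl ij1 pp1 d l1 bd(2) aB B(2) refl refl]])
      show "(words s1 (cnt b) ?j + C*\<sigma> + 4)*(2000*(H + 1)^2) <= (3*\<sigma> + 2 + (C*\<sigma> + 1) + 2)*(2000*(H + 1)^2)"
        by (intro mult_le_mono1) (use cj e w1 in simp)
      fix s2 assume s2: "pframe b s1 s2 & words s2 (cnt b) = (words s1 (cnt b))(?j := words s1 (cnt b) ?j - 1) & stored s2 b \<sigma> m ?xs &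
         levelled s2 b H (set (adl (6*\<sigma>) (Suc m) ((words s1 (cnt b))(?j := words s1 (cnt b) ?j - 1)))) (C*\<sigma>) &
         s2$big b = s1$big b &
         s2$fresh b <= s1$fresh b + 6*\<sigma>*(2*H + 2) + (C*\<sigma> + 2)*(4*H + 4)"
      have "(C*\<sigma> + 2)*(4*H + 4) <= (C*\<sigma> + 3)*(4*H + 4)" by (intro mult_le_mono1) simp
      then have "s2$fresh b <= s$fresh b + alloc C \<sigma> H" using s2 w1 unfolding alloc_def by simp
      then have "s2$fresh b <= 1 + (length ?xs + 2*Suc e)*alloc C \<sigma> H" using fa(2) by (rule le_trans)
      moreover have "pframe b s s2" using pframe_trans[OF ext_pframe[OF e1]] s2 by auto
      moreover have c2: "words s2 (cnt b) = (words s (cnt b))(?j := words s (cnt b) ?j - 1)" using s2 w1 by simp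
      have "words s2 (cnt b) j <= words s (cnt b) j" for j unfolding c2 by simp
      then have "\<forall>j\<le>m. words s2 (cnt b) j <= \<sigma> + e" "words s2 (cnt b) m <= words s (cnt b) m" using ce le_trans by blast+
      ultimately show "P2 s2" unfolding P2_def using s2 w1 by simp
    qed
  qed
  have 4: "run B (Set (eu b) (Plus (V (eu b)) (Const 1))) s2 10 (%s'. xframe b s s' & X C b H \<sigma> (Suc e) ?xs s')" if P: "P2 s2" for s2
  proof (rule run_loop_free)
    let ?s = "store_word (eu b) 0 (Suc e) s2"
    have pf: "pframe b s s2" using P unfolding P2_def by blast
    have e2: "s2$eu b = e" using pf eu b unfolding pframe_def by auto
    have xf: "xframe b s ?s" by (rule xframe_store[OF pframe_xframe[OF pf]]) simp
    have ex: "ext {eu b} b s2 ?s" using b unfolding ext_def by (auto simp: words_other)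
    have wo: "words ?s a = words s2 a" if "a ~= eu b" for a using that by (rule words_other)
    have ll: "levelled ?s b H A lm" if "levelled s2 b H A lm" for A lm
      using that b ext_tri[OF ex] ext_null[OF ex] unfolding levelled_def lvls_def by (auto simp: words_other)
    have n: "?s$ntl b = s$ntl b" "keys ?s (b + 11) = keys s (b + 11)" "?s$univ b = 2^H"
      using pf b U unfolding pframe_def by auto
    have tk: "take p xs @ xs ! p # drop (Suc p) xs @ zs = xs @ zs" for zs
      using id_take_nth_drop[OF p(2)] by (metis append.assoc append_Cons)
    have Lx: "LIS (xs @ zs) <= Suc (LIS (?xs @ zs))" "LIS (?xs @ zs) <= LIS (xs @ zs)" for zs
      using LIS_insert[of "take p xs" "xs ! p" "drop (Suc p) xs @ zs", unfolded tk]
        LIS_remove[of "take p xs" "drop (Suc p) xs @ zs" "xs ! p", unfolded tk] by simp_all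
    have bs': "LIS (bs @ zs) <= LIS (?xs @ zs) + Suc e & LIS (?xs @ zs) <= LIS (bs @ zs) + Suc e" for zs
      using bs(3)[rule_format, of zs] Lx[of zs] by linarith
    have "stored ?s b \<sigma> m ?xs" using P b unfolding P2_def stored_def by (simp add: words_other)
    moreover have "distinct ?xs" using d set_take_disj_set_drop_if_distinct[OF d, of p "Suc p"] by simp
    moreover have "words ?s (cnt b) = words s2 (cnt b)" "words ?s (big b) = words s2 (big b)" "words ?s (fresh b) = words s2 (fresh b)"
      using b by (auto intro!: wo)
    moreover have "m*\<sigma> + words s2 (cnt b) m <= length ?xs + Suc e" using P mc len unfolding P2_def by linarith
    \<comment> \<open>A deletion may lower the LIS by one, which the growth of \<open>e\<close>
      compensates; the mark never has to be withdrawn.\<close>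
    moreover have "s2$big b ~= 0 --> C*\<sigma> < LIS ?xs + Suc e" using P bg Lx(1)[of "[]"] unfolding P2_def by auto
    moreover have "length bs <= length ?xs + Suc e" using bs(2) len by linarith
    moreover have "\<forall>j\<le>m. words s2 (cnt b) j <= \<sigma> + Suc e" using P unfolding P2_def by (auto simp: le_SucI)
    ultimately have "X C b H \<sigma> (Suc e) ?xs ?s" unfolding X_def using P s1 U(1) n bs(1) bs' ll unfolding P2_def
      by (intro exI[of _ m]) (simp, blast)
    then show "xframe b s (result (Set (eu b) (Plus (V (eu b)) (Const 1))) s2) &
       X C b H \<sigma> (Suc e) ?xs (result (Set (eu b) (Plus (V (eu b)) (Const 1))) s2)" using xf e2 by simp
    have "e + 1 <= B" using bd(3) e H2 by linarith
    then show "fits B (Set (eu b) (Plus (V (eu b)) (Const 1))) s2" using e2 b by simp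
  qed simp_all
  show ?thesis unfolding del_def
  proof (rule run_mono[OF run_seqs[OF 0 run_seqs[OF 1 run_seqs[OF 2 run_seqs[OF 3 run_seqs1[OF 4]]]]]])
    have "50*(m + 1) + ((3*\<sigma> + 2 + (C*\<sigma> + 1) + 2)*(2000*(H + 1)^2) + 10) + 20 <= (C + 20)*\<sigma>*(2000*(H + 1)^2)"
    proof -
      have "50*(m + 1) + 30 <= 580*\<sigma>" using bd(1) s1 by simp
      moreover have "(3*\<sigma> + 2 + (C*\<sigma> + 1) + 2)*(2000*(H + 1)^2) <= (C + 8)*\<sigma>*(2000*(H + 1)^2)"
        by (rule mult_le_mono1) (use s1 in "simp add: algebra_simps")
      moreover have "580*\<sigma> <= 12*\<sigma>*(2000*(H + 1)^2)"
      proof -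
        have "(1::nat) <= (H + 1)^2" by simp
        then have "(580*\<sigma>)*1 <= (24000*\<sigma>)*(H + 1)^2" by (rule mult_le_mono[rotated]) simp
        then show ?thesis by simp
      qed
      moreover have "(C + 20)*\<sigma>*(2000*(H + 1)^2) = (C + 8)*\<sigma>*(2000*(H + 1)^2) + 12*\<sigma>*(2000*(H + 1)^2)"
        by (simp add: algebra_simps)
      ultimately show ?thesis by linarith
    qed
    then show "10 + (50*(m + 1) + (10 + ((3*\<sigma> + 2 + (C*\<sigma> + 1) + 2)*(2000*(H + 1)^2) + 10))) <= (C + 20)*\<sigma>*(2000*(H + 1)^2)"
      by linarith
  qed
qed

section \<open>Appending an element\<close>

definition tail_test :: "nat => com" where
  "tail_test b = Cond (KeyLess (b + 11) (Plus (V vmid) (Const 1)) 0 (Const 0)) (Set vflag (Const 0)) (Set vflag (Const 1))"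

definition pat :: "nat => com" where
  "pat b = seqs [bsearch (V (ntl b)) (tail_test b),
     seqs [Cond (Less (V (ntl b)) (Plus (V vlo) (Const 1))) (Set (ntl b) (Plus (V vlo) (Const 1))) Skip,
       KeyCopy (b + 11) (Plus (V vlo) (Const 1)) 0 (Const 0)]]"

lemma pat_run:
  assumes b: "40 <= b" and p: "patience bs (s$ntl b) (keys s (b + 11))" and n: "s$ntl b < 2^H"
    and x: "keys s 0 0 = x" and B: "2*2^H + 4 <= B"
  shows "run B (pat b) s (200*(H + 1)^2) (%s'. patience (bs @ [x]) (s'$ntl b) (keys s' (b + 11)) &
    (\<forall>a. a \<notin> {2..<14} \<union> {ntl b} --> words s' a = words s a) & (\<forall>k. k ~= b + 11 --> keys s' k = keys s k))"
proof -
  let ?n = "s$ntl b" and ?t = "keys s (b + 11)"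
  define Q where "Q j \<longleftrightarrow> ~ ?t (Suc j) < x" for j
  have 1: "run B (bsearch (V (ntl b)) (tail_test b)) s (H*(20 + 30) + 20 + wcost (V (ntl b))) (%s'. same_but {2..<14} s s' & s'$vlo <= ?n &
     (\<forall>j<s'$vlo. ~ Q j) & (s'$vlo < ?n --> Q (s'$vlo)))"
  proof (rule bsearch_run[OF _ _ n])
    show "Q j" if "i <= j" "j < ?n" "Q i" for i j
      using patience_mono[OF p, of "Suc i" "Suc j"] that unfolding Q_def by (cases "i = j") auto
    show "run B (tail_test b) s1 20 (%s2. same_but ({2..<10} \<union> {vflag}) s1 s2 & s2$vflag <= 1 & (s2$vflag = 1 \<longleftrightarrow> Q m))"
      if "m < ?n" "same_but {2..<14} s s1" "s1$vmid = m" for s1 m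
      using that n B x b unfolding tail_test_def Q_def
      by (intro run_loop_free) (auto simp: words_other)
  qed (use n B in auto)
  let ?c = "seqs [Cond (Less (V (ntl b)) (Plus (V vlo) (Const 1))) (Set (ntl b) (Plus (V vlo) (Const 1))) Skip,
       KeyCopy (b + 11) (Plus (V vlo) (Const 1)) 0 (Const 0)]"
  have 2: "run B ?c s1 30 (%s'. patience (bs @ [x]) (s'$ntl b) (keys s' (b + 11)) &
    (\<forall>a. a \<notin> {2..<14} \<union> {ntl b} --> words s' a = words s a) & (\<forall>k. k ~= b + 11 --> keys s' k = keys s k))"
    if s1: "same_but {2..<14} s s1 & s1$vlo <= ?n &
     (\<forall>j<s1$vlo. ~ Q j) & (s1$vlo < ?n --> Q (s1$vlo))" for s1
  proof (rule run_loop_free)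
    let ?j = "s1$vlo"
    have w: "s1$ntl b = ?n" using s1 b by auto
    have pa: "patience (bs @ [x]) (max ?n (Suc ?j)) (?t(Suc ?j := x))"
      by (rule patience_snoc[OF p]) (use s1 in "auto simp: Q_def")
    have r: "(result ?c s1)$ntl b = max ?n (Suc ?j)" "keys (result ?c s1) (b + 11) = ?t(Suc ?j := x)"
      using w b s1 x by (auto simp: fun_eq_iff)
    have o: "words (result ?c s1) a = words s1 a" if "a ~= ntl b" for a
      using that by (auto simp: words_other)
    have k: "keys (result ?c s1) k = keys s1 k" if "k ~= b + 11" for k
      using that by (auto simp: keys_other)
    show "patience (bs @ [x]) ((result ?c s1)$ntl b) (keys (result ?c s1) (b + 11)) &
      (\<forall>a. a \<notin> {2..<14} \<union> {ntl b} --> words (result ?c s1) a = words s a) & (\<forall>k. k ~= b + 11 --> keys (result ?c s1) k = keys s k)"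
      unfolding r using pa o k s1 by auto
    show "fits B ?c s1" using w n s1 B b by auto
  qed simp_all
  show ?thesis unfolding pat_def
    by (rule run_mono[OF run_seqs[OF 1 run_seqs1[OF 2]]]) (use sq_ge[of H] in auto)
qed

text \<open>A new block is opened only once the last one holds at least \<open>\<sigma>\<close>
  elements, which keeps the number of blocks of order \<open>\<sigma>\<close>.\<close>

definition app :: "nat => nat => com" where
  "app C b = seqs [pat b,
     Cond (Less (Cell (cnt b) (V (cb b))) (V (sz b))) Skip
       (seqs [Set (cb b) (Plus (V (cb b)) (Const 1)), Store (cnt b) (V (cb b)) (Const 0)]),
     seqs [Set vj (V (cb b)), Set vi (Cell (cnt b) (V (cb b)))],
     ins_at C b]"

text \<open>Nothing is shifted and the cascade makes a single pass, so the time has no factor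
  \<open>\<sigma>\<close>. The error \<open>e\<close> does not grow, since the element is appended
  to \<open>bs\<close> as well.\<close>

lemma X_app:
  assumes b: "40 <= b" and X: "X C b H \<sigma> e xs s"
    and x: "keys s 0 0 = x" "x \<notin> set xs" and e: "e <= 2*\<sigma>" and S: "length xs + e <= 10*\<sigma>*\<sigma>"
    and B: "(length xs + 2*e + 2)*alloc C \<sigma> H + 50 <= B" "2*2^H + 4 <= B" "C <= B"
  shows "run B (app C b) s (7000*(H + 1)^2) (%s'. xframe b s s' & X C b H \<sigma> e (xs @ [x]) s')"
proof -
  obtain m bs where st: "stored s b \<sigma> m xs" and s1: "1 <= \<sigma>" and U: "128*\<sigma>*\<sigma> <= 2^H" "s$univ b = 2^H"
    and d: "distinct xs" and eu: "s$eu b = e" and ce: "\<forall>j\<le>m. words s (cnt b) j <= \<sigma> + e"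
    and mc: "m*\<sigma> + words s (cnt b) m <= length xs + e"
    and l: "levelled s b H (set (adl (6*\<sigma>) (Suc m) (words s (cnt b)))) (C*\<sigma>)"
    and bg: "s$big b ~= 0 --> C*\<sigma> < LIS xs + e" and fr: "s$fresh b <= 1 + (length xs + 2*e)*alloc C \<sigma> H"
    and bs: "patience bs (s$ntl b) (keys s (b + 11))" "length bs <= length xs + e"
      "\<forall>zs. LIS (bs @ zs) <= LIS (xs @ zs) + e & LIS (xs @ zs) <= LIS (bs @ zs) + e"
    using X unfolding X_def by blast
  have cmW: "\<forall>j\<le>m. words s (cnt b) j <= 6*\<sigma>" "s$cb b = m" "s$sz b = \<sigma>"
    "map (keys s b) (adl (6*\<sigma>) (Suc m) (words s (cnt b))) = xs" using st unfolding stored_def by blast+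
  have fa: "s$fresh b + alloc C \<sigma> H + 40 <= B" "s$fresh b + alloc C \<sigma> H <= 1 + (length (xs @ [x]) + 2*e)*alloc C \<sigma> H"
    using fr B(1) by (simp_all add: add_mult_distrib)
  have H2: "2^H <= B" using B(2) by linarith
  have ntl: "s$ntl b < 2^H"
    using patience_LIS[OF bs(1)] LIS_length[of bs] bs(2) X_bounds(4)[OF s1 U(1) mc S] by linarith
  define N where "N s' \<longleftrightarrow> patience (bs @ [x]) (s'$ntl b) (keys s' (b + 11)) & xframe b s s' & keys s' b = keys s b &
     s'$univ b = 2^H & s'$eu b = e & s'$sz b = \<sigma> & s'$big b = s$big b &
     s'$fresh b = s$fresh b" for s'
  have 1: "run B (pat b) s (200*(H + 1)^2) (%s1. N s1 & words s1 (cnt b) = words s (cnt b) & s1$cb b = m &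
      levelled s1 b H (set (adl (6*\<sigma>) (Suc m) (words s (cnt b)))) (C*\<sigma>))"
  proof (rule run_mono[OF pat_run[OF b bs(1) ntl x(1) B(2)] order_refl])
    fix s' :: state assume s': "patience (bs @ [x]) (s'$ntl b) (keys s' (b + 11)) &
      (\<forall>a. a \<notin> {2..<14} \<union> {ntl b} --> words s' a = words s a) & (\<forall>k. k ~= b + 11 --> keys s' k = keys s k)"
    have w: "words s' (b + c) = words s (b + c)" if "c ~= 23" for c using s' that b by auto
    have kb: "keys s' b = keys s b" using s' by simp
    have "levelled s' b H (set (adl (6*\<sigma>) (Suc m) (words s (cnt b)))) (C*\<sigma>)"
      using l unfolding levelled_def lvls_def null_ok_def by (simp add: w kb)
    moreover have "xframe b s s'" using s' unfolding xframe_def by auto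
    ultimately show "N s' & words s' (cnt b) = words s (cnt b) & s'$cb b = m &
      levelled s' b H (set (adl (6*\<sigma>) (Suc m) (words s (cnt b)))) (C*\<sigma>)"
      unfolding N_def using s' w kb U eu cmW by simp
  qed
  define R where "R s1 \<longleftrightarrow> N s1 & (\<exists>m. stored s1 b \<sigma> m xs & words s1 (cnt b) m < \<sigma> &
     (\<forall>j\<le>m. words s1 (cnt b) j <= \<sigma> + e) & m*\<sigma> + words s1 (cnt b) m <= length xs + e &
     levelled s1 b H (set (adl (6*\<sigma>) (Suc m) (words s1 (cnt b)))) (C*\<sigma>))" for s1
  have mB: "m <= 10*\<sigma>" "20*\<sigma> + 2 <= 2^H" using X_bounds(1,3)[OF s1 U(1) mc S] .
  have 2: "run B (Cond (Less (Cell (cnt b) (V (cb b))) (V (sz b))) Skip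
       (seqs [Set (cb b) (Plus (V (cb b)) (Const 1)), Store (cnt b) (V (cb b)) (Const 0)])) s1 30 R"
    if P: "N s1 & words s1 (cnt b) = words s (cnt b) & s1$cb b = m &
      levelled s1 b H (set (adl (6*\<sigma>) (Suc m) (words s (cnt b)))) (C*\<sigma>)" for s1
  proof (rule run_mono[OF run_Cond])
    have sz1: "s1$sz b = \<sigma>" "keys s1 b = keys s b" using P unfolding N_def by blast+
    have "words s (cnt b) m <= \<sigma> + e" using ce by blast
    then have bb: "words s (cnt b) m <= B" "m + 1 <= B" "\<sigma> <= B" using e mB H2 by linarith+
    show "tfits B (Less (Cell (cnt b) (V (cb b))) (V (sz b))) s1" using P sz1 bb by simp
    show "run B Skip s1 20 R" if "tval (Less (Cell (cnt b) (V (cb b))) (V (sz b))) s1"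
    proof (rule run_loop_free)
      have "stored s1 b \<sigma> m xs" using P sz1 cmW unfolding stored_def by simp
      moreover have "words s1 (cnt b) m < \<sigma>" using that P sz1 by simp
      ultimately show "R (result Skip s1)" unfolding R_def using P ce mc by auto
    qed simp_all
    assume "~ tval (Less (Cell (cnt b) (V (cb b))) (V (sz b))) s1"
    then have full: "\<sigma> <= words s (cnt b) m" using P sz1 by simp
    show "run B (seqs [Set (cb b) (Plus (V (cb b)) (Const 1)), Store (cnt b) (V (cb b)) (Const 0)]) s1 20 R"
    proof (rule run_loop_free)
      let ?c = "seqs [Set (cb b) (Plus (V (cb b)) (Const 1)), Store (cnt b) (V (cb b)) (Const 0)]"
      let ?s = "store_word (cnt b) (Suc m) 0 (store_word (cb b) 0 (Suc m) s1)"
      have rs: "result ?c s1 = ?s" using P by simp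
      have cn: "words ?s (cnt b) = (words s (cnt b))(Suc m := 0)" using P by (simp add: fun_eq_iff)
      \<comment> \<open>An empty block contributes no addresses, so opening one changes neither the
        stored list nor the levels.\<close>
      have ad: "adl (6*\<sigma>) (Suc (Suc m)) (words ?s (cnt b)) = adl (6*\<sigma>) (Suc m) (words s (cnt b))"
      proof -
        have "adl (6*\<sigma>) (Suc m) (words ?s (cnt b)) = adl (6*\<sigma>) (Suc m) (words s (cnt b))"
          unfolding cn by (rule adl_cong) simp
        moreover have "row (6*\<sigma>) (words ?s (cnt b)) (Suc m) = []" unfolding cn row_def by simp
        ultimately show ?thesis unfolding adl_Suc[of _ "Suc m"] by simp
      qed
      have w: "words ?s (b + c) = words s1 (b + c)" if "c ~= 18" "c ~= 19" for c using that by (simp add: words_other)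
      have "levelled ?s b H (set (adl (6*\<sigma>) (Suc (Suc m)) (words ?s (cnt b)))) (C*\<sigma>)"
        using P unfolding ad levelled_def lvls_def null_ok_def by (simp add: w del: words_store)
      moreover have "stored ?s b \<sigma> (Suc m) xs"
      proof -
        have 1: "?s$cb b = Suc m" "?s$sz b = \<sigma>" "keys ?s b = keys s b" using sz1 by simp_all
        have 2: "\<forall>j\<le>Suc m. words ?s (cnt b) j <= 6*\<sigma>" using cmW(1) unfolding cn by (simp add: le_Suc_eq)
        show ?thesis unfolding stored_def ad using 1 2 cmW(4) by presburger
      qed
      moreover have "N ?s" using P unfolding N_def by (auto intro!: xframe_store)
      moreover have "Suc m*\<sigma> + words ?s (cnt b) (Suc m) <= length xs + e" using mc full unfolding cn by simp
      moreover have "\<forall>j\<le>Suc m. words ?s (cnt b) j <= \<sigma> + e" "words ?s (cnt b) (Suc m) < \<sigma>" using ce s1 unfolding cn by (auto simp: le_Suc_eq)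
      ultimately show "R (result ?c s1)" unfolding rs R_def by blast
      show "fits B ?c s1" using P bb by simp
    qed simp_all
  qed simp_all
  have 3: "run B (seqs [Set vj (V (cb b)), Set vi (Cell (cnt b) (V (cb b)))]) s1 20
     (%s2. R s2 & s2$vj = s2$cb b & s2$vi = words s2 (cnt b) (s2$cb b))" if R1: "R s1" for s1
  proof -
    obtain m where R: "N s1" "stored s1 b \<sigma> m xs" "words s1 (cnt b) m < \<sigma>"
     "\<forall>j\<le>m. words s1 (cnt b) j <= \<sigma> + e" "m*\<sigma> + words s1 (cnt b) m <= length xs + e"
     "levelled s1 b H (set (adl (6*\<sigma>) (Suc m) (words s1 (cnt b)))) (C*\<sigma>)" using R1 unfolding R_def by blast
    have cb1: "s1$cb b = m" using R(2) unfolding stored_def by blast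
    let ?s = "store_word vi 0 (words s1 (cnt b) m) (store_word vj 0 m s1)"
    have sm: "same_but {vi, vj} s1 ?s" by (auto simp: words_other)
    have ex: "ext {vi, vj} b s1 ?s" by (rule same_ext[OF sm _ b]) auto
    have w: "words ?s (b + c) = words s1 (b + c)" for c using b by (simp add: words_other)
    have "levelled ?s b H (set (adl (6*\<sigma>) (Suc m) (words s1 (cnt b)))) (C*\<sigma>)" by (rule levelled_ext[OF ex _ b R(6)]) auto
    moreover have "stored ?s b \<sigma> m xs" using R(2) unfolding stored_def w by simp
    moreover have "N ?s" using R(1) unfolding N_def w by (auto intro!: xframe_store)
    ultimately have "R ?s" unfolding R_def w using R by blast
    moreover have "m <= 10*\<sigma>" using X_bounds(1)[OF s1 U(1) R(5) S] .
    ultimately show ?thesis using cb1 R(3) mB H2 b by (intro run_loop_free) auto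
  qed
  have 4: "run B (ins_at C b) s2 ((0 + 1 + 2)*(2000*(H + 1)^2)) (%s'. xframe b s s' & X C b H \<sigma> e (xs @ [x]) s')"
    if P: "R s2 & s2$vj = s2$cb b & s2$vi = words s2 (cnt b) (s2$cb b)" for s2
  proof -
    obtain m where R: "N s2" "stored s2 b \<sigma> m xs" "words s2 (cnt b) m < \<sigma>"
     "\<forall>j\<le>m. words s2 (cnt b) j <= \<sigma> + e" "m*\<sigma> + words s2 (cnt b) m <= length xs + e"
     "levelled s2 b H (set (adl (6*\<sigma>) (Suc m) (words s2 (cnt b)))) (C*\<sigma>)" using P unfolding R_def by blast
    note bd = X_bounds[OF s1 U(1) R(5) S]
    have cb1: "s2$cb b = m" using R(2) unfolding stored_def by blast
    let ?c = "words s2 (cnt b)"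
    let ?c' = "?c(m := Suc (?c m))"
    have vj: "s2$vj = m" and vi: "s2$vi = ?c m" using P cb1 by auto
    have c6: "?c m < 6*\<sigma>" using R(3) by simp
    have pp: "length xs = (\<Sum>j'<m. ?c j') + ?c m" using sum_adl[OF R(2)] by simp
    have N2: "s2$fresh b = s$fresh b" "s2$big b = s$big b" "xframe b s s2"
      "s2$eu b = e" "s2$univ b = 2^H" "patience (bs @ [x]) (s2$ntl b) (keys s2 (b + 11))" using R(1) unfolding N_def by blast+
    have k1: "keys s2 0 0 = x" using N2(3) x b unfolding xframe_def by simp
    have aB: "s2$fresh b + 6*\<sigma>*(2*H + 2) + (C*\<sigma> + 3)*(4*H + 4) + 40 <= B"
      using fa(1) N2(1) unfolding alloc_def by simp
    \<comment> \<open>The new address is the largest one in use; this selects the case of a single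
      cascade pass.\<close>
    have last: "\<forall>y\<in>set (adl (6*\<sigma>) (Suc m) ?c') - {m*(6*\<sigma>) + ?c m}. y < m*(6*\<sigma>) + ?c m"
    proof
      fix y assume y: "y \<in> set (adl (6*\<sigma>) (Suc m) ?c') - {m*(6*\<sigma>) + ?c m}"
      have "adl (6*\<sigma>) m ?c' = adl (6*\<sigma>) m ?c" by (rule adl_cong) simp
      then have "y \<in> set (adl (6*\<sigma>) m ?c) \<or> y \<in> {m*(6*\<sigma>)..<m*(6*\<sigma>) + Suc (?c m)}"
        using y unfolding adl_Suc by (auto simp: set_row)
      moreover have "y < m*(6*\<sigma>)" if "y \<in> set (adl (6*\<sigma>) m ?c)"
        using adl_bound[of m ?c "6*\<sigma>" y] that R(2) unfolding stored_def by auto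
      ultimately show "y < m*(6*\<sigma>) + ?c m" using y by auto
    qed
    have cc: "(if \<forall>y\<in>set (adl (6*\<sigma>) (Suc m) ?c') - {m*(6*\<sigma>) + ?c m}. y < m*(6*\<sigma>) + ?c m then 1 else C*\<sigma> + 1) = 1" using last by simp
    have xs': "take (length xs) xs @ x # drop (length xs) xs = xs @ [x]" by simp
    show ?thesis
    proof (rule run_mono[OF ins_at_run[OF b R(2) vj order_refl vi order_refl c6 pp k1 x(2) d R(6) bd(2) aB B(2,3) _ refl cc[symmetric] xs'[symmetric], of 0] order_refl])
      fix s3 assume s3: "pframe b s2 s3 & words s3 (cnt b) = ?c' & stored s3 b \<sigma> m (xs @ [x]) &
         levelled s3 b H (set (adl (6*\<sigma>) (Suc m) ?c')) (C*\<sigma>) &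
         (s3$big b ~= 0 --> s2$big b ~= 0 \<or> C*\<sigma> < LIS (xs @ [x])) &
         s3$fresh b <= s2$fresh b + 0*(2*H + 2) + (C*\<sigma> + 2)*(4*H + 4)"
      have pf: "pframe b s2 s3" using s3 by blast
      have n: "s3$ntl b = s2$ntl b" "keys s3 (b + 11) = keys s2 (b + 11)" "s3$univ b = 2^H" "s3$eu b = e"
        using pf b N2 unfolding pframe_def by auto
      have "(C*\<sigma> + 2)*(4*H + 4) <= (C*\<sigma> + 3)*(4*H + 4)" by (intro mult_le_mono1) simp
      then have "s3$fresh b <= s$fresh b + alloc C \<sigma> H" using s3 N2(1) unfolding alloc_def by simp
      then have f3: "s3$fresh b <= 1 + (length (xs @ [x]) + 2*e)*alloc C \<sigma> H" using fa(2) by (rule le_trans)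
      have "LIS xs <= LIS (xs @ [x])" using LIS_remove[of xs "[]" x] by simp
      then have b3: "s3$big b ~= 0 --> C*\<sigma> < LIS (xs @ [x]) + e" using s3 bg N2(2) by auto
      have d3: "distinct (xs @ [x])" using d x by simp
      have c3: "\<forall>j\<le>m. words s3 (cnt b) j <= \<sigma> + e" "m*\<sigma> + words s3 (cnt b) m <= length (xs @ [x]) + e"
        using s3 R(3,4,5) by (auto simp: Suc_le_eq)
      have bs3: "patience (bs @ [x]) (s3$ntl b) (keys s3 (b + 11))" "length (bs @ [x]) <= length (xs @ [x]) + e"
        "\<forall>zs. LIS ((bs @ [x]) @ zs) <= LIS ((xs @ [x]) @ zs) + e & LIS ((xs @ [x]) @ zs) <= LIS ((bs @ [x]) @ zs) + e"
        using N2(6) n bs(2,3) by simp_all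
      have l3: "levelled s3 b H (set (adl (6*\<sigma>) (Suc m) (words s3 (cnt b)))) (C*\<sigma>)" "stored s3 b \<sigma> m (xs @ [x])" using s3 by simp_all
      have "X C b H \<sigma> e (xs @ [x]) s3" unfolding X_def using l3 s1 U(1) d3 n(3,4) c3 b3 f3 bs3 by blast
      then show "xframe b s s3 & X C b H \<sigma> e (xs @ [x]) s3" using xframe_trans[OF N2(3) pframe_xframe[OF pf]] by blast
    qed simp
  qed
  show ?thesis unfolding app_def
  proof (rule run_mono[OF run_seqs[OF 1 run_seqs[OF 2 run_seqs[OF 3 run_seqs1[OF 4]]]]])
    have "200*z + (30 + (20 + (0 + 1 + 2)*(2000*z))) <= 7000*z" if "1 <= z" for z :: nat using that by simp
    then show "200*(H + 1)^2 + (30 + (20 + (0 + 1 + 2)*(2000*(H + 1)^2))) <= 7000*(H + 1)^2" by simp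
  qed
qed

text \<open>An update behind the copied prefix leaves the next structure as it is but counts towards
  its age.\<close>

definition tick :: "nat => com" where
  "tick b = Set (eu b) (Plus (V (eu b)) (Const 1))"

lemma X_tick:
  assumes X: "X C b H \<sigma> e xs s" and B: "e + 1 <= B"
  shows "run B (tick b) s 10 (%s'. xframe b s s' & X C b H \<sigma> (Suc e) xs s')"
  unfolding tick_def
proof (rule run_loop_free)
  let ?s = "store_word (eu b) 0 (Suc e) s"
  obtain m bs where st: "stored s b \<sigma> m xs" "1 <= \<sigma>" "128*\<sigma>*\<sigma> <= 2^H" "distinct xs" "s$univ b = 2^H"
    and eu: "s$eu b = e" and ce: "\<forall>j\<le>m. words s (cnt b) j <= \<sigma> + e"
    and mc: "m*\<sigma> + words s (cnt b) m <= length xs + e"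
    and l: "levelled s b H (set (adl (6*\<sigma>) (Suc m) (words s (cnt b)))) (C*\<sigma>)"
    and bg: "s$big b ~= 0 --> C*\<sigma> < LIS xs + e" and fr: "s$fresh b <= 1 + (length xs + 2*e)*alloc C \<sigma> H"
    and bs: "patience bs (s$ntl b) (keys s (b + 11))" "length bs <= length xs + e"
      "\<forall>zs. LIS (bs @ zs) <= LIS (xs @ zs) + e & LIS (xs @ zs) <= LIS (bs @ zs) + e"
    using X unfolding X_def by blast
  have w: "words ?s (b + c) = words s (b + c)" if "c ~= 22" for c using that by (simp add: words_other)
  have "s$fresh b <= 1 + (length xs + 2*Suc e)*alloc C \<sigma> H"
    by (rule le_trans[OF fr]) (intro add_le_mono mult_le_mono1; simp)
  moreover have "\<forall>zs. LIS (bs @ zs) <= LIS (xs @ zs) + Suc e & LIS (xs @ zs) <= LIS (bs @ zs) + Suc e"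
    using bs(3) by (simp add: le_SucI)
  moreover have "?s$eu b = Suc e" by simp
  moreover have "levelled ?s b H (set (adl (6*\<sigma>) (Suc m) (words s (cnt b)))) (C*\<sigma>)"
    using l unfolding levelled_def lvls_def null_ok_def by (simp add: w del: words_store)
  moreover have "stored ?s b \<sigma> m xs" using st(1) unfolding stored_def by (simp add: w del: words_store)
  moreover have "\<forall>j\<le>m. words s (cnt b) j <= \<sigma> + Suc e" "m*\<sigma> + words s (cnt b) m <= length xs + Suc e"
    "s$big b ~= 0 --> C*\<sigma> < LIS xs + Suc e" "length bs <= length xs + Suc e" using ce mc bg bs(2) by auto
  moreover have "words ?s (cnt b) = words s (cnt b)" "words ?s (big b) = words s (big b)" "words ?s (fresh b) = words s (fresh b)"
    "words ?s (univ b) = words s (univ b)" "words ?s (ntl b) = words s (ntl b)" "keys ?s = keys s"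
    by (simp_all add: w del: words_store)
  ultimately have "X C b H \<sigma> (Suc e) xs ?s"
    unfolding X_def using st(2-5) bs(1) by (intro exI[of _ m] conjI exI[of _ bs]) presburger+
  moreover have "xframe b s ?s" by (rule xframe_store) (auto simp: xframe_def)
  ultimately show "xframe b s (result (Set (eu b) (Plus (V (eu b)) (Const 1))) s) &
     X C b H \<sigma> (Suc e) xs (result (Set (eu b) (Plus (V (eu b)) (Const 1))) s)" using eu by simp
  show "fits B (Set (eu b) (Plus (V (eu b)) (Const 1))) s" using eu B by simp
qed simp_all

section \<open>Starting a new structure\<close>

abbreviation (input) flip :: nat where "flip == 44"
abbreviation (input) nxt :: nat where "nxt == 45"
abbreviation (input) num :: nat where "num == 46"
abbreviation (input) started :: nat where "started == 47"

text \<open>Linear search for \<open>\<sigma>\<close> and doubling for the universe take time of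
  order \<open>\<sigma> + H\<close>, affordable within one update. Trie nodes, roots, block sizes
  and pile tops are written before they are read, so resetting a few cells suffices even on used
  memory. Allocation starts at 1 because node 0 is the empty trie.\<close>

definition start_build :: "nat => com" where
  "start_build b = seqs [Set (sz b) (Const 1),
     While (Less (Times (V (sz b)) (V (sz b))) (Plus (V num) (Const 1))) (Set (sz b) (Plus (V (sz b)) (Const 1))),
     Set (univ b) (Const 1),
     While (Less (V (univ b)) (Times (Times (Const 128) (V (sz b))) (V (sz b)))) (Set (univ b) (Plus (V (univ b)) (V (univ b)))),
     seqs [Set (cb b) (Const 0), Set (cnt b) (Const 0), Set (fresh b) (Const 1), Set (nl b) (Const 0), Set (ntl b) (Const 0),
       Set (big b) (Const 0), Set (eu b) (Const 0), Set (aL b) (Const 0), Set (aR b) (Const 0), Set (aM b) (Const 0)]]"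

text \<open>The parameters of a structure whose construction starts with an array of length \<open>n\<close>.\<close>

definition params :: "nat => nat => nat => bool" where
  "params n \<sigma> H \<longleftrightarrow> 1 <= \<sigma> & (\<sigma> - 1)*(\<sigma> - 1) <= n & n < \<sigma>*\<sigma> & 128*\<sigma>*\<sigma> <= 2^H & 2^H < 256*\<sigma>*\<sigma>"

text \<open>Both parameters are taken least: minimality of \<open>\<sigma>\<close> gives the lower
  bound on \<open>n\<close>, minimality of \<open>H\<close> the upper bound on
  \<open>2^H\<close>.\<close>

lemma ex_params: "\<exists>\<sigma> H. params n \<sigma> H"
proof -
  have "\<exists>\<sigma>. n < \<sigma>*\<sigma>" by (rule exI[of _ "Suc n"]) simp
  then obtain \<sigma> where s: "n < \<sigma>*\<sigma>" "!!k. k < \<sigma> ==> k*k <= n" using exists_least_iff[of "%k. n < k*k"] by (meson not_le)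
  have s1: "1 <= \<sigma>" using s(1) by (cases \<sigma>) auto
  have "\<exists>H. 128*\<sigma>*\<sigma> <= 2^H" by (rule exI[of _ "128*\<sigma>*\<sigma>"]) (simp add: less_imp_le)
  then obtain H where H: "128*\<sigma>*\<sigma> <= 2^H" "!!k. k < H ==> 2^k < 128*\<sigma>*\<sigma>"
    using exists_least_iff[of "%k. 128*\<sigma>*\<sigma> <= 2^k"] by (meson not_le)
  have "1 < 128*\<sigma>*\<sigma>" using s1 by (cases \<sigma>) auto
  then obtain h where h: "H = Suc h" using H(1) by (cases H) auto
  have "2^H < 256*\<sigma>*\<sigma>" using H(2)[of h] unfolding h by simp
  then show ?thesis using s s1 H(1) unfolding params_def by (intro exI[of _ \<sigma>] exI[of _ H]) auto
qed

lemma start_build_run: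
  assumes b: "40 <= b" "b ~= 44" and n: "s$num = n" and p: "params n r H" and B: "n + 2 <= B" "2*2^H + 4 <= B"
    and num: "num \<notin> {b + 11..<b + 24}"
  shows "run B (start_build b) s (20*r + 20*H + 100) (%s'. xframe b s s' & X C b H r 0 [] s')"
proof -
  have r1: "1 <= r" and r: "(r - 1)*(r - 1) <= n" "n < r*r" and H: "128*r*r <= 2^H" "2^H < 256*r*r"
    using p unfolding params_def by blast+
  have rr: "r <= r*r" using r1 by simp
  have rB: "r <= B" "r*r <= B" using rr H(1) B by linarith+
  have xr: "xframe b s s" by (simp add: xframe_def)
  have nn: "num ~= b + c" if "11 <= c" "c < 24" for c using num that by auto
  have wn: "words s1 num = words s num" if "xframe b s s1" for s1
  proof -
    have "num \<notin> {2..<40} \<union> {b + 11..<b + 24}" using num by simp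
    then show ?thesis using that unfolding xframe_def by blast
  qed
  define I where "I k s1 \<longleftrightarrow> xframe b s s1 & 1 <= s1$sz b & s1$sz b + k = r" for k s1
  have 1: "run B (Set (sz b) (Const 1)) s 5 (I (r - 1))"
    using B r1 by (intro run_loop_free) (auto simp: I_def intro!: xframe_store xr)
  have 2: "run B (While (Less (Times (V (sz b)) (V (sz b))) (Plus (V num) (Const 1))) (Set (sz b) (Plus (V (sz b)) (Const 1)))) s1
     ((r - 1)*(10 + 10) + 10) (I 0)" if I0: "I (r - 1) s1" for s1
  proof -
    let ?t = "Less (Times (V (sz b)) (V (sz b))) (Plus (V num) (Const 1))"
    have lt: "s2$sz b <= r & s2$sz b*s2$sz b <= r*r" if "I k s2" for k s2
    proof -
      have "s2$sz b <= r" using that unfolding I_def by linarith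
      then show ?thesis by (simp add: mult_le_mono)
    qed
    have t: "tval ?t s2 \<longleftrightarrow> s2$sz b*s2$sz b <= n" if "I k s2" for k s2
      using that wn n unfolding I_def by (simp add: less_Suc_eq_le)
    show ?thesis
    proof (rule run_mono[OF run_loop[where I = I and k = 10 and Q = "I 0", OF I0]])
      show "tfits B ?t s2" if "I k s2" for k s2
        using lt[OF that] that wn n B rB unfolding I_def by auto
      show "~ tval ?t s2" if "I 0 s2" for s2 using t[OF that] that r(2) unfolding I_def by simp
      show "run B (Set (sz b) (Plus (V (sz b)) (Const 1))) s2 10 (I k)" if "I (Suc k) s2" for k s2
        using that B H(1) rr unfolding I_def by (intro run_loop_free) (auto intro!: xframe_store)
      show "I 0 s2" if I1: "I k s2" "~ tval ?t s2" for k s2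
      proof (cases k)
        case (Suc k')
        have "s2$sz b <= r - 1" using I1(1) unfolding I_def Suc by linarith
        then have "s2$sz b*s2$sz b <= (r - 1)*(r - 1)" by (simp add: mult_le_mono)
        then show ?thesis using t[OF I1(1)] I1(2) r(1) by linarith
      qed (use I1 in simp)
    qed simp_all
  qed
  define J where "J k s1 \<longleftrightarrow> xframe b s s1 & s1$sz b = r & k <= H & s1$univ b = 2^(H - k)" for k s1
  have 3: "run B (Set (univ b) (Const 1)) s1 5 (J H)" if "I 0 s1" for s1
    using that B unfolding I_def J_def by (intro run_loop_free) (auto intro!: xframe_store)
  have 4: "run B (While (Less (V (univ b)) (Times (Times (Const 128) (V (sz b))) (V (sz b)))) (Set (univ b) (Plus (V (univ b)) (V (univ b))))) s1
     (H*(10 + 10) + 10) (J 0)" if J0: "J H s1" for s1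
  proof -
    let ?t = "Less (V (univ b)) (Times (Times (Const 128) (V (sz b))) (V (sz b)))"
    have t: "tval ?t s2 \<longleftrightarrow> 2^(H - k) < 128*r*r" if "J k s2" for k s2
      using that unfolding J_def by simp
    have p2: "(2::nat)^(H - k) <= 2^H" for k by (rule power_increasing) auto
    show ?thesis
    proof (rule run_mono[OF run_loop[where I = J and k = 10 and Q = "J 0", OF J0]])
      show "tfits B ?t s2" if "J k s2" for k s2
      proof -
        have "128*r <= 128*r*r" "128 <= 128*r" using r1 by simp_all
        then have "128*r*r <= B" "128*r <= B" "128 <= B" "2^(H - k) <= B" using B H(1) p2[of k] by linarith+
        then show ?thesis using that rB unfolding J_def by simp
      qed
      show "~ tval ?t s2" if "J 0 s2" for s2 using t[OF that] H(1) by simp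
      show "run B (Set (univ b) (Plus (V (univ b)) (V (univ b)))) s2 10 (J k)" if J1: "J (Suc k) s2" for k s2
      proof (rule run_loop_free)
        have "H - k = Suc (H - Suc k)" using J1 unfolding J_def by linarith
        then show "J k (result (Set (univ b) (Plus (V (univ b)) (V (univ b)))) s2)"
          using J1 unfolding J_def by (auto intro!: xframe_store)
        show "fits B (Set (univ b) (Plus (V (univ b)) (V (univ b)))) s2"
        proof -
          have "(2::nat)^(H - Suc k) + 2^(H - Suc k) <= B" using B p2[of "Suc k"] by linarith
          then show ?thesis using J1 unfolding J_def by simp
        qed
      qed simp_all
      show "J 0 s2" if J1: "J k s2" "~ tval ?t s2" for k s2
      proof (cases k)
        case (Suc k')
        \<comment> \<open>Stopping with doublings left would give \<open>2^H >= 256*r*r\<close>,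
          against the choice of \<open>H\<close>.\<close>
        then have "H = Suc (H - k) + k'" using J1(1) unfolding J_def by simp
        then have "(2::nat)^H = 2^Suc (H - k)*2^k'" by (metis power_add)
        moreover have "(2::nat)^Suc (H - k) \<ge> 256*r*r" using t[OF J1(1)] J1(2) by simp
        moreover have "(1::nat) <= 2^k'" by simp
        ultimately have "256*r*r*1 <= 2^H" by (metis mult_le_mono)
        then show ?thesis using H(2) by simp
      qed (use J1 in simp)
    qed simp_all
  qed
  let ?c = "seqs [Set (cb b) (Const 0), Set (cnt b) (Const 0), Set (fresh b) (Const 1), Set (nl b) (Const 0), Set (ntl b) (Const 0),
       Set (big b) (Const 0), Set (eu b) (Const 0), Set (aL b) (Const 0), Set (aR b) (Const 0), Set (aM b) (Const 0)]"
  have 5: "run B ?c s1 40 (%s'. xframe b s s' & X C b H r 0 [] s')" if J1: "J 0 s1" for s1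
  proof (rule run_loop_free)
    let ?s = "result ?c s1"
    have w: "?s$cb b = 0" "?s$cnt b = 0" "?s$fresh b = 1" "?s$nl b = 0"
      "?s$ntl b = 0" "?s$big b = 0" "?s$eu b = 0" "?s$aL b = 0"
      "?s$aR b = 0" "?s$aM b = 0" "?s$sz b = r" "?s$univ b = 2^H"
      using J1 by (simp_all add: J_def)
    have a: "adl (6*r) (Suc 0) (words ?s (cnt b)) = []" by (simp add: adl_Suc adl_0 row_def del: seqs.simps result.simps) (simp add: w)
    have "stored ?s b r 0 []" unfolding stored_def a using w by (simp del: seqs.simps result.simps)
    moreover have "levelled ?s b H {} (C*r)" unfolding levelled_def lvls_def null_ok_def leveling_def
      using w by (auto simp del: seqs.simps result.simps)
    ultimately have "X C b H r 0 [] ?s" unfolding X_def using w r1 H(1) a patience_Nil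
      by (intro exI[of _ 0]) (auto simp del: seqs.simps result.simps intro!: exI[of _ "[]"])
    moreover have "xframe b s ?s" using J1 unfolding J_def by (auto intro!: xframe_store)
    ultimately show "xframe b s ?s & X C b H r 0 [] ?s" by blast
    show "fits B ?c s1" using B by simp
  qed simp_all
  show ?thesis unfolding start_build_def
    by (rule run_mono[OF run_seqs[OF 1 run_seqs[OF 2 run_seqs[OF 3 run_seqs[OF 4 run_seqs1[OF 5]]]]]]) (use r1 in auto)
qed

text \<open>Without levels, \<open>e\<close> is subtracted from the number of piles so that the
  answer never exceeds the LIS.\<close>

definition report :: "nat => com" where
  "report b = Cond (Less (V (big b)) (Const 1)) (Set 1 (V (nl b))) (Set 1 (Minus (V (ntl b)) (V (eu b))))"

lemma report_run:
  assumes X: "X C b H \<sigma> e xs s" and b: "40 <= b" and B: "length xs + e + 4 <= B"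
  shows "run B (report b) s 20 (%s'. s' = store_word 1 0 (s'$1) s &
     s'$1 <= LIS xs & (s'$1 = LIS xs \<or> LIS xs <= s'$1 + 2*e & C*\<sigma> < LIS xs + e))"
proof (rule run_loop_free)
  obtain m bs where st: "stored s b \<sigma> m xs" and eu: "s$eu b = e"
    and l: "levelled s b H (set (adl (6*\<sigma>) (Suc m) (words s (cnt b)))) (C*\<sigma>)"
    and bg: "s$big b ~= 0 --> C*\<sigma> < LIS xs + e"
    and bs: "patience bs (s$ntl b) (keys s (b + 11))" "length bs <= length xs + e"
      "\<forall>zs. LIS (bs @ zs) <= LIS (xs @ zs) + e & LIS (xs @ zs) <= LIS (bs @ zs) + e"
    using X unfolding X_def by blast
  have nt: "s$ntl b = LIS bs" "LIS bs <= length xs + e" "LIS bs <= LIS xs + e" "LIS xs <= LIS bs + e"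
    using patience_LIS[OF bs(1)] LIS_length[of bs] bs(2) bs(3)[rule_format, of "[]"] by simp_all
  have bb: "s$big b <= 1" using l unfolding levelled_def by blast
  have nl: "s$nl b = LIS xs" if b0: "s$big b = 0"
  proof -
    obtain g n where g: "lvls s b H (set (adl (6*\<sigma>) (Suc m) (words s (cnt b)))) g n {}"
      "leveling (set (adl (6*\<sigma>) (Suc m) (words s (cnt b)))) (keys s b) g n"
      using l b0 unfolding levelled_def by blast
    have "LIS (map (keys s b) (adl (6*\<sigma>) (Suc m) (words s (cnt b)))) = n"
      by (rule leveling_LIS[OF sorted_adl g(2)]) (use st in "auto simp: stored_def")
    moreover have "map (keys s b) (adl (6*\<sigma>) (Suc m) (words s (cnt b))) = xs" using st unfolding stored_def by blast
    moreover have "s$nl b = n" using g(1) unfolding lvls_def by blast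
    ultimately show ?thesis by simp
  qed
  show "fits B (report b) s" unfolding report_def using nl nt LIS_length[of xs] eu B bb by auto
  have r: "result (report b) s = store_word 1 0 (if s$big b = 0 then LIS xs else LIS bs - e) s"
    unfolding report_def using nl nt eu by auto
  show "result (report b) s = store_word 1 0 ((result (report b) s)$1) s &
     (result (report b) s)$1 <= LIS xs & ((result (report b) s)$1 = LIS xs \<or>
     LIS xs <= (result (report b) s)$1 + 2*e & C*\<sigma> < LIS xs + e)"
    unfolding r using nt bg by auto
qed (simp_all add: report_def)

section \<open>Copying the array into the next structure\<close>

lemma stored_nth:
  assumes st: "stored s b \<sigma> m xs" and j: "j <= m" "i < words s (cnt b) j"
  shows "keys s b (j*(6*\<sigma>) + i) = xs ! ((\<Sum>j<j. words s (cnt b) j) + i)"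
proof -
  let ?c = "words s (cnt b)"
  have "xs = map (keys s b) (adl (6*\<sigma>) j ?c) @ map (keys s b) (row (6*\<sigma>) ?c j) @
     map (keys s b) (concat (map (row (6*\<sigma>) ?c) [Suc j..<Suc m]))"
    using st adl_split[of j "Suc m" "6*\<sigma>" ?c] j(1) unfolding stored_def by auto
  then show ?thesis using j(2) by (simp add: nth_append length_adl row_def)
qed

abbreviation (input) gj :: nat where "gj == 64"
abbreviation (input) gi :: nat where "gi == 65"
abbreviation (input) fuel :: nat where "fuel == 66"

text \<open>One step either copies an element or passes to the next block. Both consume fuel, so
  that empty blocks are accounted for.\<close>

definition copy_step :: "nat => nat => nat => com" where
  "copy_step C b b' = seqs [Cond (Less (V gi) (Cell (cnt b) (V gj)))
     (seqs [KeyCopy 0 (Const 0) b (Plus (Times (V gj) (Times (Const 6) (V (sz b)))) (V gi)), app C b',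
        seqs [Set gi (Plus (V gi) (Const 1)), Set nxt (Plus (V nxt) (Const 1))]])
     (seqs [Set gj (Plus (V gj) (Const 1)), Set gi (Const 0)]),
     Set fuel (Minus (V fuel) (Const 1))]"

text \<open>At most \<open>cb\<close> units of fuel go into passing to another block. The remaining
  \<open>\<sigma>' + 3\<close> units copy that many elements, unless the array ends before.\<close>

definition advance :: "nat => nat => nat => com" where
  "advance C b b' = seqs [Set vi (V nxt), locate b,
     seqs [Set gj (V vj), Set gi (V vi), Set fuel (Plus (Plus (V (cb b)) (V (sz b'))) (Const 3))],
     While (Conj (Less (Const 0) (V fuel)) (Less (V nxt) (V num))) (copy_step C b b')]"

text \<open>Two structures at fixed places take turns in being the current one. The names 44 to 47
  and 64 to 69 avoid the word arrays of both and hold the variables they share.\<close>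

definition bases :: "nat => nat => bool" where
  "bases b b' \<longleftrightarrow> b = 40 & b' = 70 \<or> b = 70 & b' = 40"

text \<open>Key array 0 is exempt because it hands the copied elements to
  \<open>app\<close>.\<close>

definition gframe :: "nat set => nat => state => state => bool" where
  "gframe G b s s' \<longleftrightarrow> (\<forall>a. a \<notin> G \<union> {2..<40} \<union> {b + 11..<b + 24} --> words s' a = words s a) &
     (\<forall>k. k \<notin> {0, b, b + 11} --> keys s' k = keys s k)"

lemma gframe_refl: "gframe G b s s"
  by (simp add: gframe_def)

lemma gframe_xframe: "gframe G b s s' ==> xframe b s' s'' ==> gframe G b s s''"
  by (simp add: gframe_def xframe_def)

lemma gframe_store: "gframe G b s s' ==> a \<in> G \<union> {2..<40} \<union> {b + 11..<b + 24} ==> gframe G b s (store_word a i w s')"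
  unfolding gframe_def by (metis keys_store words_other)

lemma gframe_store_key: "gframe G b s s' ==> gframe G b s (store_key 0 i w s')"
  unfolding gframe_def by (simp add: keys_other)

abbreviation (input) globals :: "nat set" where "globals == {1} \<union> {44..<48} \<union> {64..<70}"

lemma gframe_words: "gframe G b' s s' ==> bases b b' ==> G \<subseteq> globals ==> 11 <= c ==> c < 24 ==> words s' (b + c) = words s (b + c)"
proof -
  assume g: "gframe G b' s s'" and b: "bases b b'" and G: "G \<subseteq> globals" and c: "11 <= c" "c < 24"
  have "b + c \<notin> globals \<union> {2..<40} \<union> {b' + 11..<b' + 24}" using b c unfolding bases_def by auto
  then have "b + c \<notin> G \<union> {2..<40} \<union> {b' + 11..<b' + 24}" using G by blast
  then show ?thesis using g unfolding gframe_def by blast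
qed

lemma X_gframe:
  assumes X: "X C b H \<sigma> e xs s" and g: "gframe G b' s s'" and b: "bases b b'" and G: "G \<subseteq> globals"
  shows "X C b H \<sigma> e xs s'"
proof (rule X_cong[OF X])
  fix a assume "a \<in> {b + 11..<b + 24}"
  then have "a = b + (a - b)" "11 <= a - b" "a - b < 24" by auto
  then show "words s' a = words s a" using gframe_words[OF g b G, of "a - b"] by simp
next
  show "keys s' b = keys s b" "keys s' (b + 11) = keys s (b + 11)" using g b unfolding gframe_def bases_def by auto
qed

lemma X_store:
  assumes X: "X C b H \<sigma> e xs s" and "a \<notin> {b + 11..<b + 24}"
  shows "X C b H \<sigma> e xs (store_word a i w s)"
proof (rule X_cong[OF X])
  show "words (store_word a i w s) a' = words s a'" if "a' \<in> {b + 11..<b + 24}" for a'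
    using assms(2) that by (intro words_other) blast
qed simp_all

lemma advance_run:
  assumes bb: "bases b b'" and X: "X C b H \<sigma> e a s" and X': "X C b' H' \<sigma>' e' (take m a) s" and m: "m <= length a"
    and w: "s$nxt = m" "s$num = length a"
    and S: "length a + e <= 10*\<sigma>*\<sigma>" "e' <= 2*\<sigma>'" "length a + e' <= 10*\<sigma>'*\<sigma>'"
    and B: "(length a + 2*e' + 2)*alloc C \<sigma>' H' + 50 <= B" "2*2^H' + 4 <= B" "C <= B" "2*2^H + 4 <= B"
  shows "run B (advance C b b') s (50*(10*\<sigma> + 1) + (10*\<sigma> + \<sigma>' + 3)*(7000*(H' + 1)^2 + 60) + 80)
    (%s'. \<exists>m'. gframe {nxt, gj, gi, fuel} b' s s' & s'$nxt = m' & m <= m' & m' <= length a &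
      X C b' H' \<sigma>' e' (take m' a) s' & (m' = length a \<or> m + \<sigma>' + 3 <= m'))"
proof -
  let ?G = "{nxt, gj, gi, fuel}"
  have b: "40 <= b" "40 <= b'" using bb unfolding bases_def by auto
  have G: "?G \<subseteq> globals" by auto
  obtain M where st: "stored s b \<sigma> M a" and s1: "1 <= \<sigma>" and U: "128*\<sigma>*\<sigma> <= 2^H" and d: "distinct a"
    and mc: "M*\<sigma> + words s (cnt b) M <= length a + e"
    using X unfolding X_def by blast
  have s1': "1 <= \<sigma>'" "128*\<sigma>'*\<sigma>' <= 2^H'" "s$sz b' = \<sigma>'" using X' unfolding X_def stored_def by blast+
  have ss: "\<sigma>' <= 128*\<sigma>'*\<sigma>'" using s1' by simp
  let ?c = "words s (cnt b)"
  have st': "s$cb b = M" "s$sz b = \<sigma>" "!!j. j <= M ==> ?c j <= 6*\<sigma>" using st unfolding stored_def by blast+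
  note bd = X_bounds[OF s1 U mc S(1)]
  have H2: "2^H <= B" "2^H' <= B" using B by linarith+
  have W: "words s1 (b + c) = words s (b + c)" if "gframe ?G b' s s1" "11 <= c" "c < 24" for s1 c
    using gframe_words[OF that(1) bb G that(2,3)] .
  have num: "s1$num = length a" if "gframe ?G b' s s1" for s1
  proof -
    have "num \<notin> ?G \<union> {2..<40} \<union> {b' + 11..<b' + 24}" using bb unfolding bases_def by auto
    then show ?thesis using that w unfolding gframe_def by auto
  qed
  have n0: "nxt \<notin> {2..<40} \<union> {b' + 11..<b' + 24}" "gi \<notin> {2..<40} \<union> {b' + 11..<b' + 24}" "gj \<notin> {2..<40} \<union> {b' + 11..<b' + 24}"
    "fuel \<notin> {2..<40} \<union> {b' + 11..<b' + 24}" using bb unfolding bases_def by auto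
  have xw: "words s2 nxt = words s1 nxt" "words s2 gi = words s1 gi" "words s2 gj = words s1 gj" "words s2 fuel = words s1 fuel"
    if "xframe b' s1 s2" for s1 s2 using that n0 unfolding xframe_def by blast+
  have sumM: "(\<Sum>j<Suc M. ?c j) = length a" by (rule sum_adl[OF st])
  have 1: "run B (Set vi (V nxt)) s 10 (%s0. s0 = store_word vi 0 m s)"
    by (rule run_loop_free) (use w m bd(4) H2 in auto)
  define P1 where "P1 s1 \<longleftrightarrow> same_but {vi, vj} s s1 & s1$vj <= M & s1$vi <= ?c (s1$vj) &
    m = (\<Sum>j<s1$vj. ?c j) + s1$vi" for s1
  have 2: "run B (locate b) s0 (50*(M + 1)) P1" if s0: "s0 = store_word vi 0 m s" for s0
  proof (rule run_mono[OF locate_run[OF b(1), of s0 m M] order_refl])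
    have w: "words s0 (cnt b) = ?c" unfolding s0 using b by (intro words_other) simp
    show "s0$vi = m" by (simp add: s0)
    show "m <= (\<Sum>j<Suc M. words s0 (cnt b) j)" using sumM m unfolding w by simp
    show "m <= B" "M + 2 <= B" using m bd H2 by linarith+
    show "words s0 (cnt b) j <= B" if "j <= M" for j
    proof -
      have "?c j <= 6*\<sigma>" using st'(3)[OF that] .
      then show ?thesis using bd(3) H2 unfolding w by linarith
    qed
    fix s1 assume a: "same_but {vi, vj} s0 s1 & s1$vj <= M & s1$vi <= words s0 (cnt b) (s1$vj) &
      m = (\<Sum>j<s1$vj. words s0 (cnt b) j) + s1$vi & (0 < m --> 0 < s1$vi)"
    have "same_but {vi, vj} s s1" using a by (auto simp: s0 words_other)
    then show "P1 s1" unfolding P1_def using a unfolding w by auto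
  qed
  \<comment> \<open>The last conjunct is the account: elements copied, blocks passed and fuel left
    together make up at least the initial fuel.\<close>
  define I where "I k s1 \<longleftrightarrow> gframe ?G b' s s1 & s1$fuel = k & k <= M + \<sigma>' + 3 & m <= s1$nxt & s1$nxt <= length a &
    s1$gj <= M & s1$gi <= ?c (s1$gj) & s1$nxt = (\<Sum>j<s1$gj. ?c j) + s1$gi &
    X C b' H' \<sigma>' e' (take (s1$nxt) a) s1 & M + \<sigma>' + 3 + m <= s1$nxt + s1$gj + k" for k s1
  have 3: "run B (seqs [Set gj (V vj), Set gi (V vi), Set fuel (Plus (Plus (V (cb b)) (V (sz b'))) (Const 3))]) s1 30 (I (M + \<sigma>' + 3))" if P: "P1 s1" for s1
  proof (rule run_loop_free)
    let ?cc = "seqs [Set gj (V vj), Set gi (V vi), Set fuel (Plus (Plus (V (cb b)) (V (sz b'))) (Const 3))]"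
    have ws: "words s1 a = words s a" if "a ~= vi" "a ~= vj" for a using P that unfolding P1_def by simp
    have w1: "s1$cb b = M" "s1$sz b' = \<sigma>'" "s1$nxt = m" using st' s1' b w by (auto simp: ws)
    have g1: "gframe ?G b' s s1" using P unfolding P1_def gframe_def by auto
    have x1: "X C b' H' \<sigma>' e' (take m a) s1"
      by (rule X_cong[OF X']) (use P b in "auto simp: P1_def")
    have ne: "b + 19 \<notin> {gj, gi}" "b' + 20 \<notin> {gj, gi}" using bb unfolding bases_def by auto
    let ?s = "store_word fuel 0 (M + \<sigma>' + 3) (store_word gi 0 (s1$vi) (store_word gj 0 (s1$vj) s1))"
    have r: "result ?cc s1 = ?s" using w1 ne by simp
    have "gframe ?G b' s ?s" by (intro gframe_store g1) auto
    moreover have "X C b' H' \<sigma>' e' (take m a) ?s" using n0 by (intro X_store x1) auto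
    ultimately show "I (M + \<sigma>' + 3) (result ?cc s1)" unfolding r I_def using P w1 m unfolding P1_def by simp
    have "6*\<sigma> <= B" "M + \<sigma>' + 3 <= B" using bd H2 ss s1'(2) B by linarith+
    moreover have "?c (s1$vj) <= 6*\<sigma>" using st'(3) P unfolding P1_def by blast
    ultimately show "fits B ?cc s1" using P w1 ne unfolding P1_def by auto
  qed simp_all
  let ?t = "Conj (Less (Const 0) (V fuel)) (Less (V nxt) (V num))"
  have step: "run B (copy_step C b b') s1 (7000*(H' + 1)^2 + 50) (I k)" if I0: "I (Suc k) s1" and t0: "tval ?t s1" for k s1
  proof -
    let ?m = "s1$nxt" and ?j = "s1$gj" and ?i = "s1$gi"
    have g1: "gframe ?G b' s s1" and fu: "s1$fuel = Suc k" "Suc k <= M + \<sigma>' + 3" and mm: "m <= ?m" and j: "?j <= M" "?i <= ?c ?j" "?m = (\<Sum>j<?j. ?c j) + ?i"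
      and x1: "X C b' H' \<sigma>' e' (take ?m a) s1" and pr: "M + \<sigma>' + 3 + m <= ?m + ?j + Suc k" using I0 unfolding I_def by blast+
    have ml: "?m < length a" using t0 num[OF g1] by simp
    have cj: "?c ?j <= 6*\<sigma>" using st'(3)[OF j(1)] .
    have w1: "words s1 (cnt b) = ?c" "s1$sz b = \<sigma>" using W[OF g1, of 18] W[OF g1, of 20] st' by simp_all
    have kb: "keys s1 b = keys s b" using g1 bb unfolding gframe_def bases_def by auto
    have mB: "?m + 2 <= B" using ml bd(4) H2 by linarith
    have jB: "?j*(6*\<sigma>) + 6*\<sigma> + 2 <= B" "M + 2 <= B"
    proof -
      have "Suc ?j*(6*\<sigma>) <= Suc M*(6*\<sigma>)" by (rule mult_le_mono1) (use j in simp)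
      then have "?j*(6*\<sigma>) + 6*\<sigma> + 2 <= Suc M*(6*\<sigma>) + 2" by (simp del: mult_le_cancel2 mult_le_cancel1)
      then show "?j*(6*\<sigma>) + 6*\<sigma> + 2 <= B" "M + 2 <= B" using bd H2 by linarith+
    qed
    define Q where "Q s2 \<longleftrightarrow> gframe ?G b' s s2 & s2$fuel = Suc k & k <= M + \<sigma>' + 3 & m <= s2$nxt & s2$nxt <= length a &
      s2$gj <= M & s2$gi <= ?c (s2$gj) & s2$nxt = (\<Sum>j<s2$gj. ?c j) + s2$gi &
      X C b' H' \<sigma>' e' (take (s2$nxt) a) s2 & M + \<sigma>' + 3 + m <= s2$nxt + s2$gj + k" for s2
    let ?A = "seqs [KeyCopy 0 (Const 0) b (Plus (Times (V gj) (Times (Const 6) (V (sz b)))) (V gi)), app C b',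
        seqs [Set gi (Plus (V gi) (Const 1)), Set nxt (Plus (V nxt) (Const 1))]]"
    let ?D = "seqs [Set gj (Plus (V gj) (Const 1)), Set gi (Const 0)]"
    have 1: "run B (Cond (Less (V gi) (Cell (cnt b) (V gj))) ?A ?D) s1 (6 + (7000*(H' + 1)^2 + 34)) Q"
    proof (rule run_mono[OF run_Cond])
      show "tfits B (Less (V gi) (Cell (cnt b) (V gj))) s1" using w1 j cj jB by simp
      show "run B ?A s1 (7000*(H' + 1)^2 + 34) Q" if lt: "tval (Less (V gi) (Cell (cnt b) (V gj))) s1"
      proof -
        have ij: "?i < ?c ?j" using lt w1 by simp
        let ?x = "a ! ?m"
        have kx: "keys s1 b (?j*(6*\<sigma>) + ?i) = ?x" using stored_nth[OF st j(1) ij] j(3) kb by simp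
        have 1: "run B (KeyCopy 0 (Const 0) b (Plus (Times (V gj) (Times (Const 6) (V (sz b)))) (V gi))) s1 12 (%s2. s2 = store_key 0 0 ?x s1)"
        proof (rule run_loop_free)
          have "?j <= B" "?i <= B" "6 <= B" "\<sigma> <= B" using j cj jB s1 by linarith+
          then show "fits B (KeyCopy 0 (Const 0) b (Plus (Times (V gj) (Times (Const 6) (V (sz b)))) (V gi))) s1"
            using w1 jB ij cj by simp
        qed (use w1 kx in simp_all)
        have 2: "run B (app C b') s2 (7000*(H' + 1)^2) (%s3. xframe b' s2 s3 & X C b' H' \<sigma>' e' (take (Suc ?m) a) s3)"
          if s2: "s2 = store_key 0 0 ?x s1" for s2
          unfolding take_Suc_conv_app_nth[OF ml]
        proof (rule X_app[OF b(2)])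
          show "X C b' H' \<sigma>' e' (take ?m a) s2" by (rule X_cong[OF x1]) (use b in "auto simp: s2 keys_other")
          show "keys s2 0 0 = ?x" by (simp add: s2)
          have "distinct (take (Suc ?m) a)" using d by (rule distinct_take)
          then show "?x \<notin> set (take ?m a)" unfolding take_Suc_conv_app_nth[OF ml] by simp
          show "length (take ?m a) + e' <= 10*\<sigma>'*\<sigma>'" using S by simp
          have "(length (take ?m a) + 2*e' + 2)*alloc C \<sigma>' H' <= (length a + 2*e' + 2)*alloc C \<sigma>' H'" by (rule mult_le_mono1) simp
          then show "(length (take ?m a) + 2*e' + 2)*alloc C \<sigma>' H' + 50 <= B" using B by linarith
        qed (use S B in auto)
        have 3: "run B (seqs [Set gi (Plus (V gi) (Const 1)), Set nxt (Plus (V nxt) (Const 1))]) s3 20 Q"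
          if s3: "xframe b' (store_key 0 0 ?x s1) s3 & X C b' H' \<sigma>' e' (take (Suc ?m) a) s3" for s3
        proof (rule run_loop_free)
          let ?cc = "seqs [Set gi (Plus (V gi) (Const 1)), Set nxt (Plus (V nxt) (Const 1))]"
          let ?s = "store_word nxt 0 (Suc ?m) (store_word gi 0 (Suc ?i) s3)"
          have g3: "gframe ?G b' s s3" using gframe_xframe[OF gframe_store_key[OF g1]] s3 by blast
          have w3: "words s3 nxt = words s1 nxt" "words s3 gi = words s1 gi" "words s3 gj = words s1 gj" "words s3 fuel = words s1 fuel"
            using xw s3 by (metis words_store_key)+
          have r: "result ?cc s3 = ?s" using w3 by simp
          have "gframe ?G b' s ?s" by (intro gframe_store g3) auto
          moreover have "X C b' H' \<sigma>' e' (take (Suc ?m) a) ?s" using n0 s3 by (intro X_store) auto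
          ultimately show "Q (result ?cc s3)" unfolding r Q_def using w3 fu mm ml j ij pr by simp
          show "fits B ?cc s3" using w3 mB ij cj jB by simp
        qed simp_all
        show ?thesis by (rule run_mono[OF run_seqs[OF 1 run_seqs[OF 2 run_seqs1[OF 3]]]]) auto
      qed
      show "run B ?D s1 (7000*(H' + 1)^2 + 34) Q" if lt: "~ tval (Less (V gi) (Cell (cnt b) (V gj))) s1"
      proof (rule run_loop_free)
        have ij: "?i = ?c ?j" using lt w1 j by simp
        \<comment> \<open>At the end of the last block all elements would have been copied, against
          the loop test.\<close>
        have jM: "?j < M"
        proof (rule ccontr)
          assume "~ ?j < M"
          then have "?j = M" using j by simp
          then have "?m = length a" using j(3) ij sumM by simp
          then show False using ml by simp
        qed
        let ?s = "store_word gi 0 0 (store_word gj 0 (Suc ?j) s1)"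
        have r: "result ?D s1 = ?s" by simp
        have "gframe ?G b' s ?s" by (intro gframe_store g1) auto
        moreover have "X C b' H' \<sigma>' e' (take ?m a) ?s" using n0 by (intro X_store x1) auto
        ultimately show "Q (result ?D s1)" unfolding r Q_def using fu mm ml j ij pr jM by simp
        show "fits B ?D s1" using jB j by simp
      qed simp_all
    qed simp_all
    have 2: "run B (Set fuel (Minus (V fuel) (Const 1))) s2 10 (I k)" if q: "Q s2" for s2
    proof (rule run_loop_free)
      let ?s = "store_word fuel 0 k s2"
      have g2: "gframe ?G b' s s2" and x2: "X C b' H' \<sigma>' e' (take (s2$nxt) a) s2" and f2: "s2$fuel = Suc k"
        using q unfolding Q_def by blast+
      have "gframe ?G b' s ?s" by (intro gframe_store g2) auto
      moreover have "X C b' H' \<sigma>' e' (take (s2$nxt) a) ?s" using n0 by (intro X_store x2) auto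
      ultimately show "I k (result (Set fuel (Minus (V fuel) (Const 1))) s2)" using q f2 unfolding I_def Q_def by simp
      have "M + \<sigma>' + 3 <= B" using bd H2 ss s1'(2) B by linarith
      then have "Suc k <= B" using fu(2) by linarith
      then show "fits B (Set fuel (Minus (V fuel) (Const 1))) s2" using f2 by simp
    qed simp_all
    show ?thesis unfolding copy_step_def by (rule run_mono[OF run_seqs[OF 1 run_seqs1[OF 2]]]) auto
  qed
  have 4: "run B (While ?t (copy_step C b b')) s1 ((M + \<sigma>' + 3)*(10 + (7000*(H' + 1)^2 + 50)) + 10)
    (%s'. \<exists>m'. gframe ?G b' s s' & s'$nxt = m' & m <= m' & m' <= length a &
      X C b' H' \<sigma>' e' (take m' a) s' & (m' = length a \<or> m + \<sigma>' + 3 <= m'))" if I0: "I (M + \<sigma>' + 3) s1" for s1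
  proof (rule run_mono[OF run_loop[where I = I and k = "7000*(H' + 1)^2 + 50", OF I0]])
    have mB: "M + \<sigma>' + 3 <= B" using bd H2 ss s1'(2) B by linarith
    show "tfits B ?t s2" if "I k s2" for k s2
      using that num[of s2] bd(4) H2 mB unfolding I_def by auto
    show "~ tval ?t s2" if "I 0 s2" for s2 using that unfolding I_def by simp
    show "run B (copy_step C b b') s2 (7000*(H' + 1)^2 + 50) (I k)" if "I (Suc k) s2" "tval ?t s2" for k s2
      by (rule step[OF that])
    show "\<exists>m'. gframe ?G b' s s2 & s2$nxt = m' & m <= m' & m' <= length a &
      X C b' H' \<sigma>' e' (take m' a) s2 & (m' = length a \<or> m + \<sigma>' + 3 <= m')"
      if I1: "I k s2" and nt: "~ tval ?t s2" for k s2
    proof -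
      have "k = 0 \<or> length a <= s2$nxt" using nt I1 num[of s2] unfolding I_def by auto
      then show ?thesis using I1 unfolding I_def by auto
    qed
  qed (simp_all)
  show ?thesis unfolding advance_def
  proof (rule run_mono[OF run_seqs[OF 1 run_seqs[OF 2 run_seqs[OF 3 run_seqs1[OF 4]]]]])
    have "(M + \<sigma>' + 3)*(10 + (7000*(H' + 1)^2 + 50)) <= (10*\<sigma> + \<sigma>' + 3)*(7000*(H' + 1)^2 + 60)"
      by (rule mult_le_mono) (use bd(1) in auto)
    moreover have "50*(M + 1) <= 50*(10*\<sigma> + 1)" using bd(1) by simp
    ultimately show "10 + (50*(M + 1) + (30 + ((M + \<sigma>' + 3)*(10 + (7000*(H' + 1)^2 + 50)) + 10))) <=
      50*(10*\<sigma> + 1) + (10*\<sigma> + \<sigma>' + 3)*(7000*(H' + 1)^2 + 60) + 80" by linarith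
  qed
qed

section \<open>The schedule of rebuilding\<close>

text \<open>
  Parameters of the current structure (unprimed) and of the next one (primed), which holds the first
  \<open>m\<close> of \<open>n\<close> elements. The last condition ensures that the next structure is complete
  after at most \<open>\<sigma>'\<close> updates; \<open>d\<close> is the slack before the elements of the present update are copied.
\<close>

definition ok :: "nat => nat => nat => nat => nat => nat => nat => nat => nat => nat => nat => nat => bool" where
  "ok d N n m n0 \<sigma> H e n0' \<sigma>' H' e' \<longleftrightarrow> params n0 \<sigma> H & params n0' \<sigma>' H' & n0 <= N & n0' <= N &
     n0 <= n + e & n <= n0 + e & n0' <= n + e' & n <= n0' + e' &
     e <= \<sigma> + e' & \<sigma>' <= \<sigma> + 1 & e' <= \<sigma>' & n - m + e'*(\<sigma>' + 1) <= n0' + d"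

lemma ok_bounds:
  assumes "ok d N n m n0 \<sigma> H e n0' \<sigma>' H' e'"
  shows "e <= 2*\<sigma> + 1" "e' <= 2*\<sigma>'" "n + e <= 10*\<sigma>*\<sigma>" "n + e' <= 10*\<sigma>'*\<sigma>'" "1 <= \<sigma>" "1 <= \<sigma>'"
proof -
  have p: "1 <= \<sigma>" "n0 < \<sigma>*\<sigma>" "1 <= \<sigma>'" "n0' < \<sigma>'*\<sigma>'" "n <= n0 + e" "n <= n0' + e'" "e <= \<sigma> + e'" "\<sigma>' <= \<sigma> + 1" "e' <= \<sigma>'"
    using assms unfolding ok_def params_def by blast+
  show e: "e <= 2*\<sigma> + 1" "e' <= 2*\<sigma>'" "1 <= \<sigma>" "1 <= \<sigma>'" using p by linarith+
  have "\<sigma> <= \<sigma>*\<sigma>" "\<sigma>' <= \<sigma>'*\<sigma>'" using p by simp_all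
  then show "n + e <= 10*\<sigma>*\<sigma>" "n + e' <= 10*\<sigma>'*\<sigma>'" using p e by linarith+
qed

text \<open>After \<open>\<sigma>'\<close> updates the product would exceed \<open>n0'\<close>,
  which is less than \<open>\<sigma>'*\<sigma>'\<close>. So the next structure is complete in time,
  and the current one is replaced before its age passes \<open>2*\<sigma> + 1\<close>.\<close>

lemma ok_fresh:
  assumes "ok 0 N n m n0 \<sigma> H e n0' \<sigma>' H' e'"
  shows "e' < \<sigma>'" "e <= 2*\<sigma>"
proof -
  have p: "n0' < \<sigma>'*\<sigma>'" "e'*(\<sigma>' + 1) <= n0'" "e <= \<sigma> + e'" "\<sigma>' <= \<sigma> + 1"
    using assms unfolding ok_def params_def by linarith+
  show "e' < \<sigma>'"
  proof (rule ccontr)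
    assume "~ e' < \<sigma>'"
    then have "\<sigma>'*(\<sigma>' + 1) <= e'*(\<sigma>' + 1)" by (intro mult_le_mono1) simp
    then show False using p by simp
  qed
  then show "e <= 2*\<sigma>" using p by linarith
qed

text \<open>An update leaves at most one more element to be copied and adds
  \<open>\<sigma>' + 1\<close> to the product; the slack \<open>\<sigma>' + 2\<close> pays for
  both.\<close>

lemma ok_update:
  assumes o: "ok 0 N n m n0 \<sigma> H e n0' \<sigma>' H' e'" and n: "n' <= n + 1" "n <= n' + 1" "n' - m' <= n - m + 1" and N: "N <= N'"
  shows "ok (\<sigma>' + 2) N' n' m' n0 \<sigma> H (Suc e) n0' \<sigma>' H' (Suc e')"
  using o ok_fresh[OF o] n N unfolding ok_def by simp

text \<open>Copying \<open>\<sigma>' + 3\<close> elements more than repays the slack.\<close>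

lemma ok_advance:
  assumes o: "ok (\<sigma>' + 2) N n m n0 \<sigma> H e n0' \<sigma>' H' e'" and m: "m + \<sigma>' + 3 <= m'" "m' <= n"
  shows "ok 0 N n m' n0 \<sigma> H e n0' \<sigma>' H' e'"
proof -
  have "n - m' + (\<sigma>' + 3) <= n - m" using m by linarith
  moreover have "n - m + e'*(\<sigma>' + 1) <= n0' + (\<sigma>' + 2)" using o unfolding ok_def by blast
  ultimately have "n - m' + e'*(\<sigma>' + 1) <= n0' + 0" by linarith
  then show ?thesis using o unfolding ok_def by blast
qed

text \<open>From \<open>n' < \<sigma>'*\<sigma>'\<close>, growth by \<open>\<sigma>'\<close> stays
  below the next square \<open>(\<sigma>' + 1)*(\<sigma>' + 1)\<close>, so the parameter rises by at
  most one.\<close>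

lemma params_mono:
  assumes "params n \<sigma> H" "params n' \<sigma>' H'" "n <= n' + \<sigma>'"
  shows "\<sigma> <= \<sigma>' + 1"
proof (rule ccontr)
  assume "~ \<sigma> <= \<sigma>' + 1"
  then have "(\<sigma>' + 1)*(\<sigma>' + 1) <= (\<sigma> - 1)*(\<sigma> - 1)" by (intro mult_le_mono) auto
  then show False using assms unfolding params_def by simp
qed

lemma params_le:
  assumes p: "params n \<sigma> H" and "\<sigma> <= S" "256*S*S <= 2^Suc L"
  shows "H <= L"
proof -
  have "256*\<sigma>*\<sigma> <= 256*S*S" using assms(2) by (intro mult_le_mono) auto
  then have "(2::nat)^H < 2^Suc L" using p assms(3) unfolding params_def by linarith
  then have "H < Suc L" by (rule power_less_imp_less_exp[rotated]) simp
  then show ?thesis by simp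
qed

text \<open>The completed structure enters service with age at most \<open>\<sigma>'\<close>, and
  its successor starts with age 0 and nothing copied.\<close>

lemma ok_swap:
  assumes o: "ok d N n m n0 \<sigma> H e n0' \<sigma>' H' e'" and p: "params n r h" and n: "n <= N"
  shows "ok 0 N n 0 n0' \<sigma>' H' e' n r h 0"
proof -
  have q: "params n0' \<sigma>' H'" "n <= n0' + e'" "e' <= \<sigma>'" using o unfolding ok_def by blast+
  have "r <= \<sigma>' + 1" by (rule params_mono[OF p q(1)]) (use q in linarith)
  then show ?thesis using o p n unfolding ok_def by simp
qed

section \<open>Word size\<close>

text \<open>Collects what the word range has to hold: node names, sums of two addresses, and
  counters, for all parameters that can arise while the length is at most \<open>N\<close>.\<close>

definition room :: "nat => nat => nat => bool" where
  "room C N B \<longleftrightarrow> C <= B & (\<forall>n0 \<sigma> H n e. params n0 \<sigma> H --> n0 <= N --> n <= N --> e <= 2*\<sigma> + 1 -->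
     (n + 2*e + 2)*alloc C \<sigma> H + 50 <= B & 2*2^H + 4 <= B & n + e + 4 <= B)"

lemma roomD:
  assumes "room C N B" "params n0 \<sigma> H" "n0 <= N" "n <= N" "e <= 2*\<sigma> + 1"
  shows "(n + 2*e + 2)*alloc C \<sigma> H + 50 <= B" "2*2^H + 4 <= B" "n + e + 4 <= B" "C <= B"
  using assms unfolding room_def by blast+

text \<open>With \<open>M = N + 2\<close> one has \<open>\<sigma> < M\<close> and
  \<open>2^H <= 256*M*M\<close>, so the node bound is at most \<open>(6144*C + 36864)*M^4\<close>,
  where \<open>6144 = 6*4*256\<close> and \<open>36864 = 6*24*256\<close>. Adding 50 gives the
  factor \<open>K\<close>, which \<open>K <= M^K\<close> absorbs into the exponent
  \<open>K + 4\<close>.\<close>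

lemma room_power: "room C N ((N + 2)^(6144*C + 36918))"
proof -
  define M where "M = N + 2"
  define K where "K = 6144*C + 36914"
  have M: "2 <= M" "N + 2 <= M" by (simp_all add: M_def)
  have M4: "1 <= M^4" "M*M <= M^4" "M <= M*M"
  proof -
    show "1 <= M^4" "M <= M*M" using M by simp_all
    have "M^2 <= M^4" by (rule power_increasing) (use M in auto)
    then show "M*M <= M^4" by (simp add: power2_eq_square)
  qed
  have "K <= M^K"
  proof -
    have "K <= 2^K" by (simp add: less_imp_le)
    also have "\<dots> <= M^K" using M by (intro power_mono) auto
    finally show ?thesis .
  qed
  then have KB: "K*M^4 <= M^(6144*C + 36918)"
  proof -
    assume "K <= M^K"
    then have "K*M^4 <= M^K*M^4" by (rule mult_le_mono1)
    also have "\<dots> = M^(K + 4)" by (simp only: power_add)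
    also have "K + 4 = 6144*C + 36918" by (simp add: K_def)
    finally show ?thesis .
  qed
  have K1: "K*1 <= K*M^4" using M4 by (intro mult_le_mono2)
  have "(n + 2*e + 2)*alloc C \<sigma> H + 50 <= K*M^4 & 2*2^H + 4 <= K*M^4 & n + e + 4 <= K*M^4"
    if p: "params n0 \<sigma> H" and n0: "n0 <= N" and n: "n <= N" and e: "e <= 2*\<sigma> + 1" for n0 \<sigma> H n e
  proof -
    have s1: "1 <= \<sigma>" using p unfolding params_def by blast
    have "\<sigma> - 1 <= (\<sigma> - 1)*(\<sigma> - 1)" by (cases "\<sigma> - 1") auto
    then have sM: "\<sigma> + 1 <= M" using p n0 M unfolding params_def by linarith
    have "256*\<sigma>*\<sigma> <= 256*M*M" using sM by (intro mult_le_mono) auto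
    then have H2: "2^H <= 256*(M*M)" using p unfolding params_def by linarith
    have "H < 2^H" by simp
    then have H: "H + 1 <= 256*(M*M)" using H2 by linarith
    have sH: "\<sigma>*(H + 1) <= M*(256*(M*M))" by (rule mult_le_mono) (use sM H in auto)
    have "(C*\<sigma> + 3)*(4*H + 4) <= ((C + 3)*\<sigma>)*(4*H + 4)" using s1 by (intro mult_le_mono1) (simp add: algebra_simps)
    also have "\<dots> = (4*C + 12)*(\<sigma>*(H + 1))" by (simp add: algebra_simps)
    finally have "alloc C \<sigma> H <= 12*(\<sigma>*(H + 1)) + (4*C + 12)*(\<sigma>*(H + 1))" unfolding alloc_def by (simp add: algebra_simps)
    also have "\<dots> = (4*C + 24)*(\<sigma>*(H + 1))" by (simp only: add_mult_distrib[symmetric]) simp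
    also have "\<dots> <= (4*C + 24)*(M*(256*(M*M)))" using sH by (rule mult_le_mono2)
    finally have a: "alloc C \<sigma> H <= (4*C + 24)*(M*(256*(M*M)))" .
    have n6: "n + 2*e + 2 <= 6*M" using n e sM M by linarith
    have "(n + 2*e + 2)*alloc C \<sigma> H <= (6*M)*((4*C + 24)*(M*(256*(M*M))))" using n6 a by (rule mult_le_mono)
    also have "\<dots> = (6144*C + 36864)*M^4" by (simp add: algebra_simps power4_eq_xxxx)
    finally have "(n + 2*e + 2)*alloc C \<sigma> H + 50 <= (6144*C + 36864)*M^4 + 50*M^4" using M4 by linarith
    also have "\<dots> = K*M^4" unfolding K_def by (simp only: add_mult_distrib[symmetric]) simp
    finally have 1: "(n + 2*e + 2)*alloc C \<sigma> H + 50 <= K*M^4" .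
    have k: "600*M^4 <= K*M^4" unfolding K_def by (rule mult_le_mono1) simp
    have "2*2^H + 4 <= K*M^4" using H2 M4 k by linarith
    moreover have "n + e + 4 <= K*M^4" using n6 M4 k M by linarith
    ultimately show ?thesis using 1 by blast
  qed
  moreover have "C <= K*1" by (simp add: K_def)
  then have "C <= K*M^4" using K1 by (rule le_trans)
  ultimately show ?thesis unfolding room_def M_def[symmetric] using KB le_trans by blast
qed

section \<open>One update of the pair of structures\<close>

definition finish :: "nat => com" where
  "finish b = Cond (Less (V nxt) (V num)) Skip
     (seqs [seqs [Set flip (Minus (Const 1) (V flip)), Set nxt (Const 0)], start_build b])"

definition dyn_inv :: "nat => nat => nat => real list => nat => state => bool" where
  "dyn_inv C b b' a N s \<longleftrightarrow> bases b b' & s$num = length a & s$started = 1 & s$flip = (if b = 40 then 0 else 1) &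
     (\<exists>m n0 \<sigma> H e n0' \<sigma>' H' e'. ok 0 N (length a) m n0 \<sigma> H e n0' \<sigma>' H' e' & m <= length a & s$nxt = m &
       X C b H \<sigma> e a s & X C b' H' \<sigma>' e' (take m a) s)"

lemma gframe_global: "gframe G b s s' ==> bases b b' \<or> bases b' b ==> a \<in> {0, 1} \<union> {44..<48} ==> a \<notin> G ==> words s' a = words s a"
proof -
  assume g: "gframe G b s s'" and "bases b b' \<or> bases b' b" "a \<in> {0, 1} \<union> {44..<48}" "a \<notin> G"
  then have "a \<notin> G \<union> {2..<40} \<union> {b + 11..<b + 24}" unfolding bases_def by auto
  then show ?thesis using g unfolding gframe_def by blast
qed

lemma bases_sym: "bases b b' ==> bases b' b"
  unfolding bases_def by blast

lemma xframe_gframe: "xframe b s s' ==> gframe {} b s s'"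
  by (rule gframe_xframe[OF gframe_refl])

text \<open>Unless copying is finished, the slack \<open>d\<close> has been repaid; if it is
  finished, the swap opens a new account. The old structure's arrays are reused for the
  successor.\<close>

lemma finish_run:
  assumes bb: "bases b b'" and o: "ok d N (length a) m n0 \<sigma> H e n0' \<sigma>' H' e'" and d: "d = 0 \<or> m = length a"
    and m: "m <= length a" "s$nxt = m" and N: "length a <= N" "room C N B"
    and w: "s$num = length a" "s$started = 1" "s$flip = (if b = 40 then 0 else 1)"
    and X: "X C b H \<sigma> e a s" "X C b' H' \<sigma>' e' (take m a) s" and L: "256*(\<sigma> + 2)*(\<sigma> + 2) <= 2^Suc L"
  shows "run B (finish b) s (20*\<sigma> + 20*L + 200) (%s'. s'$1 = s$1 & (dyn_inv C b b' a N s' \<or> dyn_inv C b' b a N s'))"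
proof -
  obtain r h where p: "params (length a) r h" using ex_params by blast
  have o': "ok 0 N (length a) 0 n0' \<sigma>' H' e' (length a) r h 0" by (rule ok_swap[OF o p N(1)])
  have rs: "r <= \<sigma> + 2" using o o' unfolding ok_def by linarith
  have hL: "h <= L" by (rule params_le[OF p rs L])
  have B: "length a + 4 <= B" "2*2^h + 4 <= B" using roomD(2,3)[OF N(2) p N(1) N(1), of 0] by simp_all
  have b: "40 <= b" "40 <= b'" using bb unfolding bases_def by auto
  let ?c = "seqs [seqs [Set flip (Minus (Const 1) (V flip)), Set nxt (Const 0)], start_build b]"
  show ?thesis unfolding finish_def
  proof (rule run_mono[OF run_Cond[where k = "20 + (20*r + 20*h + 100)"]])
    show "tfits B (Less (V nxt) (V num)) s" using m w B by simp
    let ?Q = "%s'. s'$1 = s$1 & (dyn_inv C b b' a N s' \<or> dyn_inv C b' b a N s')"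
    show "run B Skip s (20 + (20*r + 20*h + 100)) ?Q" if t: "tval (Less (V nxt) (V num)) s"
    proof (rule run_loop_free)
      have "d = 0" using t m w d by simp
      then have "dyn_inv C b b' a N s" unfolding dyn_inv_def using bb w o m X by blast
      then show "?Q (result Skip s)" by simp
    qed simp_all
    show "run B ?c s (20 + (20*r + 20*h + 100)) ?Q" if t: "~ tval (Less (V nxt) (V num)) s"
    proof -
      let ?f = "if b' = 40 then 0 else 1"
      let ?s = "store_word nxt 0 0 (store_word flip 0 ?f s)"
      have mn: "m = length a" using t m w by simp
      have 1: "run B (seqs [Set flip (Minus (Const 1) (V flip)), Set nxt (Const 0)]) s 20 (%s1. s1 = ?s)"
        using w(3) bb B by (intro run_loop_free) (auto simp: bases_def)
      have 2: "run B (start_build b) s1 (20*r + 20*h + 100) ?Q" if s1: "s1 = ?s" for s1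
      proof (rule run_mono[OF start_build_run[OF b(1) _ _ p _ B(2), of s1 C] order_refl])
        show "b ~= 44" "num \<notin> {b + 11..<b + 24}" using bb unfolding bases_def by auto
        show "s1$num = length a" "length a + 2 <= B" using w B unfolding s1 by simp_all
        fix s2 assume s2: "xframe b s1 s2 & X C b h r 0 [] s2"
        have g2: "gframe {} b s1 s2" using s2 xframe_gframe by blast
        have ws: "s2$1 = s$1" "s2$num = length a" "s2$started = 1" "s2$flip = ?f" "s2$nxt = 0"
          using gframe_global[OF g2 disjI1[OF bb]] w unfolding s1 by simp_all
        have n1: "nxt \<notin> {b' + 11..<b' + 24}" "flip \<notin> {b' + 11..<b' + 24}" using bb unfolding bases_def by auto
        have "X C b' H' \<sigma>' e' a s1" unfolding s1 using X(2) mn n1 by (intro X_store) auto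
        then have "X C b' H' \<sigma>' e' a s2" by (rule X_gframe[OF _ g2 bases_sym[OF bb]]) simp
        moreover have "X C b h r 0 (take 0 a) s2" using s2 by simp
        ultimately have "dyn_inv C b' b a N s2" unfolding dyn_inv_def using ws bases_sym[OF bb] o' by blast
        then show "?Q s2" using ws(1) by blast
      qed
      show ?thesis by (rule run_mono[OF run_seqs[OF 1 run_seqs1[OF 2]] order_refl])
    qed
  qed (use rs hL in simp_all)
qed

text \<open>Integer form of the guarantee: for \<open>C > 3\<close> the error \<open>n - v\<close>
  is at most \<open>6/(C - 3)\<close> times \<open>n\<close>.\<close>

definition good :: "nat => nat => nat => bool" where
  "good C n v \<longleftrightarrow> v <= n & (C - 3)*(n - v) <= 6*n"

text \<open>The error is at most \<open>2*e <= 6*\<sigma>\<close>, whereas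
  \<open>n > C*\<sigma> - e >= (C - 3)*\<sigma>\<close>.\<close>

lemma good_intro:
  assumes "v <= n" "v = n \<or> n <= v + 2*e & C*\<sigma> < n + e" "e <= 3*\<sigma>"
  shows "good C n v"
proof (cases "v = n")
  case False
  then have a: "n - v <= 6*\<sigma>" "C*\<sigma> <= n + 3*\<sigma>" using assms by linarith+
  have "(C - 3)*\<sigma> <= n" using a(2) by (simp add: diff_mult_distrib)
  moreover have "(C - 3)*(n - v) <= (C - 3)*(6*\<sigma>)" using a(1) by (rule mult_le_mono2)
  moreover have "(C - 3)*(6*\<sigma>) = 6*((C - 3)*\<sigma>)" by simp
  ultimately have "(C - 3)*(n - v) <= 6*n" by linarith
  then show ?thesis using assms(1) unfolding good_def by blast
qed (simp add: good_def)

text \<open>The search in \<open>c1\<close> changes \<open>vi\<close>, which is therefore reloaded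
  before \<open>c2\<close>. Copying overwrites the inserted value in key array 0, so
  \<open>advance\<close> has to come after \<open>c2\<close>.\<close>

definition update_com :: "nat => nat => nat => com => wexp => com => com" where
  "update_com C b b' c1 en c2 = seqs [Set vi (V 0), c1, seqs [Set num en, Set vi (V 0)], report b, c2, advance C b b', finish b]"

lemma time_bound:
  fixes S L :: nat
  assumes S: "\<sigma> + 2 <= S" "\<sigma>' + 1 <= S" "H <= L" "H' <= L"
  shows "(C + 20)*\<sigma>*(2000*(H + 1)^2) + ((C + 20)*\<sigma>'*(2000*(H' + 1)^2) + 30) +
    (50*(10*\<sigma> + 1) + (10*\<sigma> + \<sigma>' + 3)*(7000*(H' + 1)^2 + 60) + 80) + (20*\<sigma> + 20*L + 200) + 60
    <= (4000*C + 200000)*(S*(L + 1)^2)"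
proof -
  define Z where "Z = (L + 1)^2"
  define P where "P = S*Z"
  have Z: "(H + 1)^2 <= Z" "(H' + 1)^2 <= Z" "L + 1 <= Z" unfolding Z_def using S by (intro power_mono; simp)+ (simp add: power2_eq_square)
  have P: "S <= P" "L <= P" "1 <= P" unfolding P_def using Z S by (cases Z; cases S; auto)+
  have "(C + 20)*\<sigma>*(2000*(H + 1)^2) <= (C + 20)*S*(2000*Z)" using S Z by (intro mult_le_mono) auto
  also have "\<dots> = (2000*C + 40000)*P" unfolding P_def by (simp add: algebra_simps)
  finally have 1: "(C + 20)*\<sigma>*(2000*(H + 1)^2) <= (2000*C + 40000)*P" .
  have "(C + 20)*\<sigma>'*(2000*(H' + 1)^2) <= (C + 20)*S*(2000*Z)" using S Z by (intro mult_le_mono) auto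
  also have "\<dots> = (2000*C + 40000)*P" unfolding P_def by (simp add: algebra_simps)
  finally have 2: "(C + 20)*\<sigma>'*(2000*(H' + 1)^2) <= (2000*C + 40000)*P" .
  have "(10*\<sigma> + \<sigma>' + 3)*(7000*(H' + 1)^2 + 60) <= (13*S)*(7060*Z)" using S Z by (intro mult_le_mono) auto
  also have "\<dots> = 91780*P" unfolding P_def by simp
  finally have 3: "(10*\<sigma> + \<sigma>' + 3)*(7000*(H' + 1)^2 + 60) <= 91780*P" .
  have "(4000*C + 200000)*P = (2000*C + 40000)*P + (2000*C + 40000)*P + 120000*P" by (simp add: algebra_simps)
  moreover have "x + (y + 30) + (50*(10*\<sigma> + 1) + z + 80) + (20*\<sigma> + 20*L + 200) + 60 <= u"
    if "x <= q" "y <= q" "z <= 91780*P" "u = q + q + 120000*P" for x y z u q :: nat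
  proof -
    have "\<sigma> <= P" "L <= P" "1 <= P" using P S by linarith+
    then have "20*\<sigma> + 20*L + 500*\<sigma> + 420 <= 28220*P" by simp
    then show ?thesis using that by simp
  qed
  ultimately show ?thesis using 1 2 3 unfolding P_def[symmetric] Z_def[symmetric] by blast
qed

lemma update_run:
  assumes bb: "bases b b'" and o: "ok 0 N (length a) m n0 \<sigma> H e n0' \<sigma>' H' e'"
    and m: "m <= length a" "s$nxt = m"
    and w: "s$num = length a" "s$started = 1" "s$flip = (if b = 40 then 0 else 1)"
    and X: "X C b H \<sigma> e a s" "X C b' H' \<sigma>' e' (take m a) s"
    and px: "s$0 = p" "keys s 0 0 = x" "p <= length a"
    and n: "length a' <= length a + 1" "length a <= length a' + 1" "length a' - m' <= length a - m + 1" "m' <= length a'"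
    and N: "N <= N'" "length a <= N" "length a' <= N'" "room C N' B"
    and c1: "!!s0. s0$vi = p ==> keys s0 0 0 = x ==> X C b H \<sigma> e a s0 ==>
      run B c1 s0 ((C + 20)*\<sigma>*(2000*(H + 1)^2)) (%s1. xframe b s0 s1 & X C b H \<sigma> (Suc e) a' s1)"
    and c2: "!!s0. s0$vi = p ==> s0$0 = p ==> s0$nxt = m ==> keys s0 0 0 = x ==> X C b' H' \<sigma>' e' (take m a) s0 ==>
      run B c2 s0 ((C + 20)*\<sigma>'*(2000*(H' + 1)^2) + 30)
        (%s1. gframe {nxt} b' s0 s1 & X C b' H' \<sigma>' (Suc e') (take m' a') s1 & s1$nxt = m')"
    and en: "!!s0. s0$num = length a ==> wval en s0 = length a' & wfits B en s0" "wcost en <= 4"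
    and L: "256*(\<sigma> + 2)*(\<sigma> + 2) <= 2^Suc L"
  shows "run B (update_com C b b' c1 en c2) s ((4000*C + 200000)*((\<sigma> + 2)*(L + 1)^2))
    (%s'. (dyn_inv C b b' a' N' s' \<or> dyn_inv C b' b a' N' s') & good C (LIS a') (s'$1))"
proof -
  let ?fl = "if b = 40 then 0 else 1 :: nat"
  have b: "40 <= b" "40 <= b'" using bb unfolding bases_def by auto
  have sb: "bases b' b" by (rule bases_sym[OF bb])
  have o1: "ok (\<sigma>' + 2) N' (length a') m' n0 \<sigma> H (Suc e) n0' \<sigma>' H' (Suc e')" by (rule ok_update[OF o n(1,2,3) N(1)])
  note bd = ok_bounds[OF o1]
  have ps: "params n0 \<sigma> H" "params n0' \<sigma>' H'" "n0 <= N'" "n0' <= N'" "\<sigma>' <= \<sigma> + 1" using o1 unfolding ok_def by blast+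
  have e2: "Suc e' <= 2*\<sigma>' + 1" using bd by linarith
  note r1 = roomD[OF N(4) ps(1,3) N(3) bd(1)] and r2 = roomD[OF N(4) ps(2,4) N(3) e2]
  have pB: "p + 2 <= B" "length a + 2 <= B" using roomD(3)[OF N(4) ps(1,3), of "length a" 0] N px(3) by linarith+
  have nx: "a \<in> {vi, num, 1, nxt} ==> a \<notin> {b + 11..<b + 24} & a \<notin> {b' + 11..<b' + 24}" for a
    using bb unfolding bases_def by auto
  define F where "F s1 \<longleftrightarrow> s1$0 = p & keys s1 0 0 = x & s1$nxt = m & s1$started = 1 &
    s1$flip = ?fl & X C b' H' \<sigma>' e' (take m a) s1" for s1
  have Fstore: "F (store_word c 0 v s1)" if "F s1" "c \<in> {vi, num, 1}" for c v s1
  proof -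
    have "X C b' H' \<sigma>' e' (take m a) s1" using that(1) unfolding F_def by blast
    then have "X C b' H' \<sigma>' e' (take m a) (store_word c 0 v s1)" by (rule X_store) (use that(2) nx[of c] in blast)
    moreover have "c ~= 0" "c ~= nxt" "c ~= started" "c ~= flip" using that(2) by auto
    ultimately show ?thesis using that(1) unfolding F_def by simp
  qed
  define A1 where "A1 s1 \<longleftrightarrow> F s1 & s1$num = length a & X C b H \<sigma> (Suc e) a' s1" for s1
  define A2 where "A2 s1 \<longleftrightarrow> F s1 & s1$num = length a' & X C b H \<sigma> (Suc e) a' s1 & s1$vi = p" for s1
  define A3 where "A3 s1 \<longleftrightarrow> A2 s1 & good C (LIS a') (s1$1)" for s1
  define A4 where "A4 k s1 \<longleftrightarrow> s1$started = 1 & s1$flip = ?fl & s1$num = length a' & s1$nxt = k &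
    X C b H \<sigma> (Suc e) a' s1 & X C b' H' \<sigma>' (Suc e') (take k a') s1 & good C (LIS a') (s1$1)" for k s1
  define A5 where "A5 s1 \<longleftrightarrow> (\<exists>k. A4 k s1 & k <= length a' & (k = length a' \<or> m' + \<sigma>' + 3 <= k))" for s1
  have 1: "run B (Set vi (V 0)) s 10 (%s0. s0 = store_word vi 0 p s)"
    by (rule run_loop_free) (use px pB in auto)
  have 2: "run B c1 s0 ((C + 20)*\<sigma>*(2000*(H + 1)^2)) A1" if s0: "s0 = store_word vi 0 p s" for s0
  proof (rule run_mono[OF c1 order_refl])
    have F0: "F s0" unfolding s0 by (rule Fstore) (use px m w X in "auto simp: F_def")
    show "s0$vi = p" "keys s0 0 0 = x" using px s0 by simp_all
    show "X C b H \<sigma> e a s0" unfolding s0 by (rule X_store[OF X(1)]) (use nx[of vi] in simp)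
    fix s1 assume s1: "xframe b s0 s1 & X C b H \<sigma> (Suc e) a' s1"
    have g: "gframe {} b s0 s1" using s1 xframe_gframe by blast
    have "words s1 c = words s0 c" if "c \<in> {0, 1} \<union> {44..<48}" for c using gframe_global[OF g disjI1[OF bb] that] by simp
    moreover have "keys s1 0 = keys s0 0" using s1 b unfolding xframe_def by simp
    moreover have "X C b' H' \<sigma>' e' (take m a) s1" by (rule X_gframe[OF _ g sb]) (use F0 in "auto simp: F_def")
    ultimately show "A1 s1" unfolding A1_def using F0 s1 w(1) unfolding F_def s0 by simp
  qed
  have 3: "run B (seqs [Set num en, Set vi (V 0)]) s1 20 A2" if a1: "A1 s1" for s1
  proof (rule run_loop_free)
    let ?s = "store_word vi 0 p (store_word num 0 (length a') s1)"
    have F1: "F s1" "s1$num = length a" "X C b H \<sigma> (Suc e) a' s1" using a1 unfolding A1_def by blast+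
    have p1: "s1$0 = p" using F1 unfolding F_def by blast
    have r: "result (seqs [Set num en, Set vi (V 0)]) s1 = ?s" using en(1)[OF F1(2)] p1 by simp
    have "F ?s" by (intro Fstore F1) auto
    moreover have "X C b H \<sigma> (Suc e) a' ?s" using nx[of vi] nx[of num] by (intro X_store F1) simp_all
    ultimately show "A2 (result (seqs [Set num en, Set vi (V 0)]) s1)" unfolding r A2_def by simp
    show "fits B (seqs [Set num en, Set vi (V 0)]) s1" using en(1)[OF F1(2)] p1 pB by simp
  qed (use en(2) in simp_all)
  have 4: "run B (report b) s2 20 A3" if a2: "A2 s2" for s2
  proof (rule run_mono[OF report_run order_refl])
    have F2: "F s2" "X C b H \<sigma> (Suc e) a' s2" using a2 unfolding A2_def by blast+
    show "X C b H \<sigma> (Suc e) a' s2" by (rule F2(2))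
    show "40 <= b" "length a' + Suc e + 4 <= B" using b r1(3) by simp_all
    fix s3 assume s3: "s3 = store_word 1 0 (s3$1) s2 & s3$1 <= LIS a' &
       (s3$1 = LIS a' \<or> LIS a' <= s3$1 + 2*Suc e & C*\<sigma> < LIS a' + Suc e)"
    define v where "v = s3$1"
    have s3': "s3 = store_word 1 0 v s2" using s3 unfolding v_def by blast
    have vv: "v <= LIS a'" "v = LIS a' \<or> LIS a' <= v + 2*Suc e & C*\<sigma> < LIS a' + Suc e" using s3 unfolding v_def by blast+
    have "Suc e <= 3*\<sigma>" using bd by linarith
    then have "good C (LIS a') v" by (rule good_intro[OF vv])
    moreover have "s3$1 = v" "s3$num = s2$num" "s3$vi = s2$vi" by (simp_all add: s3')
    moreover have "F s3" unfolding s3' by (intro Fstore F2) auto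
    moreover have "X C b H \<sigma> (Suc e) a' s3" unfolding s3' using nx[of 1] by (intro X_store F2) simp
    ultimately show "A3 s3" unfolding A3_def A2_def using a2 unfolding A2_def by presburger
  qed
  have 5: "run B c2 s3 ((C + 20)*\<sigma>'*(2000*(H' + 1)^2) + 30) (A4 m')" if a3: "A3 s3" for s3
  proof (rule run_mono[OF c2 order_refl])
    have F3: "F s3" "s3$num = length a'" "X C b H \<sigma> (Suc e) a' s3" "s3$vi = p" "good C (LIS a') (s3$1)"
      using a3 unfolding A3_def A2_def by blast+
    show "s3$vi = p" "s3$0 = p" "s3$nxt = m" "keys s3 0 0 = x" "X C b' H' \<sigma>' e' (take m a) s3"
      using F3 unfolding F_def by blast+
    fix s4 assume s4: "gframe {nxt} b' s3 s4 & X C b' H' \<sigma>' (Suc e') (take m' a') s4 & s4$nxt = m'"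
    have g: "gframe {nxt} b' s3 s4" using s4 by blast
    have "words s4 1 = words s3 1" "words s4 num = words s3 num" "words s4 started = words s3 started" "words s4 flip = words s3 flip"
      by (rule gframe_global[OF g disjI1[OF sb]]; simp)+
    moreover have "X C b H \<sigma> (Suc e) a' s4" by (rule X_gframe[OF F3(3) g bb]) auto
    ultimately show "A4 m' s4" unfolding A4_def using F3 s4 unfolding F_def by simp
  qed
  have 6: "run B (advance C b b') s4 (50*(10*\<sigma> + 1) + (10*\<sigma> + \<sigma>' + 3)*(7000*(H' + 1)^2 + 60) + 80) A5" if a4: "A4 m' s4" for s4
  proof (rule run_mono[OF advance_run[OF bb] order_refl])
    show "X C b H \<sigma> (Suc e) a' s4" "X C b' H' \<sigma>' (Suc e') (take m' a') s4" "s4$nxt = m'" "s4$num = length a'"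
      using a4 unfolding A4_def by blast+
    fix s5 assume "\<exists>k. gframe {nxt, gj, gi, fuel} b' s4 s5 & s5$nxt = k & m' <= k & k <= length a' &
      X C b' H' \<sigma>' (Suc e') (take k a') s5 & (k = length a' \<or> m' + \<sigma>' + 3 <= k)"
    then obtain k where g: "gframe {nxt, gj, gi, fuel} b' s4 s5" and k: "s5$nxt = k" "m' <= k" "k <= length a'"
      "X C b' H' \<sigma>' (Suc e') (take k a') s5" "k = length a' \<or> m' + \<sigma>' + 3 <= k" by blast
    have "words s5 1 = words s4 1" "words s5 num = words s4 num" "words s5 started = words s4 started" "words s5 flip = words s4 flip"
      by (rule gframe_global[OF g disjI1[OF sb]]; simp)+
    moreover have "X C b H \<sigma> (Suc e) a' s5" by (rule X_gframe[OF _ g bb]) (use a4 in "auto simp: A4_def")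
    ultimately have "A4 k s5" using k a4 unfolding A4_def by simp
    then show "A5 s5" unfolding A5_def using k by blast
  qed (use n bd r1 r2 in auto)
  have 7: "run B (finish b) s5 (20*\<sigma> + 20*L + 200)
    (%s'. (dyn_inv C b b' a' N' s' \<or> dyn_inv C b' b a' N' s') & good C (LIS a') (s'$1))" if a5: "A5 s5" for s5
  proof -
    obtain k where k: "A4 k s5" "k <= length a'" "k = length a' \<or> m' + \<sigma>' + 3 <= k" using a5 unfolding A5_def by blast
    have f: "s5$started = 1" "s5$flip = ?fl" "s5$num = length a'" "s5$nxt = k"
      "X C b H \<sigma> (Suc e) a' s5" "X C b' H' \<sigma>' (Suc e') (take k a') s5" "good C (LIS a') (s5$1)"
      using k(1) unfolding A4_def by blast+
    obtain d where d: "d = 0 \<or> k = length a'" "ok d N' (length a') k n0 \<sigma> H (Suc e) n0' \<sigma>' H' (Suc e')"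
    proof (cases "k = length a'")
      case True
      have "length a' - k <= length a' - m'" using True by simp
      then have "ok (\<sigma>' + 2) N' (length a') k n0 \<sigma> H (Suc e) n0' \<sigma>' H' (Suc e')" using o1 unfolding ok_def by linarith
      then show ?thesis using that True by blast
    next
      case False
      then have "m' + \<sigma>' + 3 <= k" using k(3) by blast
      then show ?thesis using that ok_advance[OF o1 _ k(2)] by blast
    qed
    show ?thesis
      by (rule run_mono[OF finish_run[OF bb d(2,1) k(2) f(4) N(3,4) f(3,1,2,5,6) L] order_refl]) (use f(7) in auto)
  qed
  show ?thesis unfolding update_com_def
  proof (rule run_mono[OF run_seqs[OF 1 run_seqs[OF 2 run_seqs[OF 3 run_seqs[OF 4 run_seqs[OF 5 run_seqs[OF 6 run_seqs1[OF 7]]]]]]]])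
    have "H <= L" by (rule params_le[OF ps(1) _ L]) simp
    moreover have "H' <= L" by (rule params_le[OF ps(2) _ L]) (use ps(5) in simp)
    ultimately have t: "(C + 20)*\<sigma>*(2000*(H + 1)^2) + ((C + 20)*\<sigma>'*(2000*(H' + 1)^2) + 30) +
      (50*(10*\<sigma> + 1) + (10*\<sigma> + \<sigma>' + 3)*(7000*(H' + 1)^2 + 60) + 80) + (20*\<sigma> + 20*L + 200) + 60
      <= (4000*C + 200000)*((\<sigma> + 2)*(L + 1)^2)" using ps(5) by (intro time_bound) auto
    show "10 + ((C + 20)*\<sigma>*(2000*(H + 1)^2) + (20 + (20 + ((C + 20)*\<sigma>'*(2000*(H' + 1)^2) + 30 +
      (50*(10*\<sigma> + 1) + (10*\<sigma> + \<sigma>' + 3)*(7000*(H' + 1)^2 + 60) + 80 + (20*\<sigma> + 20*L + 200)))))) <=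
      (4000*C + 200000)*((\<sigma> + 2)*(L + 1)^2)" by (rule le_trans[OF _ t]) simp
  qed
qed

definition ins_next :: "nat => nat => com" where
  "ins_next C b = Cond (Less (V 0) (Plus (V nxt) (Const 1))) (seqs [ins C b, Set nxt (Plus (V nxt) (Const 1))]) (tick b)"

definition del_next :: "nat => com" where
  "del_next b = Cond (Less (V 0) (V nxt)) (seqs [del b, Set nxt (Minus (V nxt) (Const 1))]) (tick b)"

definition ins_com :: "nat => nat => nat => com" where
  "ins_com C b b' = update_com C b b' (ins C b) (Plus (V num) (Const 1)) (ins_next C b')"

definition del_com :: "nat => nat => nat => com" where
  "del_com C b b' = update_com C b b' (del b) (Minus (V num) (Const 1)) (del_next b')"

lemma next_run:
  assumes bb: "bases b b'" and m: "s$nxt = m" and B: "e' + 1 <= B" "tfits B t s" "tcost t <= 10" "wfits B en s" "wcost en <= 4" "wval en s = k"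
    and en: "!!s'. s'$nxt = m ==> wval en s' = k & wfits B en s'"
    and X: "X C b' H' \<sigma>' e' xs s" and c: "tval t s ==> run B c s T (%s'. xframe b' s s' & X C b' H' \<sigma>' (Suc e') ys s')"
    and r: "~ tval t s ==> ys = xs & k' = m" "tval t s ==> k' = k"
  shows "run B (Cond t (seqs [c, Set nxt en]) (tick b')) s (T + 30)
    (%s1. gframe {nxt} b' s s1 & X C b' H' \<sigma>' (Suc e') ys s1 & s1$nxt = k')"
proof (rule run_mono[OF run_Cond[where k = "T + 10"]])
  let ?Q = "%s1. gframe {nxt} b' s s1 & X C b' H' \<sigma>' (Suc e') ys s1 & s1$nxt = k'"
  have n: "nxt \<notin> {b' + 11..<b' + 24}" "nxt \<notin> {2..<40} \<union> {b' + 11..<b' + 24}" using bb unfolding bases_def by auto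
  have g: "gframe {nxt} b' s s1 & s1$nxt = m" if "xframe b' s s1" for s1
    using gframe_xframe[OF gframe_refl that] that n m unfolding xframe_def by auto
  show "run B (seqs [c, Set nxt en]) s (T + 10) ?Q" if t: "tval t s"
  proof (rule run_mono[OF run_seqs[OF c[OF t] run_seqs1] order_refl])
    show "run B (Set nxt en) s1 10 ?Q" if s1: "xframe b' s s1 & X C b' H' \<sigma>' (Suc e') ys s1" for s1
    proof (rule run_loop_free)
      have w: "gframe {nxt} b' s s1" "s1$nxt = m" using g s1 by blast+
      have "gframe {nxt} b' s (store_word nxt 0 k s1)" by (rule gframe_store[OF w(1)]) simp
      moreover have "X C b' H' \<sigma>' (Suc e') ys (store_word nxt 0 k s1)" by (rule X_store) (use s1 n in blast)+
      ultimately show "?Q (result (Set nxt en) s1)" using en[OF w(2)] r(2)[OF t] by simp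
      show "fits B (Set nxt en) s1" using en[OF w(2)] by simp
    qed (use B in simp_all)
  qed
  show "run B (tick b') s (T + 10) ?Q" if t: "~ tval t s"
    by (rule run_mono[OF X_tick[OF X B(1)]]) (use g r(1)[OF t] in auto)
qed (use B in auto)

text \<open>Holds for suitable \<open>S\<close> of order \<open>sqrt n\<close> and \<open>L\<close> of order \<open>log n\<close>.\<close>

definition span :: "nat => nat => nat => bool" where
  "span n S L \<longleftrightarrow> (\<forall>\<sigma>. (\<sigma> - 1)*(\<sigma> - 1) <= n + 1 + 2*\<sigma> --> \<sigma> + 2 <= S) & 256*S*S <= 2^Suc L"

text \<open>\<open>\<sigma>\<close> was chosen for the length at the start of construction. At most
  \<open>2*\<sigma>\<close> updates have happened since, so it is still of the order of the square
  root of the current length, in which time is measured.\<close>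

lemma span_ok:
  assumes o: "ok 0 N n m n0 \<sigma> H e n0' \<sigma>' H' e'" and n: "n <= n' + 1" and s: "span n' S L"
  shows "\<sigma> + 2 <= S" "256*(\<sigma> + 2)*(\<sigma> + 2) <= 2^Suc L"
proof -
  have "(\<sigma> - 1)*(\<sigma> - 1) <= n0" "n0 <= n + e" using o unfolding ok_def params_def by blast+
  then have "(\<sigma> - 1)*(\<sigma> - 1) <= n' + 1 + 2*\<sigma>" using ok_fresh[OF o] n by linarith
  then show S: "\<sigma> + 2 <= S" using s unfolding span_def by blast
  have "256*(\<sigma> + 2)*(\<sigma> + 2) <= 256*S*S" using S by (intro mult_le_mono) auto
  then show "256*(\<sigma> + 2)*(\<sigma> + 2) <= 2^Suc L" using s unfolding span_def by linarith
qed

lemma ins_com_run: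
  assumes I: "dyn_inv C b b' a N s" and px: "s$0 = p" "keys s 0 0 = x" "p <= length a" "x \<notin> set a"
    and a': "a' = take p a @ x # drop p a" and N: "N <= N'" "length a <= N" "length a' <= N'" "room C N' B" and sp: "span (length a') S L"
  shows "run B (ins_com C b b') s ((4000*C + 200000)*(S*(L + 1)^2))
    (%s'. (dyn_inv C b b' a' N' s' \<or> dyn_inv C b' b a' N' s') & good C (LIS a') (s'$1))"
proof -
  obtain m n0 \<sigma> H e n0' \<sigma>' H' e' where bb: "bases b b'" and w: "s$num = length a" "s$started = 1" "s$flip = (if b = 40 then 0 else 1)"
    and o: "ok 0 N (length a) m n0 \<sigma> H e n0' \<sigma>' H' e'" and m: "m <= length a" "s$nxt = m"
    and X: "X C b H \<sigma> e a s" "X C b' H' \<sigma>' e' (take m a) s" using I unfolding dyn_inv_def by blast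
  have b: "40 <= b" "40 <= b'" using bb unfolding bases_def by auto
  have len: "length a' = length a + 1" using px(3) unfolding a' by simp
  have mN: "m <= N'" "length a <= N'" using m N by linarith+
  note bd = ok_bounds[OF o] and fr = ok_fresh[OF o]
  have ps: "params n0 \<sigma> H" "n0 <= N'" "params n0' \<sigma>' H'" "n0' <= N'" using o N(1) unfolding ok_def by auto
  have e': "e' <= 2*\<sigma>' + 1" using bd by simp
  note r1 = roomD[OF N(4) ps(1,2) mN(2) bd(1)] and r2 = roomD[OF N(4) ps(3,4) mN(1) e']
  define m' where "m' = (if p < m + 1 then m + 1 else m)"
  have sL: "length a <= length a' + 1" using len by simp
  show ?thesis unfolding ins_com_def
  proof (rule run_mono[OF update_run[OF bb o m w X px(1,2,3) _ sL _ _ N _ _ _ _ span_ok(2)[OF o sL sp], where m' = m']])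
    show "length a' <= length a + 1" "length a' - m' <= length a - m + 1" "m' <= length a'" using len m px unfolding m'_def by auto
    show "run B (ins C b) s0 ((C + 20)*\<sigma>*(2000*(H + 1)^2)) (%s1. xframe b s0 s1 & X C b H \<sigma> (Suc e) a' s1)"
      if "s0$vi = p" "keys s0 0 0 = x" "X C b H \<sigma> e a s0" for s0
      unfolding a' by (rule X_ins[OF b(1) that(3,1) px(3) that(2) px(4) fr(2) bd(3) r1(1,2,4)])
    show "run B (ins_next C b') s0 ((C + 20)*\<sigma>'*(2000*(H' + 1)^2) + 30)
        (%s1. gframe {nxt} b' s0 s1 & X C b' H' \<sigma>' (Suc e') (take m' a') s1 & s1$nxt = m')"
      if s0: "s0$vi = p" "s0$0 = p" "s0$nxt = m" "keys s0 0 0 = x" "X C b' H' \<sigma>' e' (take m a) s0" for s0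
      unfolding ins_next_def
    proof (rule next_run[OF bb s0(3) _ _ _ _ _ _ _ s0(5), where k = "m + 1"])
      show "run B (ins C b') s0 ((C + 20)*\<sigma>'*(2000*(H' + 1)^2)) (%s'. xframe b' s0 s' & X C b' H' \<sigma>' (Suc e') (take m' a') s')"
        if "tval (Less (V 0) (Plus (V nxt) (Const 1))) s0"
      proof -
        have pm: "p <= m" using that s0 by simp
        have lm: "length (take m a) = m" using m by simp
        have t: "take m' a' = take p (take m a) @ x # drop p (take m a)"
          using pm px(3) m unfolding m'_def a' by (simp add: min_def take_Cons' drop_take Suc_diff_le)
        have x': "x \<notin> set (take m a)" using px(4) set_take_subset[of m a] by blast
        have S': "length (take m a) + e' <= 10*\<sigma>'*\<sigma>'" using bd(4) m lm by linarith
        show ?thesis unfolding t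
          by (rule X_ins[OF b(2) s0(5,1) _ s0(4) x' bd(2) S']) (use pm lm r2 in auto)
      qed
      show "take m' a' = take m a & m' = m" if "~ tval (Less (V 0) (Plus (V nxt) (Const 1))) s0"
        using that s0 px(3) m unfolding m'_def a' by (simp add: min_def)
      show "m' = m + 1" if "tval (Less (V 0) (Plus (V nxt) (Const 1))) s0" using that s0 unfolding m'_def by simp
    qed (use r1 r2 s0 px m in auto)
    show "(4000*C + 200000)*((\<sigma> + 2)*(L + 1)^2) <= (4000*C + 200000)*(S*(L + 1)^2)"
      using span_ok(1)[OF o sL sp] by (intro mult_le_mono) auto
  qed (use len r1 in auto)
qed

lemma del_com_run:
  assumes I: "dyn_inv C b b' a N s" and px: "s$0 = p" "p < length a"
    and a': "a' = take p a @ drop (Suc p) a" and N: "N <= N'" "length a <= N" "room C N' B" and sp: "span (length a') S L"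
  shows "run B (del_com C b b') s ((4000*C + 200000)*(S*(L + 1)^2))
    (%s'. (dyn_inv C b b' a' N' s' \<or> dyn_inv C b' b a' N' s') & good C (LIS a') (s'$1))"
proof -
  obtain m n0 \<sigma> H e n0' \<sigma>' H' e' where bb: "bases b b'" and w: "s$num = length a" "s$started = 1" "s$flip = (if b = 40 then 0 else 1)"
    and o: "ok 0 N (length a) m n0 \<sigma> H e n0' \<sigma>' H' e'" and m: "m <= length a" "s$nxt = m"
    and X: "X C b H \<sigma> e a s" "X C b' H' \<sigma>' e' (take m a) s" using I unfolding dyn_inv_def by blast
  have b: "40 <= b" "40 <= b'" using bb unfolding bases_def by auto
  have len: "length a = length a' + 1" using px(2) unfolding a' by simp
  have mN: "m <= N'" "length a <= N'" "length a' <= N'" using m N len by linarith+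
  note bd = ok_bounds[OF o] and fr = ok_fresh[OF o]
  have ps: "params n0 \<sigma> H" "n0 <= N'" "params n0' \<sigma>' H'" "n0' <= N'" using o N(1) unfolding ok_def by auto
  have e': "e' <= 2*\<sigma>' + 1" using bd by simp
  note r1 = roomD[OF N(3) ps(1,2) mN(2) bd(1)] and r2 = roomD[OF N(3) ps(3,4) mN(1) e']
  define m' where "m' = (if p < m then m - 1 else m)"
  have sL: "length a <= length a' + 1" using len by simp
  have pl: "p <= length a" using px by simp
  show ?thesis unfolding del_com_def
  proof (rule run_mono[OF update_run[OF bb o m w X px(1) refl pl _ sL _ _ N(1,2) mN(3) N(3) _ _ _ _ span_ok(2)[OF o sL sp], where m' = m']])
    show "length a' <= length a + 1" "length a' - m' <= length a - m + 1" "m' <= length a'" using len m px unfolding m'_def by auto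
    show "run B (del b) s0 ((C + 20)*\<sigma>*(2000*(H + 1)^2)) (%s1. xframe b s0 s1 & X C b H \<sigma> (Suc e) a' s1)"
      if "s0$vi = p" "X C b H \<sigma> e a s0" for s0
      unfolding a' by (rule X_del[OF b(1) that(2,1) px(2) fr(2) bd(3) r1(1,2)])
    show "run B (del_next b') s0 ((C + 20)*\<sigma>'*(2000*(H' + 1)^2) + 30)
        (%s1. gframe {nxt} b' s0 s1 & X C b' H' \<sigma>' (Suc e') (take m' a') s1 & s1$nxt = m')"
      if s0: "s0$vi = p" "s0$0 = p" "s0$nxt = m" "X C b' H' \<sigma>' e' (take m a) s0" for s0
      unfolding del_next_def
    proof (rule next_run[OF bb s0(3) _ _ _ _ _ _ _ s0(4), where k = "m - 1"])
      show "run B (del b') s0 ((C + 20)*\<sigma>'*(2000*(H' + 1)^2)) (%s'. xframe b' s0 s' & X C b' H' \<sigma>' (Suc e') (take m' a') s')"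
        if "tval (Less (V 0) (V nxt)) s0"
      proof -
        have pm: "p < m" using that s0 by simp
        have lm: "length (take m a) = m" using m by simp
        obtain k where k: "m = Suc (p + k)" using less_imp_Suc_add[OF pm] by blast
        have t: "take m' a' = take p (take m a) @ drop (Suc p) (take m a)"
          using px(2) m(1) unfolding m'_def a' k by (simp add: drop_take)
        have S': "length (take m a) + e' <= 10*\<sigma>'*\<sigma>'" using bd(4) m lm by linarith
        show ?thesis unfolding t
          by (rule X_del[OF b(2) s0(4,1) _ bd(2) S']) (use pm lm r2 in auto)
      qed
      show "take m' a' = take m a & m' = m" if "~ tval (Less (V 0) (V nxt)) s0"
        using that s0 px m unfolding m'_def a' by (simp add: min_def)
      show "m' = m - 1" if "tval (Less (V 0) (V nxt)) s0" using that s0 unfolding m'_def by simp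
    qed (use r1 r2 s0 px m in auto)
    show "(4000*C + 200000)*((\<sigma> + 2)*(L + 1)^2) <= (4000*C + 200000)*(S*(L + 1)^2)"
      using span_ok(1)[OF o sL sp] by (intro mult_le_mono) auto
  qed (use len r1 in auto)
qed

section \<open>The complete algorithm\<close>

definition init :: com where
  "init = seqs [start_build 40, start_build 70, Set started (Const 1)]"

text \<open>Array names are constants of a program, so the code is written out for both assignments
  of roles and \<open>flip\<close> selects one. Zeroed memory has \<open>started\<close> equal to 0,
  which triggers the initialisation.\<close>

definition dispatch :: "(nat => nat => com) => com" where
  "dispatch c = Seq (Cond (Less (V started) (Const 1)) init Skip) (Cond (Less (V flip) (Const 1)) (c 40 70) (c 70 40))"

definition alg :: "nat => dyn_alg" where
  "alg C = \<lparr>insert_code = dispatch (ins_com C), delete_code = dispatch (del_com C)\<rparr>"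

text \<open>The last disjunct describes the memory before the first update; array 0 is exempt
  because the position is loaded into it.\<close>

definition ready :: "nat => real list => nat => state => bool" where
  "ready C a N s \<longleftrightarrow> dyn_inv C 40 70 a N s \<or> dyn_inv C 70 40 a N s \<or> a = [] & (\<forall>c i. c ~= 0 --> words s c i = 0)"

lemma ready_load: "ready C a N s ==> ready C a N (load_update u s)"
proof -
  assume r: "ready C a N s"
  have w: "words (load_update u s) c = words s c" "keys (load_update u s) c = keys s c" if "c ~= 0" for c
    using that by (cases u; simp add: words_other keys_other)+
  have X: "X C b H \<sigma> e xs (load_update u s)" if "X C b H \<sigma> e xs s" "0 < b" for b H \<sigma> e xs
    by (rule X_cong[OF that(1)]) (use w that(2) in auto)
  have D: "dyn_inv C b b' a N (load_update u s)" if d: "dyn_inv C b b' a N s" for b b'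
  proof -
    have b: "0 < b" "0 < b'" using d unfolding dyn_inv_def bases_def by auto
    have w': "words (load_update u s) num = words s num" "words (load_update u s) started = words s started"
      "words (load_update u s) flip = words s flip" "words (load_update u s) nxt = words s nxt" by (simp_all add: w)
    show ?thesis using d unfolding dyn_inv_def w' using X[OF _ b(1)] X[OF _ b(2)] by blast
  qed
  have "words (load_update u s) c i = words s c i" if "c ~= 0" for c i using w(1)[OF that] by simp
  then show ?thesis using r D unfolding ready_def by presburger
qed

lemma init_run:
  assumes z: "!!c i. c ~= 0 ==> words s c i = 0" and B: "room C N B"
  shows "run B init s 600 (%s'. dyn_inv C 40 70 [] N s' & words s' 0 = words s 0 & keys s' 0 = keys s 0)"
proof -
  \<comment> \<open>For length 0 the least square above is 1, and
    \<open>128 <= 2^7 < 256\<close>.\<close>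
  have p: "params 0 1 7" by (simp add: params_def)
  have bb: "bases 40 70" by (simp add: bases_def)
  have B7: "0 + 2 <= B" "2*2^7 + 4 <= B" using roomD(2)[OF B p, of 0 0] by simp_all
  have 1: "run B (start_build 40) s (20*1 + 20*7 + 100) (%s1. xframe 40 s s1 & X C 40 7 1 0 [] s1)"
    by (rule start_build_run[OF _ _ _ p B7]) (use z in auto)
  have 2: "run B (start_build 70) s1 (20*1 + 20*7 + 100) (%s2. (xframe 40 s s1 & X C 40 7 1 0 [] s1) & xframe 70 s1 s2 & X C 70 7 1 0 [] s2)"
    if s1: "xframe 40 s s1 & X C 40 7 1 0 [] s1" for s1
  proof (rule run_mono[OF start_build_run[OF _ _ _ p B7, of 70 s1 C] order_refl])
    show "s1$num = 0" using s1 z unfolding xframe_def by simp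
  qed (use s1 in auto)
  have 3: "run B (Set started (Const 1)) s2 10 (%s'. dyn_inv C 40 70 [] N s' & words s' 0 = words s 0 & keys s' 0 = keys s 0)"
    if s2: "\<exists>s1. (xframe 40 s s1 & X C 40 7 1 0 [] s1) & xframe 70 s1 s2 & X C 70 7 1 0 [] s2" for s2
  proof (rule run_loop_free)
    obtain s1 where s1: "xframe 40 s s1" "X C 40 7 1 0 [] s1" "xframe 70 s1 s2" "X C 70 7 1 0 [] s2" using s2 by blast
    let ?s = "store_word started 0 1 s2"
    have g: "gframe {} 40 s s1" "gframe {} 70 s1 s2" using s1 xframe_gframe by blast+
    have w: "words s2 c = words s c" if "c \<in> {0, 1} \<union> {44..<48}" for c
      using gframe_global[OF g(1) disjI1[OF bb] that] gframe_global[OF g(2) disjI2[OF bb] that] by simp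
    have X2: "X C 40 7 1 0 [] s2" by (rule X_gframe[OF s1(2) g(2) bb]) simp
    have "X C 40 7 1 0 [] ?s" "X C 70 7 1 0 (take 0 []) ?s" by (rule X_store; use X2 s1 in simp)+
    moreover have "ok 0 N (length ([] :: real list)) 0 0 1 7 0 0 1 7 0" using p by (simp add: ok_def)
    moreover have "?s$num = length ([] :: real list)" "?s$started = 1" "?s$flip = 0" "?s$nxt = 0"
      using w z by simp_all
    ultimately have "dyn_inv C 40 70 [] N ?s" unfolding dyn_inv_def using bb by (metis le0 list.size(3))
    moreover have "keys s2 0 = keys s 0" using s1(1,3) unfolding xframe_def by simp
    moreover have "words ?s 0 = words s 0" using w[of 0] by (simp add: words_other)
    ultimately show "dyn_inv C 40 70 [] N (result (Set started (Const 1)) s2) & words (result (Set started (Const 1)) s2) 0 = words s 0 &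
      keys (result (Set started (Const 1)) s2) 0 = keys s 0" by simp
    show "fits B (Set started (Const 1)) s2" using B7 by simp
  qed simp_all
  have 4: "run B (start_build 70) s1 (20*1 + 20*7 + 100) (%s2. \<exists>s1. (xframe 40 s s1 & X C 40 7 1 0 [] s1) & xframe 70 s1 s2 & X C 70 7 1 0 [] s2)"
    if "xframe 40 s s1 & X C 40 7 1 0 [] s1" for s1
    by (rule run_mono[OF 2[OF that] order_refl]) blast
  show ?thesis unfolding init_def by (rule run_mono[OF run_seqs[OF 1 run_seqs[OF 4 run_seqs1[OF 3]]]]) auto
qed

lemma dispatch_run:
  assumes r: "ready C a N s" and B: "room C N B"
    and c: "!!b b' s1. dyn_inv C b b' a N s1 ==> words s1 0 = words s 0 ==> keys s1 0 = keys s 0 ==>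
      run B (c b b') s1 k (%s'. (dyn_inv C b b' a' N' s' \<or> dyn_inv C b' b a' N' s') & P s')"
  shows "run B (dispatch c) s (k + 700) (%s'. ready C a' N' s' & P s')"
proof -
  have B1: "1 <= B" using roomD(2)[OF B, of 0 1 7 0 0] by (simp add: params_def)
  define Q where "Q s1 \<longleftrightarrow> (dyn_inv C 40 70 a N s1 \<or> dyn_inv C 70 40 a N s1) & words s1 0 = words s 0 & keys s1 0 = keys s 0" for s1
  have st: "s$started = 1" if "dyn_inv C b b' a N s" for b b' using that unfolding dyn_inv_def by blast
  have 1: "run B (Cond (Less (V started) (Const 1)) init Skip) s (10 + 600) Q"
  proof (rule run_mono[OF run_Cond])
    have "s$started <= 1" using r st unfolding ready_def by fastforce
    then show "tfits B (Less (V started) (Const 1)) s" using B1 by simp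
    show "run B init s 600 Q" if t: "tval (Less (V started) (Const 1)) s"
    proof -
      have "s$started ~= 1" using t by simp
      then have "a = []" "!!c i. c ~= 0 ==> words s c i = 0" using r st unfolding ready_def by blast+
      then show ?thesis using run_mono[OF init_run[OF _ B, of s] order_refl] unfolding Q_def by simp
    qed
    show "run B Skip s 600 Q" if t: "~ tval (Less (V started) (Const 1)) s"
    proof (rule run_loop_free)
      show "Q (result Skip s)" using t r unfolding Q_def ready_def by auto
    qed simp_all
  qed simp_all
  have 2: "run B (Cond (Less (V flip) (Const 1)) (c 40 70) (c 70 40)) s1 (10 + k) (%s'. ready C a' N' s' & P s')" if q: "Q s1" for s1
  proof (rule run_mono[OF run_Cond])
    have f: "dyn_inv C 40 70 a N s1 & s1$flip = 0 \<or> dyn_inv C 70 40 a N s1 & s1$flip = 1" and q': "words s1 0 = words s 0" "keys s1 0 = keys s 0"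
    proof -
      have "s1$flip = 0" if "dyn_inv C 40 70 a N s1" using that unfolding dyn_inv_def by simp
      moreover have "s1$flip = 1" if "dyn_inv C 70 40 a N s1" using that unfolding dyn_inv_def by simp
      ultimately show "dyn_inv C 40 70 a N s1 & s1$flip = 0 \<or> dyn_inv C 70 40 a N s1 & s1$flip = 1"
        "words s1 0 = words s 0" "keys s1 0 = keys s 0" using q unfolding Q_def by blast+
    qed
    show "tfits B (Less (V flip) (Const 1)) s1" using f B1 by auto
    show "run B (c 40 70) s1 k (%s'. ready C a' N' s' & P s')" if "tval (Less (V flip) (Const 1)) s1"
    proof -
      have "dyn_inv C 40 70 a N s1" using f that by auto
      then show ?thesis by (intro run_mono[OF c[OF _ q'] order_refl]) (auto simp: ready_def)
    qed
    show "run B (c 70 40) s1 k (%s'. ready C a' N' s' & P s')" if "~ tval (Less (V flip) (Const 1)) s1"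
    proof -
      have "dyn_inv C 70 40 a N s1" using f that by auto
      then show ?thesis by (intro run_mono[OF c[OF _ q'] order_refl]) (auto simp: ready_def)
    qed
  qed simp_all
  show ?thesis unfolding dispatch_def by (rule run_mono[OF run_SeqI[OF 1 2]]) auto
qed

lemma room_mono: "room C N B ==> M <= N ==> room C M B"
  unfolding room_def using le_trans by blast

lemma alg_run:
  assumes r: "ready C a N s" and N: "length a <= N" and u: "valid_update u a" and a': "a' = apply_update u a"
    and N': "N' = max N (length a')" and B: "room C N' B" and sp: "span (length a') S L"
  shows "run B (code_for (alg C) u) (load_update u s) ((4000*C + 200000)*(S*(L + 1)^2) + 700)
    (%s'. ready C a' N' s' & good C (LIS a') (s'$1))"
proof -
  have r': "ready C a N (load_update u s)" by (rule ready_load[OF r])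
  have NN: "N <= N'" "length a' <= N'" using N' by simp_all
  have B0: "room C N B" by (rule room_mono[OF B NN(1)])
  show ?thesis
  proof (cases u)
    case (Insert p x)
    have c: "code_for (alg C) u = dispatch (ins_com C)" by (simp add: alg_def Insert)
    show ?thesis unfolding c
    proof (rule dispatch_run[OF r' B0])
      fix b b' s1 assume s1: "dyn_inv C b b' a N s1" "words s1 0 = words (load_update u s) 0" "keys s1 0 = keys (load_update u s) 0"
      show "run B (ins_com C b b') s1 ((4000*C + 200000)*(S*(L + 1)^2))
        (%s'. (dyn_inv C b b' a' N' s' \<or> dyn_inv C b' b a' N' s') & good C (LIS a') (s'$1))"
        by (rule ins_com_run[OF s1(1) _ _ _ _ _ NN(1) N NN(2) B sp, of p x]) (use s1 u a' in "auto simp: Insert")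
    qed
  next
    case (Delete p)
    have c: "code_for (alg C) u = dispatch (del_com C)" by (simp add: alg_def Delete)
    show ?thesis unfolding c
    proof (rule dispatch_run[OF r' B0])
      fix b b' s1 assume s1: "dyn_inv C b b' a N s1" "words s1 0 = words (load_update u s) 0" "keys s1 0 = keys (load_update u s) 0"
      show "run B (del_com C b b') s1 ((4000*C + 200000)*(S*(L + 1)^2))
        (%s'. (dyn_inv C b b' a' N' s' \<or> dyn_inv C b' b a' N' s') & good C (LIS a') (s'$1))"
        by (rule del_com_run[OF s1(1) _ _ _ NN(1) N B sp, of p]) (use s1 u a' in "auto simp: Delete")
    qed
  qed
qed

section \<open>Asymptotic time and approximation factor\<close>

text \<open>\<open>4 + sqrt (n + 4)\<close> bounds \<open>\<sigma> + 2\<close>, the squared factor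
  bounds \<open>(L + 1)^2\<close>, and 700 pays for dispatch and initialisation.\<close>

definition bound :: "nat => nat => real" where
  "bound C n = (4000*real C + 200000)*((4 + sqrt (real n + 4))*(10 + 2*log 2 (4 + sqrt (real n + 4)))^2) + 700"

text \<open>With \<open>q = \<sigma> - 1\<close> the condition reads
  \<open>q*q <= n + 3 + 2*q\<close>; completing the square gives
  \<open>(q - 1)^2 <= n + 4\<close>.\<close>

lemma ex_span:
  "\<exists>S L. span n S L & real ((4000*C + 200000)*(S*(L + 1)^2) + 700) <= bound C n"
proof -
  define y where "y = 4 + sqrt (real n + 4)"
  define S where "S = nat \<lfloor>y\<rfloor>"
  have y: "4 <= y" by (simp add: y_def)
  have S: "real S <= y" "4 <= S" using y unfolding S_def by linarith+
  have "\<exists>k. S <= 2^k" by (rule exI[of _ S]) (simp add: less_imp_le)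
  then obtain k where k: "S <= 2^k" "!!j. j < k ==> 2^j < S" using exists_least_iff[of "%k. S <= 2^k"] by (meson not_le)
  have k0: "0 < k" using k(1) S(2) by (cases k) auto
  have "2^(k - 1) < S" using k(2)[of "k - 1"] k0 by simp
  then have "(2::real)^(k - 1) <= y" using S(1) by (metis less_imp_le of_nat_less_iff of_nat_numeral of_nat_power order_trans)
  then have "real (k - 1) <= log 2 y" using y by (simp add: le_log_iff powr_realpow)
  then have kl: "real k <= 1 + log 2 y" using k0 by simp
  \<comment> \<open>From \<open>S <= 2^k\<close> one gets \<open>256*S*S <= 2^(8 + 2*k)\<close>, and
    the exponent is to be \<open>Suc L\<close>.\<close>
  define L where "L = 2*k + 7"
  have "S*S <= 2^k*2^k" using k(1) by (rule mult_le_mono[OF _ k(1)])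
  moreover have "(2::nat)^Suc L = 256*(2^k*2^k)"
  proof -
    have "Suc L = 8 + (k + k)" by (simp add: L_def)
    then have "(2::nat)^Suc L = 2^8*(2^k*2^k)" by (simp only: power_add)
    then show ?thesis by simp
  qed
  ultimately have "256*S*S <= 2^Suc L" by linarith
  moreover have "\<sigma> + 2 <= S" if "(\<sigma> - 1)*(\<sigma> - 1) <= n + 1 + 2*\<sigma>" for \<sigma>
  proof (cases \<sigma>)
    case (Suc q)
    have "real (q*q) <= real (n + 3 + 2*q)" using that unfolding Suc by (intro of_nat_mono) simp
    then have "(real q - 1)\<^sup>2 <= real n + 4" by (simp add: power2_eq_square algebra_simps)
    then have "real q - 1 <= sqrt (real n + 4)" by (rule real_le_rsqrt)
    then have "real (q + 3) <= y" by (simp add: y_def)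
    then show ?thesis unfolding S_def Suc using le_nat_floor[of "q + 3" y] by simp
  qed (use S in simp)
  ultimately have "span n S L" unfolding span_def by blast
  moreover have "real ((4000*C + 200000)*(S*(L + 1)^2) + 700) <= bound C n"
  proof -
    have "real (L + 1) <= 10 + 2*log 2 y" using kl by (simp add: L_def)
    then have "real (L + 1)^2 <= (10 + 2*log 2 y)^2" by (intro power_mono) auto
    then have "real S*real (L + 1)^2 <= y*(10 + 2*log 2 y)^2" using S(1) y by (intro mult_mono) auto
    then have "(4000*real C + 200000)*(real S*real (L + 1)^2) <= (4000*real C + 200000)*(y*(10 + 2*log 2 y)^2)"
      by (intro mult_left_mono) auto
    then show ?thesis unfolding bound_def y_def[symmetric] by (simp add: of_nat_power)
  qed
  ultimately show ?thesis by blast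
qed

text \<open>One of the two logarithms is the height of a trie, the other comes from the binary
  searches around the trie queries.\<close>

lemma bound_soft_O: "bound C \<in> soft_O (%n. sqrt (real n))"
proof -
  have "(%n. (4 + sqrt (real n + 4))*(10 + 2*log 2 (4 + sqrt (real n + 4)))^2) \<in> O(%n. sqrt (real n)*ln (real n)^2)"
    by real_asymp
  then have "(%n. (4000*real C + 200000)*((4 + sqrt (real n + 4))*(10 + 2*log 2 (4 + sqrt (real n + 4)))^2)) \<in> O(%n. sqrt (real n)*ln (real n)^2)"
    by simp
  moreover have "(%n::nat. 700 :: real) \<in> O(%n. sqrt (real n)*ln (real n)^2)" by real_asymp
  ultimately have "bound C \<in> O(%n. sqrt (real n)*ln (real n)^2)" unfolding bound_def[abs_def] by (rule sum_in_bigo)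
  then show ?thesis unfolding soft_O_def by blast
qed

text \<open>The condition on \<open>C\<close> says
  \<open>6/(C - 3) <= \<epsilon>/(1 + \<epsilon>)\<close>, and
  \<open>1 - \<epsilon>/(1 + \<epsilon>)\<close> is \<open>1/(1 + \<epsilon>)\<close>.\<close>

lemma good_approx:
  fixes \<epsilon> :: real
  assumes g: "good C n v" and e: "0 < \<epsilon>" and C: "6*(1 + \<epsilon>) / \<epsilon> + 3 <= real C"
  shows "real n / (1 + \<epsilon>) <= real v" "v <= n"
proof -
  show v: "v <= n" using g unfolding good_def by blast
  have C3: "3 <= C"
  proof -
    have "0 <= 6*(1 + \<epsilon>) / \<epsilon>" using e by simp
    then show ?thesis using C by linarith
  qed
  have "real ((C - 3)*(n - v)) <= real (6*n)" using g unfolding good_def of_nat_le_iff by blast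
  then have 1: "(real C - 3)*(real n - real v) <= 6*real n" using C3 v by (simp add: of_nat_diff)
  have "6*(1 + \<epsilon>) / \<epsilon> <= real C - 3" using C by simp
  then have "6*(1 + \<epsilon>) <= (real C - 3)*\<epsilon>" using e by (simp add: pos_divide_le_eq)
  then have "6*(1 + \<epsilon>)*(real n - real v) <= (real C - 3)*\<epsilon>*(real n - real v)" using v by (intro mult_right_mono) auto
  also have "\<dots> = \<epsilon>*((real C - 3)*(real n - real v))" by simp
  also have "\<dots> <= \<epsilon>*(6*real n)" using 1 e by (intro mult_left_mono) auto
  finally have "real n <= real v*(1 + \<epsilon>)" by (simp add: algebra_simps)
  then show "real n / (1 + \<epsilon>) <= real v" using e by (simp add: pos_divide_le_eq)
qed

lemma handles_alg:
  assumes e: "0 < \<epsilon>" and C: "6*(1 + \<epsilon>) / \<epsilon> + 3 <= real C" and "ready C a N s" "length a <= N"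
  shows "handles (alg C) (6144*C + 36918) (1 + \<epsilon>) (bound C) us a N s"
  using assms(3,4)
proof (induction us arbitrary: a N s)
  case (Cons u us)
  show ?case unfolding handles.simps Let_def
  proof (rule impI)
    assume u: "valid_update u a"
    let ?a = "apply_update u a"
    let ?N = "max N (length ?a)"
    obtain S L where sp: "span (length ?a) S L" and t: "real ((4000*C + 200000)*(S*(L + 1)^2) + 700) <= bound C (length ?a)"
      using ex_span by blast
    obtain k s' where k: "exec ((?N + 2)^(6144*C + 36918)) (code_for (alg C) u) (load_update u s) k s'"
      "k <= (4000*C + 200000)*(S*(L + 1)^2) + 700" and s': "ready C ?a ?N s'" "good C (LIS ?a) (s'$1)"
      using alg_run[OF Cons.prems u refl refl room_power sp] unfolding run_def by blast
    have "real k <= bound C (length ?a)" using k(2) t of_nat_mono[OF k(2), where 'a = real] by linarith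
    moreover have "handles (alg C) (6144*C + 36918) (1 + \<epsilon>) (bound C) us ?a ?N s'" by (rule Cons.IH[OF s'(1)]) simp
    ultimately show "\<exists>t s'. exec ((?N + 2)^(6144*C + 36918)) (code_for (alg C) u) (load_update u s) t s' &
      real (LIS ?a) / (1 + \<epsilon>) <= real (answer s') & answer s' <= LIS ?a & real t <= bound C (length ?a) &
      handles (alg C) (6144*C + 36918) (1 + \<epsilon>) (bound C) us ?a ?N s'"
      using k(1) good_approx[OF s'(2) e C] unfolding answer_def by blast
  qed
qed simp

theorem theorem2:
  fixes \<epsilon> :: real
  assumes "\<epsilon> > 0"
  shows "\<exists>A T. dynamic_LIS_algorithm A (1 + \<epsilon>) T \<and> T \<in> soft_O (\<lambda>n. sqrt (real n))"
proof -
  obtain C :: nat where C: "6 * (1 + \<epsilon>) / \<epsilon> + 3 \<le> real C" using real_arch_simple by blast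
  have "ready C [] 0 initial_state" by (simp add: ready_def initial_state_def)
  then have "dynamic_LIS_algorithm (alg C) (1 + \<epsilon>) (bound C)"
    unfolding dynamic_LIS_algorithm_def using handles_alg[OF assms C] by (intro exI allI) auto
  then show ?thesis using bound_soft_O by blast
qed

end
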